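(* The specializations $[[K]]|_{A=1}$ and $[[K]]|_{A=-1}$, computed from oriented virtual link diagrams $K$, are invariants of (oriented) free links.
   Context: Graphs. $\mathcal S$ is the collection of finite oriented graphs (up to isomorphism; multiple edges allowed; finite disjoint unions allowed; oriented circle components without vertices allowed) which are trivalent and bipartite, with every edge oriented from the first part to the second; thus every vertex is a source or a sink. A bigon is a pair of distinct vertices joined by (at least) two edges, with a chosen pair of such edges; a quadrilateral is a 4-cycle with four distinct vertices. $\mathcal T=\{t_1,t_2,\dots\}\subset\mathcal S$ is the set of connected graphs (having vertices) with neither bigons nor quadrilaterals. $\mathcal M=\mathbb Z[A,A^{-1}][t_1,t_2,\dots]$ is the commutative polynomial algebra. The map $f:\mathcal S\to\mathcal M$ is the unique map which sends disjoint unions to products, sends $t\in\mathcal T$ to $t$, sends a circle to $A^6+1+A^{-6}$, and satisfies: $f(\Gamma)=(A^3+A^{-3})f(\Gamma')$ if $\Gamma'$ is obtained by resolving a bigon (delete its two vertices and the two chosen edges, glue the two remaining external edge-ends together); $f(\Gamma)=f(\Gamma')+f(\Gamma'')$ for a quadrilateral $v_1v_2v_3v_4$ with external edge-ends $e_i$ at $v_i$, where the quadrilateral is deleted and one glues $e_1$ to $e_2$, $e_3$ to $e_4$ in $\Gamma'$, and $e_2$ to $e_3$, $e_4$ to $e_1$ in $\Gamma''$. Virtual and free links. An oriented virtual link diagram is an oriented planar link diagram with classical (over/under) and virtual crossings; virtual links are classes of diagrams under the classical Reidemeister moves and the detour move (an arc containing only virtual crossings may be replaced by any other arc with the same endpoints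 all of whose new crossings are virtual). The $Z$-move interchanges a classical crossing $c$ with an adjacent virtual crossing $v$: viewed as 2-strand tangles, it replaces the composite $cv$ by $vc$. Free links are the equivalence classes of virtual link diagrams under virtual link equivalence together with $Z$-moves and crossing switches (exchanging over and under at a classical crossing). Bracket. At a classical crossing let $i_1,i_2$ be the incoming and $o_1,o_2$ the outgoing edge-ends, $i_k$ opposite to $o_k$. The oriented local state connects $i_1$ to $o_2$ and $i_2$ to $o_1$. The unoriented local state replaces the crossing by a sink $x$ receiving $i_1,i_2$, a source $y$ emitting $o_1,o_2$, and an edge from $y$ to $x$. A state $s$ is a choice of local state at each classical crossing; $K_s\in\mathcal S$ is the resulting abstract graph (virtual crossings ignored). Its weight $w(K_s)$ is the product over classical crossings of sign $\varepsilon$ of $A^{2\varepsilon}$ (oriented state) or $-A^{-\varepsilon}$ (unoriented state). Then $[[K]]=\sum_s w(K_s)f(K_s)\in\mathcal M$, and $[[K]]|_{A=\pm1}\in\mathbb Z[t_1,t_2,\dots]$. *)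

theory Defs
  imports
    "HOL-Analysis.Analysis"
    "HOL-Library.Poly_Mapping"
    "HOL-Combinatorics.Permutations"
    "Graph_Theory.Digraph_Isomorphism"
begin

section \<open>Trivalent bipartite graphs\<close>

text \<open>
  A web is a directed multigraph together with a number of oriented circles without vertices.
\<close>

datatype ('v, 'e) web = Web (graph: "('v, 'e) pre_digraph") (circles: nat)

definition trivalent_bipartite :: "('v, 'e) web \<Rightarrow> bool" where
  "trivalent_bipartite \<Gamma> \<longleftrightarrow>
     fin_digraph (graph \<Gamma>) \<and>
     (\<forall>v \<in> verts (graph \<Gamma>). in_degree (graph \<Gamma>) v + out_degree (graph \<Gamma>) v = 3) \<and>
     (\<exists>X \<subseteq> verts (graph \<Gamma>). \<forall>e \<in> arcs (graph \<Gamma>). tail (graph \<Gamma>) e \<in> X \<and> head (graph \<Gamma>) e \<notin> X)"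

text \<open>
  Every finite web is isomorphic to one with natural numbers as vertices and arcs, so the webs up
  to isomorphism are represented by their classes inside that type.
\<close>

type_synonym web_class = "(nat, nat) web set"

definition web_class :: "('v, 'e) web \<Rightarrow> web_class" where
  "web_class \<Gamma> = {\<Delta>. digraph_iso (graph \<Gamma>) (graph \<Delta>) \<and> circles \<Gamma> = circles \<Delta>}"

definition circle_web :: "(nat, nat) web" where
  "circle_web = Web \<lparr>verts = {}, arcs = {}, tail = (\<lambda>_. 0), head = (\<lambda>_. 0)\<rparr> 1"

definition disjoint_union :: "('v, 'e) web \<Rightarrow> ('w, 'f) web \<Rightarrow> ('v + 'w, 'e + 'f) web" where
  "disjoint_union \<Gamma> \<Delta> =
     Web \<lparr>verts = verts (graph \<Gamma>) <+> verts (graph \<Delta>),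
          arcs = arcs (graph \<Gamma>) <+> arcs (graph \<Delta>),
          tail = map_sum (tail (graph \<Gamma>)) (tail (graph \<Delta>)),
          head = map_sum (head (graph \<Gamma>)) (head (graph \<Delta>))\<rparr>
         (circles \<Gamma> + circles \<Delta>)"

definition delete_arcs :: "'e set \<Rightarrow> ('v, 'e) web \<Rightarrow> ('v, 'e) web" where
  "delete_arcs B \<Gamma> = Web ((graph \<Gamma>)\<lparr>arcs := arcs (graph \<Gamma>) - B\<rparr>) (circles \<Gamma>)"

text \<open>
  If a single arc \<open>p\<close> leaves the source \<open>x\<close> and a single arc \<open>q\<close> enters the sink \<open>y\<close>, then
  splicing deletes \<open>x\<close> and \<open>y\<close> and glues the two loose ends; if \<open>p = q\<close> this closes up a circle.
  Keeping the end vertices until they are spliced makes successive gluings correct even if both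
  loose ends of one arc get glued.
\<close>

definition splice :: "'v \<Rightarrow> 'v \<Rightarrow> ('v, 'e) web \<Rightarrow> ('v, 'e) web" where
  "splice x y \<Gamma> =
     (let G = graph \<Gamma>;
          p = the_elem (out_arcs G x);
          q = the_elem (in_arcs G y);
          G' = G\<lparr>verts := verts G - {x, y}, arcs := arcs G - {p}\<rparr>
      in if p = q then Web G' (circles \<Gamma> + 1)
         else Web (G'\<lparr>head := (head G)(q := head G p)\<rparr>) (circles \<Gamma>))"

text \<open>
  Since arcs run from sources to sinks, one of the two vertices of a bigon is a source \<open>x\<close> and
  the other a sink \<open>y\<close>, and up to cyclic rotation a quadrilateral \<open>v1 v2 v3 v4\<close> has sources
  \<open>v1\<close> and \<open>v3\<close>.  Rotating by one step exchanges the two resolutions of the quadrilateral.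
\<close>

definition bigon :: "('v, 'e) web \<Rightarrow> 'v \<Rightarrow> 'v \<Rightarrow> 'e \<Rightarrow> 'e \<Rightarrow> bool" where
  "bigon \<Gamma> x y a b \<longleftrightarrow>
     x \<noteq> y \<and> a \<noteq> b \<and>
     {a, b} \<subseteq> out_arcs (graph \<Gamma>) x \<inter> in_arcs (graph \<Gamma>) y"

definition quadrilateral ::
  "('v, 'e) web \<Rightarrow> 'v \<Rightarrow> 'v \<Rightarrow> 'v \<Rightarrow> 'v \<Rightarrow> 'e \<Rightarrow> 'e \<Rightarrow> 'e \<Rightarrow> 'e \<Rightarrow> bool" where
  "quadrilateral \<Gamma> v1 v2 v3 v4 a b c d \<longleftrightarrow>
     distinct [v1, v2, v3, v4] \<and>
     a \<in> out_arcs (graph \<Gamma>) v1 \<inter> in_arcs (graph \<Gamma>) v2 \<and>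
     b \<in> out_arcs (graph \<Gamma>) v3 \<inter> in_arcs (graph \<Gamma>) v2 \<and>
     c \<in> out_arcs (graph \<Gamma>) v3 \<inter> in_arcs (graph \<Gamma>) v4 \<and>
     d \<in> out_arcs (graph \<Gamma>) v1 \<inter> in_arcs (graph \<Gamma>) v4"

definition irreducible_web :: "('v, 'e) web \<Rightarrow> bool" where
  "irreducible_web \<Gamma> \<longleftrightarrow>
     trivalent_bipartite \<Gamma> \<and> Digraph_Component.connected (graph \<Gamma>) \<and> circles \<Gamma> = 0 \<and>
     \<not> (\<exists>x y a b. bigon \<Gamma> x y a b) \<and>
     \<not> (\<exists>v1 v2 v3 v4 a b c d. quadrilateral \<Gamma> v1 v2 v3 v4 a b c d)"


section \<open>The type of generators\<close>

text \<open>
  The incidence graph of the Fano plane is an irreducible web.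
\<close>

definition heawood_head :: "nat \<Rightarrow> nat" where
  "heawood_head e = 7 + (e div 3 + (if e mod 3 = 2 then 3 else e mod 3)) mod 7"

definition heawood :: "(nat, nat) web" where
  "heawood = Web \<lparr>verts = {..<14}, arcs = {..<21}, tail = (\<lambda>e. e div 3), head = heawood_head\<rparr> 0"

lemma heawood_degrees:
  "\<forall>v \<in> set [0..<14].
     card (set (filter (\<lambda>e. heawood_head e = v) [0..<21])) +
     card (set (filter (\<lambda>e. e div 3 = v) [0..<21])) = 3"
  by code_simp

lemma heawood_girth:
  "\<forall>a \<in> set [0..<21]. \<forall>d \<in> set (filter (\<lambda>d. d \<noteq> a \<and> d div 3 = a div 3) [0..<21]).
     heawood_head a \<noteq> heawood_head d \<and>
     (\<forall>b \<in> set (filter (\<lambda>b. b \<noteq> a \<and> heawood_head b = heawood_head a) [0..<21]).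
       \<forall>c \<in> set (filter (\<lambda>c. c div 3 = b div 3) [0..<21]). heawood_head c \<noteq> heawood_head d)"
  by code_simp

lemma heawood_less: "e < 21 \<Longrightarrow> heawood_head e < 14" "7 \<le> heawood_head e"
  by (auto simp: heawood_head_def)

lemma heawood_connected: "Digraph_Component.connected (graph heawood)"
proof -
  let ?G = "graph heawood"
  let ?S = "with_proj (mk_symmetric ?G)"
  interpret G: wf_digraph ?G
    by unfold_locales (auto simp: heawood_def heawood_less)
  interpret S: pair_wf_digraph "mk_symmetric ?G" ..
  define R where "R u v \<longleftrightarrow> u \<rightarrow>\<^sup>*\<^bsub>?S\<^esub> v \<and> v \<rightarrow>\<^sup>*\<^bsub>?S\<^esub> u" for u v
  have R_trans: "R u w" if "R u v" "R v w" for u v w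
    using that S.reachable_trans unfolding R_def by metis
  have R_sym: "R v u" if "R u v" for u v
    using that unfolding R_def by metis
  have vS: "verts ?S = {..<14}"
    by (simp add: heawood_def)
  have step: "R u v" if "e < 21" "u = e div 3" "v = heawood_head e" for e u v
  proof -
    have "(u, v) \<in> arcs_ends ?S" "(v, u) \<in> arcs_ends ?S"
      using that by (force simp: parcs_mk_symmetric heawood_def arcs_ends_conv)+
    then show ?thesis
      unfolding R_def by (intro conjI S.reachable_adjI) simp_all
  qed
  have src: "R 0 i" if "i < 7" for i
    using that
  proof (induction i)
    case 0
    have "0 \<in> verts ?S" by (simp add: heawood_def)
    then show ?case
      unfolding R_def by (intro conjI S.reachable_refl) simp_all
  next
    case (Suc i)
    have d: "(3 * i + 1) div 3 = i" "(3 * i + 1) mod 3 = 1" by presburger+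
    then have h: "heawood_head (3 * i + 1) = heawood_head (3 * Suc i)"
      by (simp add: heawood_head_def)
    have "R i (heawood_head (3 * i + 1))"
      by (rule step[OF _ d(1)[symmetric] refl]) (use Suc.prems in linarith)
    moreover have "R (Suc i) (heawood_head (3 * i + 1))"
      by (rule step[OF _ _ h]) (use Suc.prems in simp_all)
    moreover have "R 0 i" using Suc by simp
    ultimately show ?case by (metis R_trans R_sym)
  qed
  have all: "R 0 v" if "v < 14" for v
  proof (cases "v < 7")
    case True
    then show ?thesis by (rule src)
  next
    case False
    then have *: "heawood_head (3 * (v - 7)) = v" "3 * (v - 7) < 21" "v - 7 < 7"
      using that by (auto simp: heawood_head_def)
    have "R (v - 7) v"
      using * by (intro step[of "3 * (v - 7)"]) auto
    then show ?thesis using src[OF *(3)] R_trans by metis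
  qed
  have "R u v" if "u < 14" "v < 14" for u v
    using all[OF that(1)] all[OF that(2)] R_trans R_sym by metis
  then have "u \<rightarrow>\<^sup>*\<^bsub>?S\<^esub> v" if "u \<in> verts ?S" "v \<in> verts ?S" for u v
    using that unfolding R_def vS by blast
  moreover have "0 \<in> verts ?S" unfolding vS by (rule lessThan_iff[THEN iffD2]) simp
  ultimately show ?thesis
    unfolding Digraph_Component.connected_def strongly_connected_def by (metis empty_iff)
qed

lemma irreducible_heawood: "irreducible_web heawood"
  unfolding irreducible_web_def
proof (intro conjI)
  show "trivalent_bipartite heawood"
    unfolding trivalent_bipartite_def
  proof (intro conjI ballI)
    show "fin_digraph (graph heawood)"
      by unfold_locales (auto simp: heawood_def heawood_less)
  next
    fix v assume "v \<in> verts (graph heawood)"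
    then have "v \<in> set [0..<14]" by (auto simp: heawood_def)
    with heawood_degrees show "in_degree (graph heawood) v + out_degree (graph heawood) v = 3"
      by (auto simp: in_degree_def out_degree_def in_arcs_def out_arcs_def heawood_def
            atLeast0LessThan simp del: upt.simps upt_rec_numeral
            cong: conj_cong)
  next
    show "\<exists>X\<subseteq>verts (graph heawood).
        \<forall>e\<in>arcs (graph heawood). tail (graph heawood) e \<in> X \<and> head (graph heawood) e \<notin> X"
      by (rule exI[of _ "{..<7}"]) (auto simp: heawood_def not_less heawood_less)
  qed
  show "Digraph_Component.connected (graph heawood)" by (rule heawood_connected)
  show "circles heawood = 0" by (simp add: heawood_def)
  have *: "heawood_head a \<noteq> heawood_head d \<and>
      (heawood_head b = heawood_head a \<longrightarrow> b \<noteq> a \<longrightarrow> c div 3 = b div 3 \<longrightarrow>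
        heawood_head c \<noteq> heawood_head d)"
    if "a < 21" "b < 21" "c < 21" "d < 21" "d \<noteq> a" "d div 3 = a div 3" for a b c d
  proof -
    have mem: "x \<in> set [0..<21]" if "x < 21" for x :: nat
      using that unfolding set_upt atLeastLessThan_iff by blast
    have fmem: "x \<in> set (filter P [0..<21])" if "x < 21" "P x" for x :: nat and P
      using mem[OF that(1)] that(2) unfolding set_filter by blast
    have d: "d \<in> set (filter (\<lambda>d. d \<noteq> a \<and> d div 3 = a div 3) [0..<21])"
      by (rule fmem) (use that in blast)+
    note girth = bspec[OF bspec[OF heawood_girth mem[OF that(1)]] d]
    show ?thesis
    proof (intro conjI impI)
      show "heawood_head a \<noteq> heawood_head d" by (rule conjunct1[OF girth])
      assume bc: "heawood_head b = heawood_head a" "b \<noteq> a" "c div 3 = b div 3"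
      have "b \<in> set (filter (\<lambda>b. b \<noteq> a \<and> heawood_head b = heawood_head a) [0..<21])"
        by (rule fmem) (use that bc in blast)+
      moreover have "c \<in> set (filter (\<lambda>c. c div 3 = b div 3) [0..<21])"
        by (rule fmem) (use that bc in blast)+
      ultimately show "heawood_head c \<noteq> heawood_head d"
        by (rule bspec[OF bspec[OF conjunct2[OF girth]]])
    qed
  qed
  show "\<not> (\<exists>x y a b. bigon heawood x y a b)"
    using * by (fastforce simp: bigon_def heawood_def)
  show "\<not> (\<exists>v1 v2 v3 v4 a b c d. quadrilateral heawood v1 v2 v3 v4 a b c d)"
  proof safe
    fix v1 v2 v3 v4 a b c d
    assume q: "quadrilateral heawood v1 v2 v3 v4 a b c d"
    show False
      using *[of a b c d] q by (auto simp: quadrilateral_def heawood_def)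
  qed
qed

typedef irreducible = "{web_class \<Gamma> | \<Gamma> :: (nat, nat) web. irreducible_web \<Gamma>}"
  using irreducible_heawood by auto


section \<open>Laurent polynomials and the graph evaluation\<close>

text \<open>
  \<open>laurent\<close> is the ring of Laurent polynomials in \<open>A\<close> with integer coefficients, and
  \<open>'r mpoly\<close> is the polynomial ring over \<open>'r\<close> in the irreducible webs.
\<close>

type_synonym laurent = "int \<Rightarrow>\<^sub>0 int"
type_synonym 'r mpoly = "(irreducible \<Rightarrow>\<^sub>0 nat) \<Rightarrow>\<^sub>0 'r"

abbreviation A_pow :: "int \<Rightarrow> laurent" where
  "A_pow k \<equiv> Poly_Mapping.single k 1"

abbreviation Const :: "laurent \<Rightarrow> laurent mpoly" where
  "Const c \<equiv> Poly_Mapping.single 0 c"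

abbreviation Gen :: "irreducible \<Rightarrow> laurent mpoly" where
  "Gen t \<equiv> Poly_Mapping.single (Poly_Mapping.single t 1) 1"

definition web_evaluation :: "(web_class \<Rightarrow> laurent mpoly) \<Rightarrow> bool" where
  "web_evaluation f \<longleftrightarrow>
     (\<forall>(\<Gamma> :: (nat, nat) web) (\<Delta> :: (nat, nat) web). trivalent_bipartite \<Gamma> \<longrightarrow> trivalent_bipartite \<Delta> \<longrightarrow>
        f (web_class (disjoint_union \<Gamma> \<Delta>)) = f (web_class \<Gamma>) * f (web_class \<Delta>)) \<and>
     (\<forall>t. f (Rep_irreducible t) = Gen t) \<and>
     f (web_class circle_web) = Const (A_pow 6 + 1 + A_pow (-6)) \<and>
     (\<forall>(\<Gamma> :: (nat, nat) web) x y a b. trivalent_bipartite \<Gamma> \<longrightarrow> bigon \<Gamma> x y a b \<longrightarrow>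
        f (web_class \<Gamma>) =
          Const (A_pow 3 + A_pow (-3)) * f (web_class (splice x y (delete_arcs {a, b} \<Gamma>)))) \<and>
     (\<forall>(\<Gamma> :: (nat, nat) web) v1 v2 v3 v4 a b c d.
        trivalent_bipartite \<Gamma> \<longrightarrow> quadrilateral \<Gamma> v1 v2 v3 v4 a b c d \<longrightarrow>
        (let \<Gamma>' = delete_arcs {a, b, c, d} \<Gamma>
         in f (web_class \<Gamma>) =
              f (web_class (splice v3 v4 (splice v1 v2 \<Gamma>'))) +
              f (web_class (splice v1 v4 (splice v3 v2 \<Gamma>')))))"

text \<open>
  Evaluation of a Laurent polynomial at \<open>A = \<epsilon>\<close>.  It is used for \<open>\<epsilon> = 1\<close> and \<open>\<epsilon> = -1\<close> only,
  where \<open>\<epsilon>\<close> is its own inverse, so that the \<open>k\<close>-th power depends on \<open>\<bar>k\<bar>\<close> only.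
\<close>

definition laurent_at :: "int \<Rightarrow> laurent \<Rightarrow> int" where
  "laurent_at \<epsilon> c = (\<Sum>k \<in> Poly_Mapping.keys c. Poly_Mapping.lookup c k * \<epsilon> ^ nat \<bar>k\<bar>)"

definition specialize :: "int \<Rightarrow> laurent mpoly \<Rightarrow> int mpoly" where
  "specialize \<epsilon> = Poly_Mapping.map (laurent_at \<epsilon>)"


section \<open>Virtual link diagrams\<close>

text \<open>
  A diagram consists of \<open>comps\<close> closed curves in the plane, the \<open>i\<close>-th one being given by a
  function of period 1 that runs through the component along its orientation.  Thus the points of
  the link are the parameters \<open>(i, t)\<close> with \<open>i < comps\<close> and \<open>0 \<le> t < 1\<close>.  The crossings in
  \<open>virt\<close> are the virtual ones; \<open>over\<close> contains the parameter of the overpassing strand of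
  each classical crossing.
\<close>

record diagram =
  comps :: nat
  curve :: "nat \<Rightarrow> real \<Rightarrow> complex"
  virt :: "complex set"
  over :: "(nat \<times> real) set"

definition params :: "diagram \<Rightarrow> (nat \<times> real) set" where
  "params D = {..<comps D} \<times> {0..<1}"

definition point :: "diagram \<Rightarrow> nat \<times> real \<Rightarrow> complex" where
  "point D = (\<lambda>(i, t). curve D i t)"

definition tangent :: "diagram \<Rightarrow> nat \<times> real \<Rightarrow> complex" where
  "tangent D = (\<lambda>(i, t). vector_derivative (curve D i) (at t))"

definition crossings :: "diagram \<Rightarrow> complex set" where
  "crossings D = {z. \<exists>p \<in> params D. \<exists>q \<in> params D. p \<noteq> q \<and> point D p = z \<and> point D q = z}"

definition classical :: "diagram \<Rightarrow> complex set" where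
  "classical D = crossings D - virt D"

text \<open>
  \<open>Im (cnj v * w)\<close> is the determinant of the pair \<open>(v, w)\<close> of plane vectors.
\<close>

definition virtual_link_diagram :: "diagram \<Rightarrow> bool" where
  "virtual_link_diagram D \<longleftrightarrow>
     (\<forall>i < comps D. curve D i C1_differentiable_on UNIV \<and>
        (\<forall>t. curve D i (t + 1) = curve D i t \<and> vector_derivative (curve D i) (at t) \<noteq> 0)) \<and>
     finite (crossings D) \<and>
     (\<forall>z \<in> crossings D. card {p \<in> params D. point D p = z} = 2) \<and>
     (\<forall>p \<in> params D. \<forall>q \<in> params D. p \<noteq> q \<longrightarrow> point D p = point D q \<longrightarrow>
        Im (cnj (tangent D p) * tangent D q) \<noteq> 0) \<and>
     virt D \<subseteq> crossings D \<and>
     over D \<subseteq> {p \<in> params D. point D p \<in> classical D} \<and>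
     (\<forall>z \<in> classical D. \<exists>!p. p \<in> over D \<and> point D p = z)"

definition crossing_sign :: "diagram \<Rightarrow> complex \<Rightarrow> int" where
  "crossing_sign D z =
     (if \<exists>p \<in> over D. \<exists>q \<in> params D. p \<noteq> q \<and> point D p = z \<and> point D q = z \<and>
           0 < Im (cnj (tangent D p) * tangent D q)
      then 1 else -1)"


section \<open>Equivalence of diagrams\<close>

text \<open>
  Planar isotopy, including renumbering and reparametrization of the components: an
  orientation-preserving diffeomorphism \<open>h\<close> of the plane takes one diagram to the other.
\<close>

definition isotopic :: "diagram \<Rightarrow> diagram \<Rightarrow> bool" where
  "isotopic D D' \<longleftrightarrow>
     comps D = comps D' \<and>
     (\<exists>h h' \<sigma> \<phi>.
        bij h \<and> (\<forall>z. (h has_derivative h' z) (at z)) \<and>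
        (\<forall>w. continuous_on UNIV (\<lambda>z. h' z w)) \<and>
        (\<forall>z. 0 < Im (cnj (h' z 1) * h' z \<i>)) \<and>
        \<sigma> permutes {..<comps D} \<and>
        (\<forall>i < comps D. continuous_on UNIV (\<phi> i) \<and> strict_mono (\<phi> i) \<and>
           (\<forall>t. \<phi> i (t + 1) = \<phi> i t + 1 \<and> curve D' i t = h (curve D (\<sigma> i) (\<phi> i t)))) \<and>
        virt D' = h ` virt D \<and>
        over D' = {(i, t) \<in> params D'. (\<sigma> i, frac (\<phi> i t)) \<in> over D})"

text \<open>
  A strand \<open>(i, a, b)\<close> is the arc of component \<open>i\<close> with parameters from \<open>a\<close> to \<open>b\<close>, where
  parameters are taken modulo 1.
\<close>

type_synonym strand = "nat \<times> real \<times> real"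

fun strand_of :: "diagram \<Rightarrow> strand \<Rightarrow> bool" where
  "strand_of D (i, a, b) \<longleftrightarrow> i < comps D \<and> a < b \<and> b < a + 1"

fun strand_params :: "strand \<Rightarrow> (nat \<times> real) set" where
  "strand_params (i, a, b) = (\<lambda>t. (i, frac t)) ` {a..b}"

definition strand_image :: "diagram \<Rightarrow> strand \<Rightarrow> complex set" where
  "strand_image D k = point D ` strand_params k"

definition passes_over :: "diagram \<Rightarrow> strand \<Rightarrow> strand \<Rightarrow> complex \<Rightarrow> bool" where
  "passes_over D k l z \<longleftrightarrow> z \<in> point D ` (over D \<inter> strand_params k) \<and> z \<in> strand_image D l"

fun before :: "diagram \<Rightarrow> strand \<Rightarrow> complex \<Rightarrow> complex \<Rightarrow> bool" where
  "before D (i, a, b) x y \<longleftrightarrow>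
     (\<exists>s t. a \<le> s \<and> s < t \<and> t \<le> b \<and> curve D i s = x \<and> curve D i t = y)"

text \<open>
  The part of \<open>D\<close> inside the closed disc \<open>U\<close> is a tangle formed by the strands \<open>ks\<close>.
\<close>

definition tangle_in :: "diagram \<Rightarrow> complex set \<Rightarrow> strand list \<Rightarrow> bool" where
  "tangle_in D U ks \<longleftrightarrow>
     U homeomorphic cball (0 :: complex) 1 \<and>
     (\<forall>k \<in> set ks. strand_of D k) \<and>
     sorted_wrt (\<lambda>k l. strand_params k \<inter> strand_params l = {}) ks \<and>
     {p \<in> params D. point D p \<in> U} = (\<Union>k \<in> set ks. strand_params k) \<and>
     (\<forall>(i, a, b) \<in> set ks. curve D i a \<in> frontier U \<and> curve D i b \<in> frontier U \<and>
        curve D i ` {a<..<b} \<subseteq> interior U) \<and>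
     crossings D \<inter> frontier U = {}"

text \<open>
  \<open>D\<close> and \<open>D'\<close> are related by replacing the tangle inside \<open>U\<close>.  The moves below are described
  by the crossings inside the disc, which determine a tangle of the given kind up to isotopy of
  the disc relative to its boundary.
\<close>

definition tangle_replacement ::
  "diagram \<Rightarrow> diagram \<Rightarrow> complex set \<Rightarrow> strand list \<Rightarrow> bool" where
  "tangle_replacement D D' U ks \<longleftrightarrow>
     comps D = comps D' \<and> tangle_in D U ks \<and> tangle_in D' U ks \<and>
     (\<forall>p \<in> params D - (\<Union>k \<in> set ks. strand_params k).
        point D p = point D' p \<and> (p \<in> over D \<longleftrightarrow> p \<in> over D')) \<and>
     virt D - U = virt D' - U"

definition reidemeister1 :: "diagram \<Rightarrow> diagram \<Rightarrow> bool" where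
  "reidemeister1 D D' \<longleftrightarrow>
     (\<exists>U k c. tangle_replacement D D' U [k] \<and>
        crossings D \<inter> U = {} \<and> crossings D' \<inter> U = {c} \<and> c \<in> classical D')"

definition reidemeister2 :: "diagram \<Rightarrow> diagram \<Rightarrow> bool" where
  "reidemeister2 D D' \<longleftrightarrow>
     (\<exists>U k l c d. tangle_replacement D D' U [k, l] \<and>
        crossings D \<inter> U = {} \<and> crossings D' \<inter> U = {c, d} \<and> c \<noteq> d \<and>
        passes_over D' k l c \<and> passes_over D' k l d)"

text \<open>
  In the third move a strand is moved across the crossing of the two others, so that each strand
  meets the two others in the opposite order afterwards.
\<close>

definition reidemeister3 :: "diagram \<Rightarrow> diagram \<Rightarrow> bool" where
  "reidemeister3 D D' \<longleftrightarrow>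
     (\<exists>U k l m x y z x' y' z'. tangle_replacement D D' U [k, l, m] \<and>
        crossings D \<inter> U = {x, y, z} \<and> crossings D' \<inter> U = {x', y', z'} \<and>
        passes_over D k l x \<and> passes_over D k m y \<and> passes_over D l m z \<and>
        passes_over D' k l x' \<and> passes_over D' k m y' \<and> passes_over D' l m z' \<and>
        (before D k x y \<longleftrightarrow> \<not> before D' k x' y') \<and>
        (before D l x z \<longleftrightarrow> \<not> before D' l x' z') \<and>
        (before D m y z \<longleftrightarrow> \<not> before D' m y' z'))"

definition detour :: "diagram \<Rightarrow> diagram \<Rightarrow> bool" where
  "detour D D' \<longleftrightarrow>
     comps D = comps D' \<and>
     (\<exists>k. strand_of D k \<and>
        (\<forall>p \<in> params D - strand_params k.
           point D p = point D' p \<and> (p \<in> over D \<longleftrightarrow> p \<in> over D')) \<and>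
        strand_image D k \<inter> crossings D \<subseteq> virt D \<and>
        strand_image D' k \<inter> crossings D' \<subseteq> virt D' \<and>
        virt D - strand_image D k = virt D' - strand_image D' k)"

text \<open>
  In the Z-move the classical crossing keeps its place in the plane while the positions of the two
  strands at it are interchanged.  Hence the strand that passes over becomes the one that passes
  under.
\<close>

definition Z_move :: "diagram \<Rightarrow> diagram \<Rightarrow> bool" where
  "Z_move D D' \<longleftrightarrow>
     (\<exists>U k l c v c' v'. tangle_replacement D D' U [k, l] \<and>
        crossings D \<inter> U = {c, v} \<and> crossings D' \<inter> U = {c', v'} \<and>
        v \<in> virt D \<inter> strand_image D k \<inter> strand_image D l \<and> v' \<in> virt D' \<inter> strand_image D' k \<inter> strand_image D' l \<and>
        passes_over D k l c \<and> passes_over D' l k c' \<and>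
        (before D k c v \<longleftrightarrow> \<not> before D' k c' v'))"

definition crossing_switch :: "diagram \<Rightarrow> diagram \<Rightarrow> bool" where
  "crossing_switch D D' \<longleftrightarrow>
     (\<exists>c \<in> classical D.
        D' = D\<lparr>over := (over D - point D -` {c}) \<union> {p \<in> params D - over D. point D p = c}\<rparr>)"

definition virtual_move :: "diagram \<Rightarrow> diagram \<Rightarrow> bool" where
  "virtual_move D D' \<longleftrightarrow>
     isotopic D D' \<or> reidemeister1 D D' \<or> reidemeister2 D D' \<or> reidemeister3 D D' \<or> detour D D'"

definition free_equivalent :: "diagram \<Rightarrow> diagram \<Rightarrow> bool" where
  "free_equivalent =
     equivclp (\<lambda>D D'. virtual_link_diagram D \<and> virtual_link_diagram D' \<and>
       (virtual_move D D' \<or> Z_move D D' \<or> crossing_switch D D'))"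


section \<open>The bracket\<close>

definition cparams :: "diagram \<Rightarrow> (nat \<times> real) set" where
  "cparams D = {p \<in> params D. point D p \<in> classical D}"

text \<open>
  \<open>next_param D p\<close> is the next passage through a classical crossing after \<open>p\<close> along the link,
  and \<open>opposite_param D p\<close> is the other passage through the crossing at \<open>p\<close>.  For \<open>p\<close> in
  \<open>cparams D\<close>, the outgoing edge-end at \<open>p\<close> is the beginning of an edge that ends as the incoming
  edge-end at \<open>next_param D p\<close>.
\<close>

definition next_param :: "diagram \<Rightarrow> nat \<times> real \<Rightarrow> nat \<times> real" where
  "next_param D = (\<lambda>(i, t). (i, frac (t + Min {d. 0 < d \<and> d \<le> 1 \<and> (i, frac (t + d)) \<in> cparams D})))"

definition opposite_param :: "diagram \<Rightarrow> nat \<times> real \<Rightarrow> nat \<times> real" where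
  "opposite_param D p = (THE q. q \<in> params D \<and> q \<noteq> p \<and> point D q = point D p)"

text \<open>
  A state is the set \<open>S\<close> of classical crossings that get the unoriented local state.  The edge
  leaving \<open>p\<close> that arrives at a crossing outside \<open>S\<close> is continued by the edge leaving
  \<open>follow D p\<close>, since there the incoming edge-end of one passage is joined to the outgoing
  edge-end of the other one.
\<close>

definition follow :: "diagram \<Rightarrow> nat \<times> real \<Rightarrow> nat \<times> real" where
  "follow D p = opposite_param D (next_param D p)"

definition state_params :: "diagram \<Rightarrow> complex set \<Rightarrow> (nat \<times> real) set" where
  "state_params D S = {p \<in> cparams D. point D p \<in> S}"

definition arrival :: "diagram \<Rightarrow> complex set \<Rightarrow> nat \<times> real \<Rightarrow> complex" where
  "arrival D S p =
     point D ((follow D ^^ (LEAST k. 0 < k \<and> (follow D ^^ k) p \<in> state_params D S)) p)"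

text \<open>
  The circles of the state are the cyclic sequences of edges that avoid the crossings in \<open>S\<close>,
  together with the components of the link without classical crossings.
\<close>

definition state_circles :: "diagram \<Rightarrow> complex set \<Rightarrow> nat" where
  "state_circles D S =
     card {C. \<exists>p \<in> cparams D. C = range (\<lambda>k. (follow D ^^ k) p) \<and> C \<inter> state_params D S = {}} +
     card {i. i < comps D \<and> (\<forall>t. (i, t) \<notin> cparams D)}"

text \<open>
  The vertices \<open>(z, True)\<close> and \<open>(z, False)\<close> are the source and the sink replacing the crossing
  \<open>z\<close>.  The arc \<open>Inr z\<close> joins them, and \<open>Inl p\<close> starts along the outgoing edge-end at \<open>p\<close>.
\<close>

definition state_web :: "diagram \<Rightarrow> complex set \<Rightarrow> (complex \<times> bool, (nat \<times> real) + complex) web" where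
  "state_web D S =
     Web \<lparr>verts = S \<times> UNIV,
          arcs = state_params D S <+> S,
          tail = case_sum (\<lambda>p. (point D p, True)) (\<lambda>z. (z, True)),
          head = case_sum (\<lambda>p. (arrival D S p, False)) (\<lambda>z. (z, False))\<rparr>
         (state_circles D S)"

definition state_weight :: "diagram \<Rightarrow> complex set \<Rightarrow> laurent" where
  "state_weight D S =
     (\<Prod>z \<in> classical D. if z \<in> S then - A_pow (- crossing_sign D z) else A_pow (2 * crossing_sign D z))"

definition bracket :: "(web_class \<Rightarrow> laurent mpoly) \<Rightarrow> diagram \<Rightarrow> laurent mpoly" where
  "bracket f D = (\<Sum>S \<in> Pow (classical D). Const (state_weight D S) * f (web_class (state_web D S)))"

end

theory Submission
  imports Defs
begin

text \<open>
  At \<open>A = \<epsilon>\<close> with \<open>\<epsilon> = 1\<close> or \<open>\<epsilon> = -1\<close> the weight of a state \<open>S\<close> is \<open>(-\<epsilon>)\<close> to the power \<open>card S\<close>, whatever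
  the signs of the crossings are.  So the specialized bracket is a state sum that depends only on the cyclic order of the
  passages through classical crossings along the components (a chord diagram), and neither sees
  virtual crossings nor the over/under information nor the position of the chords in the plane.
  The detour move, the \<open>Z\<close>-move and the crossing switches do not change the chord diagram.  For the
  Reidemeister moves, the states of the crossings inside the disc are resolved locally: the circle,
  bigon and quadrilateral relations become \<open>3\<close>, \<open>2 * \<epsilon>\<close> and a sum of two gluings, and both sides
  of each move reduce to the same combination of gluings of the strands.  In the third move this
  has to be checked for two orientations of the triangle formed by the strands.

  A web obtained by resolving part of a state is presented by a permutation \<open>\<phi>\<close> of ports, some of
  which are attached to vertices; gluing two ends composes \<open>\<phi>\<close> with a transposition.
\<close>

subsection \<open>Specialization at a sign\<close>

text \<open>Resolving a bigon or a quadrilateral deletes and splices arcs and so changes vertices,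
  arcs and the circle count at once. With permutations this stays manageable: an arc is a first
  return between active ports, splicing makes an active port passive, and a circle is an orbit
  without active ports. The coefficients fit because \<epsilon> squares to 1. A kink gives 3 -
  \<epsilon> * 2\<epsilon> = 1. For two parallel strands the unwanted term has coefficient
  -\<epsilon> - \<epsilon> + 2\<epsilon> = 0, for antiparallel ones 3 - 2 - 2 + 1 = 0. For a cyclic
  triangle it has 3 - 3 * 2 + 3 = 0, but a hexagon remains on both sides; no relation reduces it,
  and it has to be matched by an isomorphism of webs. The geometry must supply the order of the
  passages along each strand.\<close>

lemma poly_mapping_sum_single:
  "p = (\<Sum>k \<in> Poly_Mapping.keys p. Poly_Mapping.single k (Poly_Mapping.lookup p k))"
  by (rule poly_mapping_eqI)
    (auto simp: lookup_sum lookup_single when_def in_keys_iff sum.delta)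

text \<open>Both factors expand into monomials, so an additive map is multiplicative as soon as it
  is so on monomials. This serves both for the evaluation of coefficients and for its extension to
  \<open>mpoly\<close>.\<close>

lemma additive_multiplicative:
  fixes F :: "('a::comm_monoid_add \<Rightarrow>\<^sub>0 'b::comm_semiring_1) \<Rightarrow> 'c::comm_semiring_1"
  assumes add: "\<And>p q. F (p + q) = F p + F q"
    and zero: "F 0 = 0"
    and single: "\<And>k l c d. F (Poly_Mapping.single (k + l) (c * d)) =
      F (Poly_Mapping.single k c) * F (Poly_Mapping.single l d)"
  shows "F (p * q) = F p * F q"
proof -
  have sum: "F (sum g A) = (\<Sum>x\<in>A. F (g x))" for g and A :: "'d set"
    by (induction A rule: infinite_finite_induct) (auto simp: add zero)
  let ?s = "\<lambda>p k. Poly_Mapping.single k (Poly_Mapping.lookup p k)"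
  have "p * q = (\<Sum>k \<in> Poly_Mapping.keys p. ?s p k) * (\<Sum>l \<in> Poly_Mapping.keys q. ?s q l)"
    by (rule arg_cong2[where f = "(*)"]) (rule poly_mapping_sum_single)+
  also have "\<dots> = (\<Sum>k \<in> Poly_Mapping.keys p. \<Sum>l \<in> Poly_Mapping.keys q. ?s p k * ?s q l)"
    by (rule sum_product)
  finally have "F (p * q) =
      (\<Sum>k \<in> Poly_Mapping.keys p. \<Sum>l \<in> Poly_Mapping.keys q. F (?s p k * ?s q l))"
    by (simp only: sum)
  also have "\<dots> = (\<Sum>k \<in> Poly_Mapping.keys p. F (?s p k)) * (\<Sum>l \<in> Poly_Mapping.keys q. F (?s q l))"
    by (simp only: mult_single single sum_product)
  also have "\<dots> = F p * F q"
    by (simp only: sum[symmetric] poly_mapping_sum_single[symmetric])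
  finally show ?thesis .
qed

lemma laurent_at_superset:
  assumes "finite A" "Poly_Mapping.keys c \<subseteq> A"
  shows "laurent_at \<epsilon> c = (\<Sum>k \<in> A. Poly_Mapping.lookup c k * \<epsilon> ^ nat \<bar>k\<bar>)"
  unfolding laurent_at_def
  by (rule sum.mono_neutral_left) (use assms in \<open>auto simp: in_keys_iff\<close>)

lemma laurent_at_add: "laurent_at \<epsilon> (c + d) = laurent_at \<epsilon> c + laurent_at \<epsilon> d"
proof -
  let ?A = "Poly_Mapping.keys c \<union> Poly_Mapping.keys d"
  have "Poly_Mapping.keys (c + d) \<subseteq> ?A" by (rule keys_add)
  then show ?thesis
    by (simp add: laurent_at_superset[of ?A] lookup_add algebra_simps sum.distrib)
qed

lemma laurent_at_zero [simp]: "laurent_at \<epsilon> 0 = 0"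
  by (simp add: laurent_at_def)

lemma laurent_at_single [simp]: "laurent_at \<epsilon> (Poly_Mapping.single k c) = c * \<epsilon> ^ nat \<bar>k\<bar>"
  by (simp add: laurent_at_def)

text \<open>As \<epsilon> is its own inverse, \<open>\<epsilon> ^ nat \<bar>k\<bar>\<close> depends
  on the parity of \<open>k\<close> only, and \<bar>k + l\<bar> has the parity of \<bar>k\<bar> +
  \<bar>l\<bar>.\<close>

lemma laurent_at_mult:
  assumes "\<epsilon> = 1 \<or> \<epsilon> = -1"
  shows "laurent_at \<epsilon> (c * d) = laurent_at \<epsilon> c * laurent_at \<epsilon> d"
proof (rule additive_multiplicative)
  fix k l c d :: int
  have "even (nat \<bar>k + l\<bar>) \<longleftrightarrow> even (nat \<bar>k\<bar> + nat \<bar>l\<bar>)"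
    by (simp add: even_nat_iff)
  then have "\<epsilon> ^ nat \<bar>k + l\<bar> = \<epsilon> ^ (nat \<bar>k\<bar> + nat \<bar>l\<bar>)"
    using assms by (auto simp: minus_one_power_iff)
  then show "laurent_at \<epsilon> (Poly_Mapping.single (k + l) (c * d)) =
      laurent_at \<epsilon> (Poly_Mapping.single k c) * laurent_at \<epsilon> (Poly_Mapping.single l d)"
    by (simp add: power_add)
qed (simp_all add: laurent_at_add)

lemma laurent_at_one [simp]: "laurent_at \<epsilon> 1 = 1"
  using laurent_at_single[of \<epsilon> 0 1] by (simp add: single_one)

lemma laurent_at_uminus [simp]: "laurent_at \<epsilon> (- c) = - laurent_at \<epsilon> c"
  using laurent_at_add[of \<epsilon> c "- c"] by simp

lemma laurent_at_prod:
  assumes "\<epsilon> = 1 \<or> \<epsilon> = -1"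
  shows "laurent_at \<epsilon> (\<Prod>x\<in>A. g x) = (\<Prod>x\<in>A. laurent_at \<epsilon> (g x))"
  by (induction A rule: infinite_finite_induct) (auto simp: laurent_at_mult[OF assms])

lemma lookup_specialize: "Poly_Mapping.lookup (specialize \<epsilon> p) m = laurent_at \<epsilon> (Poly_Mapping.lookup p m)"
  by (simp add: specialize_def map.rep_eq when_def)

lemma specialize_single [simp]:
  "specialize \<epsilon> (Poly_Mapping.single m c) = Poly_Mapping.single m (laurent_at \<epsilon> c)"
  by (rule poly_mapping_eqI) (simp add: lookup_specialize lookup_single when_def)

lemma specialize_zero [simp]: "specialize \<epsilon> 0 = 0"
  by (rule poly_mapping_eqI) (simp add: lookup_specialize)

lemma specialize_add: "specialize \<epsilon> (p + q) = specialize \<epsilon> p + specialize \<epsilon> q"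
  by (rule poly_mapping_eqI) (simp add: lookup_specialize lookup_add laurent_at_add)

lemma specialize_sum: "specialize \<epsilon> (\<Sum>x\<in>A. g x) = (\<Sum>x\<in>A. specialize \<epsilon> (g x))"
  by (induction A rule: infinite_finite_induct) (auto simp: specialize_add)

lemma specialize_mult:
  assumes "\<epsilon> = 1 \<or> \<epsilon> = -1"
  shows "specialize \<epsilon> (p * q) = specialize \<epsilon> p * specialize \<epsilon> q"
  by (rule additive_multiplicative)
    (simp_all add: specialize_add laurent_at_mult[OF assms] mult_single)

text \<open>Constants become integers of the ring \<open>int mpoly\<close>, so that the later
  cancellations are plain ring arithmetic.\<close>

lemma specialize_Const: "specialize \<epsilon> (Const c) = of_int (laurent_at \<epsilon> c)"
  by (rule trans[OF specialize_single]) (metis of_int_eq_id id_apply single_of_int)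

subsection \<open>Isomorphic webs\<close>

text \<open>Well-formedness is included because it allows a \<open>digraph_iso\<close> to be
  inverted, as the comparison of whole classes in \<open>web_class_eqI\<close> requires.\<close>

definition web_iso :: "('v, 'e) web \<Rightarrow> ('w, 'f) web \<Rightarrow> bool" where
  "web_iso \<Gamma> \<Delta> \<longleftrightarrow> wf_digraph (graph \<Gamma>) \<and> digraph_iso (graph \<Gamma>) (graph \<Delta>) \<and> circles \<Gamma> = circles \<Delta>"

lemma web_isoI:
  assumes "wf_digraph (graph \<Gamma>)"
    and "inj_on f (verts (graph \<Gamma>))" "inj_on g (arcs (graph \<Gamma>))"
    and "verts (graph \<Delta>) = f ` verts (graph \<Gamma>)" "arcs (graph \<Delta>) = g ` arcs (graph \<Gamma>)"
    and "\<And>e. e \<in> arcs (graph \<Gamma>) \<Longrightarrow> tail (graph \<Delta>) (g e) = f (tail (graph \<Gamma>) e)"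
    and "\<And>e. e \<in> arcs (graph \<Gamma>) \<Longrightarrow> head (graph \<Delta>) (g e) = f (head (graph \<Gamma>) e)"
    and "circles \<Gamma> = circles \<Delta>"
  shows "web_iso \<Gamma> \<Delta>"
proof -
  \<comment> \<open>\<open>app_iso\<close> takes tail and head of the image graph from the record.
    Inserting those of \<Delta> makes them agree as total functions, also outside the arcs.\<close>
  let ?hom = "\<lparr>iso_verts = f, iso_arcs = g, iso_head = head (graph \<Delta>), iso_tail = tail (graph \<Delta>)\<rparr>"
  have "pre_digraph.digraph_isomorphism (graph \<Gamma>) ?hom"
    using assms by (simp add: pre_digraph.digraph_isomorphism_def)
  moreover have "graph \<Delta> = app_iso ?hom (graph \<Gamma>)"
    using assms by (simp add: app_iso_def)
  ultimately show ?thesis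
    using assms unfolding web_iso_def digraph_iso_def by blast
qed

lemma web_iso_sym: "web_iso \<Gamma> \<Delta> \<Longrightarrow> digraph_iso (graph \<Delta>) (graph \<Gamma>)"
  unfolding web_iso_def by (blast intro: digraph_iso_swap)

lemma web_class_eqI:
  assumes "web_iso \<Gamma> \<Delta>"
  shows "web_class \<Gamma> = web_class \<Delta>"
proof -
  have "digraph_iso (graph \<Gamma>) (graph \<Lambda>) \<longleftrightarrow> digraph_iso (graph \<Delta>) (graph \<Lambda>)" for \<Lambda> :: "(nat, nat) web"
    using assms digraph_iso_trans[OF web_iso_sym[OF assms]] digraph_iso_trans[of "graph \<Gamma>" "graph \<Delta>"]
    unfolding web_iso_def by blast
  then show ?thesis using assms unfolding web_class_def web_iso_def by simp
qed

subsection \<open>First returns of a permutation\<close>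

text \<open>Unlike \<open>permutes\<close>, this says nothing about values outside \<open>P\<close>,
  so one function can be used on smaller and smaller sets of ports.\<close>

definition perm :: "'a set \<Rightarrow> ('a \<Rightarrow> 'a) \<Rightarrow> bool" where
  "perm P \<phi> \<longleftrightarrow> finite P \<and> bij_betw \<phi> P P"

definition orb :: "('a \<Rightarrow> 'a) \<Rightarrow> 'a \<Rightarrow> 'a set" where
  "orb \<phi> p = range (\<lambda>k. (\<phi> ^^ k) p)"

definition ret :: "('a \<Rightarrow> 'a) \<Rightarrow> 'a set \<Rightarrow> 'a \<Rightarrow> 'a" where
  "ret \<phi> Q p = (\<phi> ^^ (LEAST k. 0 < k \<and> (\<phi> ^^ k) p \<in> Q)) p"

definition loops :: "'a set \<Rightarrow> ('a \<Rightarrow> 'a) \<Rightarrow> 'a set \<Rightarrow> 'a set set" where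
  "loops P \<phi> Q = {C. \<exists>p \<in> P. C = orb \<phi> p \<and> C \<inter> Q = {}}"

text \<open>Following a strand step by step gives an induction principle in place of reasoning about
  the least exponent in \<open>ret\<close>.\<close>

inductive reaches :: "('a \<Rightarrow> 'a) \<Rightarrow> 'a set \<Rightarrow> 'a \<Rightarrow> bool" for \<phi> Q where
  hit: "\<phi> p \<in> Q \<Longrightarrow> reaches \<phi> Q p"
| step: "\<phi> p \<notin> Q \<Longrightarrow> reaches \<phi> Q (\<phi> p) \<Longrightarrow> reaches \<phi> Q p"

lemma funpow_Suc_apply: "(\<phi> ^^ Suc k) p = (\<phi> ^^ k) (\<phi> p)"
  by (simp add: funpow_swap1)

lemma reachesI: "0 < k \<Longrightarrow> (\<phi> ^^ k) p \<in> Q \<Longrightarrow> reaches \<phi> Q p"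
proof (induction k arbitrary: p)
  case (Suc k)
  show ?case
  proof (cases "\<phi> p \<in> Q")
    case True then show ?thesis by (rule hit)
  next
    case False
    with Suc.prems have "0 < k" by (cases k) auto
    with Suc False show ?thesis unfolding funpow_Suc_apply by (blast intro: step)
  qed
qed simp

lemma ret_eqI:
  assumes "0 < k" "(\<phi> ^^ k) p \<in> Q" "\<And>j. 0 < j \<Longrightarrow> j < k \<Longrightarrow> (\<phi> ^^ j) p \<notin> Q"
  shows "ret \<phi> Q p = (\<phi> ^^ k) p"
proof -
  have "(LEAST k. 0 < k \<and> (\<phi> ^^ k) p \<in> Q) = k"
    using assms by (intro Least_equality) (auto simp: not_less[symmetric])
  then show ?thesis by (simp add: ret_def)
qed

lemma ret_hit: "\<phi> p \<in> Q \<Longrightarrow> ret \<phi> Q p = \<phi> p"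
  using ret_eqI[of 1 \<phi> p Q] by simp

lemma reaches_first:
  "reaches \<phi> Q p \<Longrightarrow> \<exists>k>0. (\<phi> ^^ k) p \<in> Q \<and> (\<forall>j. 0 < j \<longrightarrow> j < k \<longrightarrow> (\<phi> ^^ j) p \<notin> Q)"
proof (induction rule: reaches.induct)
  case (hit p)
  then show ?case by (intro exI[of _ 1]) auto
next
  case (step p)
  then obtain k where k: "0 < k" "(\<phi> ^^ k) (\<phi> p) \<in> Q"
    "\<forall>j. 0 < j \<longrightarrow> j < k \<longrightarrow> (\<phi> ^^ j) (\<phi> p) \<notin> Q" by blast
  have "(\<phi> ^^ j) p \<notin> Q" if "0 < j" "j < Suc k" for j
    using that k(3) step(1) by (cases j; cases "j = 1") (auto simp: funpow_Suc_apply simp del: funpow.simps(2))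
  with k show ?case
    by (intro exI[of _ "Suc k"]) (simp add: funpow_Suc_apply del: funpow.simps(2))
qed

lemma ret_step:
  assumes "\<phi> p \<notin> Q" "reaches \<phi> Q (\<phi> p)"
  shows "ret \<phi> Q p = ret \<phi> Q (\<phi> p)"
proof -
  obtain k where k: "0 < k" "(\<phi> ^^ k) (\<phi> p) \<in> Q"
    "\<forall>j. 0 < j \<longrightarrow> j < k \<longrightarrow> (\<phi> ^^ j) (\<phi> p) \<notin> Q" using reaches_first[OF assms(2)] by blast
  have "(\<phi> ^^ j) p \<notin> Q" if "0 < j" "j < Suc k" for j
    using that k(3) assms(1) by (cases j; cases "j = 1") (auto simp: funpow_Suc_apply simp del: funpow.simps(2))
  then have "ret \<phi> Q p = (\<phi> ^^ Suc k) p"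
    using k by (intro ret_eqI) (simp_all add: funpow_Suc_apply del: funpow.simps(2))
  moreover have "ret \<phi> Q (\<phi> p) = (\<phi> ^^ k) (\<phi> p)"
    using k by (intro ret_eqI) auto
  ultimately show ?thesis by (simp add: funpow_Suc_apply del: funpow.simps(2))
qed

lemma ret_in: "reaches \<phi> Q p \<Longrightarrow> ret \<phi> Q p \<in> Q"
  by (induction rule: reaches.induct) (auto simp: ret_hit ret_step)

section \<open>Cycles, orbits and first-return maps of permutations of a finite set\<close>

lemma perm_finite: "perm P \<phi> \<Longrightarrow> finite P"
  by (simp add: perm_def)

lemma perm_in: "perm P \<phi> \<Longrightarrow> x \<in> P \<Longrightarrow> \<phi> x \<in> P"
  by (auto simp: perm_def bij_betw_def)

lemma perm_inj: "perm P \<phi> \<Longrightarrow> x \<in> P \<Longrightarrow> y \<in> P \<Longrightarrow> \<phi> x = \<phi> y \<longleftrightarrow> x = y"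
  by (auto simp: perm_def bij_betw_def inj_on_def)

lemma perm_funpow_in: "perm P \<phi> \<Longrightarrow> x \<in> P \<Longrightarrow> (\<phi> ^^ k) x \<in> P"
  by (induction k) (auto simp: perm_in)

text \<open>Pigeonhole gives two equal iterates, and injectivity of the smaller power cancels the
  common part.\<close>

lemma perm_cycle:
  assumes "perm P \<phi>" "x \<in> P"
  obtains k where "0 < k" "(\<phi> ^^ k) x = x"
proof -
  have "\<not> inj_on (\<lambda>k. (\<phi> ^^ k) x) UNIV"
  proof
    assume "inj_on (\<lambda>k. (\<phi> ^^ k) x) UNIV"
    then have "infinite (range (\<lambda>k. (\<phi> ^^ k) x))" by (rule range_inj_infinite)
    moreover have "range (\<lambda>k. (\<phi> ^^ k) x) \<subseteq> P" using perm_funpow_in[OF assms] by auto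
    ultimately show False using perm_finite[OF assms(1)] finite_subset by blast
  qed
  then obtain i j where "i < j" "(\<phi> ^^ i) x = (\<phi> ^^ j) x"
    unfolding inj_on_def by (metis linorder_neqE_nat)
  moreover have "(\<phi> ^^ j) x = (\<phi> ^^ i) ((\<phi> ^^ (j - i)) x)"
    using \<open>i < j\<close> by (metis add_diff_inverse_nat comp_apply funpow_add less_imp_le not_le)
  moreover have "inj_on (\<phi> ^^ i) P"
    using assms(1) bij_betw_funpow bij_betw_imp_inj_on unfolding perm_def by blast
  ultimately have "(\<phi> ^^ (j - i)) x = x"
    using assms(2) perm_funpow_in[OF assms] by (metis inj_onD)
  with \<open>i < j\<close> that[of "j - i"] show ?thesis by simp
qed

lemma perm_reaches: "perm P \<phi> \<Longrightarrow> Q \<subseteq> P \<Longrightarrow> x \<in> Q \<Longrightarrow> reaches \<phi> Q x"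
  by (metis perm_cycle reachesI subsetD)

text \<open>On a full turn of the cycle of \<open>q\<close>, the last visit to \<open>Q\<close>
  before the cycle closes is a preimage of \<open>q\<close>. There is one, since the turn starts at
  \<open>q\<close> itself.\<close>

lemma ret_surj:
  assumes "perm P \<phi>" "Q \<subseteq> P" "q \<in> Q"
  shows "\<exists>x \<in> Q. ret \<phi> Q x = q"
proof -
  obtain n where n: "0 < n" "(\<phi> ^^ n) q = q"
    using assms perm_cycle by (metis subsetD)
  define J where "J = {j. j < n \<and> (\<phi> ^^ j) q \<in> Q}"
  have J: "finite J" "0 \<in> J" using n assms by (auto simp: J_def)
  define j where "j = Max J"
  have j: "j \<in> J" "\<And>i. i \<in> J \<Longrightarrow> i \<le> j"
    unfolding j_def using J by (auto intro: Max_in Max_ge)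
  have eq: "(\<phi> ^^ i) ((\<phi> ^^ j) q) = (\<phi> ^^ (i + j)) q" for i
    by (simp add: funpow_add)
  have jn: "j < n" and jQ: "(\<phi> ^^ j) q \<in> Q" using j(1) by (simp_all add: J_def)
  have last: "(\<phi> ^^ (n - j)) ((\<phi> ^^ j) q) = q" unfolding eq using jn n(2) by simp
  have "ret \<phi> Q ((\<phi> ^^ j) q) = (\<phi> ^^ (n - j)) ((\<phi> ^^ j) q)"
  proof (rule ret_eqI)
    fix i assume i: "0 < i" "i < n - j"
    then have "i + j \<notin> J" using j(2)[of "i + j"] by linarith
    moreover have "i + j < n" using i by linarith
    ultimately show "(\<phi> ^^ i) ((\<phi> ^^ j) q) \<notin> Q" by (simp add: eq J_def)
  next
    show "0 < n - j" using jn by simp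
    show "(\<phi> ^^ (n - j)) ((\<phi> ^^ j) q) \<in> Q" unfolding last by (rule assms(3))
  qed
  then show ?thesis using jQ unfolding last by (rule bexI)
qed

lemma ret_bij:
  assumes "perm P \<phi>" "Q \<subseteq> P"
  shows "bij_betw (ret \<phi> Q) Q Q"
proof -
  have fin: "finite Q" using perm_finite[OF assms(1)] assms(2) by (rule finite_subset[rotated])
  have "Q \<subseteq> ret \<phi> Q ` Q"
  proof
    fix q assume "q \<in> Q"
    then obtain x where "x \<in> Q" "ret \<phi> Q x = q" using ret_surj[OF assms] by blast
    then show "q \<in> ret \<phi> Q ` Q" by (intro image_eqI) simp_all
  qed
  moreover have "ret \<phi> Q ` Q \<subseteq> Q"
    using ret_in[OF perm_reaches[OF assms]] by (rule image_subsetI)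
  ultimately have "ret \<phi> Q ` Q = Q" by (rule subset_antisym[rotated])
  moreover from this have "inj_on (ret \<phi> Q) Q" by (intro eq_card_imp_inj_on fin) simp
  ultimately show ?thesis by (simp add: bij_betw_def)
qed

lemma ret_inj:
  assumes "perm P \<phi>" "Q \<subseteq> P" "x \<in> Q" "y \<in> Q"
  shows "ret \<phi> Q x = ret \<phi> Q y \<longleftrightarrow> x = y"
  using inj_on_eq_iff[OF bij_betw_imp_inj_on[OF ret_bij[OF assms(1,2)]] assms(3,4)] .

lemma orb_self: "x \<in> orb \<phi> x"
  unfolding orb_def using rangeI[of "\<lambda>k. (\<phi> ^^ k) x" 0] by simp

lemma orb_step: "y \<in> orb \<phi> x \<Longrightarrow> \<phi> y \<in> orb \<phi> x"
proof -
  assume "y \<in> orb \<phi> x"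
  then obtain k where "y = (\<phi> ^^ k) x" by (auto simp: orb_def)
  then have "\<phi> y = (\<phi> ^^ Suc k) x" by simp
  then show ?thesis unfolding orb_def by (rule range_eqI)
qed

lemma orb_least:
  assumes "x \<in> A" "\<And>y. y \<in> A \<Longrightarrow> y \<in> orb \<phi> x \<Longrightarrow> \<phi> y \<in> A"
  shows "orb \<phi> x \<subseteq> A"
proof -
  have orb: "(\<phi> ^^ k) x \<in> orb \<phi> x" for k
    unfolding orb_def by (rule rangeI)
  have "(\<phi> ^^ k) x \<in> A" for k
  proof (induction k)
    case (Suc k)
    then show ?case using assms(2)[OF Suc orb] by simp
  qed (use assms(1) in simp)
  then show ?thesis by (auto simp: orb_def)
qed

lemma orb_subset: "y \<in> orb \<phi> x \<Longrightarrow> orb \<phi> y \<subseteq> orb \<phi> x"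
  by (rule orb_least) (auto intro: orb_step)

lemma orb_in_P: "perm P \<phi> \<Longrightarrow> x \<in> P \<Longrightarrow> orb \<phi> x \<subseteq> P"
  by (rule orb_least) (auto intro: perm_in)

text \<open>\<open>orb\<close> iterates forward only. If \<open>n\<close> is a period of
  \<open>x\<close>, then \<open>n * k - k\<close> further steps undo the \<open>k\<close> steps from
  \<open>x\<close> to \<open>y\<close>.\<close>

lemma orb_sym:
  assumes "perm P \<phi>" "x \<in> P" "y \<in> orb \<phi> x"
  shows "x \<in> orb \<phi> y"
proof -
  obtain k where k: "y = (\<phi> ^^ k) x" using assms(3) by (auto simp: orb_def)
  obtain n where n: "0 < n" "(\<phi> ^^ n) x = x" using perm_cycle assms by metis
  have "(\<phi> ^^ (n * j)) x = x" for j
    by (induction j) (auto simp: funpow_add n)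
  moreover have "n * k - k + k = n * k" using n by simp
  then have "(\<phi> ^^ (n * k - k)) y = (\<phi> ^^ (n * k)) x"
    unfolding k by (metis comp_apply funpow_add)
  ultimately have "(\<phi> ^^ (n * k - k)) y = x" by simp
  then show ?thesis by (auto simp: orb_def)
qed

lemma orb_eq: "perm P \<phi> \<Longrightarrow> x \<in> P \<Longrightarrow> y \<in> orb \<phi> x \<Longrightarrow> orb \<phi> y = orb \<phi> x"
  by (rule subset_antisym[OF orb_subset orb_subset[OF orb_sym]])

lemma finite_loops: "perm P \<phi> \<Longrightarrow> finite (loops P \<phi> Q)"
proof -
  assume "perm P \<phi>"
  moreover have "loops P \<phi> Q \<subseteq> orb \<phi> ` P" by (auto simp: loops_def)
  ultimately show ?thesis using perm_finite finite_surj by metis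
qed

section \<open>Transpositions, fixed points and conjugates of permutations\<close>

abbreviation swap :: "'a \<Rightarrow> 'a \<Rightarrow> 'a \<Rightarrow> 'a" where
  "swap \<equiv> Transposition.transpose"

lemma perm_swap:
  assumes "perm P \<phi>" "a \<in> P" "b \<in> P"
  shows "perm P (swap a b \<circ> \<phi>)"
proof -
  have "bij_betw (swap a b) P P"
    using assms(2,3) by (rule permutes_imp_bij[OF permutes_swap_id])
  then show ?thesis using assms(1) unfolding perm_def by (blast intro: bij_betw_trans)
qed

lemma perm_remove:
  assumes "perm P \<phi>" "\<phi> a = a"
  shows "perm (P - {a}) \<phi>"
proof (cases "a \<in> P")
  case True
  then have "bij_betw \<phi> (P - {a}) (P - {a})"
    using assms by (intro bij_betw_DiffI) (auto simp: perm_def)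
  then show ?thesis using assms by (simp add: perm_def)
qed (use assms in simp)

lemma perm_insert:
  assumes "perm P \<phi>" "\<phi> a = a"
  shows "perm (insert a P) \<phi>"
proof (cases "a \<in> P")
  case False
  then have "bij_betw \<phi> (P \<union> {a}) (P \<union> {a})"
    using assms by (intro bij_betw_combine) (auto simp: perm_def)
  then show ?thesis using assms by (simp add: perm_def)
qed (use assms in \<open>simp add: insert_absorb\<close>)

lemma perm_cong: "perm P \<phi> \<Longrightarrow> (\<And>x. x \<in> P \<Longrightarrow> \<psi> x = \<phi> x) \<Longrightarrow> perm P \<psi>"
  unfolding perm_def using bij_betw_cong[of P \<psi> \<phi> P] by simp

lemma perm_comp: "perm P \<phi> \<Longrightarrow> perm P \<psi> \<Longrightarrow> perm P (\<psi> \<circ> \<phi>)"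
  unfolding perm_def using bij_betw_trans[of \<phi> P P \<psi> P] by simp

lemma perm_conj:
  assumes "perm P \<phi>" "inj_on f P" "\<And>x. x \<in> P \<Longrightarrow> \<phi>' (f x) = f (\<phi> x)"
  shows "perm (f ` P) \<phi>'"
proof -
  have "inj_on \<phi>' (f ` P)"
  proof (rule inj_onI, elim imageE)
    fix x y u v assume h: "\<phi>' u = \<phi>' v" "u = f x" "v = f y" "x \<in> P" "y \<in> P"
    then have "f (\<phi> x) = f (\<phi> y)" using assms(3) by simp
    then have "\<phi> x = \<phi> y"
      using inj_on_eq_iff[OF assms(2)] perm_in[OF assms(1)] h by blast
    then show "u = v" using h perm_inj[OF assms(1)] by blast
  qed
  moreover have "\<phi>' ` f ` P = f ` \<phi> ` P" using assms(3) by (simp add: image_image)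
  moreover have "\<phi> ` P = P" using assms(1) by (simp add: perm_def bij_betw_def)
  ultimately show ?thesis using perm_finite[OF assms(1)] unfolding perm_def bij_betw_def by simp
qed

subsection \<open>Webs presented by permutations\<close>

text \<open>
  The ports \<open>P\<close> are places where a strand passes; \<open>\<phi> p\<close> is the port whose incoming side is joined
  to the outgoing side of \<open>p\<close>.  At a port in \<open>Q\<close> the incoming side ends in the sink \<open>t p\<close> and the
  outgoing side starts in the source \<open>s p\<close>; at all other ports the strand passes through.
  Sources get even numbers and sinks odd ones.
\<close>

definition pweb ::
  "'a set \<Rightarrow> ('a \<Rightarrow> 'a) \<Rightarrow> 'a set \<Rightarrow> ('a \<Rightarrow> nat) \<Rightarrow> ('a \<Rightarrow> nat) \<Rightarrow> nat \<Rightarrow> (nat, 'a) web" where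
  "pweb P \<phi> Q s t n =
     Web \<lparr>verts = (\<lambda>p. 2 * s p) ` Q \<union> (\<lambda>p. Suc (2 * t p)) ` Q, arcs = Q,
          tail = (\<lambda>p. 2 * s p), head = (\<lambda>p. Suc (2 * t (ret \<phi> Q p)))\<rparr>
         (n + card (loops P \<phi> Q))"

lemma pweb_simps [simp]:
  "verts (graph (pweb P \<phi> Q s t n)) = (\<lambda>p. 2 * s p) ` Q \<union> (\<lambda>p. Suc (2 * t p)) ` Q"
  "arcs (graph (pweb P \<phi> Q s t n)) = Q"
  "tail (graph (pweb P \<phi> Q s t n)) = (\<lambda>p. 2 * s p)"
  "head (graph (pweb P \<phi> Q s t n)) = (\<lambda>p. Suc (2 * t (ret \<phi> Q p)))"
  "circles (pweb P \<phi> Q s t n) = n + card (loops P \<phi> Q)"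
  by (simp_all add: pweb_def)

lemma pweb_wf:
  assumes "perm P \<phi>" "Q \<subseteq> P"
  shows "wf_digraph (graph (pweb P \<phi> Q s t n))"
proof
  fix e assume "e \<in> arcs (graph (pweb P \<phi> Q s t n))"
  then have "e \<in> Q" "ret \<phi> Q e \<in> Q"
    using ret_in[OF perm_reaches[OF assms]] by simp_all
  then show "tail (graph (pweb P \<phi> Q s t n)) e \<in> verts (graph (pweb P \<phi> Q s t n))"
    "head (graph (pweb P \<phi> Q s t n)) e \<in> verts (graph (pweb P \<phi> Q s t n))"
    by simp_all
qed

text \<open>An active port plays two independent roles: its outgoing side is an arc, renamed by
  \<open>g\<close>, and its incoming side is an end at a sink, renamed by \<open>h\<close>.\<close>

lemma pweb_isoI:
  assumes "perm P \<phi>" "Q \<subseteq> P" "inj_on g Q" "Q' = g ` Q"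
    and s: "\<And>x y. x \<in> Q \<Longrightarrow> y \<in> Q \<Longrightarrow> s' (g x) = s' (g y) \<longleftrightarrow> s x = s y"
    and t: "\<And>x y. x \<in> Q \<Longrightarrow> y \<in> Q \<Longrightarrow> t' (h x) = t' (h y) \<longleftrightarrow> t x = t y"
    and h: "h ` Q = Q'"
    and ret: "\<And>x. x \<in> Q \<Longrightarrow> ret \<phi>' Q' (g x) = h (ret \<phi> Q x)"
    and n: "n + card (loops P \<phi> Q) = n' + card (loops P' \<phi>' Q')"
  shows "web_iso (pweb P \<phi> Q s t n) (pweb P' \<phi>' Q' s' t' n')"
proof (rule web_isoI)
  \<comment> \<open>A vertex is decoded to some port with its label; by \<open>s\<close> and
    \<open>t\<close> the image does not depend on the port chosen.\<close>
  define iv where "iv v =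
    (if even v then 2 * s' (g (SOME x. x \<in> Q \<and> s x = v div 2))
     else Suc (2 * t' (h (SOME x. x \<in> Q \<and> t x = v div 2))))" for v
  have iv_s: "iv (2 * s x) = 2 * s' (g x)" if "x \<in> Q" for x
  proof -
    have "\<exists>y. y \<in> Q \<and> s y = s x" using that by blast
    from someI_ex[OF this] show ?thesis using s[OF _ that] by (simp add: iv_def)
  qed
  have iv_t: "iv (Suc (2 * t x)) = Suc (2 * t' (h x))" if "x \<in> Q" for x
  proof -
    have "\<exists>y. y \<in> Q \<and> t y = t x" using that by blast
    from someI_ex[OF this] show ?thesis using t[OF _ that] by (simp add: iv_def)
  qed
  let ?G = "graph (pweb P \<phi> Q s t n)" and ?H = "graph (pweb P' \<phi>' Q' s' t' n')"
  show "wf_digraph ?G" by (rule pweb_wf[OF assms(1,2)])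
  show "inj_on iv (verts ?G)"
  proof (rule inj_onI)
    fix u v assume uv: "u \<in> verts ?G" "v \<in> verts ?G" "iv u = iv v"
    obtain x where x: "x \<in> Q" "u = 2 * s x \<or> u = Suc (2 * t x)" using uv(1) by auto
    obtain y where y: "y \<in> Q" "v = 2 * s y \<or> v = Suc (2 * t y)" using uv(2) by auto
    note iv = iv_s[OF x(1)] iv_t[OF x(1)] iv_s[OF y(1)] iv_t[OF y(1)]
    have parity: "2 * m \<noteq> Suc (2 * k)" for m k :: nat by presburger
    from x(2) y(2) show "u = v"
    proof (elim disjE)
      assume "u = 2 * s x" "v = 2 * s y"
      then show ?thesis using uv(3) s[OF x(1) y(1)] iv by simp
    next
      assume "u = Suc (2 * t x)" "v = Suc (2 * t y)"
      then show ?thesis using uv(3) t[OF x(1) y(1)] iv by simp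
    next
      assume "u = 2 * s x" "v = Suc (2 * t y)"
      then show ?thesis using uv(3) iv parity by simp
    next
      assume "u = Suc (2 * t x)" "v = 2 * s y"
      then show ?thesis using uv(3) iv parity[symmetric] by simp
    qed
  qed
  show "inj_on g (arcs ?G)" using assms by simp
  have "(\<lambda>p. Suc (2 * t' p)) ` Q' = (\<lambda>p. Suc (2 * t' (h p))) ` Q" unfolding h[symmetric] image_image ..
  then show "verts ?H = iv ` verts ?G"
    using \<open>Q' = g ` Q\<close> by (simp add: image_Un image_image iv_s iv_t)
  show "arcs ?H = g ` arcs ?G" using assms by simp
  show "tail ?H (g e) = iv (tail ?G e)" if "e \<in> arcs ?G" for e
    using that by (simp add: iv_s)
  show "head ?H (g e) = iv (head ?G e)" if "e \<in> arcs ?G" for e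
    using that ret_in[OF perm_reaches[OF assms(1,2)]] by (simp add: iv_t ret)
  show "circles (pweb P \<phi> Q s t n) = circles (pweb P' \<phi>' Q' s' t' n')"
    using n by simp
qed

text \<open>Outgoing sides are renamed by \<open>f\<close>, incoming sides by \<open>g\<close>. At a
  passive port the two sides belong to the same passing strand, hence \<open>g\<close> and
  \<open>f\<close> have to agree there; at active ports they may differ.\<close>

lemma pweb_rename:
  assumes P: "perm P \<phi>" and Q: "Q \<subseteq> P" and inj: "inj_on f P" and P': "P' = f ` P" and Q': "Q' = f ` Q"
    and step: "\<And>x. x \<in> P \<Longrightarrow> \<phi>' (f x) = g (\<phi> x)"
    and off: "\<And>x. x \<in> P - Q \<Longrightarrow> g x = f x" and g: "g ` Q = Q'"
    and s: "\<And>x y. x \<in> Q \<Longrightarrow> y \<in> Q \<Longrightarrow> s' (f x) = s' (f y) \<longleftrightarrow> s x = s y"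
    and t: "\<And>x y. x \<in> Q \<Longrightarrow> y \<in> Q \<Longrightarrow> t' (g x) = t' (g y) \<longleftrightarrow> t x = t y"
  shows "web_iso (pweb P \<phi> Q s t n) (pweb P' \<phi>' Q' s' t' n)"
proof -
  have f_mem: "f x \<in> Q' \<longleftrightarrow> x \<in> Q" if "x \<in> P" for x
    unfolding Q' using inj_on_image_mem_iff[OF inj that Q] .
  have g_mem: "g x \<in> Q' \<longleftrightarrow> x \<in> Q" if "x \<in> P" for x
    using g off[of x] f_mem[OF that] that by (cases "x \<in> Q") auto
  have ret: "reaches \<phi>' Q' (f x) \<and> ret \<phi>' Q' (f x) = g (ret \<phi> Q x)" if "reaches \<phi> Q x" "x \<in> P" for x
    using that
  proof (induction rule: reaches.induct)
    case (hit x)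
    then have "\<phi>' (f x) \<in> Q'" using step g by auto
    with hit show ?case by (simp add: reaches.hit ret_hit step)
  next
    case (step x)
    have x: "\<phi> x \<in> P" using perm_in[OF P] step.prems .
    have eq: "\<phi>' (f x) = f (\<phi> x)" using assms(6)[OF step.prems] off[of "\<phi> x"] x step.hyps by simp
    have nq: "\<phi>' (f x) \<notin> Q'" unfolding eq f_mem[OF x] by (rule step.hyps)
    note ih = step.IH[OF x]
    show ?case
      using ih ret_step[of \<phi>' "f x" Q'] ret_step[of \<phi> x Q] reaches.step[of \<phi>' "f x" Q'] nq step.hyps
      unfolding eq by simp
  qed
  \<comment> \<open>Along an orbit without active ports \<open>g\<close> agrees with
    \<open>f\<close>, so \<open>f\<close> conjugates the whole orbit.\<close>
  have fwd: "orb \<phi>' (f p) = f ` orb \<phi> p" if p: "p \<in> P" "orb \<phi> p \<inter> Q = {}" for p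
  proof -
    have "(\<phi>' ^^ k) (f p) = f ((\<phi> ^^ k) p)" for k
    proof (induction k)
      case (Suc k)
      have "(\<phi> ^^ Suc k) p \<notin> Q" using p(2) unfolding orb_def by blast
      moreover have "(\<phi> ^^ Suc k) p \<in> P" "(\<phi> ^^ k) p \<in> P" by (rule perm_funpow_in[OF P p(1)])+
      ultimately show ?case using Suc step[of "(\<phi> ^^ k) p"] off[of "(\<phi> ^^ Suc k) p"] by simp
    qed simp
    then show ?thesis by (simp add: orb_def image_image)
  qed
  \<comment> \<open>Here the orbit of \<open>p\<close> is not yet known to be free of active ports,
    so this is shown together with the conjugation, by one induction on the iterate.\<close>
  have bwd: "orb \<phi> p \<inter> Q = {}" if p: "p \<in> P" "orb \<phi>' (f p) \<inter> Q' = {}" for p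
  proof -
    have "(\<phi> ^^ k) p \<notin> Q \<and> (\<phi>' ^^ k) (f p) = f ((\<phi> ^^ k) p)" for k
    proof (induction k)
      case 0
      have "f p \<notin> Q'" using p(2) orb_self[of "f p" \<phi>'] by blast
      then show ?case using f_mem[OF p(1)] by simp
    next
      case (Suc k)
      have m: "(\<phi> ^^ Suc k) p \<in> P" "(\<phi> ^^ k) p \<in> P" by (rule perm_funpow_in[OF P p(1)])+
      have eq: "(\<phi>' ^^ Suc k) (f p) = g ((\<phi> ^^ Suc k) p)" using Suc step[OF m(2)] by simp
      have "(\<phi>' ^^ Suc k) (f p) \<notin> Q'" using p(2) unfolding orb_def by blast
      then have "(\<phi> ^^ Suc k) p \<notin> Q" unfolding eq g_mem[OF m(1)] .
      with off[of "(\<phi> ^^ Suc k) p"] m(1) eq show ?case by simp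
    qed
    then show ?thesis unfolding orb_def by blast
  qed
  have "bij_betw (image f) (loops P \<phi> Q) (loops P' \<phi>' Q')"
    unfolding bij_betw_def
  proof
    have "loops P \<phi> Q \<subseteq> Pow P" using orb_in_P[OF P] unfolding loops_def by blast
    then show "inj_on (image f) (loops P \<phi> Q)"
      using inj_on_image_Pow[OF inj] inj_on_subset by blast
    show "image f ` loops P \<phi> Q = loops P' \<phi>' Q'"
    proof (intro equalityI subsetI)
      fix C assume "C \<in> image f ` loops P \<phi> Q"
      then obtain p where p: "p \<in> P" "orb \<phi> p \<inter> Q = {}" "C = f ` orb \<phi> p" unfolding loops_def by blast
      have "f ` orb \<phi> p \<inter> Q' = {}"
        using p(2) f_mem orb_in_P[OF P p(1)] by blast
      then show "C \<in> loops P' \<phi>' Q'" unfolding loops_def P' p(3) fwd[OF p(1,2), symmetric] using p(1) by blast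
    next
      fix C assume "C \<in> loops P' \<phi>' Q'"
      then obtain p where p: "p \<in> P" "C = orb \<phi>' (f p)" "C \<inter> Q' = {}" unfolding loops_def P' by blast
      then have "orb \<phi> p \<inter> Q = {}" using bwd by blast
      then show "C \<in> image f ` loops P \<phi> Q" unfolding loops_def p(2) using p(1) fwd by blast
    qed
  qed
  then have "card (loops P \<phi> Q) = card (loops P' \<phi>' Q')" by (rule bij_betw_same_card)
  moreover have "ret \<phi>' Q' (f x) = g (ret \<phi> Q x)" if "x \<in> Q" for x
    using ret perm_reaches[OF P Q that] that Q by blast
  ultimately show ?thesis
    using inj_on_subset[OF inj Q] Q' g s t by (intro pweb_isoI[OF P Q, where g = f and h = g]) auto
qed

section \<open>Removing a passive port\<close>

lemma swap_comp_apply: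
  "(swap a (\<phi> a) \<circ> \<phi>) x = (if \<phi> x = a then \<phi> a else if \<phi> x = \<phi> a then a else \<phi> x)"
  by (simp add: Transposition.transpose_def)

lemma perm_skip:
  assumes "perm P \<phi>" "a \<in> P"
  shows "perm (P - {a}) (swap a (\<phi> a) \<circ> \<phi>)"
  using perm_remove[OF perm_swap[OF assms(1,2) perm_in[OF assms]], of a] by simp

text \<open>Composing with \<open>swap a (\<phi> a)\<close> sends the predecessor of
  \<open>a\<close> directly to its successor and leaves \<open>a\<close> fixed. If \<open>a\<close>
  was fixed before, the circle through it would be lost with the port, so it is added to
  \<open>n\<close>.\<close>

lemma pweb_skip:
  assumes P: "perm P \<phi>" and Q: "Q \<subseteq> P" and a: "a \<in> P - Q"
  shows "web_iso (pweb P \<phi> Q s t n) (pweb (P - {a}) (swap a (\<phi> a) \<circ> \<phi>) Q s t (n + (if \<phi> a = a then 1 else 0)))"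
proof -
  define \<psi> where "\<psi> = swap a (\<phi> a) \<circ> \<phi>"
  have \<psi>: "\<psi> x = (if \<phi> x = a then \<phi> a else \<phi> x)" if "x \<in> P" "x \<noteq> a" for x
    unfolding \<psi>_def swap_comp_apply using perm_inj[OF P] that a by auto
  have P': "perm (P - {a}) \<psi>" unfolding \<psi>_def using perm_skip[OF P] a by simp
  \<comment> \<open>The induction follows \<phi> and may pass through \<open>a\<close>, which
    \<open>\<psi>\<close> bypasses. The case \<open>x = a\<close> carries over what is known from
    \<open>\<phi> a\<close> on.\<close>
  have ret: "if x = a then \<phi> a \<in> Q \<or> \<phi> a \<noteq> a \<and> reaches \<psi> Q (\<phi> a) \<and> ret \<psi> Q (\<phi> a) = ret \<phi> Q a
      else reaches \<psi> Q x \<and> ret \<psi> Q x = ret \<phi> Q x" if "reaches \<phi> Q x" "x \<in> P" for x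
    using that
  proof (induction rule: reaches.induct)
    case (hit x)
    show ?case
    proof (cases "x = a")
      case False
      then have "\<psi> x = \<phi> x" using \<psi>[OF hit.prems] hit.hyps a by auto
      with hit.hyps False show ?thesis by (simp add: reaches.hit ret_hit)
    qed (use hit in simp)
  next
    case (step x)
    have x: "\<phi> x \<in> P" using perm_in[OF P] step.prems .
    note ih = step.IH[OF x] and r = ret_step[of \<phi> x Q, OF step.hyps]
    show ?case
    proof (cases "x = a")
      case True
      show ?thesis
      proof (cases "\<phi> a = a")
        case eq: True
        then show ?thesis using ih step.hyps True a by simp
      next
        case False
        then show ?thesis using ih True r by simp
      qed
    next
      case x_a: False
      show ?thesis
      proof (cases "\<phi> x = a")
        case True
        then have px: "\<psi> x = \<phi> a" using \<psi>[OF step.prems x_a] by simp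
        show ?thesis
        proof (cases "\<phi> a \<in> Q")
          case hit: True
          then have "ret \<psi> Q x = \<phi> a" "reaches \<psi> Q x" using px by (simp_all add: ret_hit reaches.hit)
          moreover have "ret \<phi> Q x = \<phi> a" using r True hit by (simp add: ret_hit)
          ultimately show ?thesis using x_a by simp
        next
          case False
          then have i: "reaches \<psi> Q (\<psi> x)" "ret \<psi> Q (\<psi> x) = ret \<phi> Q a" using ih True px by simp_all
          have "reaches \<psi> Q x" using reaches.step[of \<psi> x Q] i False px by simp
          moreover have "ret \<psi> Q x = ret \<phi> Q x" using ret_step[of \<psi> x Q] i False px r True by simp
          ultimately show ?thesis using x_a by simp
        qed
      next
        case False
        then have px: "\<psi> x = \<phi> x" using \<psi>[OF step.prems x_a] by simp
        have i: "reaches \<psi> Q (\<psi> x)" "ret \<psi> Q (\<psi> x) = ret \<phi> Q (\<phi> x)" using ih False px by simp_all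
        have "reaches \<psi> Q x" using reaches.step[of \<psi> x Q] i px step.hyps by simp
        moreover have "ret \<psi> Q x = ret \<phi> Q x" using ret_step[of \<psi> x Q] i px r step.hyps by simp
        ultimately show ?thesis using x_a by simp
      qed
    qed
  qed
  have orb: "orb \<psi> x = orb \<phi> x - {a}" if x: "x \<in> P" "x \<noteq> a" for x
  proof
    show "orb \<psi> x \<subseteq> orb \<phi> x - {a}"
    proof (rule orb_least)
      show "x \<in> orb \<phi> x - {a}" using orb_self[of x \<phi>] x by simp
      fix y assume y: "y \<in> orb \<phi> x - {a}" "y \<in> orb \<psi> x"
      then have yP: "y \<in> P" "y \<noteq> a" using orb_in_P[OF P x(1)] by auto
      have "\<psi> y \<noteq> a" using perm_in[OF P', of y] yP by simp
      moreover have "\<psi> y \<in> orb \<phi> x"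
      proof -
        have "\<phi> y \<in> orb \<phi> x" using y(1) orb_step[of y \<phi> x] by simp
        then show ?thesis using \<psi>[OF yP] orb_step[of "\<phi> y" \<phi> x] by auto
      qed
      ultimately show "\<psi> y \<in> orb \<phi> x - {a}" by simp
    qed
    \<comment> \<open>While the iterate sits at \<open>a\<close>, only its predecessor
      \<open>y\<close> is known to be in the new orbit; from there \<open>\<psi>\<close> jumps to
      \<open>\<phi> a\<close>.\<close>
    have "if (\<phi> ^^ k) x = a then \<exists>y \<in> orb \<psi> x. \<phi> y = a \<and> y \<in> P \<and> y \<noteq> a else (\<phi> ^^ k) x \<in> orb \<psi> x" for k
    proof (induction k)
      case 0
      then show ?case using x orb_self by auto
    next
      case (Suc k)
      have m: "(\<phi> ^^ k) x \<in> P" by (rule perm_funpow_in[OF P x(1)])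
      show ?case
      proof (cases "(\<phi> ^^ k) x = a")
        case True
        then obtain y where y: "y \<in> orb \<psi> x" "\<phi> y = a" "y \<in> P" "y \<noteq> a" using Suc by auto
        have "\<psi> y = \<phi> a" using \<psi>[OF y(3,4)] y(2) by simp
        then have "\<phi> a \<in> orb \<psi> x" using orb_step[OF y(1)] by simp
        moreover have "\<phi> a \<noteq> a" using perm_inj[OF P, of y a] y a by auto
        ultimately show ?thesis using True by simp
      next
        case False
        then have k: "(\<phi> ^^ k) x \<in> orb \<psi> x" using Suc by simp
        show ?thesis using orb_step[OF k] k \<psi>[OF m False] m False by auto
      qed
    qed
    then have "(\<phi> ^^ k) x \<in> orb \<psi> x" if "(\<phi> ^^ k) x \<noteq> a" for k
      using that by (smt (verit))
    then show "orb \<phi> x - {a} \<subseteq> orb \<psi> x" unfolding orb_def[of \<phi>] by blast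
  qed
  have fixed: "orb \<phi> a = {a}" if "\<phi> a = a"
    using orb_least[of a "{a}" \<phi>] that orb_self[of a \<phi>] by blast
  \<comment> \<open>Deleting \<open>a\<close> from a loop yields a loop of the smaller permutation,
    except for the loop consisting of \<open>a\<close> alone, which would become empty.\<close>
  let ?L = "loops P \<phi> Q - {{a}}"
  have "bij_betw (\<lambda>C. C - {a}) ?L (loops (P - {a}) \<psi> Q)"
    unfolding bij_betw_def
  proof
    have L: "\<exists>x. x \<in> P \<and> x \<noteq> a \<and> C = orb \<phi> x \<and> C \<inter> Q = {}" if "C \<in> ?L" for C
    proof -
      have "C \<in> loops P \<phi> Q" using that by simp
      then obtain x where x: "x \<in> P" "C = orb \<phi> x" "C \<inter> Q = {}" unfolding loops_def by auto
      show ?thesis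
      proof (cases "x = a")
        case True
        then have "\<phi> a \<noteq> a" using fixed x(2) that by auto
        moreover have m: "\<phi> a \<in> orb \<phi> a" by (rule orb_step[OF orb_self])
        moreover have "orb \<phi> (\<phi> a) = orb \<phi> a" using orb_eq[OF P _ m] a by simp
        ultimately show ?thesis using x True perm_in[OF P, of a] by (intro exI[of _ "\<phi> a"]) simp
      qed (use x in blast)
    qed
    show "inj_on (\<lambda>C. C - {a}) ?L"
    proof (rule inj_onI)
      fix C D assume CD: "C \<in> ?L" "D \<in> ?L" "C - {a} = D - {a}"
      obtain x where x: "x \<in> P" "x \<noteq> a" "C = orb \<phi> x" using L[OF CD(1)] by blast
      obtain y where y: "y \<in> P" "D = orb \<phi> y" using L[OF CD(2)] by blast
      have "x \<in> orb \<phi> y" using CD(3) x y orb_self[of x \<phi>] by blast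
      then show "C = D" unfolding x(3) y(2) using orb_eq[OF P y(1)] by simp
    qed
    show "(\<lambda>C. C - {a}) ` ?L = loops (P - {a}) \<psi> Q"
    proof (intro equalityI subsetI)
      fix D assume "D \<in> (\<lambda>C. C - {a}) ` ?L"
      then obtain C where C: "C \<in> ?L" "D = C - {a}" by blast
      obtain x where x: "x \<in> P" "x \<noteq> a" "C = orb \<phi> x" "C \<inter> Q = {}" using L[OF C(1)] by blast
      then have "D = orb \<psi> x" "D \<inter> Q = {}" "x \<in> P - {a}" using orb[OF x(1,2)] C(2) by auto
      then show "D \<in> loops (P - {a}) \<psi> Q" unfolding loops_def by blast
    next
      fix D assume "D \<in> loops (P - {a}) \<psi> Q"
      then obtain x where x: "x \<in> P" "x \<noteq> a" "D = orb \<psi> x" "D \<inter> Q = {}" unfolding loops_def by blast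
      then have D: "D = orb \<phi> x - {a}" using orb by simp
      have "orb \<phi> x \<inter> Q = {}" using x(4) a unfolding D by blast
      then have "orb \<phi> x \<in> ?L" using x(1,2) orb_self[of x \<phi>] unfolding loops_def by blast
      then show "D \<in> (\<lambda>C. C - {a}) ` ?L" unfolding D by blast
    qed
  qed
  then have card: "card ?L = card (loops (P - {a}) \<psi> Q)" by (rule bij_betw_same_card)
  have "card (loops P \<phi> Q) = card (loops (P - {a}) \<psi> Q) + (if \<phi> a = a then 1 else 0)"
  proof (cases "\<phi> a = a")
    case True
    then have "{a} \<in> loops P \<phi> Q" using a fixed unfolding loops_def by blast
    then have "card (loops P \<phi> Q) = Suc (card ?L)"
      by (rule card.remove[OF finite_loops[OF P]])
    with True show ?thesis unfolding card by simp
  next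
    case False
    have "{a} \<notin> loops P \<phi> Q"
    proof
      assume "{a} \<in> loops P \<phi> Q"
      then obtain p where p: "{a} = orb \<phi> p" unfolding loops_def by blast
      have "\<phi> a \<in> orb \<phi> p" by (rule orb_step) (use p in blast)
      with p False show False by blast
    qed
    then have "?L = loops P \<phi> Q" by (rule Diff_insert0[where B = "{}", unfolded Diff_empty])
    with False show ?thesis unfolding card[symmetric] by simp
  qed
  moreover have "ret \<psi> Q x = ret \<phi> Q x" if "x \<in> Q" for x
  proof -
    have "x \<in> P" "x \<noteq> a" using that Q a by auto
    with ret[OF perm_reaches[OF P Q that]] show ?thesis by simp
  qed
  ultimately show ?thesis
    using a unfolding \<psi>_def[symmetric]
    by (intro pweb_isoI[OF P Q, where g = id and h = id]) auto
qed

section \<open>Deleting and splicing arcs of a presented web\<close>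

text \<open>This is equality with \<open>pweb\<close> up to the values of tail and head outside the
  arcs: deleting and splicing leave old values there.\<close>

definition presents ::
  "(nat, 'a) web \<Rightarrow> 'a set \<Rightarrow> ('a \<Rightarrow> 'a) \<Rightarrow> 'a set \<Rightarrow> ('a \<Rightarrow> nat) \<Rightarrow> ('a \<Rightarrow> nat) \<Rightarrow> nat \<Rightarrow> bool" where
  "presents \<Gamma> P \<phi> Q s t n \<longleftrightarrow>
     verts (graph \<Gamma>) = (\<lambda>p. 2 * s p) ` Q \<union> (\<lambda>p. Suc (2 * t p)) ` Q \<and> arcs (graph \<Gamma>) = Q \<and>
     (\<forall>e\<in>Q. tail (graph \<Gamma>) e = 2 * s e \<and> head (graph \<Gamma>) e = Suc (2 * t (ret \<phi> Q e))) \<and>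
     circles \<Gamma> = n + card (loops P \<phi> Q)"

lemma presents_pweb: "presents (pweb P \<phi> Q s t n) P \<phi> Q s t n"
  by (simp add: presents_def)

lemma presents_iso:
  assumes "presents \<Gamma> P \<phi> Q s t n" "perm P \<phi>" "Q \<subseteq> P"
  shows "web_iso (pweb P \<phi> Q s t n) \<Gamma>"
  by (rule web_isoI[where f = id and g = id])
    (use assms pweb_wf[OF assms(2,3)] in \<open>simp_all add: presents_def\<close>)

lemma presents_cong:
  assumes "presents \<Gamma> P \<phi> Q s t n" "perm P \<phi>" "Q \<subseteq> P"
    and "\<And>x. x \<in> Q \<Longrightarrow> s' x = s x" "\<And>x. x \<in> Q \<Longrightarrow> t' x = t x"
  shows "presents \<Gamma> P \<phi> Q s' t' n"
proof -
  have "ret \<phi> Q x \<in> Q" if "x \<in> Q" for x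
    using ret_in[OF perm_reaches[OF assms(2,3) that]] .
  then show ?thesis using assms by (simp add: presents_def cong: image_cong)
qed

lemma ret_relabel:
  assumes "reaches \<phi> Q x" "p \<in> Q" "r \<in> Q"
  shows "reaches (swap p r \<circ> \<phi>) Q x \<and> ret (swap p r \<circ> \<phi>) Q x = swap p r (ret \<phi> Q x)"
  using assms(1)
proof (induction rule: reaches.induct)
  case (hit x)
  have "swap p r (\<phi> x) \<in> Q" using hit assms(2,3) by (simp add: Transposition.transpose_def)
  then show ?case using hit by (simp add: reaches.hit ret_hit)
next
  case (step x)
  have "swap p r (\<phi> x) = \<phi> x" using step.hyps(1) assms(2,3) by (auto simp: Transposition.transpose_def)
  then have eq: "(swap p r \<circ> \<phi>) x = \<phi> x" by simp
  then show ?case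
    using step reaches.step[of "swap p r \<circ> \<phi>" x Q] ret_step[of "swap p r \<circ> \<phi>" x Q] ret_step[of \<phi> x Q]
    by (simp add: o_def)
qed

lemma loops_relabel:
  assumes "p \<in> Q" "r \<in> Q"
  shows "loops P (swap p r \<circ> \<phi>) Q = loops P \<phi> Q"
proof -
  have orb: "orb (swap p r \<circ> \<phi>) x = orb \<phi> x" if "orb \<phi> x \<inter> Q = {}" for \<phi> :: "'a \<Rightarrow> 'a" and x
  proof -
    have "((swap p r \<circ> \<phi>) ^^ k) x = (\<phi> ^^ k) x" for k
    proof (induction k)
      case (Suc k)
      have "(\<phi> ^^ Suc k) x \<notin> Q" using that unfolding orb_def by blast
      then have "swap p r ((\<phi> ^^ Suc k) x) = (\<phi> ^^ Suc k) x"
        using assms by (auto simp: Transposition.transpose_def)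
      then show ?case using Suc by simp
    qed simp
    then show ?thesis by (simp add: orb_def)
  qed
  have invol: "swap p r \<circ> (swap p r \<circ> \<phi>) = \<phi>" by (simp add: fun_eq_iff)
  show ?thesis
  proof (intro equalityI subsetI)
    fix C assume "C \<in> loops P (swap p r \<circ> \<phi>) Q"
    then obtain x where x: "x \<in> P" "C = orb (swap p r \<circ> \<phi>) x" "C \<inter> Q = {}" unfolding loops_def by auto
    then have "C = orb \<phi> x" using orb[of "swap p r \<circ> \<phi>" x] unfolding invol by simp
    then show "C \<in> loops P \<phi> Q" using x unfolding loops_def by blast
  next
    fix C assume "C \<in> loops P \<phi> Q"
    then obtain x where x: "x \<in> P" "C = orb \<phi> x" "C \<inter> Q = {}" unfolding loops_def by auto
    then have "C = orb (swap p r \<circ> \<phi>) x" using orb[of \<phi> x] by simp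
    then show "C \<in> loops P (swap p r \<circ> \<phi>) Q" using x unfolding loops_def by blast
  qed
qed

text \<open>The first visit to \<open>Q\<close> happens at the same step as before and only its port
  is exchanged, so an exchange of the sink labels compensates for it. The same web thus gets the
  presentation needed for the second resolution of a quadrilateral.\<close>

lemma presents_relabel:
  assumes "presents \<Gamma> P \<phi> Q s t n" "perm P \<phi>" "Q \<subseteq> P" "p \<in> Q" "r \<in> Q"
  shows "presents \<Gamma> P (swap p r \<circ> \<phi>) Q s (t \<circ> swap p r) n"
proof -
  have "ret (swap p r \<circ> \<phi>) Q x = swap p r (ret \<phi> Q x)" if "x \<in> Q" for x
    using ret_relabel[OF perm_reaches[OF assms(2,3) that] assms(4,5)] by simp
  moreover have "swap p r ` Q = Q"
    using permutes_image[OF permutes_swap_id[OF assms(4,5)]] .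
  then have "(\<lambda>x. Suc (2 * t x)) ` swap p r ` Q = (\<lambda>x. Suc (2 * t x)) ` Q" by (rule arg_cong)
  then have "(\<lambda>x. Suc (2 * t x)) ` Q = (\<lambda>x. Suc (2 * t (swap p r x))) ` Q"
    unfolding image_image by (rule sym)
  ultimately show ?thesis
    using assms(1) by (simp add: presents_def loops_relabel[OF assms(4,5)])
qed

lemma perm_Diff_fixed:
  assumes "perm P \<phi>" "B \<subseteq> P" "\<And>b. b \<in> B \<Longrightarrow> \<phi> b = b"
  shows "perm (P - B) \<phi>"
proof -
  have "bij_betw \<phi> B B" using assms(3) by (auto simp: bij_betw_def inj_on_def)
  then show ?thesis
    using assms(1,2) unfolding perm_def by (auto intro!: bij_betw_DiffI)
qed

lemma image_Diff_eq:
  assumes "\<And>b. b \<in> B \<Longrightarrow> \<exists>q \<in> Q - B. h q = h b"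
  shows "h ` Q = h ` (Q - B)"
proof
  show "h ` Q \<subseteq> h ` (Q - B)"
  proof (rule image_subsetI)
    fix x assume "x \<in> Q"
    show "h x \<in> h ` (Q - B)"
    proof (cases "x \<in> B")
      case True
      then obtain q where "q \<in> Q - B" "h q = h x" using assms by blast
      then show ?thesis by (metis imageI)
    qed (use \<open>x \<in> Q\<close> in simp)
  qed
qed (rule image_mono, rule Diff_subset)

text \<open>A fixed active port is an arc that no other strand runs into, so the remaining first
  returns survive its deletion. As \<open>delete_arcs\<close> keeps all vertices, every label used
  in \<open>B\<close> must still occur at a port outside \<open>B\<close>.\<close>

lemma presents_delete:
  assumes \<Gamma>: "presents \<Gamma> P \<phi> Q s t n" and P: "perm P \<phi>" and Q: "Q \<subseteq> P" and B: "B \<subseteq> Q"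
    and fixed: "\<And>b. b \<in> B \<Longrightarrow> \<phi> b = b"
    and s: "\<And>b. b \<in> B \<Longrightarrow> \<exists>q \<in> Q - B. s q = s b" and t: "\<And>b. b \<in> B \<Longrightarrow> \<exists>q \<in> Q - B. t q = t b"
  shows "presents (delete_arcs B \<Gamma>) (P - B) \<phi> (Q - B) s t n" "perm (P - B) \<phi>"
proof -
  show P': "perm (P - B) \<phi>" by (rule perm_Diff_fixed[OF P subset_trans[OF B Q] fixed])
  have ret: "reaches \<phi> (Q - B) x \<and> ret \<phi> (Q - B) x = ret \<phi> Q x" if "reaches \<phi> Q x" "x \<in> P - B" for x
    using that
  proof (induction rule: reaches.induct)
    case (hit x)
    have "\<phi> x \<in> P - B" using perm_in[OF P' hit.prems] .
    then show ?case using hit.hyps by (simp add: reaches.hit ret_hit)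
  next
    case (step x)
    note ih = step.IH[OF perm_in[OF P' step.prems]]
    show ?case
      using ih step.hyps reaches.step[of \<phi> x "Q - B"] ret_step[of \<phi> x "Q - B"] ret_step[of \<phi> x Q] by simp
  qed
  have "loops (P - B) \<phi> (Q - B) = loops P \<phi> Q"
  proof (intro equalityI subsetI)
    fix C assume "C \<in> loops (P - B) \<phi> (Q - B)"
    then obtain x where x: "x \<in> P - B" "C = orb \<phi> x" "C \<inter> (Q - B) = {}" unfolding loops_def by auto
    then have "C \<inter> Q = {}" using orb_in_P[OF P' x(1)] by blast
    then show "C \<in> loops P \<phi> Q" using x unfolding loops_def by blast
  next
    fix C assume "C \<in> loops P \<phi> Q"
    then obtain x where x: "x \<in> P" "C = orb \<phi> x" "C \<inter> Q = {}" unfolding loops_def by auto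
    then have "x \<in> P - B" "C \<inter> (Q - B) = {}" using orb_self[of x \<phi>] B by auto
    then show "C \<in> loops (P - B) \<phi> (Q - B)" using x unfolding loops_def by blast
  qed
  moreover have "(\<lambda>p. 2 * s p) ` Q = (\<lambda>p. 2 * s p) ` (Q - B)"
    "(\<lambda>p. Suc (2 * t p)) ` Q = (\<lambda>p. Suc (2 * t p)) ` (Q - B)"
    by (rule image_Diff_eq; use s t in fastforce)+
  moreover have "ret \<phi> (Q - B) x = ret \<phi> Q x" if "x \<in> Q - B" for x
    using ret[OF perm_reaches[OF P Q]] that Q by auto
  ultimately show "presents (delete_arcs B \<Gamma>) (P - B) \<phi> (Q - B) s t n"
    using \<Gamma> by (simp add: presents_def delete_arcs_def)
qed

lemma ret_drop:
  assumes "reaches \<phi> Q x" "ret \<phi> Q x \<noteq> p"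
  shows "reaches \<phi> (Q - {p}) x \<and> ret \<phi> (Q - {p}) x = ret \<phi> Q x"
  using assms
proof (induction rule: reaches.induct)
  case (hit x)
  then have "\<phi> x \<in> Q - {p}" by (simp add: ret_hit)
  then show ?case using hit.hyps by (simp add: reaches.hit ret_hit)
next
  case (step x)
  then show ?case
    using reaches.step[of \<phi> x "Q - {p}"] ret_step[of \<phi> x "Q - {p}"] ret_step[of \<phi> x Q] by simp
qed

lemma ret_drop_through:
  assumes "reaches \<phi> Q x" "ret \<phi> Q x = p" "reaches \<phi> (Q - {p}) p"
  shows "reaches \<phi> (Q - {p}) x \<and> ret \<phi> (Q - {p}) x = ret \<phi> (Q - {p}) p"
  using assms(1,2)
proof (induction rule: reaches.induct)
  case (hit x)
  then have "\<phi> x = p" by (simp add: ret_hit)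
  then show ?case using reaches.step[of \<phi> x "Q - {p}"] ret_step[of \<phi> x "Q - {p}"] assms(3) by simp
next
  case (step x)
  then show ?case
    using reaches.step[of \<phi> x "Q - {p}"] ret_step[of \<phi> x "Q - {p}"] ret_step[of \<phi> x Q] by simp
qed

text \<open>A loop that appears when \<open>p\<close> becomes passive must contain \<open>p\<close>,
  and it avoids the other active ports just if the strand from \<open>p\<close> returns to
  \<open>p\<close> first.\<close>

lemma card_loops_drop:
  assumes P: "perm P \<phi>" and Q: "Q \<subseteq> P" and p: "p \<in> Q"
  shows "card (loops P \<phi> (Q - {p})) = card (loops P \<phi> Q) + (if ret \<phi> Q p = p then 1 else 0)"
proof -
  have pP: "p \<in> P" using p Q by blast
  have sub: "loops P \<phi> Q \<subseteq> loops P \<phi> (Q - {p})" unfolding loops_def by blast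
  have new: "C = orb \<phi> p" if C: "C \<in> loops P \<phi> (Q - {p})" "C \<notin> loops P \<phi> Q" for C
  proof -
    obtain x where x: "x \<in> P" "C = orb \<phi> x" "C \<inter> (Q - {p}) = {}" using C unfolding loops_def by auto
    have "p \<in> C"
    proof (rule ccontr)
      assume "p \<notin> C"
      then have "C \<inter> Q = {}" using x(3) by blast
      then show False using C(2) x unfolding loops_def by blast
    qed
    then show ?thesis using orb_eq[OF P x(1), of p] x(2) by simp
  qed
  have old: "orb \<phi> p \<notin> loops P \<phi> Q" using orb_self[of p \<phi>] p unfolding loops_def by auto
  show ?thesis
  proof (cases "ret \<phi> Q p = p")
    case True
    obtain k where k: "0 < k" "(\<phi> ^^ k) p \<in> Q" "\<forall>j. 0 < j \<longrightarrow> j < k \<longrightarrow> (\<phi> ^^ j) p \<notin> Q"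
      using reaches_first[OF perm_reaches[OF P Q p]] by auto
    have "ret \<phi> Q p = (\<phi> ^^ k) p" by (rule ret_eqI[OF k(1,2)]) (rule k(3)[rule_format])
    with True have kp: "(\<phi> ^^ k) p = p" by simp
    define A where "A = (\<lambda>j. (\<phi> ^^ j) p) ` {..<k}"
    have "orb \<phi> p \<subseteq> A"
    proof (rule orb_least)
      show "p \<in> A" unfolding A_def using k(1) by (intro image_eqI[of _ _ 0]) simp_all
      fix y assume "y \<in> A"
      then obtain j where j: "j < k" "y = (\<phi> ^^ j) p" unfolding A_def by auto
      show "\<phi> y \<in> A"
      proof (cases "Suc j = k")
        case True
        then have "\<phi> y = (\<phi> ^^ k) p" using j by auto
        then show ?thesis using kp \<open>p \<in> A\<close> by simp
      next
        case False
        then have "Suc j < k" using j by simp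
        then show ?thesis unfolding A_def using j by (intro image_eqI[of _ _ "Suc j"]) simp_all
      qed
    qed
    moreover have "A \<inter> (Q - {p}) = {}"
    proof -
      have avoid: "(\<phi> ^^ j) p \<notin> Q - {p}" if "j < k" for j
        using k(3) that by (cases "j = 0") auto
      have "y \<notin> Q - {p}" if y: "y \<in> A" for y
      proof -
        obtain j where j: "j < k" "y = (\<phi> ^^ j) p" using y unfolding A_def by auto
        show ?thesis unfolding j(2) by (rule avoid[OF j(1)])
      qed
      then show ?thesis by (simp only: disjoint_iff) simp
    qed
    ultimately have "orb \<phi> p \<inter> (Q - {p}) = {}"
      using Int_mono[OF _ subset_refl, of "orb \<phi> p" A "Q - {p}"] by (simp only: subset_empty)
    then have mem: "orb \<phi> p \<in> loops P \<phi> (Q - {p})"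
      unfolding loops_def by (intro CollectI bexI[OF _ pP]) simp
    have "loops P \<phi> (Q - {p}) = insert (orb \<phi> p) (loops P \<phi> Q)"
    proof (rule subset_antisym[OF _ insert_subsetI[OF mem sub]], rule subsetI)
      fix C assume "C \<in> loops P \<phi> (Q - {p})"
      then show "C \<in> insert (orb \<phi> p) (loops P \<phi> Q)"
        using new by (cases "C \<in> loops P \<phi> Q") simp_all
    qed
    then have "card (loops P \<phi> (Q - {p})) = Suc (card (loops P \<phi> Q))"
      using card_insert_disjoint[OF finite_loops[OF P] old] by (simp only:)
    with True show ?thesis by simp
  next
    case False
    obtain k where k: "(\<phi> ^^ k) p \<in> Q" "\<forall>j. 0 < j \<longrightarrow> j < k \<longrightarrow> (\<phi> ^^ j) p \<notin> Q" "0 < k"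
      using reaches_first[OF perm_reaches[OF P Q p]] by auto
    have "ret \<phi> Q p = (\<phi> ^^ k) p" by (rule ret_eqI[OF k(3,1)]) (rule k(2)[rule_format])
    with False have "(\<phi> ^^ k) p \<noteq> p" by simp
    moreover have "(\<phi> ^^ k) p \<in> orb \<phi> p" unfolding orb_def by simp
    ultimately have "orb \<phi> p \<inter> (Q - {p}) \<noteq> {}" using k(1) by blast
    then have "orb \<phi> p \<notin> loops P \<phi> (Q - {p})" unfolding loops_def by blast
    then have "loops P \<phi> (Q - {p}) = loops P \<phi> Q" using sub new by blast
    then show ?thesis using False by simp
  qed
qed

text \<open>The outgoing side of \<open>p\<close> starts in \<open>x\<close> and its incoming side
  ends in \<open>y\<close>; gluing these two ends lets the strand run through \<open>p\<close>, so
  \<open>p\<close> becomes passive. Since \<open>p\<close> is alone at both labels, the arcs that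
  \<open>splice\<close> picks by \<open>the_elem\<close> are the ones at \<open>p\<close>.\<close>

lemma presents_splice:
  assumes \<Gamma>: "presents \<Gamma> P \<phi> Q s t n" and P: "perm P \<phi>" and Q: "Q \<subseteq> P" and p: "p \<in> Q"
    and s: "\<And>q. q \<in> Q \<Longrightarrow> s q = s p \<Longrightarrow> q = p" and t: "\<And>q. q \<in> Q \<Longrightarrow> t q = t p \<Longrightarrow> q = p"
    and xy: "x = 2 * s p" "y = Suc (2 * t p)"
  shows "presents (splice x y \<Gamma>) P \<phi> (Q - {p}) s t n"
proof -
  let ?G = "graph \<Gamma>"
  have G: "verts ?G = (\<lambda>p. 2 * s p) ` Q \<union> (\<lambda>p. Suc (2 * t p)) ` Q" "arcs ?G = Q"
    "\<And>e. e \<in> Q \<Longrightarrow> tail ?G e = 2 * s e" "\<And>e. e \<in> Q \<Longrightarrow> head ?G e = Suc (2 * t (ret \<phi> Q e))"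
    "circles \<Gamma> = n + card (loops P \<phi> Q)"
    using \<Gamma> by (auto simp: presents_def)
  note rQ = ret_in[OF perm_reaches[OF P Q]]
  obtain q where q: "q \<in> Q" "ret \<phi> Q q = p" using ret_surj[OF P Q p] by auto
  have "out_arcs ?G x = {p}" using G(2,3) s p unfolding out_arcs_def xy by auto
  then have p': "the_elem (out_arcs ?G x) = p" by simp
  have "in_arcs ?G y = {q}"
  proof -
    have only: "e = q" if "e \<in> Q" "head ?G e = y" for e
    proof -
      have "t (ret \<phi> Q e) = t p" using that G(4) xy by simp
      then have "ret \<phi> Q e = p" by (rule t[OF rQ[OF that(1)]])
      then show ?thesis using ret_inj[OF P Q that(1) q(1)] unfolding q(2) by (rule iffD1[rotated])
    qed
    have hq: "head ?G q = y" unfolding xy G(4)[OF q(1)] q(2) ..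
    show ?thesis
    proof (intro set_eqI iffI)
      fix e assume "e \<in> in_arcs ?G y"
      then have "e \<in> Q" "head ?G e = y" by (simp_all add: in_arcs_def G(2))
      then show "e \<in> {q}" using only[of e] by simp
    next
      fix e assume "e \<in> {q}"
      then show "e \<in> in_arcs ?G y" using q(1) hq unfolding in_arcs_def G(2) by simp
    qed
  qed
  then have q': "the_elem (in_arcs ?G y) = q" by simp
  have parity: "2 * m \<noteq> Suc (2 * k)" for m k :: nat by presburger
  have verts: "verts ?G - {x, y} = (\<lambda>p. 2 * s p) ` (Q - {p}) \<union> (\<lambda>p. Suc (2 * t p)) ` (Q - {p})"
    using s t unfolding G(1) xy by (auto simp: parity parity[symmetric])
  have rp: "p = q \<longleftrightarrow> ret \<phi> Q p = p" using ret_inj[OF P Q p q(1)] unfolding q(2) by (rule sym)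
  show ?thesis
  proof (cases "p = q")
    case True
    have "ret \<phi> (Q - {p}) e = ret \<phi> Q e" if "e \<in> Q - {p}" for e
    proof -
      have e: "e \<in> Q" using that by simp
      have "ret \<phi> Q e \<noteq> p" using ret_inj[OF P Q e q(1)] that unfolding q(2) by (simp add: True)
      then show ?thesis using ret_drop[OF perm_reaches[OF P Q e]] by simp
    qed
    then show ?thesis
      using True rp verts G card_loops_drop[OF P Q p]
      by (simp add: presents_def splice_def Let_def p' q')
  next
    case False
    have rpp: "ret \<phi> Q p \<noteq> p" using False rp by simp
    note dp = ret_drop[OF perm_reaches[OF P Q p] rpp]
    \<comment> \<open>The arc \<open>q\<close>, which used to end at \<open>p\<close>, is prolonged
      by the arc that started there.\<close>
    have "ret \<phi> (Q - {p}) e = (if e = q then ret \<phi> Q p else ret \<phi> Q e)" if "e \<in> Q - {p}" for e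
    proof -
      have e: "e \<in> Q" using that by simp
      show ?thesis
      proof (cases "e = q")
        case True
        then show ?thesis
          using ret_drop_through[OF perm_reaches[OF P Q e], of p] dp q by simp
      next
        case False
        then have "ret \<phi> Q e \<noteq> p" using ret_inj[OF P Q e q(1)] unfolding q(2) by simp
        then show ?thesis using ret_drop[OF perm_reaches[OF P Q e]] False by simp
      qed
    qed
    then show ?thesis
      using False rpp verts G card_loops_drop[OF P Q p] p
      by (simp add: presents_def splice_def Let_def p' q')
  qed
qed

section \<open>Trivalence of presented webs\<close>

text \<open>Vertices are classes of ports with equal label, and a port contributes one outgoing arc
  to its source and one incoming arc to its sink.\<close>

definition triv :: "'a set \<Rightarrow> ('a \<Rightarrow> nat) \<Rightarrow> ('a \<Rightarrow> nat) \<Rightarrow> bool" where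
  "triv Q s t \<longleftrightarrow> finite Q \<and> (\<forall>x \<in> Q. card {y \<in> Q. s y = s x} = 3 \<and> card {y \<in> Q. t y = t x} = 3)"

lemma triv_three:
  assumes "triv Q s t" "{a, b, c} \<subseteq> Q" "distinct [a, b, c]"
  shows "s a = s c \<Longrightarrow> s b = s c \<Longrightarrow> q \<in> Q \<Longrightarrow> s q = s c \<Longrightarrow> q \<in> {a, b, c}"
    and "t a = t c \<Longrightarrow> t b = t c \<Longrightarrow> q \<in> Q \<Longrightarrow> t q = t c \<Longrightarrow> q \<in> {a, b, c}"
proof -
  have card: "card {a, b, c} = 3" using assms(3) by simp
  {
    assume h: "s a = s c" "s b = s c" "q \<in> Q" "s q = s c"
    have "{a, b, c} = {y \<in> Q. s y = s c}"
      by (rule card_subset_eq) (use assms h card in \<open>auto simp: triv_def\<close>)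
    then show "q \<in> {a, b, c}" using h by blast
  next
    assume h: "t a = t c" "t b = t c" "q \<in> Q" "t q = t c"
    have "{a, b, c} = {y \<in> Q. t y = t c}"
      by (rule card_subset_eq) (use assms h card in \<open>auto simp: triv_def\<close>)
    then show "q \<in> {a, b, c}" using h by blast
  }
qed

lemma triv_insert3:
  assumes "triv Q s t" "{a, b, c} \<inter> Q = {}" "distinct [a, b, c]"
    and "s a = s c" "s b = s c" "t a = t c" "t b = t c" "s c \<notin> s ` Q" "t c \<notin> t ` Q"
  shows "triv (insert a (insert b (insert c Q))) s t"
proof -
  let ?Q = "insert a (insert b (insert c Q))"
  have Q: "s x \<noteq> s c" "t x \<noteq> t c" if "x \<in> Q" for x
    using assms(8,9) imageI[OF that, of s] imageI[OF that, of t] by metis+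
  have new: "{y \<in> ?Q. s y = s c} = {a, b, c}" "{y \<in> ?Q. t y = t c} = {a, b, c}"
    using assms(4-7) Q by auto
  have old: "{y \<in> ?Q. s y = s x} = {y \<in> Q. s y = s x}" "{y \<in> ?Q. t y = t x} = {y \<in> Q. t y = t x}"
    if "x \<in> Q" for x
    using assms(4-7) Q[OF that] by auto
  have "card {a, b, c} = 3" using assms(3) by simp
  then have "card {y \<in> ?Q. s y = s x} = 3 \<and> card {y \<in> ?Q. t y = t x} = 3" if "x \<in> ?Q" for x
  proof (cases "x \<in> Q")
    case True
    then show ?thesis using assms(1) unfolding old[OF True] triv_def by blast
  next
    case False
    then have "s x = s c" "t x = t c" using that assms by auto
    then show ?thesis using new \<open>card {a, b, c} = 3\<close> by simp
  qed
  then show ?thesis using assms(1) unfolding triv_def by simp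
qed

text \<open>The bijection \<open>ret\<close> turns the arcs that enter a sink into the ports with
  the label of that sink, which are counted by \<open>triv\<close>.\<close>

lemma trivalent_pweb:
  assumes P: "perm P \<phi>" and Q: "Q \<subseteq> P" and "triv Q s t"
  shows "trivalent_bipartite (pweb P \<phi> Q s t n)"
  unfolding trivalent_bipartite_def
proof (intro conjI ballI)
  let ?G = "graph (pweb P \<phi> Q s t n)"
  interpret wf_digraph ?G by (rule pweb_wf[OF P Q])
  show "fin_digraph ?G" by unfold_locales (use assms(3) in \<open>simp_all add: triv_def\<close>)
  have parity: "2 * m \<noteq> Suc (2 * k)" for m k :: nat by presburger
  show "\<exists>X \<subseteq> verts ?G. \<forall>e \<in> arcs ?G. tail ?G e \<in> X \<and> head ?G e \<notin> X"
    by (rule exI[of _ "(\<lambda>p. 2 * s p) ` Q"]) (auto simp: parity parity[symmetric])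
  fix v assume "v \<in> verts ?G"
  then obtain x where x: "x \<in> Q" "v = 2 * s x \<or> v = Suc (2 * t x)" by auto
  have out: "out_degree ?G v = card {e \<in> Q. 2 * s e = v}"
    by (simp add: out_degree_def out_arcs_def)
  have "{e \<in> Q. Suc (2 * t (ret \<phi> Q e)) = v} = {e \<in> Q. ret \<phi> Q e \<in> {y \<in> Q. Suc (2 * t y) = v}}"
    using ret_in[OF perm_reaches[OF P Q]] by auto
  also have "card \<dots> = card {y \<in> Q. Suc (2 * t y) = v}"
  proof -
    have b: "bij_betw (ret \<phi> Q) Q Q" by (rule ret_bij[OF P Q])
    have "bij_betw (ret \<phi> Q) {e \<in> Q. ret \<phi> Q e \<in> {y \<in> Q. Suc (2 * t y) = v}} {y \<in> Q. Suc (2 * t y) = v}"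
      by (rule bij_betw_subset[OF b]) (use b in \<open>auto simp: bij_betw_def\<close>)
    then show ?thesis by (rule bij_betw_same_card)
  qed
  finally have inn: "in_degree ?G v = card {y \<in> Q. Suc (2 * t y) = v}"
    by (simp add: in_degree_def in_arcs_def)
  from x(2) show "in_degree ?G v + out_degree ?G v = 3"
  proof
    assume "v = 2 * s x"
    then show ?thesis
      using assms(3) x(1) unfolding out inn triv_def by (simp add: parity[symmetric])
  next
    assume "v = Suc (2 * t x)"
    then show ?thesis
      using assms(3) x(1) unfolding out inn triv_def by (simp add: parity)
  qed
qed

subsection \<open>Evaluating presentations at a sign\<close>

locale evaluation =
  fixes f :: "web_class \<Rightarrow> laurent mpoly" and \<epsilon> :: int
  assumes evaluation: "web_evaluation f" and sign: "\<epsilon> = 1 \<or> \<epsilon> = -1"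
begin

definition F where
  "F P \<phi> Q s t n = specialize \<epsilon> (f (web_class (pweb P \<phi> Q s t n)))"

lemma F_presents:
  assumes "presents \<Gamma> P \<phi> Q s t n" "perm P \<phi>" "Q \<subseteq> P"
  shows "specialize \<epsilon> (f (web_class \<Gamma>)) = F P \<phi> Q s t n"
  unfolding F_def web_class_eqI[OF presents_iso[OF assms]] ..

text \<open>The labels matter up to injective renaming only, and sources and sinks may be renamed by
  different maps \<open>u\<close> and \<open>v\<close>.\<close>

lemma F_rename:
  assumes "perm P \<phi>" "Q \<subseteq> P" "inj_on h P" "P' = h ` P" "Q' = h ` Q"
    and "\<And>x. x \<in> P \<Longrightarrow> \<phi>' (h x) = g (\<phi> x)"
    and "\<And>x. x \<in> P - Q \<Longrightarrow> g x = h x" "g ` Q = Q'"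
    and "\<And>x. x \<in> Q \<Longrightarrow> s' (h x) = u (s x)" "\<And>x. x \<in> Q \<Longrightarrow> t' (g x) = v (t x)"
    and "inj_on u (s ` Q)" "inj_on v (t ` Q)"
  shows "F P \<phi> Q s t n = F P' \<phi>' Q' s' t' n"
proof -
  have "web_iso (pweb P \<phi> Q s t n) (pweb P' \<phi>' Q' s' t' n)"
    by (rule pweb_rename[OF assms(1-8)])
      (simp_all add: assms(9,10) inj_on_eq_iff[OF assms(11)] inj_on_eq_iff[OF assms(12)])
  then show ?thesis unfolding F_def using web_class_eqI by metis
qed

lemma F_cong:
  assumes "perm P \<phi>" "Q \<subseteq> P" "\<And>x. x \<in> P \<Longrightarrow> \<phi>' x = \<phi> x"
    and "\<And>x. x \<in> Q \<Longrightarrow> s' x = s x" "\<And>x. x \<in> Q \<Longrightarrow> t' x = t x"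
  shows "F P \<phi> Q s t n = F P \<phi>' Q s' t' n"
  by (rule F_rename[where h = id and g = id and u = id and v = id]) (simp_all add: assms)

lemma F_relabel:
  assumes "perm P \<phi>" "Q \<subseteq> P" "\<And>x. x \<in> P \<Longrightarrow> \<phi>' x = g (\<phi> x)"
    and "\<And>x. x \<in> P - Q \<Longrightarrow> g x = x" "g ` Q = Q" "\<And>x. x \<in> Q \<Longrightarrow> t' (g x) = t x"
  shows "F P \<phi> Q s t n = F P \<phi>' Q s t' n"
  by (rule F_rename[where h = id and g = g and u = id and v = id]) (simp_all add: assms)

lemma F_skip:
  assumes "perm P \<phi>" "Q \<subseteq> P" "a \<in> P - Q"
  shows "F P \<phi> Q s t n = F (P - {a}) (swap a (\<phi> a) \<circ> \<phi>) Q s t (n + (if \<phi> a = a then 1 else 0))"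
  unfolding F_def using web_class_eqI[OF pweb_skip[OF assms]] by metis

text \<open>The relations in \<open>web_evaluation\<close> speak of webs with natural numbers as
  arcs, whereas the ports of a link have other types. An injection \<iota> with left inverse
  \<open>j\<close> transports presentations and thereby the relations.\<close>

lemma F_model:
  assumes \<iota>: "inj_on \<iota> P" "\<And>x. x \<in> P \<Longrightarrow> j (\<iota> x) = x"
    and "perm P0 \<psi>" "P0 \<subseteq> P" "R \<subseteq> P0"
  shows "F P0 \<psi> R s t n = F (\<iota> ` P0) (\<iota> \<circ> \<psi> \<circ> j) (\<iota> ` R) (s \<circ> j) (t \<circ> j) n"
proof (rule F_rename[where h = \<iota> and g = \<iota> and u = id and v = id, OF assms(3,5)])
  show "inj_on \<iota> P0" using \<iota>(1) assms(4) by (rule inj_on_subset)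
  have j: "j (\<iota> x) = x" if "x \<in> P0" for x using \<iota>(2) that assms(4) by blast
  then show "(\<iota> \<circ> \<psi> \<circ> j) (\<iota> x) = \<iota> (\<psi> x)" if "x \<in> P0" for x using that by simp
  show "(s \<circ> j) (\<iota> x) = id (s x)" "(t \<circ> j) (\<iota> x) = id (t x)" if "x \<in> R" for x
    using j[of x] that assms(5) by auto
qed simp_all

lemma perm_model:
  assumes \<iota>: "inj_on \<iota> P" "\<And>x. x \<in> P \<Longrightarrow> j (\<iota> x) = x" and "perm P \<psi>"
  shows "perm (\<iota> ` P) (\<iota> \<circ> \<psi> \<circ> j)"
  by (rule perm_conj[OF assms(3) \<iota>(1)]) (simp add: \<iota>(2))

lemma nat_model:
  assumes "perm P \<phi>"
  shows "\<exists>(\<iota> :: 'a \<Rightarrow> nat) j. inj_on \<iota> P \<and> (\<forall>x \<in> P. j (\<iota> x) = x)"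
proof -
  obtain \<iota> :: "'a \<Rightarrow> nat" where "inj_on \<iota> P"
    using finite_imp_inj_to_nat_seg[OF perm_finite[OF assms]] by metis
  then show ?thesis
    by (intro exI[of _ \<iota>] exI[of _ "inv_into P \<iota>"] conjI ballI inv_into_f_f)
qed

lemma triv_model:
  assumes "inj_on \<iota> Q" "\<And>x. x \<in> Q \<Longrightarrow> j (\<iota> x) = x" "triv Q s t"
  shows "triv (\<iota> ` Q) (s \<circ> j) (t \<circ> j)"
proof -
  have *: "card {y \<in> \<iota> ` Q. r (j y) = c} = card {y \<in> Q. r y = c}" for r :: "'a \<Rightarrow> nat" and c
  proof -
    have "{y \<in> \<iota> ` Q. r (j y) = c} = \<iota> ` {y \<in> Q. r y = c}" using assms(2) by auto
    then show ?thesis using card_image[OF inj_on_subset[OF assms(1)], of "{y \<in> Q. r y = c}"] by simp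
  qed
  show ?thesis using assms(3) * unfolding triv_def by (simp add: assms(2))
qed

section \<open>The circle, bigon and quadrilateral relations for presentations\<close>

text \<open>All exponents in the value of a circle are even, so each of its three monomials becomes
  1.\<close>

lemma specialize_f_circle:
  fixes \<Gamma> :: "(nat, nat) web"
  assumes "trivalent_bipartite \<Gamma>"
  shows "specialize \<epsilon> (f (web_class (disjoint_union \<Gamma> circle_web))) = 3 * specialize \<epsilon> (f (web_class \<Gamma>))"
proof -
  have "fin_digraph (graph circle_web)" by unfold_locales (simp_all add: circle_web_def)
  then have "trivalent_bipartite circle_web" unfolding trivalent_bipartite_def by (simp add: circle_web_def)
  with assms have "f (web_class (disjoint_union \<Gamma> circle_web)) = f (web_class \<Gamma>) * f (web_class circle_web)"
    using evaluation unfolding web_evaluation_def by blast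
  moreover have "f (web_class circle_web) = Const (A_pow 6 + 1 + A_pow (-6))"
    using evaluation unfolding web_evaluation_def by blast
  moreover have "laurent_at \<epsilon> (A_pow 6 + 1 + A_pow (-6)) = 3"
    using sign by (auto simp: laurent_at_add)
  then have "specialize \<epsilon> (Const (A_pow 6 + 1 + A_pow (-6))) = 3"
    unfolding specialize_Const by simp
  ultimately show ?thesis by (simp only: specialize_mult[OF sign] mult.commute)
qed

lemma F_circle:
  fixes P :: "'a set"
  assumes P: "perm P \<phi>" and Q: "Q \<subseteq> P" and "triv Q s t"
  shows "F P \<phi> Q s t (Suc n) = 3 * F P \<phi> Q s t n"
proof -
  obtain \<iota> :: "'a \<Rightarrow> nat" and j where \<iota>: "inj_on \<iota> P" "\<And>x. x \<in> P \<Longrightarrow> j (\<iota> x) = x"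
    using nat_model[OF P] by metis
  let ?P = "\<iota> ` P" and ?\<phi> = "\<iota> \<circ> \<phi> \<circ> j" and ?Q = "\<iota> ` Q" and ?s = "s \<circ> j" and ?t = "t \<circ> j"
  have model: "F P \<phi> Q s t n = F ?P ?\<phi> ?Q ?s ?t n" for n by (rule F_model[OF \<iota> P subset_refl Q])
  have P': "perm ?P ?\<phi>" by (rule perm_model[OF \<iota> P])
  have Q': "?Q \<subseteq> ?P" using Q by (rule image_mono)
  have jQ: "j (\<iota> x) = x" if "x \<in> Q" for x using \<iota>(2) Q that by blast
  have T: "triv ?Q ?s ?t" by (rule triv_model[OF inj_on_subset[OF \<iota>(1) Q] jQ assms(3)])
  let ?\<Gamma> = "\<lambda>n. pweb ?P ?\<phi> ?Q ?s ?t n"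
  have "web_iso (?\<Gamma> (Suc n)) (disjoint_union (?\<Gamma> n) circle_web)"
    by (rule web_isoI[where f = Inl and g = Inl, OF pweb_wf[OF P' Q']])
      (simp_all add: disjoint_union_def circle_web_def Plus_def del: pweb_simps(5), simp)
  from web_class_eqI[OF this] show ?thesis
    unfolding model unfolding F_def by (simp only: specialize_f_circle[OF trivalent_pweb[OF P' Q' T]])
qed

text \<open>Both exponents are odd, so each monomial becomes \<epsilon>.\<close>

lemma specialize_bigon_coefficient:
  "specialize \<epsilon> (Const (A_pow 3 + A_pow (-3))) = of_int (2 * \<epsilon>)"
proof -
  have "laurent_at \<epsilon> (A_pow 3 + A_pow (-3)) = 2 * \<epsilon>"
    using sign by (auto simp: laurent_at_add)
  then show ?thesis unfolding specialize_Const by simp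
qed

text \<open>The fixed ports \<open>a\<close> and \<open>b\<close> are two arcs from the source of
  \<open>p\<close> to the sink of \<open>p\<close>. With both of them deleted, the third ends at
  these vertices are the two sides of \<open>p\<close>, and gluing them makes \<open>p\<close>
  passive.\<close>

lemma F_bigon:
  fixes P :: "'a set"
  assumes P: "perm P \<phi>" and Q: "Q \<subseteq> P" and T: "triv Q s t"
    and abp: "{a, b, p} \<subseteq> Q" "distinct [a, b, p]" and fixed: "\<phi> a = a" "\<phi> b = b"
    and st: "s a = s p" "s b = s p" "t a = t p" "t b = t p"
  shows "F P \<phi> Q s t n = of_int (2 * \<epsilon>) * F (P - {a, b}) \<phi> (Q - {a, b} - {p}) s t n"
proof -
  have nat: "F P \<phi> Q s t n = of_int (2 * \<epsilon>) * F (P - {a, b}) \<phi> (Q - {a, b} - {p}) s t n"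
    if P: "perm P \<phi>" and Q: "Q \<subseteq> P" and T: "triv Q s t"
      and abp: "{a, b, p} \<subseteq> Q" "distinct [a, b, p]" and fixed: "\<phi> a = a" "\<phi> b = b"
      and st: "s a = s p" "s b = s p" "t a = t p" "t b = t p"
    for P :: "nat set" and \<phi> Q s t a b p
  proof -
    let ?\<Gamma> = "pweb P \<phi> Q s t n" and ?x = "2 * s p" and ?y = "Suc (2 * t p)"
    have fixed': "ret \<phi> Q a = a" "ret \<phi> Q b = b" using fixed abp(1) by (simp_all add: ret_hit)
    have "bigon ?\<Gamma> ?x ?y a b"
      unfolding bigon_def using abp st fixed' by (simp add: out_arcs_def in_arcs_def) presburger
    with trivalent_pweb[OF P Q T] have eq: "f (web_class ?\<Gamma>) =
        Const (A_pow 3 + A_pow (-3)) * f (web_class (splice ?x ?y (delete_arcs {a, b} ?\<Gamma>)))"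
      using evaluation unfolding web_evaluation_def by blast
    have B: "{a, b} \<subseteq> Q" using abp by simp
    have p: "p \<in> Q - {a, b}" using abp by auto
    have del: "presents (delete_arcs {a, b} ?\<Gamma>) (P - {a, b}) \<phi> (Q - {a, b}) s t n"
      by (rule presents_delete(1)[OF presents_pweb P Q B]; use fixed st p in \<open>elim insertE; force\<close>)
    have del': "perm (P - {a, b}) \<phi>"
      by (rule perm_Diff_fixed[OF P subset_trans[OF B Q]]) (use fixed in auto)
    have "presents (splice ?x ?y (delete_arcs {a, b} ?\<Gamma>)) (P - {a, b}) \<phi> (Q - {a, b} - {p}) s t n"
    proof (rule presents_splice[OF del del'])
      show "q = p" if "q \<in> Q - {a, b}" "s q = s p" for q
        using triv_three(1)[OF T abp st(1,2), of q] that by simp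
      show "q = p" if "q \<in> Q - {a, b}" "t q = t p" for q
        using triv_three(2)[OF T abp st(3,4), of q] that by simp
    qed (use Q p in auto)
    from F_presents[OF this del'] Q
    have "specialize \<epsilon> (f (web_class (splice ?x ?y (delete_arcs {a, b} ?\<Gamma>)))) =
        F (P - {a, b}) \<phi> (Q - {a, b} - {p}) s t n" by blast
    then show ?thesis
      unfolding F_def[of P] eq specialize_mult[OF sign] specialize_bigon_coefficient by simp
  qed
  obtain \<iota> :: "'a \<Rightarrow> nat" and j where \<iota>: "inj_on \<iota> P" "\<And>x. x \<in> P \<Longrightarrow> j (\<iota> x) = x"
    using nat_model[OF P] by metis
  have jQ: "j (\<iota> x) = x" if "x \<in> Q" for x using \<iota>(2) Q that by blast
  have abp': "a \<in> Q" "b \<in> Q" "p \<in> Q" "a \<in> P" "b \<in> P" "p \<in> P" using abp(1) Q by auto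
  have img: "\<iota> ` (X - Y) = \<iota> ` X - \<iota> ` Y" if "X \<subseteq> P" "Y \<subseteq> P" for X Y
    using inj_on_image_set_diff[OF \<iota>(1), of X Y] that by blast
  have sets: "\<iota> ` (P - {a, b}) = \<iota> ` P - {\<iota> a, \<iota> b}"
    "\<iota> ` (Q - {a, b} - {p}) = \<iota> ` Q - {\<iota> a, \<iota> b} - {\<iota> p}"
    using img[of P "{a, b}"] img[of "Q - {a, b}" "{p}"] img[of Q "{a, b}"] abp' Q by auto
  have P': "perm (P - {a, b}) \<phi>"
    by (rule perm_Diff_fixed[OF P]) (use abp' fixed in auto)
  have sub: "Q - {a, b} - {p} \<subseteq> P - {a, b}" using Q by auto
  have jabp: "j (\<iota> a) = a" "j (\<iota> b) = b" "j (\<iota> p) = p" by (rule \<iota>(2), rule abp')+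
  have d: "distinct [\<iota> a, \<iota> b, \<iota> p]"
    using abp(2) inj_on_eq_iff[OF \<iota>(1)] abp' by simp
  have sub': "{\<iota> a, \<iota> b, \<iota> p} \<subseteq> \<iota> ` Q" using abp' by simp
  have m1: "F P \<phi> Q s t n = F (\<iota> ` P) (\<iota> \<circ> \<phi> \<circ> j) (\<iota> ` Q) (s \<circ> j) (t \<circ> j) n"
    by (rule F_model[OF \<iota> P subset_refl Q])
  have m2: "F (P - {a, b}) \<phi> (Q - {a, b} - {p}) s t n =
      F (\<iota> ` (P - {a, b})) (\<iota> \<circ> \<phi> \<circ> j) (\<iota> ` (Q - {a, b} - {p})) (s \<circ> j) (t \<circ> j) n"
    by (rule F_model[OF \<iota> P' Diff_subset sub])
  show ?thesis
    unfolding m1 m2 sets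
    by (intro nat d sub' perm_model[OF \<iota> P] image_mono Q triv_model[OF inj_on_subset[OF \<iota>(1) Q] jQ T])
      (simp_all add: jabp fixed st)
qed

text \<open>The vertices in cyclic order are the source of \<open>p\<close>, the sink of
  \<open>p\<close>, the source of \<open>r\<close> and the sink of \<open>r\<close>. The external
  ends are the two sides of \<open>p\<close> and of \<open>r\<close>. One resolution glues the two
  sides of each port, the other glues the outgoing side of each to the incoming side of the other,
  which is what \<open>swap p r\<close> does.\<close>

lemma F_quad:
  fixes P :: "'a set"
  assumes P: "perm P \<phi>" and Q: "Q \<subseteq> P" and T: "triv Q s t"
    and ports: "{a, b, c, d, p, r} \<subseteq> Q" "distinct [a, b, c, d, p, r]"
    and fixed: "\<phi> a = a" "\<phi> b = b" "\<phi> c = c" "\<phi> d = d"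
    and s: "s a = s p" "s d = s p" "s b = s r" "s c = s r" "s p \<noteq> s r"
    and t: "t a = t p" "t b = t p" "t c = t r" "t d = t r" "t p \<noteq> t r"
  shows "F P \<phi> Q s t n =
    F (P - {a, b, c, d}) \<phi> (Q - {a, b, c, d} - {p, r}) s t n +
    F (P - {a, b, c, d}) (swap p r \<circ> \<phi>) (Q - {a, b, c, d} - {p, r}) s t n"
proof -
  have nat: "F P \<phi> Q s t n =
    F (P - {a, b, c, d}) \<phi> (Q - {a, b, c, d} - {p, r}) s t n +
    F (P - {a, b, c, d}) (swap p r \<circ> \<phi>) (Q - {a, b, c, d} - {p, r}) s t n"
    if P: "perm P \<phi>" and Q: "Q \<subseteq> P" and T: "triv Q s t"
      and ports: "{a, b, c, d, p, r} \<subseteq> Q" "distinct [a, b, c, d, p, r]"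
      and fixed: "\<phi> a = a" "\<phi> b = b" "\<phi> c = c" "\<phi> d = d"
      and s: "s a = s p" "s d = s p" "s b = s r" "s c = s r" "s p \<noteq> s r"
      and t: "t a = t p" "t b = t p" "t c = t r" "t d = t r" "t p \<noteq> t r"
    for P :: "nat set" and \<phi> Q s t a b c d p r
  proof -
    let ?\<Gamma> = "pweb P \<phi> Q s t n" and ?B = "{a, b, c, d}"
    let ?v1 = "2 * s p" and ?v2 = "Suc (2 * t p)" and ?v3 = "2 * s r" and ?v4 = "Suc (2 * t r)"
    let ?\<Delta> = "delete_arcs ?B ?\<Gamma>" and ?P = "P - ?B" and ?Q = "Q - ?B"
    have fixed': "ret \<phi> Q a = a" "ret \<phi> Q b = b" "ret \<phi> Q c = c" "ret \<phi> Q d = d"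
      using fixed ports(1) by (simp_all add: ret_hit)
    have parity: "2 * m \<noteq> Suc (2 * k)" "Suc (2 * k) \<noteq> 2 * m" for m k :: nat by presburger+
    have quad: "quadrilateral ?\<Gamma> ?v1 ?v2 ?v3 ?v4 a b c d"
      unfolding quadrilateral_def
    proof (intro conjI)
      show "distinct [?v1, ?v2, ?v3, ?v4]" using s(5) t(5) parity by simp
      have arc: "e \<in> out_arcs (graph ?\<Gamma>) (2 * s u) \<inter> in_arcs (graph ?\<Gamma>) (Suc (2 * t v))"
        if "e \<in> Q" "ret \<phi> Q e = e" "s e = s u" "t e = t v" for e u v
        using that by (simp add: out_arcs_def in_arcs_def)
      have mem: "a \<in> Q" "b \<in> Q" "c \<in> Q" "d \<in> Q" using ports(1) by simp_all
      show "a \<in> out_arcs (graph ?\<Gamma>) ?v1 \<inter> in_arcs (graph ?\<Gamma>) ?v2"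
        by (rule arc[OF mem(1) fixed'(1) s(1) t(1)])
      show "b \<in> out_arcs (graph ?\<Gamma>) ?v3 \<inter> in_arcs (graph ?\<Gamma>) ?v2"
        by (rule arc[OF mem(2) fixed'(2) s(3) t(2)])
      show "c \<in> out_arcs (graph ?\<Gamma>) ?v3 \<inter> in_arcs (graph ?\<Gamma>) ?v4"
        by (rule arc[OF mem(3) fixed'(3) s(4) t(3)])
      show "d \<in> out_arcs (graph ?\<Gamma>) ?v1 \<inter> in_arcs (graph ?\<Gamma>) ?v4"
        by (rule arc[OF mem(4) fixed'(4) s(2) t(4)])
    qed
    have eq: "f (web_class ?\<Gamma>) =
        f (web_class (splice ?v3 ?v4 (splice ?v1 ?v2 ?\<Delta>))) +
        f (web_class (splice ?v1 ?v4 (splice ?v3 ?v2 ?\<Delta>)))"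
      by (rule evaluation[unfolded web_evaluation_def Let_def, THEN conjunct2, THEN conjunct2,
            THEN conjunct2, THEN conjunct2, rule_format, OF trivalent_pweb[OF P Q T] quad])
    have B: "?B \<subseteq> Q" using ports by simp
    have pr: "p \<in> ?Q" "r \<in> ?Q" "p \<noteq> r" using ports by auto
    have Q': "?Q \<subseteq> ?P" "?Q - {x} \<subseteq> ?P" for x using Q by auto
    have \<Delta>: "presents ?\<Delta> ?P \<phi> ?Q s t n"
    proof (rule presents_delete(1)[OF presents_pweb P Q B])
      fix e assume e: "e \<in> ?B"
      then show "\<phi> e = e" using fixed by (elim insertE emptyE) simp_all
      have bex: "\<exists>q \<in> ?Q. h q = h e" if "h e = h p \<or> h e = h r" for h :: "nat \<Rightarrow> nat"
        using that
      proof
        assume "h e = h p"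
        then show ?thesis by (intro bexI[OF _ pr(1)]) (rule sym)
      next
        assume "h e = h r"
        then show ?thesis by (intro bexI[OF _ pr(2)]) (rule sym)
      qed
      have "s e = s p \<or> s e = s r"
        using e by (elim insertE emptyE) (simp_all only: s(1-4) simp_thms)
      then show "\<exists>q \<in> ?Q. s q = s e" by (rule bex)
      have "t e = t p \<or> t e = t r"
        using e by (elim insertE emptyE) (simp_all only: t(1-4) simp_thms)
      then show "\<exists>q \<in> ?Q. t q = t e" by (rule bex)
    qed
    have P': "perm ?P \<phi>"
      by (rule perm_Diff_fixed[OF P subset_trans[OF B Q]]) (use fixed in auto)
    have sp: "q = p" if "q \<in> ?Q" "s q = s p" for q
      using triv_three(1)[OF T _ _ s(1,2), of q] ports that by simp
    have sr: "q = r" if "q \<in> ?Q" "s q = s r" for q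
      using triv_three(1)[OF T _ _ s(3,4), of q] ports that by simp
    have tp: "q = p" if "q \<in> ?Q" "t q = t p" for q
      using triv_three(2)[OF T _ _ t(1,2), of q] ports that by simp
    have tr: "q = r" if "q \<in> ?Q" "t q = t r" for q
      using triv_three(2)[OF T _ _ t(3,4), of q] ports that by simp
    have set: "?Q - {p} - {r} = ?Q - {p, r}" "?Q - {r} - {p} = ?Q - {p, r}" by auto
    have "presents (splice ?v1 ?v2 ?\<Delta>) ?P \<phi> (?Q - {p}) s t n"
      by (rule presents_splice[OF \<Delta> P' Q'(1) pr(1) sp tp refl refl])
    then have "presents (splice ?v3 ?v4 (splice ?v1 ?v2 ?\<Delta>)) ?P \<phi> (?Q - {p} - {r}) s t n"
      by (rule presents_splice[OF _ P' Q'(2)]) (use pr sr tr in simp_all)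
    from F_presents[OF this P'] Q'
    have one: "specialize \<epsilon> (f (web_class (splice ?v3 ?v4 (splice ?v1 ?v2 ?\<Delta>)))) = F ?P \<phi> (?Q - {p, r}) s t n"
      unfolding set by blast
    \<comment> \<open>For the second resolution the incoming sides of \<open>p\<close> and
      \<open>r\<close> exchange their names, so that both splices again concern the two sides of a
      single port.\<close>
    let ?\<psi> = "swap p r \<circ> \<phi>" and ?t = "t \<circ> swap p r"
    have \<Delta>': "presents ?\<Delta> ?P ?\<psi> ?Q s ?t n"
      by (rule presents_relabel[OF \<Delta> P' Q'(1) pr(1,2)])
    have P'': "perm ?P ?\<psi>"
      by (rule perm_swap[OF P']) (use pr Q in auto)
    have swap_in: "swap p r q \<in> ?Q" if "q \<in> ?Q" for q
      using that pr unfolding Transposition.transpose_def by presburger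
    have tp': "q = r" if "q \<in> ?Q" "?t q = ?t r" for q
      using tp[OF swap_in[OF that(1)]] that(2) by (simp add: Transposition.transpose_def split: if_splits)
    have tr': "q = p" if "q \<in> ?Q" "?t q = ?t p" for q
      using tr[OF swap_in[OF that(1)]] that(2) by (simp add: Transposition.transpose_def split: if_splits)
    have "presents (splice ?v3 ?v2 ?\<Delta>) ?P ?\<psi> (?Q - {r}) s ?t n"
      by (rule presents_splice[OF \<Delta>' P'' Q'(1) pr(2) sr tp']) simp_all
    then have "presents (splice ?v1 ?v4 (splice ?v3 ?v2 ?\<Delta>)) ?P ?\<psi> (?Q - {r} - {p}) s ?t n"
      by (rule presents_splice[OF _ P'' Q'(2)]) (use pr sp tr' in simp_all)
    then have "presents (splice ?v1 ?v4 (splice ?v3 ?v2 ?\<Delta>)) ?P ?\<psi> (?Q - {p, r}) s t n"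
      unfolding set by (rule presents_cong[OF _ P'']) (use Q in \<open>auto simp: Transposition.transpose_def\<close>)
    from F_presents[OF this P''] Q'
    have two: "specialize \<epsilon> (f (web_class (splice ?v1 ?v4 (splice ?v3 ?v2 ?\<Delta>)))) = F ?P ?\<psi> (?Q - {p, r}) s t n"
      by blast
    show ?thesis unfolding F_def[of P] eq specialize_add one two ..
  qed
  let ?B = "{a, b, c, d}"
  obtain \<iota> :: "'a \<Rightarrow> nat" and j where \<iota>: "inj_on \<iota> P" "\<And>x. x \<in> P \<Longrightarrow> j (\<iota> x) = x"
    using nat_model[OF P] by metis
  have jQ: "j (\<iota> x) = x" if "x \<in> Q" for x using \<iota>(2) Q that by blast
  have mem: "a \<in> Q" "b \<in> Q" "c \<in> Q" "d \<in> Q" "p \<in> Q" "r \<in> Q" using ports(1) by auto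
  have memP: "a \<in> P" "b \<in> P" "c \<in> P" "d \<in> P" "p \<in> P" "r \<in> P" using mem Q by auto
  have img: "\<iota> ` (X - Y) = \<iota> ` X - \<iota> ` Y" if "X \<subseteq> P" "Y \<subseteq> P" for X Y
    using inj_on_image_set_diff[OF \<iota>(1), of X Y] that by blast
  have BP: "?B \<subseteq> P" "{p, r} \<subseteq> P" "Q - ?B \<subseteq> P" using memP Q by auto
  have sets: "\<iota> ` (P - ?B) = \<iota> ` P - {\<iota> a, \<iota> b, \<iota> c, \<iota> d}"
    "\<iota> ` (Q - ?B - {p, r}) = \<iota> ` Q - {\<iota> a, \<iota> b, \<iota> c, \<iota> d} - {\<iota> p, \<iota> r}"
    using img[OF subset_refl BP(1)] img[OF BP(3,2)] img[OF Q BP(1)]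
    by (simp_all only: image_insert image_empty)
  have P': "perm (P - ?B) \<phi>"
    by (rule perm_Diff_fixed[OF P]) (use memP fixed in auto)
  have P'': "perm (P - ?B) (swap p r \<circ> \<phi>)"
    by (rule perm_swap[OF P']) (use memP ports(2) in auto)
  have sub: "Q - ?B - {p, r} \<subseteq> P - ?B" using Q by auto
  have j6: "j (\<iota> a) = a" "j (\<iota> b) = b" "j (\<iota> c) = c" "j (\<iota> d) = d" "j (\<iota> p) = p" "j (\<iota> r) = r"
    by (rule \<iota>(2), rule memP)+
  have comm: "F (\<iota> ` (P - ?B)) (\<iota> \<circ> (swap p r \<circ> \<phi>) \<circ> j) (\<iota> ` (Q - ?B - {p, r})) (s \<circ> j) (t \<circ> j) n =
      F (\<iota> ` (P - ?B)) (swap (\<iota> p) (\<iota> r) \<circ> (\<iota> \<circ> \<phi> \<circ> j)) (\<iota> ` (Q - ?B - {p, r})) (s \<circ> j) (t \<circ> j) n"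
  proof (rule F_cong)
    have \<iota>': "inj_on \<iota> (P - ?B)" "\<And>x. x \<in> P - ?B \<Longrightarrow> j (\<iota> x) = x"
      using inj_on_subset[OF \<iota>(1)] \<iota>(2) by auto
    show "perm (\<iota> ` (P - ?B)) (\<iota> \<circ> (swap p r \<circ> \<phi>) \<circ> j)" by (rule perm_model[OF \<iota>' P''])
    show "\<iota> ` (Q - ?B - {p, r}) \<subseteq> \<iota> ` (P - ?B)" by (rule image_mono[OF sub])
    fix y assume "y \<in> \<iota> ` (P - ?B)"
    then obtain x where x: "x \<in> P - ?B" "y = \<iota> x" by auto
    have "\<phi> x \<in> P" using perm_in[OF P] x(1) by simp
    then show "(swap (\<iota> p) (\<iota> r) \<circ> (\<iota> \<circ> \<phi> \<circ> j)) y = (\<iota> \<circ> (swap p r \<circ> \<phi>) \<circ> j) y"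
      using inj_on_eq_iff[OF \<iota>(1)] memP unfolding x(2)
      by (simp add: \<iota>'(2)[OF x(1)] Transposition.transpose_def)
  qed simp_all
  have d: "distinct [\<iota> a, \<iota> b, \<iota> c, \<iota> d, \<iota> p, \<iota> r]"
    using ports(2) inj_on_eq_iff[OF \<iota>(1)] memP by simp
  have sub': "{\<iota> a, \<iota> b, \<iota> c, \<iota> d, \<iota> p, \<iota> r} \<subseteq> \<iota> ` Q" using mem by simp
  have m1: "F P \<phi> Q s t n = F (\<iota> ` P) (\<iota> \<circ> \<phi> \<circ> j) (\<iota> ` Q) (s \<circ> j) (t \<circ> j) n"
    by (rule F_model[OF \<iota> P subset_refl Q])
  have m2: "F (P - ?B) \<phi> (Q - ?B - {p, r}) s t n =
      F (\<iota> ` (P - ?B)) (\<iota> \<circ> \<phi> \<circ> j) (\<iota> ` (Q - ?B - {p, r})) (s \<circ> j) (t \<circ> j) n"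
    by (rule F_model[OF \<iota> P' Diff_subset sub])
  have m3: "F (P - ?B) (swap p r \<circ> \<phi>) (Q - ?B - {p, r}) s t n =
      F (\<iota> ` (P - ?B)) (\<iota> \<circ> (swap p r \<circ> \<phi>) \<circ> j) (\<iota> ` (Q - ?B - {p, r})) (s \<circ> j) (t \<circ> j) n"
    by (rule F_model[OF \<iota> P'' Diff_subset sub])
  show ?thesis
    unfolding m1 m2 m3 unfolding comm unfolding sets
    by (intro nat d sub' perm_model[OF \<iota> P] image_mono Q triv_model[OF inj_on_subset[OF \<iota>(1) Q] jQ T])
      (simp_all add: j6 fixed s t)
qed

end

section \<open>Local rules for an inner map \<theta> composed with a fixed outer map \<pi>\<close>

definition loc :: "'a set \<Rightarrow> ('a \<Rightarrow> 'a) \<Rightarrow> ('a \<Rightarrow> 'a) \<Rightarrow> 'a set \<Rightarrow> bool" where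
  "loc P \<pi> \<theta> Q \<longleftrightarrow> perm P \<pi> \<and> perm P \<theta> \<and> Q \<subseteq> P"

lemma locD: "loc P \<pi> \<theta> Q \<Longrightarrow> perm P \<pi>" "loc P \<pi> \<theta> Q \<Longrightarrow> perm P \<theta>" "loc P \<pi> \<theta> Q \<Longrightarrow> Q \<subseteq> P"
  by (simp_all add: loc_def)

lemma loc_perm: "loc P \<pi> \<theta> Q \<Longrightarrow> perm P (\<theta> \<circ> \<pi>)"
  unfolding loc_def by (blast intro: perm_comp)

text \<open>For a map given by finitely many updates, bijectivity reduces to an equation of two
  enumerated sets, which simplification can decide.\<close>

lemma perm_list:
  assumes "finite P" "set xs \<subseteq> P" "set (map \<theta> xs) = set xs" "\<And>y. y \<notin> set xs \<Longrightarrow> \<theta> y = y"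
  shows "perm P \<theta>"
proof -
  have "\<theta> ` set xs = set xs" using assms(3) by simp
  then have "bij_betw \<theta> (set xs) (set xs)"
    by (simp add: bij_betw_def eq_card_imp_inj_on)
  moreover have "bij_betw \<theta> (P - set xs) (P - set xs)"
    using bij_betw_cong[of "P - set xs" \<theta> id] assms(4) by simp
  ultimately have "bij_betw \<theta> (set xs \<union> (P - set xs)) (set xs \<union> (P - set xs))"
    by (rule bij_betw_combine) simp
  moreover have "set xs \<union> (P - set xs) = P" using assms(2) by auto
  ultimately show ?thesis using assms(1) by (simp add: perm_def)
qed

context evaluation
begin

text \<open>A passive inner port is bypassed. The new map \<theta>' is characterized by its values,
  so that it can be given as an explicit chain of updates in the applications.\<close>

lemma F_pass:
  assumes loc: "loc P \<pi> \<theta> Q" and P: "P = insert a P'" "a \<notin> P'" "a \<notin> Q" and \<pi>: "\<pi> a = a"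
    and \<theta>': "\<And>y. y \<noteq> a \<Longrightarrow> \<theta>' y = (if \<theta> y = a then \<theta> a else \<theta> y)"
  shows "F P (\<theta> \<circ> \<pi>) Q s t n = F P' (\<theta>' \<circ> \<pi>) Q s t (if \<theta> a = a then Suc n else n)"
    and "loc P' \<pi> \<theta>' Q"
proof -
  note loc' = locD[OF loc]
  have Pa: "P - {a} = P'" using P by auto
  have aP: "a \<in> P" using P by simp
  have sub: "Q \<subseteq> P'" using loc'(3) P by auto
  have p\<pi>: "perm P' \<pi>" using perm_remove[OF loc'(1) \<pi>] Pa by simp
  have eq: "swap a (\<theta> a) (\<theta> y) = \<theta>' y" if "y \<in> P'" for y
  proof -
    have y: "y \<noteq> a" "y \<in> P" using that P by auto
    then have "\<theta> y \<noteq> \<theta> a" using perm_inj[OF loc'(2) y(2) aP] by simp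
    then show ?thesis unfolding \<theta>'[OF y(1)] by (simp add: Transposition.transpose_def)
  qed
  have "perm P' (swap a (\<theta> a) \<circ> \<theta>)" using perm_skip[OF loc'(2) aP] unfolding Pa .
  then have "perm P' \<theta>'" by (rule perm_cong) (simp add: eq)
  then show "loc P' \<pi> \<theta>' Q" using p\<pi> sub by (simp add: loc_def)
  have aQ: "a \<in> P - Q" using aP P(3) by simp
  have "F P (\<theta> \<circ> \<pi>) Q s t n =
      F P' (swap a ((\<theta> \<circ> \<pi>) a) \<circ> (\<theta> \<circ> \<pi>)) Q s t (n + (if (\<theta> \<circ> \<pi>) a = a then 1 else 0))"
    using F_skip[OF loc_perm[OF loc] loc'(3) aQ] unfolding Pa .
  also have "\<dots> = F P' (\<theta>' \<circ> \<pi>) Q s t (n + (if (\<theta> \<circ> \<pi>) a = a then 1 else 0))"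
  proof (rule F_cong[OF _ sub])
    show "perm P' (swap a ((\<theta> \<circ> \<pi>) a) \<circ> (\<theta> \<circ> \<pi>))"
      using perm_skip[OF loc_perm[OF loc] aP] unfolding Pa .
    show "(\<theta>' \<circ> \<pi>) y = (swap a ((\<theta> \<circ> \<pi>) a) \<circ> (\<theta> \<circ> \<pi>)) y" if "y \<in> P'" for y
      using eq[OF perm_in[OF p\<pi> that]] \<pi> by simp
  qed simp_all
  finally show "F P (\<theta> \<circ> \<pi>) Q s t n = F P' (\<theta>' \<circ> \<pi>) Q s t (if \<theta> a = a then Suc n else n)"
    using \<pi> by (auto split: if_splits)
qed

text \<open>The strand leaving the active port \<open>a\<close> runs straight into the passive port
  \<open>l\<close>, so \<open>l\<close> can take over both vertices of \<open>a\<close>. The proof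
  exchanges the names of the two ports, after which \<open>a\<close> is passive and is
  skipped.\<close>

lemma F_slide:
  assumes loc: "loc P \<pi> \<theta> Q" and P: "P = insert a P'" "a \<notin> P'" and Q: "Q = insert a Q0" "a \<notin> Q0"
    and Q': "Q' = insert l Q0" and l: "l \<in> P'" "l \<notin> Q0" and \<pi>: "\<pi> a = a" and \<theta>: "\<theta> a = l"
    and \<theta>': "\<And>y. y \<noteq> a \<Longrightarrow> \<theta>' y = (if \<theta> y = a then l else \<theta> y)"
    and s: "s' l = s a" "\<And>x. x \<in> Q0 \<Longrightarrow> s' x = s x" and t: "t' l = t a" "\<And>x. x \<in> Q0 \<Longrightarrow> t' x = t x"
  shows "F P (\<theta> \<circ> \<pi>) Q s t n = F P' (\<theta>' \<circ> \<pi>) Q' s' t' n" and "loc P' \<pi> \<theta>' Q'"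
proof -
  note loc' = locD[OF loc]
  let ?\<phi> = "\<theta> \<circ> \<pi>" and ?S = "swap a l"
  define \<psi> where "\<psi> = ?S \<circ> ?\<phi> \<circ> ?S"
  have Pa: "P - {a} = P'" using P by auto
  have aP: "a \<in> P" "l \<in> P" "a \<noteq> l" using P l by auto
  have P\<phi>: "perm P ?\<phi>" by (rule loc_perm[OF loc])
  have S: "?S ` P = P" using permutes_image[OF permutes_swap_id[OF aP(1,2)]] .
  have SQ0: "?S x = x" if "x \<in> Q0" for x using that Q(2) l(2) by (auto simp: Transposition.transpose_def)
  have SQ: "?S ` Q = Q'" unfolding Q Q' using SQ0 by (simp add: image_cong[of Q0 Q0 ?S id])
  have sub: "Q' \<subseteq> P'" "Q0 \<subseteq> P" using loc'(3) P Q Q' l by auto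
  have \<phi>a: "?\<phi> a = l" using \<pi> \<theta> by simp
  have P\<psi>: "perm P \<psi>"
    using perm_conj[OF P\<phi> inj_on_subset[OF inj_transpose subset_UNIV], of \<psi> a l] S by (simp add: \<psi>_def)
  have one: "F P ?\<phi> Q s t n = F P \<psi> Q' s' t' n"
  proof (rule F_rename[where h = ?S and g = ?S and u = id and v = id])
    show "inj_on ?S P" by (rule inj_on_subset[OF inj_transpose subset_UNIV])
    show "s' (?S x) = id (s x)" "t' (?S x) = id (t x)" if "x \<in> Q" for x
      using that SQ0[of x] s t unfolding Q by auto
  qed (simp_all add: P\<phi> loc' S SQ \<psi>_def)
  have aQ: "a \<in> P - Q'" using aP Q' Q(2) by simp
  have ne: "\<psi> a \<noteq> a"
  proof
    assume "\<psi> a = a"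
    then have "?S (?\<phi> l) = a" by (simp add: \<psi>_def)
    then have "?\<phi> l = l" by (metis transpose_apply_first transpose_involutory)
    then show False using perm_inj[OF P\<phi> aP(1,2)] \<phi>a aP(3) by simp
  qed
  have two: "F P \<psi> Q' s' t' n = F P' (swap a (\<psi> a) \<circ> \<psi>) Q' s' t' n"
    using F_skip[OF P\<psi> _ aQ, of s' t' n] sub P ne unfolding Pa by auto
  have p\<pi>: "perm P' \<pi>" using perm_remove[OF loc'(1) \<pi>] Pa by simp
  have eq: "(\<theta>' \<circ> \<pi>) y = (swap a (\<psi> a) \<circ> \<psi>) y" if y: "y \<in> P'" for y
  proof -
    have ya: "y \<noteq> a" "y \<in> P" using y P by auto
    have \<pi>y: "\<pi> y \<noteq> a" using perm_in[OF p\<pi> y] P by auto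
    have lhs: "(\<theta>' \<circ> \<pi>) y = (if ?\<phi> y = a then l else ?\<phi> y)" using \<theta>'[OF \<pi>y] by simp
    have yl: "?\<phi> y \<noteq> l" using perm_inj[OF P\<phi> ya(2) aP(1)] ya(1) \<phi>a by simp
    have ll: "?\<phi> l \<noteq> l" using perm_inj[OF P\<phi> aP(1,2)] \<phi>a aP(3) by simp
    have Sphi: "?S (?\<phi> z) = (if ?\<phi> z = a then l else ?\<phi> z)" if "?\<phi> z \<noteq> l" for z
      using that by (simp add: Transposition.transpose_def)
    have \<psi>a: "\<psi> a = (if ?\<phi> l = a then l else ?\<phi> l)" using Sphi[OF ll] by (simp add: \<psi>_def)
    show ?thesis
    proof (cases "y = l")
      case True
      have "\<psi> l = a" using \<phi>a by (simp add: \<psi>_def)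
      then show ?thesis using lhs \<psi>a unfolding True by simp
    next
      case False
      then have "\<psi> y = ?S (?\<phi> y)" using ya(1) by (simp add: \<psi>_def)
      then have \<psi>y: "\<psi> y = (if ?\<phi> y = a then l else ?\<phi> y)" using Sphi[OF yl] by simp
      have "\<psi> y \<noteq> a" unfolding \<psi>y using aP(3) by simp
      moreover have "\<psi> y \<noteq> \<psi> a" using perm_inj[OF P\<psi> ya(2) aP(1)] ya(1) by simp
      ultimately show ?thesis unfolding lhs \<psi>y[symmetric] by (simp add: Transposition.transpose_def)
    qed
  qed
  have pskip: "perm P' (swap a (\<psi> a) \<circ> \<psi>)" using perm_skip[OF P\<psi> aP(1)] unfolding Pa .
  have three: "F P' (swap a (\<psi> a) \<circ> \<psi>) Q' s' t' n = F P' (\<theta>' \<circ> \<pi>) Q' s' t' n"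
    by (rule F_cong[OF pskip sub(1)]) (simp_all add: eq del: comp_apply)
  show "F P ?\<phi> Q s t n = F P' (\<theta>' \<circ> \<pi>) Q' s' t' n" unfolding one two three ..
  have "perm P' (swap a (\<theta> a) \<circ> \<theta>)" using perm_skip[OF loc'(2) aP(1)] unfolding Pa .
  then have "perm P' \<theta>'"
  proof (rule perm_cong)
    fix y assume "y \<in> P'"
    then have y: "y \<noteq> a" "y \<in> P" using P by auto
    then have "\<theta> y \<noteq> \<theta> a" using perm_inj[OF loc'(2) y(2) aP(1)] by simp
    then show "\<theta>' y = (swap a (\<theta> a) \<circ> \<theta>) y"
      unfolding \<theta>'[OF y(1)] using \<theta> by (simp add: Transposition.transpose_def)
  qed
  then show "loc P' \<pi> \<theta>' Q'" using p\<pi> sub by (simp add: loc_def)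
qed

text \<open>Which active port records the incoming end of an arc is a matter of naming, provided
  that the sink label moves along. The resolution rules want the inner arcs as fixed ports, and this
  rule brings them into that form. The lists \<open>xs\<close> and \<open>zs\<close> confine the
  equations to finitely many ports.\<close>

lemma F_reglue:
  assumes loc: "loc P \<pi> \<theta> Q" and zs: "\<forall>y \<in> set zs. \<theta>' y = \<sigma> (\<theta> y)" "set xs \<subseteq> set zs"
      "\<And>y. y \<notin> set zs \<Longrightarrow> \<theta>' y = y" "\<And>y. y \<notin> set zs \<Longrightarrow> \<theta> y = y"
    and \<sigma>: "\<And>y. y \<notin> set xs \<Longrightarrow> \<sigma> y = y" "set (map \<sigma> xs) = set xs" "set xs \<subseteq> Q"
    and xs: "\<forall>x \<in> set xs. t' (\<sigma> x) = t x" "\<And>x. x \<notin> set xs \<Longrightarrow> t' x = t x"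
  shows "F P (\<theta> \<circ> \<pi>) Q s t n = F P (\<theta>' \<circ> \<pi>) Q s t' n" and "loc P \<pi> \<theta>' Q"
    and "triv Q s t \<Longrightarrow> triv Q s t'"
proof -
  note loc' = locD[OF loc]
  have \<theta>': "\<theta>' y = \<sigma> (\<theta> y)" for y
  proof (cases "y \<in> set zs")
    case False
    then have "y \<notin> set xs" using zs(2) by blast
    then show ?thesis using zs(3,4)[OF False] \<sigma>(1) by simp
  qed (use zs(1) in simp)
  have t': "t' (\<sigma> x) = t x" for x
    using xs \<sigma>(1)[of x] by (cases "x \<in> set xs") simp_all
  have "perm P \<sigma>"
    by (rule perm_list[OF perm_finite[OF loc'(1)] subset_trans[OF \<sigma>(3) loc'(3)] \<sigma>(2,1)])
  from perm_comp[OF loc'(2) this] have "perm P \<theta>'" by (rule perm_cong) (simp add: \<theta>')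
  then show "loc P \<pi> \<theta>' Q" using loc' by (simp add: loc_def)
  have "finite Q" using loc'(3) perm_finite[OF loc'(1)] by (rule finite_subset)
  from perm_list[OF this \<sigma>(3,2,1)] have \<sigma>Q: "\<sigma> ` Q = Q" and inj: "inj_on \<sigma> Q"
    by (simp_all add: perm_def bij_betw_def)
  show "triv Q s t'" if T: "triv Q s t"
  proof -
    have "card {y \<in> Q. t' y = t' x} = 3" if x: "x \<in> Q" for x
    proof -
      obtain u where u: "u \<in> Q" "x = \<sigma> u" using x \<sigma>Q by blast
      have "{y \<in> Q. t' y = t' x} = \<sigma> ` {w \<in> Q. t w = t u}"
      proof (intro set_eqI iffI)
        fix y assume y: "y \<in> {y \<in> Q. t' y = t' x}"
        then obtain w where "w \<in> Q" "y = \<sigma> w" using \<sigma>Q by blast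
        with y u show "y \<in> \<sigma> ` {w \<in> Q. t w = t u}" by (simp add: t')
      next
        fix y assume "y \<in> \<sigma> ` {w \<in> Q. t w = t u}"
        then obtain w where "w \<in> Q" "y = \<sigma> w" "t w = t u" by blast
        with u \<sigma>Q show "y \<in> {y \<in> Q. t' y = t' x}" by (auto simp: t')
      qed
      then show ?thesis
        using card_image[OF inj_on_subset[OF inj, of "{w \<in> Q. t w = t u}"]] T u(1) by (simp add: triv_def)
    qed
    then show ?thesis using T by (simp add: triv_def)
  qed
  show "F P (\<theta> \<circ> \<pi>) Q s t n = F P (\<theta>' \<circ> \<pi>) Q s t' n"
    by (intro F_relabel[OF loc_perm[OF loc] loc'(3), where g = \<sigma>] \<sigma>Q t' \<sigma>(1))
      (use \<sigma>(3) in \<open>auto simp: \<theta>'\<close>)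
qed

lemma F_reglue_triv:
  assumes "loc P \<pi> \<theta> Q" "\<forall>y \<in> set zs. \<theta>' y = \<sigma> (\<theta> y)" "set xs \<subseteq> set zs"
    and "\<And>y. y \<notin> set zs \<Longrightarrow> \<theta>' y = y" "\<And>y. y \<notin> set zs \<Longrightarrow> \<theta> y = y"
    and "\<And>y. y \<notin> set xs \<Longrightarrow> \<sigma> y = y" "set (map \<sigma> xs) = set xs" "set xs \<subseteq> Q"
    and "\<forall>x \<in> set xs. t' (\<sigma> x) = t x" "\<And>x. x \<notin> set xs \<Longrightarrow> t' x = t x" and "triv Q s t"
  shows "F P (\<theta> \<circ> \<pi>) Q s t n = F P (\<theta>' \<circ> \<pi>) Q s t' n \<and> loc P \<pi> \<theta>' Q \<and> triv Q s t'"
  using F_reglue[OF assms(1-10)] assms(11) by blast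

lemma F_resolve_bigon:
  assumes loc: "loc P \<pi> \<theta> Q" and P: "P = insert a (insert b P')" "a \<notin> P'" "b \<notin> P'"
    and Q: "Q = insert a (insert b (insert p Q'))" "p \<in> P'" "Q' \<subseteq> P'" "p \<notin> Q'" and ab: "a \<noteq> b"
    and fixed: "\<pi> a = a" "\<pi> b = b" "\<theta> a = a" "\<theta> b = b" and T: "triv Q s t"
    and st: "s a = s p" "s b = s p" "t a = t p" "t b = t p"
  shows "F P (\<theta> \<circ> \<pi>) Q s t n = of_int (2 * \<epsilon>) * F P' (\<theta> \<circ> \<pi>) Q' s t n" and "loc P' \<pi> \<theta> Q'"
proof -
  note loc' = locD[OF loc]
  have sets: "P - {a, b} = P'" "Q - {a, b} - {p} = Q'" using P Q by auto
  have "perm P' \<pi>" "perm P' \<theta>"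
    using perm_Diff_fixed[OF loc'(1), of "{a, b}"] perm_Diff_fixed[OF loc'(2), of "{a, b}"] fixed P(1)
    unfolding sets by auto
  then show "loc P' \<pi> \<theta> Q'" using Q by (simp add: loc_def)
  have "{a, b, p} \<subseteq> Q" "distinct [a, b, p]" using P Q ab by auto
  from F_bigon[OF loc_perm[OF loc] loc'(3) T this _ _ st] fixed
  show "F P (\<theta> \<circ> \<pi>) Q s t n = of_int (2 * \<epsilon>) * F P' (\<theta> \<circ> \<pi>) Q' s t n"
    unfolding sets by simp
qed

lemma F_resolve_quad:
  assumes loc: "loc P \<pi> \<theta> Q" and P: "P = insert a (insert b (insert c (insert d P')))" "{a, b, c, d} \<inter> P' = {}"
    and Q: "Q = insert a (insert b (insert c (insert d (insert p (insert r Q')))))" "{p, r} \<subseteq> P'"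
      "Q' \<subseteq> P'" "{p, r} \<inter> Q' = {}"
    and dist: "distinct [a, b, c, d]" "p \<noteq> r"
    and fixed: "\<pi> a = a" "\<pi> b = b" "\<pi> c = c" "\<pi> d = d" "\<theta> a = a" "\<theta> b = b" "\<theta> c = c" "\<theta> d = d"
    and zs: "\<forall>y \<in> set zs. \<theta>' y = swap p r (\<theta> y)" "{p, r} \<subseteq> set zs"
      "\<And>y. y \<notin> set zs \<Longrightarrow> \<theta>' y = y" "\<And>y. y \<notin> set zs \<Longrightarrow> \<theta> y = y"
    and T: "triv Q s t"
    and s: "s a = s p" "s d = s p" "s b = s r" "s c = s r" "s p \<noteq> s r"
    and t: "t a = t p" "t b = t p" "t c = t r" "t d = t r" "t p \<noteq> t r"
  shows "F P (\<theta> \<circ> \<pi>) Q s t n = F P' (\<theta> \<circ> \<pi>) Q' s t n + F P' (\<theta>' \<circ> \<pi>) Q' s t n"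
    and "loc P' \<pi> \<theta> Q'" and "loc P' \<pi> \<theta>' Q'"
proof -
  note loc' = locD[OF loc]
  have \<theta>': "\<theta>' y = swap p r (\<theta> y)" for y
  proof (cases "y \<in> set zs")
    case False
    then have "y \<noteq> p" "y \<noteq> r" using zs(2) by auto
    then show ?thesis using zs(3,4)[OF False] by simp
  qed (use zs(1) in simp)
  have sets: "P - {a, b, c, d} = P'" "Q - {a, b, c, d} - {p, r} = Q'" using P Q by auto
  have "\<pi> e = e" "\<theta> e = e" if "e \<in> {a, b, c, d}" for e using that fixed by auto
  then have p: "perm P' \<pi>" "perm P' \<theta>"
    using perm_Diff_fixed[OF loc'(1), of "{a, b, c, d}"] perm_Diff_fixed[OF loc'(2), of "{a, b, c, d}"] P(1)
    unfolding sets by auto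
  then show "loc P' \<pi> \<theta> Q'" using Q by (simp add: loc_def)
  have "perm P' (swap p r \<circ> \<theta>)" by (rule perm_swap[OF p(2)]) (use Q(2) in auto)
  moreover have \<theta>'': "swap p r \<circ> \<theta> = \<theta>'" by (simp add: fun_eq_iff \<theta>')
  ultimately show "loc P' \<pi> \<theta>' Q'" using p Q by (simp add: loc_def)
  have "{a, b, c, d, p, r} \<subseteq> Q" "distinct [a, b, c, d, p, r]" using P Q dist by auto
  from F_quad[OF loc_perm[OF loc] loc'(3) T this _ _ _ _ s t, of n]
  show "F P (\<theta> \<circ> \<pi>) Q s t n = F P' (\<theta> \<circ> \<pi>) Q' s t n + F P' (\<theta>' \<circ> \<pi>) Q' s t n"
    using fixed unfolding sets comp_assoc[symmetric] \<theta>'' by simp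
qed

lemma F_through:
  assumes "loc P \<pi> \<theta> Q" "P = insert a P'" "a \<notin> P'" "a \<notin> Q" "\<pi> a = a" "\<theta> a \<noteq> a"
    and "\<And>y. y \<noteq> a \<Longrightarrow> \<theta>' y = (if \<theta> y = a then \<theta> a else \<theta> y)"
  shows "F P (\<theta> \<circ> \<pi>) Q s t n = F P' (\<theta>' \<circ> \<pi>) Q s t n \<and> loc P' \<pi> \<theta>' Q"
  using F_pass[OF assms(1-5,7)] assms(6) by simp

text \<open>Fixed by both maps, \<open>a\<close> is a circle of its own, worth the factor 3.\<close>

lemma F_close:
  assumes "loc P \<pi> \<theta> Q" "P = insert a P'" "a \<notin> P'" "a \<notin> Q" "\<pi> a = a" "\<theta> a = a"
    and "\<And>y. y \<noteq> a \<Longrightarrow> \<theta>' y = \<theta> y" and T: "triv Q s t"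
  shows "F P (\<theta> \<circ> \<pi>) Q s t n = 3 * F P' (\<theta>' \<circ> \<pi>) Q s t n \<and> loc P' \<pi> \<theta>' Q"
proof -
  have "\<theta>' y = (if \<theta> y = a then \<theta> a else \<theta> y)" if "y \<noteq> a" for y
    using assms(7)[OF that] assms(6) by simp
  note p = F_pass[OF assms(1-5) this]
  have "F P (\<theta> \<circ> \<pi>) Q s t n = F P' (\<theta>' \<circ> \<pi>) Q s t (Suc n)"
    using p(1)[of s t n] assms(6) by simp
  also have "\<dots> = 3 * F P' (\<theta>' \<circ> \<pi>) Q s t n"
    by (rule F_circle[OF loc_perm[OF p(2)] locD(3)[OF p(2)] T])
  finally show ?thesis using p(2) by simp
qed

end

subsection \<open>Resolving the crossings of a move\<close>

text \<open>
  In a move the outer part of the diagram is fixed: \<open>\<pi>\<close> joins the ports \<open>R\<close>, which contain one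
  port \<open>k\<close>, \<open>l\<close>, \<open>m\<close> for each strand of the move, and \<open>Q0\<close> are the outer active ports.
  The inner edges of the move are further ports \<open>a\<close>, \<open>b\<close>, \<open>c\<close>, and \<open>hx\<close>, \<open>hy\<close>, \<open>hz\<close> are the
  edges from source to sink at the crossings; all of them are fixed by \<open>\<pi>\<close>.  The map \<open>\<theta>\<close> says
  how the incoming sides are continued if every crossing gets its oriented state.
\<close>

locale outer = evaluation +
  fixes R :: "'a set" and \<pi> :: "'a \<Rightarrow> 'a" and Q0 :: "'a set" and lab :: "'a \<Rightarrow> nat" and n :: nat
  assumes \<pi>: "perm R \<pi>" and Q0: "Q0 \<subseteq> R" and triv0: "triv Q0 lab lab"
begin

abbreviation inner :: "'a \<Rightarrow> bool" where
  "inner i \<equiv> i \<notin> R \<and> \<pi> i = i"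

text \<open>All inner crossings are gone and the ends of the outer part are joined directly as
  \<theta> says. The sums below are reduced to such terms as far as the relations permit.\<close>

abbreviation W where "W \<theta> \<equiv> F R (\<theta> \<circ> \<pi>) Q0 lab lab n"

abbreviation leads where
  "leads E P \<theta> Q s t \<equiv> E = F P (\<theta> \<circ> \<pi>) Q s t n \<and> loc P \<pi> \<theta> Q"

lemma finite_R: "finite R" using \<pi> by (rule perm_finite)

lemma F_lab_cong:
  assumes "loc P \<pi> \<theta> Q" "\<And>y. \<theta>' y = \<theta> y" "Q' = Q" "\<And>x. x \<in> Q \<Longrightarrow> s' x = s x" "\<And>x. x \<in> Q \<Longrightarrow> t' x = t x"
  shows "F P (\<theta> \<circ> \<pi>) Q s t n' = F P (\<theta>' \<circ> \<pi>) Q' s' t' n'"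
  unfolding assms(3) by (rule F_cong[OF loc_perm[OF assms(1)] locD(3)[OF assms(1)]]) (simp_all add: assms)

end

section \<open>The kink of the first Reidemeister move\<close>

locale kink = outer +
  fixes k a h x
  assumes k: "k \<in> R - Q0" and inner: "inner a" "inner h" and ah: "a \<noteq> h"
    and x: "x \<notin> lab ` Q0" "lab a = x" "lab k = x" "lab h = x"
begin

text \<open>The oriented state splits off a circle, worth 3. In the unoriented state
  \<open>a\<close> and \<open>h\<close> form a bigon, worth 2\<epsilon> with weight -\<epsilon>.
  Together this is 3 - 2 = 1.\<close>

lemma kink_sum:
  "F (insert a R) (id \<circ> \<pi>) Q0 lab lab n +
   of_int (- \<epsilon>) * F (insert h (insert a R)) (id \<circ> \<pi>) (insert a (insert h (insert k Q0))) lab lab n = W id"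
proof -
  have loc1: "loc (insert a R) \<pi> id Q0"
    using \<pi> Q0 inner finite_R by (auto simp: loc_def perm_insert perm_def[of _ id])
  have loc2: "loc (insert h (insert a R)) \<pi> id (insert a (insert h (insert k Q0)))"
    using \<pi> Q0 inner finite_R k by (auto simp: loc_def perm_insert perm_def[of _ id])
  have aQ: "a \<notin> Q0" "h \<notin> Q0" "k \<notin> Q0" using inner Q0 k by auto
  have neq: "a \<noteq> k" "h \<noteq> k" using inner k by auto
  have "F (insert a R) (id \<circ> \<pi>) Q0 lab lab n = F R (id \<circ> \<pi>) Q0 lab lab (Suc n)"
    using F_pass(1)[OF loc1 refl _ aQ(1), of id] inner by simp
  also have "\<dots> = 3 * W id"
    using F_circle[of R "id \<circ> \<pi>" Q0] \<pi> Q0 triv0 by simp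
  finally have one: "F (insert a R) (id \<circ> \<pi>) Q0 lab lab n = 3 * W id" .
  have T: "triv (insert a (insert h (insert k Q0))) lab lab"
    by (rule triv_insert3[OF triv0]) (use aQ neq ah x in simp_all)
  have two: "F (insert h (insert a R)) (id \<circ> \<pi>) (insert a (insert h (insert k Q0))) lab lab n =
      of_int (2 * \<epsilon>) * W id"
    by (rule F_resolve_bigon(1)[OF loc2 insert_commute _ _ refl])
      (use aQ neq ah x k inner Q0 T in simp_all)
  have "- \<epsilon> * (2 * \<epsilon>) = -2" using sign by auto
  then have "of_int (- \<epsilon>) * (of_int (2 * \<epsilon>) * W id) = of_int (- 2) * W id"
    by (metis (no_types) mult.assoc of_int_mult)
  then show ?thesis unfolding one two by simp
qed

end

section \<open>Terms left over after resolution, their independence of names, and the arithmetic of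
  the moves\<close>

context outer
begin

lemma loc_outer:
  assumes "\<And>i. i \<in> A \<Longrightarrow> inner i" "finite A" "B \<subseteq> A \<union> R"
    and "set (map \<theta> xs) = set xs" "set xs \<subseteq> A \<union> R" "\<And>y. y \<notin> set xs \<Longrightarrow> \<theta> y = y"
  shows "loc (A \<union> R) \<pi> \<theta> (B \<union> Q0)"
proof -
  have "perm (A \<union> R) \<pi>"
    using assms(2,1) by (induction A rule: finite_induct) (simp_all add: \<pi> perm_insert)
  moreover have "perm (A \<union> R) \<theta>"
    by (rule perm_list[OF _ assms(5,4,6)]) (simp_all add: assms(2) finite_R)
  ultimately show ?thesis using assms(3) Q0 by (auto simp: loc_def)
qed

lemma inner_rename:
  assumes loc: "loc (A \<union> R) \<pi> \<theta> (B \<union> Q0)"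
    and inner: "\<And>i. i \<in> A \<Longrightarrow> inner i" "\<And>i. i \<in> A \<Longrightarrow> inner (g i)" and inj: "inj_on g A"
    and g: "\<And>i. i \<in> R \<Longrightarrow> g i = i" and A': "A' = g ` A" and B': "B' = g ` B"
    and \<theta>': "\<And>i. i \<in> A \<union> R \<Longrightarrow> \<theta>' (g i) = g (\<theta> i)"
    and st: "\<And>i. i \<in> B \<union> Q0 \<Longrightarrow> s' (g i) = u (s i)" "\<And>i. i \<in> B \<union> Q0 \<Longrightarrow> t' (g i) = v (t i)"
    and uv: "inj_on u (s ` (B \<union> Q0))" "inj_on v (t ` (B \<union> Q0))"
  shows "F (A \<union> R) (\<theta> \<circ> \<pi>) (B \<union> Q0) s t n' = F (A' \<union> R) (\<theta>' \<circ> \<pi>) (B' \<union> Q0) s' t' n'"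
proof (rule F_rename[where h = g and g = g, OF loc_perm[OF loc] locD(3)[OF loc]])
  have R: "g ` R = R" using g by (simp add: image_cong[of R R g id])
  have Q: "g ` Q0 = Q0" using g Q0 by (simp add: image_cong[of Q0 Q0 g id] subset_iff)
  show "A' \<union> R = g ` (A \<union> R)" "B' \<union> Q0 = g ` (B \<union> Q0)" "g ` (B \<union> Q0) = B' \<union> Q0"
    unfolding image_Un R Q A' B' by simp_all
  show "inj_on g (A \<union> R)"
  proof (rule inj_onI)
    fix i j assume ij: "i \<in> A \<union> R" "j \<in> A \<union> R" "g i = g j"
    have A: "i \<in> A" if "i \<notin> R" "i \<in> A \<union> R" for i using that by simp
    show "i = j"
    proof (cases "i \<in> R"; cases "j \<in> R")
      assume "i \<in> R" "j \<in> R"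
      then show ?thesis using ij(3) g by simp
    next
      assume "i \<in> R" "j \<notin> R"
      then show ?thesis using ij(3) g[of i] inner(2)[OF A[OF _ ij(2)]] by simp
    next
      assume "i \<notin> R" "j \<in> R"
      then show ?thesis using ij(3) g[of j] inner(2)[OF A[OF _ ij(1)]] by simp
    next
      assume "i \<notin> R" "j \<notin> R"
      then show ?thesis using inj_onD[OF inj ij(3)] A ij by simp
    qed
  qed
  show "(\<theta>' \<circ> \<pi>) (g i) = g ((\<theta> \<circ> \<pi>) i)" if i: "i \<in> A \<union> R" for i
  proof -
    have "\<pi> (g i) = g (\<pi> i)"
    proof (cases "i \<in> R")
      case True
      then show ?thesis using g perm_in[OF \<pi>] by simp
    next
      case False
      then show ?thesis using i inner by simp
    qed
    then show ?thesis using \<theta>'[OF perm_in[OF locD(1)[OF loc] i]] by simp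
  qed
  show "inj_on u (s ` (B \<union> Q0))" "inj_on v (t ` (B \<union> Q0))" by (rule uv)+
qed (simp_all add: st)

text \<open>One unoriented crossing survives: the outer strands \<open>p\<close> and
  \<open>q\<close> meet at it, and \<open>h\<close> is its edge from source to sink. Source and sink
  labels are separate parameters because a resolved bigon can leave a source and a sink that stem
  from different crossings.\<close>

abbreviation H where
  "H \<theta> p q h v w \<equiv> F ({h} \<union> R) (\<theta> \<circ> \<pi>) ({p, q, h} \<union> Q0) (lab(p := v, q := v, h := v)) (lab(p := w, q := w, h := w)) n"

lemma fresh_inj_on:
  assumes "v \<notin> lab ` Q0" "v' \<notin> lab ` Q0" "A \<subseteq> insert v (lab ` Q0)"
  shows "inj_on (id(v := v')) A"
  by (rule inj_on_subset[OF _ assms(3)]) (use assms(1,2) in \<open>auto simp: inj_on_def\<close>)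

text \<open>Different states leave this term with different inner edges and labels; it takes this
  renaming to add them up.\<close>

lemma H_indep:
  assumes loc: "loc ({h} \<union> R) \<pi> \<theta> ({p, q, h} \<union> Q0)" and pq: "p \<in> R - Q0" "q \<in> R - Q0"
    and h: "inner h" "inner h'" "\<theta> h = h" "\<theta> h' = h'"
    and v: "v \<notin> lab ` Q0" "v' \<notin> lab ` Q0" "w \<notin> lab ` Q0" "w' \<notin> lab ` Q0"
  shows "H \<theta> p q h v w = H \<theta> p q h' v' w'"
proof (rule inner_rename[OF loc, where g = "id(h := h')" and u = "id(v := v')" and v = "id(w := w')"])
  have hQ: "h \<notin> Q0" "h' \<notin> Q0" "p \<noteq> h" "q \<noteq> h" "p \<noteq> h'" "q \<noteq> h'" using h Q0 pq by auto
  have lab: "lab x \<noteq> v" "lab x \<noteq> w" if "x \<in> Q0" for x using v that by auto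
  show "\<theta> ((id(h := h')) i) = (id(h := h')) (\<theta> i)" if "i \<in> {h} \<union> R" for i
    using perm_inj[OF locD(2)[OF loc], of i h] that h by (cases "i = h") auto
  show "(lab(p := v', q := v', h' := v')) ((id(h := h')) i) = (id(v := v')) ((lab(p := v, q := v, h := v)) i)"
    if "i \<in> {p, q, h} \<union> Q0" for i
    using that hQ pq lab(1)[of i] by auto
  show "(lab(p := w', q := w', h' := w')) ((id(h := h')) i) = (id(w := w')) ((lab(p := w, q := w, h := w)) i)"
    if "i \<in> {p, q, h} \<union> Q0" for i
    using that hQ pq lab(2)[of i] by auto
  show "inj_on (id(v := v')) (lab(p := v, q := v, h := v) ` ({p, q, h} \<union> Q0))"
    by (rule fresh_inj_on[OF v(1,2)]) auto
  show "inj_on (id(w := w')) (lab(p := w, q := w, h := w) ` ({p, q, h} \<union> Q0))"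
    by (rule fresh_inj_on[OF v(3,4)]) auto
qed (use h pq in auto)

lemma H_commute: "H \<theta> p q h v w = H \<theta> q p h v w"
proof -
  have "lab(p := i, q := i, h := i) = lab(q := i, p := i, h := i)" for i by auto
  then show ?thesis by (simp add: insert_commute)
qed

lemma sign_cancel:
  fixes E :: "int mpoly"
  shows "of_int (- \<epsilon>) * (of_int (2 * \<epsilon>) * E) = - 2 * E"
    and "of_int (\<epsilon> * \<epsilon>) * E = E"
proof -
  have s: "- \<epsilon> * (2 * \<epsilon>) = -2" "\<epsilon> * \<epsilon> = 1" using sign by auto
  have "of_int (- \<epsilon>) * (of_int (2 * \<epsilon>) * E) = of_int (- \<epsilon> * (2 * \<epsilon>)) * E"
    by (simp only: of_int_mult mult.assoc)
  then show "of_int (- \<epsilon>) * (of_int (2 * \<epsilon>) * E) = - 2 * E" unfolding s by simp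
  show "of_int (\<epsilon> * \<epsilon>) * E = E" unfolding s by simp
qed

text \<open>Three outer strands end in one sink and start again from one source, without an edge
  between the two. This arises from resolving a quadrilateral when all three crossings of a triangle
  are unoriented.\<close>

abbreviation T where
  "T \<theta> p q r v w \<equiv> F R (\<theta> \<circ> \<pi>) ({p, q, r} \<union> Q0) (lab(p := v, q := v, r := v)) (lab(p := w, q := w, r := w)) n"

lemma T_indep:
  assumes loc: "loc R \<pi> \<theta> ({p, q, r} \<union> Q0)" and pqr: "{p, q, r} \<inter> Q0 = {}"
    and v: "v \<notin> lab ` Q0" "v' \<notin> lab ` Q0" "w \<notin> lab ` Q0" "w' \<notin> lab ` Q0"
  shows "T \<theta> p q r v w = T \<theta> p q r v' w'"
proof -
  have "F ({} \<union> R) (\<theta> \<circ> \<pi>) ({p, q, r} \<union> Q0) (lab(p := v, q := v, r := v)) (lab(p := w, q := w, r := w)) n =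
    F ({} \<union> R) (\<theta> \<circ> \<pi>) ({p, q, r} \<union> Q0) (lab(p := v', q := v', r := v')) (lab(p := w', q := w', r := w')) n"
  proof (rule inner_rename[where g = id and u = "id(v := v')" and v = "id(w := w')"])
    show "loc ({} \<union> R) \<pi> \<theta> ({p, q, r} \<union> Q0)" using loc by simp
    have lab: "lab x \<noteq> v" "lab x \<noteq> w" if "x \<in> Q0" for x using v that by auto
    show "(lab(p := v', q := v', r := v')) (id i) = (id(v := v')) ((lab(p := v, q := v, r := v)) i)"
      if "i \<in> {p, q, r} \<union> Q0" for i
      using that pqr lab(1)[of i] by auto
    show "(lab(p := w', q := w', r := w')) (id i) = (id(w := w')) ((lab(p := w, q := w, r := w)) i)"
      if "i \<in> {p, q, r} \<union> Q0" for i
      using that pqr lab(2)[of i] by auto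
    show "inj_on (id(v := v')) (lab(p := v, q := v, r := v) ` ({p, q, r} \<union> Q0))"
      by (rule fresh_inj_on[OF v(1,2)]) auto
    show "inj_on (id(w := w')) (lab(p := w, q := w, r := w) ` ({p, q, r} \<union> Q0))"
      by (rule fresh_inj_on[OF v(3,4)]) auto
  qed simp_all
  then show ?thesis by simp
qed

text \<open>Two unoriented crossings with labels \<open>v\<close> and \<open>w\<close>, joined by
  the inner edge \<open>a\<close> from the source of the first to the sink of the second.\<close>

abbreviation C where
  "C k l m a h h' v w \<equiv> F ({a, h, h'} \<union> R) (id(k := m, l := a, m := k, a := l) \<circ> \<pi>)
     ({a, m, h, k, l, h'} \<union> Q0) (lab(a := v, m := v, h := v, k := w, l := w, h' := w))
     (lab(a := v, m := v, h := v, k := w, l := w, h' := w)) n"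

lemma C_indep:
  assumes klm: "{k, l, m} \<subseteq> R - Q0" "distinct [k, l, m]"
    and inner: "\<And>i. i \<in> {a, h, h', a2, h2, h2'} \<Longrightarrow> inner i"
    and dist: "distinct [a, h, h']" "distinct [a2, h2, h2']"
    and v: "v \<notin> lab ` Q0" "w \<notin> lab ` Q0" "v2 \<notin> lab ` Q0" "w2 \<notin> lab ` Q0" "v \<noteq> w" "v2 \<noteq> w2"
  shows "C k l m a h h' v w = C k l m a2 h2 h2' v2 w2"
proof (rule inner_rename[where g = "id(a := a2, h := h2, h' := h2')" and u = "id(v := v2, w := w2)"
      and v = "id(v := v2, w := w2)"])
  let ?g = "id(a := a2, h := h2, h' := h2')" and ?u = "id(v := v2, w := w2)"
  let ?L = "lab(a := v, m := v, h := v, k := w, l := w, h' := w)"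
  let ?L2 = "lab(a2 := v2, m := v2, h2 := v2, k := w2, l := w2, h2' := w2)"
  have nR: "a \<notin> R" "h \<notin> R" "h' \<notin> R" "a2 \<notin> R" "h2 \<notin> R" "h2' \<notin> R"
    by (rule inner[THEN conjunct1], simp)+
  have in3: "inner i" if "i \<in> {a, h, h'}" for i by (rule inner) (use that in auto)
  have R: "k \<in> R" "l \<in> R" "m \<in> R" "k \<notin> Q0" "l \<notin> Q0" "m \<notin> Q0" using klm(1) by auto
  have lab: "lab i \<noteq> v" "lab i \<noteq> w" if "i \<in> Q0" for i using v that by auto
  have ne: "i \<noteq> a" "i \<noteq> h" "i \<noteq> h'" "i \<noteq> a2" "i \<noteq> h2" "i \<noteq> h2'" if "i \<in> R" for i using that nR by auto
  have neR: "a \<noteq> i" "h \<noteq> i" "h' \<noteq> i" "a2 \<noteq> i" "h2 \<noteq> i" "h2' \<noteq> i" if "i \<in> R" for i using that nR by auto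
  show "loc ({a, h, h'} \<union> R) \<pi> (id(k := m, l := a, m := k, a := l)) ({a, m, h, k, l, h'} \<union> Q0)"
    by (rule loc_outer[where xs = "[k, l, m, a]", OF in3]) (use R klm(2) ne[OF R(1)] ne[OF R(2)] ne[OF R(3)] in auto)
  show "inner i" if "i \<in> {a, h, h'}" for i by (rule in3[OF that])
  show "inner (?g i)" if "i \<in> {a, h, h'}" for i
    by (rule inner) (use that in auto)
  show "inj_on ?g {a, h, h'}" using dist by (auto simp: inj_on_def)
  show "?g i = i" if "i \<in> R" for i using ne[OF that] by simp
  show "{a2, h2, h2'} = ?g ` {a, h, h'}" using dist by auto
  show "{a2, m, h2, k, l, h2'} = ?g ` {a, m, h, k, l, h'}" using dist ne[OF R(1)] ne[OF R(2)] ne[OF R(3)] by auto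
  show "(id(k := m, l := a2, m := k, a2 := l)) (?g i) = ?g ((id(k := m, l := a, m := k, a := l)) i)"
    if "i \<in> {a, h, h'} \<union> R" for i
    using that
  proof
    assume "i \<in> {a, h, h'}"
    then show ?thesis
      using dist klm(2) ne[OF R(1)] ne[OF R(2)] ne[OF R(3)] by (elim insertE emptyE) auto
  next
    assume "i \<in> R"
    then show ?thesis
      using ne[of i] dist klm(2) ne[OF R(1)] ne[OF R(2)] ne[OF R(3)] by (cases "i = k"; cases "i = l"; cases "i = m") simp_all
  qed
  have L: "?L2 (?g i) = ?u (?L i)" if "i \<in> {a, m, h, k, l, h'} \<union> Q0" for i
    using that
  proof
    assume "i \<in> {a, m, h, k, l, h'}"
    then show ?thesis
      using dist v(5,6) klm(2) ne[OF R(1)] ne[OF R(2)] ne[OF R(3)] by (elim insertE emptyE) auto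
  next
    assume i: "i \<in> Q0"
    then have "i \<in> R" "i \<noteq> k" "i \<noteq> l" "i \<noteq> m" using Q0 R by auto
    then show ?thesis using ne[of i] lab[OF i] by simp
  qed
  show "?L2 (?g i) = ?u (?L i)" if "i \<in> {a, m, h, k, l, h'} \<union> Q0" for i by (rule L[OF that])
  show "?L2 (?g i) = ?u (?L i)" if "i \<in> {a, m, h, k, l, h'} \<union> Q0" for i by (rule L[OF that])
  have img: "?L ` ({a, m, h, k, l, h'} \<union> Q0) \<subseteq> {v, w} \<union> lab ` Q0" by auto
  have u: "?u i = i" "i \<noteq> v2" "i \<noteq> w2" if "i \<in> lab ` Q0" for i using that v(1-4) by auto
  have "inj_on ?u ({v, w} \<union> lab ` Q0)"
  proof (rule inj_onI)
    fix i j assume "i \<in> {v, w} \<union> lab ` Q0" "j \<in> {v, w} \<union> lab ` Q0" "?u i = ?u j"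
    then show "i = j"
      using v(5,6) u[of i] u[of j] by (elim UnE insertE emptyE) (simp_all split: if_splits)
  qed
  with img show "inj_on ?u (?L ` ({a, m, h, k, l, h'} \<union> Q0))" by (rule inj_on_subset[rotated])
  then show "inj_on ?u (?L ` ({a, m, h, k, l, h'} \<union> Q0))" .
qed

text \<open>The coefficients of \<open>E\<close> add up to -2\<epsilon> + 2\<epsilon> - \<epsilon> =
  -\<epsilon>, the same as those of \<open>E'\<close> and \<open>Z\<close>. The result is therefore
  symmetric in the three terms.\<close>

lemma acyclic_arith:
  fixes N E E' X Y Z :: "int mpoly"
  shows "N + of_int (- \<epsilon>) * E + of_int (- \<epsilon>) * E' + of_int (- \<epsilon>) * E + of_int (\<epsilon> * \<epsilon>) * X +
    of_int (\<epsilon> * \<epsilon>) * (of_int (2 * \<epsilon>) * E) + of_int (\<epsilon> * \<epsilon>) * Y + of_int (- \<epsilon> * (\<epsilon> * \<epsilon>)) * (Z + E) =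
    N + of_int (- \<epsilon>) * (E + E' + Z) + (X + Y)"
proof -
  have "\<epsilon> * \<epsilon> = 1" using sign by auto
  then have cube: "- \<epsilon> * (\<epsilon> * \<epsilon>) = - \<epsilon>" by simp
  show ?thesis unfolding cube sign_cancel(2) by (simp add: algebra_simps)
qed

text \<open>\<open>E\<close> drops out, as its coefficients are 3, three times -2, and three times
  1.\<close>

lemma cyclic_arith:
  fixes E X Y Z U :: "int mpoly"
  shows "3 * E + of_int (- \<epsilon>) * (of_int (2 * \<epsilon>) * E) + of_int (- \<epsilon>) * (of_int (2 * \<epsilon>) * E) +
    of_int (- \<epsilon>) * (of_int (2 * \<epsilon>) * E) + of_int (\<epsilon> * \<epsilon>) * (E + X) + of_int (\<epsilon> * \<epsilon>) * (E + Y) +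
    of_int (\<epsilon> * \<epsilon>) * (E + Z) + of_int (- \<epsilon> * (\<epsilon> * \<epsilon>)) * U = X + Y + Z + of_int (- \<epsilon>) * U"
proof -
  have "\<epsilon> * \<epsilon> = 1" using sign by auto
  then have cube: "- \<epsilon> * (\<epsilon> * \<epsilon>) = - \<epsilon>" by simp
  show ?thesis unfolding cube sign_cancel by (simp add: algebra_simps)
qed

text \<open>The bigon contributes 2\<epsilon> and cancels the two states with coefficient
  -\<epsilon>.\<close>

lemma parallel_arith:
  fixes N E :: "int mpoly"
  shows "N + of_int (- \<epsilon>) * E + of_int (- \<epsilon>) * E + of_int (\<epsilon> * \<epsilon>) * (of_int (2 * \<epsilon>) * E) = N"
  unfolding sign_cancel(2) by (simp add: algebra_simps)

text \<open>\<open>E\<close> drops out, as 3 - 2 - 2 + 1 = 0.\<close>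

lemma antiparallel_arith:
  fixes N E :: "int mpoly"
  shows "3 * E + of_int (- \<epsilon>) * (of_int (2 * \<epsilon>) * E) + of_int (- \<epsilon>) * (of_int (2 * \<epsilon>) * E) +
    of_int (\<epsilon> * \<epsilon>) * (E + N) = N"
  unfolding sign_cancel by (simp add: algebra_simps)

lemma triv1:
  assumes "distinct [p, q, r]" "{p, q, r} \<inter> Q0 = {}" "lab' p = lab' r" "lab' q = lab' r" "lab' r \<notin> lab ` Q0"
    and "\<And>i. i \<in> Q0 \<Longrightarrow> lab' i = lab i"
  shows "triv ({p, q, r} \<union> Q0) lab' lab'"
proof -
  have eq: "{y \<in> Q0. lab' y = lab' i} = {y \<in> Q0. lab y = lab i}" if "i \<in> Q0" for i
    using assms(6) that by (intro Collect_cong) auto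
  have "triv Q0 lab' lab'" using triv0 unfolding triv_def by (simp add: eq)
  moreover have "lab' ` Q0 = lab ` Q0" using assms(6) by (rule image_cong[OF refl])
  ultimately show ?thesis using triv_insert3[of Q0 lab' lab' p q r] assms(1-5) by simp
qed

lemma triv2:
  assumes "distinct [p, q, r, p', q', r']" "{p, q, r, p', q', r'} \<inter> Q0 = {}"
    and "lab' p = lab' r" "lab' q = lab' r" "lab' p' = lab' r'" "lab' q' = lab' r'"
    and "lab' r \<notin> lab ` Q0" "lab' r' \<notin> lab ` Q0" "lab' r \<noteq> lab' r'" "\<And>i. i \<in> Q0 \<Longrightarrow> lab' i = lab i"
  shows "triv ({p, q, r, p', q', r'} \<union> Q0) lab' lab'"
proof -
  have "triv ({p', q', r'} \<union> Q0) lab' lab'" by (rule triv1) (use assms in auto)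
  moreover have "lab' r \<notin> lab' ` ({p', q', r'} \<union> Q0)" using assms(5-10) by auto
  ultimately show ?thesis
    using triv_insert3[of "{p', q', r'} \<union> Q0" lab' lab' p q r] assms(1-4) by auto
qed

lemma triv3:
  assumes "distinct [p, q, r, p', q', r', p'', q'', r'']" "{p, q, r, p', q', r', p'', q'', r''} \<inter> Q0 = {}"
    and "lab' p = lab' r" "lab' q = lab' r" "lab' p' = lab' r'" "lab' q' = lab' r'"
    and "lab' p'' = lab' r''" "lab' q'' = lab' r''"
    and "{lab' r, lab' r', lab' r''} \<inter> lab ` Q0 = {}" "distinct [lab' r, lab' r', lab' r'']"
    and "\<And>i. i \<in> Q0 \<Longrightarrow> lab' i = lab i"
  shows "triv ({p, q, r, p', q', r', p'', q'', r''} \<union> Q0) lab' lab'"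
proof -
  have "triv ({p', q', r', p'', q'', r''} \<union> Q0) lab' lab'" by (rule triv2) (use assms in auto)
  moreover have "lab' r \<notin> lab' ` ({p', q', r', p'', q'', r''} \<union> Q0)" using assms(5-11) by auto
  ultimately show ?thesis
    using triv_insert3[of "{p', q', r', p'', q'', r''} \<union> Q0" lab' lab' p q r] assms(1-4) by auto
qed

end

section \<open>The two crossings of the second Reidemeister move\<close>

locale clasp = outer +
  fixes k l a b hx hy x y
  assumes kl: "k \<in> R - Q0" "l \<in> R - Q0" and inner: "\<And>i. i \<in> {a, b, hx, hy} \<Longrightarrow> inner i"
    and dist: "distinct [k, l]" "distinct [a, b, hx, hy]"
    and fresh: "x \<notin> lab ` Q0" "y \<notin> lab ` Q0" "x \<noteq> y" and labh: "lab hx = x" "lab hy = y"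
begin

lemma D: "distinct [k, l, a, b, hx, hy]" "{k, l, a, b, hx, hy} \<inter> Q0 = {}" "{a, b, hx, hy} \<inter> R = {}"
    "k \<in> R" "l \<in> R" "x \<noteq> y" "{x, y} \<inter> lab ` Q0 = {}"
    "\<pi> a = a" "\<pi> b = b" "\<pi> hx = hx" "\<pi> hy = hy" "lab hx = x" "lab hy = y"
    "distinct [hy, hx, b, a, l, k]" "y \<noteq> x"
  using kl inner dist Q0 fresh labh by auto

lemmas N = D[simplified]

lemma loc_clasp:
  assumes "A \<subseteq> {a, b, hx, hy}" "{a, b} \<subseteq> A" "B \<subseteq> A \<union> {k, l}"
    and "set (map \<theta> [k, l, a, b]) = {k, l, a, b}" "\<And>y. y \<notin> {k, l, a, b} \<Longrightarrow> \<theta> y = y"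
  shows "loc (A \<union> R) \<pi> \<theta> (B \<union> Q0)"
  by (rule loc_outer[where xs = "[k, l, a, b]"])
    (use assms inner kl in \<open>auto dest: subsetD intro: finite_subset\<close>)

text \<open>Both strands run through the crossing \<open>x\<close> first and then through the crossing \<open>y\<close>.\<close>

lemma parallel_sum:
  assumes lab: "lab a = x" "lab b = x" "lab k = y" "lab l = y"
    and \<theta>: "\<theta> = id(k := b, l := a, a := l, b := k)"
  shows "F ({a, b} \<union> R) (\<theta> \<circ> \<pi>) Q0 lab lab n +
    of_int (- \<epsilon>) * F ({a, b, hx} \<union> R) (\<theta> \<circ> \<pi>) ({a, b, hx} \<union> Q0) lab lab n +
    of_int (- \<epsilon>) * F ({a, b, hy} \<union> R) (\<theta> \<circ> \<pi>) ({k, l, hy} \<union> Q0) lab lab n +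
    of_int (\<epsilon> * \<epsilon>) * F ({a, b, hx, hy} \<union> R) (\<theta> \<circ> \<pi>) ({a, b, hx, k, l, hy} \<union> Q0) lab lab n = W id"
    (is "?Fa + of_int (- \<epsilon>) * ?Fb + of_int (- \<epsilon>) * ?Fc + of_int (\<epsilon> * \<epsilon>) * ?Fd = _")
proof -
  \<comment> \<open>With both crossings unoriented, \<open>a\<close> and \<open>b\<close> are arcs
    from the source of \<open>x\<close> to the sink of \<open>y\<close>. Exchanging the incoming
    sides of \<open>a\<close> and \<open>l\<close>, of \<open>b\<close> and \<open>k\<close>, and of
    \<open>hx\<close> and \<open>hy\<close> makes these arcs fixed ports; \<open>?t\<close> is the
    sink labelling moved along.\<close>
  let ?t = "lab(a := y, b := y, hx := y, k := x, l := x, hy := x)"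
  have \<theta>1: "set (map \<theta> [k, l, a, b]) = {k, l, a, b}" "\<And>y. y \<notin> {k, l, a, b} \<Longrightarrow> \<theta> y = y"
    using N unfolding \<theta> by auto
  note locs = loc_clasp[OF _ _ _ \<theta>1]
  \<comment> \<open>In these names \<open>I\<close> and \<open>H\<close> stand for the oriented and
    the unoriented state, at \<open>x\<close> and then at \<open>y\<close>.\<close>
  have II0: "loc ({a, b} \<union> R) \<pi> \<theta> Q0"
    using locs[of "{a, b}" "{}"] by simp
  have HI0: "loc ({a, b, hx} \<union> R) \<pi> \<theta> ({a, b, hx} \<union> Q0)"
    by (rule locs; auto)
  have IH0: "loc ({a, b, hy} \<union> R) \<pi> \<theta> ({k, l, hy} \<union> Q0)"
    by (rule locs; auto)
  have HH0: "loc ({a, b, hx, hy} \<union> R) \<pi> \<theta> ({a, b, hx, k, l, hy} \<union> Q0)"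
    by (rule locs; auto)
  have II1: "leads ?Fa ({b} \<union> R) (id(k := b, b := k)) Q0 lab lab" (is "_ = ?Gaa \<and> _")
    by (rule F_through[OF II0, of a]; use Q0 in \<open>auto simp: N \<theta>\<close>)
  have II2: "leads ?Gaa R id Q0 lab lab" (is "_ = ?Gab \<and> _")
    by (rule F_through[OF II1[THEN conjunct2], of b]; use Q0 in \<open>auto simp: N\<close>)
  have HI1: "leads ?Fb ({b, hx} \<union> R) (id(k := b, b := k)) ({l, b, hx} \<union> Q0) (lab(l := x)) (lab(l := x))" (is "_ = ?Gac \<and> _")
    by (intro conjI F_slide[OF HI0, of a _ "{b, hx} \<union> Q0" _ l]; use Q0 in \<open>auto simp: N lab \<theta>\<close>)
  have HI2: "leads ?Gac ({hx} \<union> R) id ({k, l, hx} \<union> Q0) (lab(l := x, k := x)) (lab(l := x, k := x))" (is "_ = ?Gad \<and> _")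
    by (intro conjI F_slide[OF HI1[THEN conjunct2], of b _ "{l, hx} \<union> Q0" _ k]; use Q0 in \<open>auto simp: N lab\<close>)
  have HIf: "?Gad = H id k l hx x x"
    by (rule F_lab_cong[OF HI2[THEN conjunct2]]; use Q0 in \<open>auto simp: N lab\<close>)
  have IH1: "leads ?Fc ({b, hy} \<union> R) (id(k := b, b := k)) ({k, l, hy} \<union> Q0) lab lab" (is "_ = ?Gae \<and> _")
    by (rule F_through[OF IH0, of a]; use Q0 in \<open>auto simp: N \<theta>\<close>)
  have IH2: "leads ?Gae ({hy} \<union> R) id ({k, l, hy} \<union> Q0) lab lab" (is "_ = ?Gaf \<and> _")
    by (rule F_through[OF IH1[THEN conjunct2], of b]; use Q0 in \<open>auto simp: N\<close>)
  have IHf: "?Gaf = H id k l hy y y"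
    by (rule F_lab_cong[OF IH2[THEN conjunct2]]; use Q0 in \<open>auto simp: N lab\<close>)
  have T: "triv ({a, b, hx, k, l, hy} \<union> Q0) lab lab"
    by (rule triv2) (use Q0 in \<open>auto simp: N lab\<close>)
  have HH1: "?Fd =
      F ({a, b, hx, hy} \<union> R) ((id(hy := hx, hx := hy)) \<circ> \<pi>) ({a, b, hx, k, l, hy} \<union> Q0) lab ?t n
      \<and> loc ({a, b, hx, hy} \<union> R) \<pi> (id(hy := hx, hx := hy)) ({a, b, hx, k, l, hy} \<union> Q0) \<and> triv ({a, b, hx, k, l, hy} \<union> Q0) lab ?t" (is "_ = ?Gag \<and> _")
    by (rule F_reglue_triv[OF HH0, where \<sigma> = "id(l := a, a := l, k := b, b := k, hy := hx, hx := hy)" and xs = "[l, a, k, b, hy, hx]" and zs = "[a, b, hx, k, l, hy]"]; (rule T | (simp add: N lab \<theta>; fail) | use Q0 in \<open>auto simp: N lab \<theta>\<close>))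
  have HH2: "?Gag =
      of_int (2 * \<epsilon>) * F ({hx, hy} \<union> R) ((id(hy := hx, hx := hy)) \<circ> \<pi>) ({k, l, hy} \<union> Q0) lab ?t n
      \<and> loc ({hx, hy} \<union> R) \<pi> (id(hy := hx, hx := hy)) ({k, l, hy} \<union> Q0)" (is "_ = _ * ?Gah \<and> _")
    by (intro conjI F_resolve_bigon[OF HH1[THEN conjunct2, THEN conjunct1], of a b "{hx, hy} \<union> R" hx "({k, l, hy} \<union> Q0)" "lab" "?t"]; (rule HH1[THEN conjunct2, THEN conjunct2] | (simp add: N lab; fail) | use Q0 in \<open>auto simp: N lab\<close>))
  have HH3: "leads ?Gah ({hy} \<union> R) id ({k, l, hy} \<union> Q0) lab ?t" (is "_ = ?Gai \<and> _")
    by (rule F_through[OF HH2[THEN conjunct2], of hx]; use Q0 in \<open>auto simp: N\<close>)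
  have HHf: "?Gai = H id k l hy y x"
    by (rule F_lab_cong[OF HH3[THEN conjunct2]]; use Q0 in \<open>auto simp: N lab\<close>)
  have Hxy: "H id k l hx x x = H id k l hy y y" "H id k l hy y x = H id k l hy y y"
    by (rule H_indep; use HI2[THEN conjunct2] IH2[THEN conjunct2] N in \<open>auto simp: insert_commute\<close>)+
  have "?Fa = W id" unfolding II1[THEN conjunct1] II2[THEN conjunct1] ..
  moreover have "?Fb = H id k l hy y y" unfolding HI1[THEN conjunct1] HI2[THEN conjunct1] HIf Hxy(1) ..
  moreover have "?Fc = H id k l hy y y" unfolding IH1[THEN conjunct1] IH2[THEN conjunct1] IHf ..
  moreover have "?Fd = of_int (2 * \<epsilon>) * H id k l hy y y" unfolding HH1[THEN conjunct1] HH2[THEN conjunct1] HH3[THEN conjunct1] HHf Hxy(2) ..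
  ultimately show ?thesis by (simp only: parallel_arith)
qed

text \<open>The strand of \<open>k\<close> meets \<open>x\<close> before \<open>y\<close>, the strand of \<open>l\<close> meets \<open>y\<close> before \<open>x\<close>.\<close>

lemma antiparallel_sum:
  assumes lab: "lab a = x" "lab l = x" "lab k = y" "lab b = y"
    and \<theta>: "\<theta> = id(k := l, l := k, a := b, b := a)"
  shows "F ({a, b} \<union> R) (\<theta> \<circ> \<pi>) Q0 lab lab n +
    of_int (- \<epsilon>) * F ({a, b, hx} \<union> R) (\<theta> \<circ> \<pi>) ({a, l, hx} \<union> Q0) lab lab n +
    of_int (- \<epsilon>) * F ({a, b, hy} \<union> R) (\<theta> \<circ> \<pi>) ({k, b, hy} \<union> Q0) lab lab n +
    of_int (\<epsilon> * \<epsilon>) * F ({a, b, hx, hy} \<union> R) (\<theta> \<circ> \<pi>) ({a, l, hx, k, b, hy} \<union> Q0) lab lab n = W id"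
    (is "?Fa + of_int (- \<epsilon>) * ?Fb + of_int (- \<epsilon>) * ?Fc + of_int (\<epsilon> * \<epsilon>) * ?Fd = _")
proof -
  let ?\<theta> = "id(k := l, l := k)"
  have \<theta>1: "set (map \<theta> [k, l, a, b]) = {k, l, a, b}" "\<And>y. y \<notin> {k, l, a, b} \<Longrightarrow> \<theta> y = y"
    using N unfolding \<theta> by auto
  note locs = loc_clasp[OF _ _ _ \<theta>1]
  have II0: "loc ({a, b} \<union> R) \<pi> \<theta> Q0"
    using locs[of "{a, b}" "{}"] by simp
  have HI0: "loc ({a, b, hx} \<union> R) \<pi> \<theta> ({a, l, hx} \<union> Q0)"
    by (rule locs; auto)
  have IH0: "loc ({a, b, hy} \<union> R) \<pi> \<theta> ({k, b, hy} \<union> Q0)"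
    by (rule locs; auto)
  have HH0: "loc ({a, b, hx, hy} \<union> R) \<pi> \<theta> ({a, l, hx, k, b, hy} \<union> Q0)"
    by (rule locs; auto)
  have T0: "triv Q0 lab lab" by (rule triv0)
  have T1: "triv ({a, l, hx} \<union> Q0) lab lab" by (rule triv1) (use Q0 in \<open>auto simp: N lab\<close>)
  have T2: "triv ({k, b, hy} \<union> Q0) lab lab" by (rule triv1) (use Q0 in \<open>auto simp: N lab\<close>)
  have T: "triv ({a, l, hx, k, b, hy} \<union> Q0) lab lab" by (rule triv2) (use Q0 in \<open>auto simp: N lab\<close>)
  have II1: "leads ?Fa ({b} \<union> R) ?\<theta> Q0 lab lab" (is "_ = ?Gaa \<and> _")
    by (rule F_through[OF II0, of a]; use Q0 in \<open>auto simp: N \<theta>\<close>)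
  have II2: "?Gaa =
      3 * F R (?\<theta> \<circ> \<pi>) Q0 lab lab n
      \<and> loc R \<pi> ?\<theta> Q0" (is "_ = _ * ?Gab \<and> _")
    by (rule F_close[OF II1[THEN conjunct2], of b]; use Q0 in \<open>auto simp: N T0\<close>)
  have HI1: "leads ?Fb ({a, hx} \<union> R) ?\<theta> ({a, l, hx} \<union> Q0) lab lab" (is "_ = ?Gac \<and> _")
    by (rule F_through[OF HI0, of b]; use Q0 in \<open>auto simp: N \<theta>\<close>)
  have HI2: "?Gac =
      of_int (2 * \<epsilon>) * ?Gab
      \<and> loc R \<pi> ?\<theta> Q0"
    by (intro conjI F_resolve_bigon[OF HI1[THEN conjunct2], of a hx "R" l "Q0" "lab" "lab"]; (rule T1 | (simp add: N lab; fail) | use Q0 in \<open>auto simp: N lab\<close>))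
  have IH1: "leads ?Fc ({b, hy} \<union> R) ?\<theta> ({k, b, hy} \<union> Q0) lab lab" (is "_ = ?Gae \<and> _")
    by (rule F_through[OF IH0, of a]; use Q0 in \<open>auto simp: N \<theta>\<close>)
  have IH2: "?Gae =
      of_int (2 * \<epsilon>) * ?Gab
      \<and> loc R \<pi> ?\<theta> Q0"
    by (intro conjI F_resolve_bigon[OF IH1[THEN conjunct2], of b hy "R" k "Q0" "lab" "lab"]; (rule T2 | (simp add: N lab; fail) | use Q0 in \<open>auto simp: N lab\<close>))
  \<comment> \<open>The arc \<open>a\<close> runs from the source of \<open>x\<close> to the sink of
    \<open>y\<close>, and \<open>b\<close> from the source of \<open>y\<close> to the sink of
    \<open>x\<close>. With \<open>hx\<close> and \<open>hy\<close> they form a quadrilateral. One of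
    its resolutions is the unwanted term, the other one joins each strand to itself.\<close>
  have HH1: "?Fd =
      F ({a, b, hx, hy} \<union> R) (?\<theta> \<circ> \<pi>) ({a, l, hx, k, b, hy} \<union> Q0) lab (lab(a := y, b := x)) n
      \<and> loc ({a, b, hx, hy} \<union> R) \<pi> ?\<theta> ({a, l, hx, k, b, hy} \<union> Q0) \<and> triv ({a, l, hx, k, b, hy} \<union> Q0) lab (lab(a := y, b := x))" (is "_ = ?Gag \<and> _")
    by (rule F_reglue_triv[OF HH0, where \<sigma> = "id(a := b, b := a)" and xs = "[a, b]" and zs = "[a, l, hx, k, b, hy]"]; (rule T | (simp add: N lab \<theta>; fail) | use Q0 in \<open>auto simp: N lab \<theta>\<close>))
  have HH2: "?Gag =
      F R (?\<theta> \<circ> \<pi>) Q0 lab (lab(a := y, b := x)) n +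
      F R (id \<circ> \<pi>) Q0 lab (lab(a := y, b := x)) n" (is "_ = ?Gah + ?Gai")
      "loc R \<pi> ?\<theta> Q0" "loc R \<pi> id Q0"
    by (rule F_resolve_quad[OF HH1[THEN conjunct2, THEN conjunct1], of hx b hy a "R" l k "Q0" "[a, l, hx, k, b, hy]" "id" "lab" "(lab(a := y, b := x))"]; (rule HH1[THEN conjunct2, THEN conjunct2] | (simp add: N lab Transposition.transpose_def; fail) | use Q0 in \<open>auto simp: N lab Transposition.transpose_def\<close>))+
  have HHf: "?Gah = W ?\<theta>"
    by (rule F_lab_cong[OF HH2(2)]; use Q0 in \<open>auto simp: N lab\<close>)
  have HHg: "?Gai = W id"
    by (rule F_lab_cong[OF HH2(3)]; use Q0 in \<open>auto simp: N lab\<close>)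
  let ?E = "W ?\<theta>"
  have "?Fa = 3 * ?E" unfolding II1[THEN conjunct1] II2[THEN conjunct1] ..
  moreover have "?Fb = of_int (2 * \<epsilon>) * ?E" unfolding HI1[THEN conjunct1] HI2[THEN conjunct1] ..
  moreover have "?Fc = of_int (2 * \<epsilon>) * ?E" unfolding IH1[THEN conjunct1] IH2[THEN conjunct1] ..
  moreover have "?Fd = ?E + W id" unfolding HH1[THEN conjunct1] HH2(1) HHf HHg ..
  ultimately show ?thesis by (simp only: antiparallel_arith)
qed

end

section \<open>The triangle of the third Reidemeister move\<close>

text \<open>\<open>lb\<close> carries the crossing labels of one side of the move, while
  \<open>lab\<close> is common to both sides and agrees with it on the outer active ports. The
  results are stated with \<open>lab\<close>, so that the two sides can be compared.\<close>

locale triangle = outer +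
  fixes k l m a b c hx hy hz x y z and lb :: "'a \<Rightarrow> nat"
  assumes strands: "{k, l, m} \<subseteq> R - Q0" "distinct [k, l, m]"
    and inner: "\<And>i. i \<in> {a, b, c, hx, hy, hz} \<Longrightarrow> inner i" and dist: "distinct [a, b, c, hx, hy, hz]"
    and fresh: "{x, y, z} \<inter> lab ` Q0 = {}" "distinct [x, y, z]"
    and lb: "\<And>i. i \<in> Q0 \<Longrightarrow> lb i = lab i" and lbh: "lb hx = x" "lb hy = y" "lb hz = z"
begin

lemma D: "distinct [k, l, m, a, b, c, hx, hy, hz]" "{k, l, m, a, b, c, hx, hy, hz} \<inter> Q0 = {}"
    "{a, b, c, hx, hy, hz} \<inter> R = {}" "{k, l, m} \<subseteq> R" "distinct [x, y, z]" "{x, y, z} \<inter> lab ` Q0 = {}"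
    "\<pi> a = a" "\<pi> b = b" "\<pi> c = c" "\<pi> hx = hx" "\<pi> hy = hy" "\<pi> hz = hz" "lb hx = x" "lb hy = y" "lb hz = z"
    "distinct [hz, hy, hx, c, b, a, m, l, k]" "distinct [z, y, x]"
  using strands inner dist Q0 fresh lbh by auto

lemmas N = D[simplified] lb

lemma loc_triangle:
  assumes "A \<subseteq> {a, b, c, hx, hy, hz}" "{a, b, c} \<subseteq> A" "B \<subseteq> A \<union> {k, l, m}"
    and "set (map \<theta> [k, l, m, a, b, c]) = {k, l, m, a, b, c}"
    and "\<And>y. y \<notin> {k, l, m, a, b, c} \<Longrightarrow> \<theta> y = y"
  shows "loc (A \<union> R) \<pi> \<theta> (B \<union> Q0)"
  by (rule loc_outer[where xs = "[k, l, m, a, b, c]"])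
    (use assms inner strands in \<open>auto dest: subsetD intro: finite_subset\<close>)

text \<open>The crossings are met in the order \<open>x\<close>, \<open>y\<close>, \<open>z\<close>: \<open>k\<close> runs through \<open>x\<close>, \<open>y\<close>, then
  \<open>l\<close> through \<open>x\<close>, \<open>z\<close> and \<open>m\<close> through \<open>y\<close>, \<open>z\<close>.\<close>

lemma acyclic_sum:
  assumes lab: "lb a = x" "lb b = x" "lb k = y" "lb c = y" "lb l = z" "lb m = z"
    and \<theta>: "\<theta> = id(k := b, l := a, m := k, a := c, b := m, c := l)"
  shows "F ({a, b, c} \<union> R) (\<theta> \<circ> \<pi>) Q0 lb lb n +
    of_int (- \<epsilon>) * F ({a, b, c, hx} \<union> R) (\<theta> \<circ> \<pi>) ({a, b, hx} \<union> Q0) lb lb n +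
    of_int (- \<epsilon>) * F ({a, b, c, hy} \<union> R) (\<theta> \<circ> \<pi>) ({k, c, hy} \<union> Q0) lb lb n +
    of_int (- \<epsilon>) * F ({a, b, c, hz} \<union> R) (\<theta> \<circ> \<pi>) ({l, m, hz} \<union> Q0) lb lb n +
    of_int (\<epsilon> * \<epsilon>) * F ({a, b, c, hx, hy} \<union> R) (\<theta> \<circ> \<pi>) ({a, b, hx, k, c, hy} \<union> Q0) lb lb n +
    of_int (\<epsilon> * \<epsilon>) * F ({a, b, c, hx, hz} \<union> R) (\<theta> \<circ> \<pi>) ({a, b, hx, l, m, hz} \<union> Q0) lb lb n +
    of_int (\<epsilon> * \<epsilon>) * F ({a, b, c, hy, hz} \<union> R) (\<theta> \<circ> \<pi>) ({k, c, hy, l, m, hz} \<union> Q0) lb lb n +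
    of_int (- \<epsilon> * (\<epsilon> * \<epsilon>)) * F ({a, b, c, hx, hy, hz} \<union> R) (\<theta> \<circ> \<pi>) ({a, b, hx, k, c, hy, l, m, hz} \<union> Q0) lb lb n =
    W (id(k := m, m := k)) + of_int (- \<epsilon>) * (H (id(k := m, m := k)) l m hx x x + H (id(k := m, m := k)) k l hx x x + T (id(k := m, m := k)) k l m x x) +
    (C k l m a hx hy x y + C m l k a hx hy x y)"
    (is "?Fa + of_int (- \<epsilon>) * ?Fb + of_int (- \<epsilon>) * ?Fc + of_int (- \<epsilon>) * ?Fd + of_int (\<epsilon> * \<epsilon>) * ?Fe + of_int (\<epsilon> * \<epsilon>) * ?Ff + of_int (\<epsilon> * \<epsilon>) * ?Fg + of_int (- \<epsilon> * (\<epsilon> * \<epsilon>)) * ?Fh = _")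
proof -
  let ?\<theta> = "id(k := m, m := k)"
    and ?t = "lb(a := y, b := z, hx := y, k := z, c := z, l := x, m := x, hz := x)"
    and ?\<theta>b = "id(k := m, m := k, hx := hz, hz := hx)"
    and ?tc = "lb(a := z, b := z, hx := z, l := x, m := x, hz := x)"
  have \<theta>1: "set (map \<theta> [k, l, m, a, b, c]) = {k, l, m, a, b, c}" "\<And>y. y \<notin> {k, l, m, a, b, c} \<Longrightarrow> \<theta> y = y"
    using N unfolding \<theta> by auto
  note locs = loc_triangle[OF _ _ _ \<theta>1]
  \<comment> \<open>The three letters give the states at \<open>x\<close>, \<open>y\<close> and
    \<open>z\<close>, with \<open>I\<close> for oriented and \<open>H\<close> for
    unoriented.\<close>
  have III0: "loc ({a, b, c} \<union> R) \<pi> \<theta> Q0"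
    using locs[of "{a, b, c}" "{}"] by simp
  have HII0: "loc ({a, b, c, hx} \<union> R) \<pi> \<theta> ({a, b, hx} \<union> Q0)"
    by (rule locs; auto)
  have IHI0: "loc ({a, b, c, hy} \<union> R) \<pi> \<theta> ({k, c, hy} \<union> Q0)"
    by (rule locs; auto)
  have IIH0: "loc ({a, b, c, hz} \<union> R) \<pi> \<theta> ({l, m, hz} \<union> Q0)"
    by (rule locs; auto)
  have HHI0: "loc ({a, b, c, hx, hy} \<union> R) \<pi> \<theta> ({a, b, hx, k, c, hy} \<union> Q0)"
    by (rule locs; auto)
  have HIH0: "loc ({a, b, c, hx, hz} \<union> R) \<pi> \<theta> ({a, b, hx, l, m, hz} \<union> Q0)"
    by (rule locs; auto)
  have IHH0: "loc ({a, b, c, hy, hz} \<union> R) \<pi> \<theta> ({k, c, hy, l, m, hz} \<union> Q0)"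
    by (rule locs; auto)
  have HHH0: "loc ({a, b, c, hx, hy, hz} \<union> R) \<pi> \<theta> ({a, b, hx, k, c, hy, l, m, hz} \<union> Q0)"
    by (rule locs; auto)
  have T2: "triv ({a, b, hx, l, m, hz} \<union> Q0) lb lb" by (rule triv2) (use Q0 in \<open>auto simp: N lab\<close>)
  have T3: "triv ({a, b, hx, k, c, hy, l, m, hz} \<union> Q0) lb lb" by (rule triv3) (use Q0 in \<open>auto simp: N lab\<close>)
  have III1: "leads ?Fa ({b, c} \<union> R) (id(k := b, l := c, m := k, b := m, c := l)) Q0 lb lb" (is "_ = ?Gaa \<and> _")
    by (rule F_through[OF III0, of a]; use Q0 in \<open>auto simp: N \<theta>\<close>)
  have III2: "leads ?Gaa ({c} \<union> R) (id(k := m, l := c, m := k, c := l)) Q0 lb lb" (is "_ = ?Gab \<and> _")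
    by (rule F_through[OF III1[THEN conjunct2], of b]; use Q0 in \<open>auto simp: N\<close>)
  have III3: "leads ?Gab R ?\<theta> Q0 lb lb" (is "_ = ?Gac \<and> _")
    by (rule F_through[OF III2[THEN conjunct2], of c]; use Q0 in \<open>auto simp: N\<close>)
  have IIIf: "?Gac = W ?\<theta>"
    by (rule F_lab_cong[OF III3[THEN conjunct2]]; use Q0 in \<open>auto simp: N lab\<close>)
  have HII1: "leads ?Fb ({a, b, hx} \<union> R) (id(k := b, l := a, m := k, a := l, b := m)) ({a, b, hx} \<union> Q0) lb lb" (is "_ = ?Gad \<and> _")
    by (rule F_through[OF HII0, of c]; use Q0 in \<open>auto simp: N \<theta>\<close>)
  have HII2: "leads ?Gad ({b, hx} \<union> R) (id(k := b, m := k, b := m)) ({l, b, hx} \<union> Q0) (lb(l := x)) (lb(l := x))" (is "_ = ?Gae \<and> _")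
    by (intro conjI F_slide[OF HII1[THEN conjunct2], of a _ "{b, hx} \<union> Q0" _ l]; use Q0 in \<open>auto simp: N lab\<close>)
  have HII3: "leads ?Gae ({hx} \<union> R) ?\<theta> ({m, l, hx} \<union> Q0) (lb(l := x, m := x)) (lb(l := x, m := x))" (is "_ = ?Gaf \<and> _")
    by (intro conjI F_slide[OF HII2[THEN conjunct2], of b _ "{l, hx} \<union> Q0" _ m]; use Q0 in \<open>auto simp: N lab\<close>)
  have HIIf: "?Gaf = H ?\<theta> l m hx x x"
    by (rule F_lab_cong[OF HII3[THEN conjunct2]]; use Q0 in \<open>auto simp: N lab\<close>)
  have IHI1: "leads ?Fc ({b, c, hy} \<union> R) (id(k := b, l := c, m := k, b := m, c := l)) ({k, c, hy} \<union> Q0) lb lb" (is "_ = ?Gag \<and> _")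
    by (rule F_through[OF IHI0, of a]; use Q0 in \<open>auto simp: N \<theta>\<close>)
  have IHI2: "leads ?Gag ({c, hy} \<union> R) (id(k := m, l := c, m := k, c := l)) ({k, c, hy} \<union> Q0) lb lb" (is "_ = ?Gah \<and> _")
    by (rule F_through[OF IHI1[THEN conjunct2], of b]; use Q0 in \<open>auto simp: N\<close>)
  have IHI3: "leads ?Gah ({hy} \<union> R) ?\<theta> ({l, k, hy} \<union> Q0) (lb(l := y)) (lb(l := y))" (is "_ = ?Gai \<and> _")
    by (intro conjI F_slide[OF IHI2[THEN conjunct2], of c _ "{k, hy} \<union> Q0" _ l]; use Q0 in \<open>auto simp: N lab\<close>)
  have IHIf: "?Gai = H ?\<theta> k l hy y y"
    by (rule F_lab_cong[OF IHI3[THEN conjunct2]]; use Q0 in \<open>auto simp: N lab\<close>)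
  have IIH1: "leads ?Fd ({b, c, hz} \<union> R) (id(k := b, l := c, m := k, b := m, c := l)) ({l, m, hz} \<union> Q0) lb lb" (is "_ = ?Gaj \<and> _")
    by (rule F_through[OF IIH0, of a]; use Q0 in \<open>auto simp: N \<theta>\<close>)
  have IIH2: "leads ?Gaj ({c, hz} \<union> R) (id(k := m, l := c, m := k, c := l)) ({l, m, hz} \<union> Q0) lb lb" (is "_ = ?Gak \<and> _")
    by (rule F_through[OF IIH1[THEN conjunct2], of b]; use Q0 in \<open>auto simp: N\<close>)
  have IIH3: "leads ?Gak ({hz} \<union> R) ?\<theta> ({l, m, hz} \<union> Q0) lb lb" (is "_ = ?Gal \<and> _")
    by (rule F_through[OF IIH2[THEN conjunct2], of c]; use Q0 in \<open>auto simp: N\<close>)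
  have IIHf: "?Gal = H ?\<theta> l m hz z z"
    by (rule F_lab_cong[OF IIH3[THEN conjunct2]]; use Q0 in \<open>auto simp: N lab\<close>)
  have HHI1: "leads ?Fe ({a, c, hx, hy} \<union> R) (id(k := m, l := a, m := k, a := c, c := l)) ({m, a, hx, k, c, hy} \<union> Q0) (lb(m := x)) (lb(m := x))" (is "_ = ?Gam \<and> _")
    by (intro conjI F_slide[OF HHI0, of b _ "{a, hx, k, c, hy} \<union> Q0" _ m]; use Q0 in \<open>auto simp: N lab \<theta>\<close>)
  have HHI2: "leads ?Gam ({a, hx, hy} \<union> R) (id(k := m, l := a, m := k, a := l)) ({l, m, a, hx, k, hy} \<union> Q0) (lb(m := x, l := y)) (lb(m := x, l := y))" (is "_ = ?Gan \<and> _")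
    by (intro conjI F_slide[OF HHI1[THEN conjunct2], of c _ "{m, a, hx, k, hy} \<union> Q0" _ l]; use Q0 in \<open>auto simp: N lab\<close>)
  have HHIf: "?Gan = C k l m a hx hy x y"
    by (rule F_lab_cong[OF HHI2[THEN conjunct2]]; use Q0 in \<open>auto simp: N lab\<close>)
  have IHH1: "leads ?Fg ({b, c, hy, hz} \<union> R) (id(k := b, l := c, m := k, b := m, c := l)) ({k, c, hy, l, m, hz} \<union> Q0) lb lb" (is "_ = ?Gao \<and> _")
    by (rule F_through[OF IHH0, of a]; use Q0 in \<open>auto simp: N \<theta>\<close>)
  have IHH2: "leads ?Gao ({c, hy, hz} \<union> R) (id(k := m, l := c, m := k, c := l)) ({k, c, hy, l, m, hz} \<union> Q0) lb lb" (is "_ = ?Gap \<and> _")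
    by (rule F_through[OF IHH1[THEN conjunct2], of b]; use Q0 in \<open>auto simp: N\<close>)
  have IHHf: "?Gap = C m l k c hy hz y z"
    by (rule F_lab_cong[OF IHH2[THEN conjunct2]]; use Q0 in \<open>auto simp: N lab\<close>)
  \<comment> \<open>Once \<open>y\<close> is oriented, \<open>a\<close> runs on through
    \<open>c\<close> and ends in the sink of \<open>z\<close>, as \<open>b\<close> does. Both start
    at the source of \<open>x\<close>, so they form a bigon.\<close>
  have HIH1: "leads ?Ff ({a, b, hx, hz} \<union> R) (id(k := b, l := a, m := k, a := l, b := m)) ({a, b, hx, l, m, hz} \<union> Q0) lb lb" (is "_ = ?Gaq \<and> _")
    by (rule F_through[OF HIH0, of c]; use Q0 in \<open>auto simp: N \<theta>\<close>)
  have HIH2: "?Gaq =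
      F ({a, b, hx, hz} \<union> R) (?\<theta>b \<circ> \<pi>) ({a, b, hx, l, m, hz} \<union> Q0) lb ?tc n
      \<and> loc ({a, b, hx, hz} \<union> R) \<pi> ?\<theta>b ({a, b, hx, l, m, hz} \<union> Q0) \<and> triv ({a, b, hx, l, m, hz} \<union> Q0) lb ?tc" (is "_ = ?Gar \<and> _")
    by (rule F_reglue_triv[OF HIH1[THEN conjunct2], where \<sigma> = "id(l := a, a := l, m := b, b := m, hx := hz, hz := hx)" and xs = "[l, a, m, b, hx, hz]" and zs = "[a, b, hx, k, c, hy, l, m, hz]"]; (rule T2 | (simp add: N lab; fail) | use Q0 in \<open>auto simp: N lab\<close>))
  have HIH3: "?Gar =
      of_int (2 * \<epsilon>) * F ({hx, hz} \<union> R) (?\<theta>b \<circ> \<pi>) ({l, m, hz} \<union> Q0) lb ?tc n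
      \<and> loc ({hx, hz} \<union> R) \<pi> ?\<theta>b ({l, m, hz} \<union> Q0)" (is "_ = _ * ?Gas \<and> _")
    by (intro conjI F_resolve_bigon[OF HIH2[THEN conjunct2, THEN conjunct1], of a b "{hx, hz} \<union> R" hx "({l, m, hz} \<union> Q0)" "lb" "?tc"]; (rule HIH2[THEN conjunct2, THEN conjunct2] | (simp add: N lab; fail) | use Q0 in \<open>auto simp: N lab\<close>))
  have HIH4: "leads ?Gas ({hz} \<union> R) ?\<theta> ({l, m, hz} \<union> Q0) lb ?tc" (is "_ = ?Gat \<and> _")
    by (rule F_through[OF HIH3[THEN conjunct2], of hx]; use Q0 in \<open>auto simp: N\<close>)
  have HIHf: "?Gat = H ?\<theta> l m hz z x"
    by (rule F_lab_cong[OF HIH4[THEN conjunct2]]; use Q0 in \<open>auto simp: N lab\<close>)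
  \<comment> \<open>The arcs \<open>a\<close>, \<open>hy\<close>, \<open>c\<close>, \<open>b\<close>
    form a quadrilateral with the sources of \<open>x\<close> and \<open>y\<close> and the sinks of
    \<open>y\<close> and \<open>z\<close>. Its external ends become the ports \<open>hx\<close> and
    \<open>k\<close> after regluing. The two resolutions give the terms \<open>T\<close> and
    \<open>H\<close>.\<close>
  have HHH1: "?Fh =
      F ({a, b, c, hx, hy, hz} \<union> R) ((id(k := m, m := hx, hx := hz, hz := k)) \<circ> \<pi>) ({a, b, hx, k, c, hy, l, m, hz} \<union> Q0) lb ?t n
      \<and> loc ({a, b, c, hx, hy, hz} \<union> R) \<pi> (id(k := m, m := hx, hx := hz, hz := k)) ({a, b, hx, k, c, hy, l, m, hz} \<union> Q0) \<and> triv ({a, b, hx, k, c, hy, l, m, hz} \<union> Q0) lb ?t" (is "_ = ?Gau \<and> _")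
    by (rule F_reglue_triv[OF HHH0, where \<sigma> = "id(c := a, a := l, l := c, m := b, b := m, k := hx, hx := hz, hz := k)" and xs = "[c, a, l, m, b, k, hx, hz]" and zs = "[a, b, hx, k, c, hy, l, m, hz]"]; (rule T3 | (simp add: N lab \<theta>; fail) | use Q0 in \<open>auto simp: N lab \<theta>\<close>))
  have HHH2: "?Gau =
      F ({hx, hz} \<union> R) ((id(k := m, m := hx, hx := hz, hz := k)) \<circ> \<pi>) ({l, m, hz} \<union> Q0) lb ?t n +
      F ({hx, hz} \<union> R) (?\<theta>b \<circ> \<pi>) ({l, m, hz} \<union> Q0) lb ?t n" (is "_ = ?Gav + ?Gaw")
      "loc ({hx, hz} \<union> R) \<pi> (id(k := m, m := hx, hx := hz, hz := k)) ({l, m, hz} \<union> Q0)" "loc ({hx, hz} \<union> R) \<pi> ?\<theta>b ({l, m, hz} \<union> Q0)"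
    by (rule F_resolve_quad[OF HHH1[THEN conjunct2, THEN conjunct1], of a hy c b "{hx, hz} \<union> R" hx k "({l, m, hz} \<union> Q0)" "[a, b, hx, k, c, hy, l, m, hz]" "?\<theta>b" "lb" "?t"]; (rule HHH1[THEN conjunct2, THEN conjunct2] | (simp add: N lab Transposition.transpose_def; fail) | use Q0 in \<open>auto simp: N lab Transposition.transpose_def\<close>))+
  have HHH3: "leads ?Gav ({hz} \<union> R) (id(k := m, m := hz, hz := k)) ({l, m, hz} \<union> Q0) lb ?t" (is "_ = ?Gax \<and> _")
    by (rule F_through[OF HHH2(2), of hx]; use Q0 in \<open>auto simp: N\<close>)
  have HHH4: "leads ?Gax R ?\<theta> ({k, l, m} \<union> Q0) (lb(k := z)) (lb(a := y, b := z, hx := y, k := z, c := z, l := x, m := x, hz := x, k := x))" (is "_ = ?Gay \<and> _")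
    by (intro conjI F_slide[OF HHH3[THEN conjunct2], of hz _ "{l, m} \<union> Q0" _ k]; use Q0 in \<open>auto simp: N lab\<close>)
  have HHHf: "?Gay = T ?\<theta> k l m z x"
    by (rule F_lab_cong[OF HHH4[THEN conjunct2]]; use Q0 in \<open>auto simp: N lab\<close>)
  have HHHx1: "leads ?Gaw ({hz} \<union> R) ?\<theta> ({l, m, hz} \<union> Q0) lb ?t" (is "_ = ?Gaz \<and> _")
    by (rule F_through[OF HHH2(3), of hx]; use Q0 in \<open>auto simp: N\<close>)
  have HHHg: "?Gaz = H ?\<theta> l m hz z x"
    by (rule F_lab_cong[OF HHHx1[THEN conjunct2]]; use Q0 in \<open>auto simp: N lab\<close>)
  have loc3: "loc ({h} \<union> R) \<pi> ?\<theta> ({p, q, h} \<union> Q0)"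
    if h: "h \<in> {hx, hy, hz}" and pq: "{p, q} \<subseteq> {k, l, m}" for h p q
  proof (rule loc_outer[where xs = "[k, m]"])
    show "inner i" if "i \<in> {h}" for i by (rule inner) (use that h in auto)
  qed (use pq in \<open>auto simp: N\<close>)
  have Hi1: "H ?\<theta> p q hy y y = H ?\<theta> p q hx x x" if "{p, q} \<subseteq> {k, l, m}" for p q
    by (rule H_indep[OF loc3[OF _ that]]) (use that in \<open>auto simp: N\<close>)
  have Hi2: "H ?\<theta> p q hz z z = H ?\<theta> p q hx x x" if "{p, q} \<subseteq> {k, l, m}" for p q
    by (rule H_indep[OF loc3[OF _ that]]) (use that in \<open>auto simp: N\<close>)
  have Hi3: "H ?\<theta> p q hz z x = H ?\<theta> p q hx x x" if "{p, q} \<subseteq> {k, l, m}" for p q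
    by (rule H_indep[OF loc3[OF _ that]]) (use that in \<open>auto simp: N\<close>)
  have Hs: "H ?\<theta> k l hy y y = H ?\<theta> k l hx x x"
    "H ?\<theta> l m hz z z = H ?\<theta> l m hx x x"
    "H ?\<theta> l m hz z x = H ?\<theta> l m hx x x"
    by (rule Hi1 Hi2 Hi3; simp)+
  have loc4: "loc R \<pi> ?\<theta> ({k, l, m} \<union> Q0)"
    using loc_outer[of "{}" "{k, l, m}" "id(k := m, m := k)" "[k, m]"] insert_commute[of m k "{}"]
    by (simp add: N)
  have Ti: "T ?\<theta> k l m z x = T ?\<theta> k l m x x"
    by (rule T_indep[OF loc4]) (use Q0 in \<open>auto simp: N\<close>)
  have Ci: "C m l k c hy hz y z = C m l k a hx hy x y"
    by (rule C_indep; ((rule inner; auto; fail) | use Q0 in \<open>auto simp: N\<close>))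
  have "?Fa = W ?\<theta>"
    unfolding III1[THEN conjunct1] III2[THEN conjunct1] III3[THEN conjunct1] IIIf ..
  moreover have "?Fb = H ?\<theta> l m hx x x"
    unfolding HII1[THEN conjunct1] HII2[THEN conjunct1] HII3[THEN conjunct1] HIIf ..
  moreover have "?Fc = H ?\<theta> k l hx x x"
    unfolding IHI1[THEN conjunct1] IHI2[THEN conjunct1] IHI3[THEN conjunct1] IHIf Hs(1) ..
  moreover have "?Fd = H ?\<theta> l m hx x x"
    unfolding IIH1[THEN conjunct1] IIH2[THEN conjunct1] IIH3[THEN conjunct1] IIHf Hs(2) ..
  moreover have "?Fe = C k l m a hx hy x y"
    unfolding HHI1[THEN conjunct1] HHI2[THEN conjunct1] HHIf ..
  moreover have "?Ff = of_int (2 * \<epsilon>) * H ?\<theta> l m hx x x"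
    unfolding HIH1[THEN conjunct1] HIH2[THEN conjunct1] HIH3[THEN conjunct1] HIH4[THEN conjunct1] HIHf Hs(3) ..
  moreover have "?Fg = C m l k a hx hy x y"
    unfolding IHH1[THEN conjunct1] IHH2[THEN conjunct1] IHHf Ci ..
  moreover have "?Fh = T ?\<theta> k l m x x + H ?\<theta> l m hx x x"
    unfolding HHH1[THEN conjunct1] HHH2(1) HHH3[THEN conjunct1] HHH4[THEN conjunct1] HHHf HHHx1[THEN conjunct1] HHHg Ti Hs(3) ..
  ultimately show ?thesis by (simp only: acyclic_arith)
qed

text \<open>After the move each strand meets its crossings in reverse order, so the triangle is
  again acyclic with \<open>k\<close> and \<open>m\<close>, \<open>a\<close> and \<open>c\<close>,
  \<open>x\<close> and \<open>z\<close> exchanged. The reduced sum is insensitive to this exchange,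
  up to names of inner ports and labels.\<close>

lemma acyclic_sym:
  "W (id(k := m, m := k)) + of_int (- \<epsilon>) * (H (id(k := m, m := k)) l m hx x x +
      H (id(k := m, m := k)) k l hx x x + T (id(k := m, m := k)) k l m x x) +
    (C k l m a hx hy x y + C m l k a hx hy x y) =
   W (id(m := k, k := m)) + of_int (- \<epsilon>) * (H (id(m := k, k := m)) l k hz z z +
      H (id(m := k, k := m)) m l hz z z + T (id(m := k, k := m)) m l k z z) +
    (C m l k c hz hy z y + C k l m c hz hy z y)"
proof -
  have \<theta>: "id(m := k, k := m) = id(k := m, m := k)" using N by auto
  have loc3: "loc ({h} \<union> R) \<pi> (id(k := m, m := k)) ({p, q, h} \<union> Q0)"
    if h: "h \<in> {hx, hy, hz}" and pq: "{p, q} \<subseteq> {k, l, m}" for h p q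
  proof (rule loc_outer[where xs = "[k, m]"])
    show "inner i" if "i \<in> {h}" for i by (rule inner) (use that h in auto)
  qed (use pq in \<open>auto simp: N\<close>)
  have Hi: "H (id(k := m, m := k)) p q hz z z = H (id(k := m, m := k)) p q hx x x"
    if "{p, q} \<subseteq> {k, l, m}" for p q
    by (rule H_indep[OF loc3[OF _ that]]) (use that in \<open>auto simp: N\<close>)
  have loc4: "loc R \<pi> (id(k := m, m := k)) ({k, l, m} \<union> Q0)"
    using loc_outer[of "{}" "{k, l, m}" "id(k := m, m := k)" "[k, m]"] insert_commute[of m k "{}"]
    by (simp add: N)
  have Ti: "T (id(k := m, m := k)) k l m z z = T (id(k := m, m := k)) k l m x x"
    by (rule T_indep[OF loc4]) (use Q0 in \<open>auto simp: N\<close>)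
  have set: "{m, l, k} = {k, l, m}" by auto
  have upd: "lab(m := i, l := i, k := i) = lab(k := i, l := i, m := i)" for i by auto
  have Ci: "C m l k c hz hy z y = C m l k a hx hy x y" "C k l m c hz hy z y = C k l m a hx hy x y"
    by (rule C_indep; ((rule inner; auto; fail) | use Q0 in \<open>auto simp: N\<close>))+
  have H1: "H (id(k := m, m := k)) l k hz z z = H (id(k := m, m := k)) k l hx x x"
    unfolding H_commute[where p = l and q = k] by (rule Hi) simp
  have H2: "H (id(k := m, m := k)) m l hz z z = H (id(k := m, m := k)) l m hx x x"
    unfolding H_commute[where p = m and q = l] by (rule Hi) simp
  show ?thesis unfolding \<theta> set upd Ti Ci H1 H2 by (simp only: add_ac)
qed

text \<open>The strands run around the triangle: \<open>k\<close> from \<open>x\<close> to \<open>y\<close>, \<open>m\<close> from \<open>y\<close> to \<open>z\<close>, and \<open>l\<close> from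
  \<open>z\<close> to \<open>x\<close>.  The last summand is the hexagon, which has no resolution.\<close>

lemma cyclic_sum:
  assumes lab: "lb a = x" "lb l = x" "lb k = y" "lb c = y" "lb m = z" "lb b = z"
    and \<theta>: "\<theta> = id(k := l, l := m, m := k, a := c, b := a, c := b)"
  shows "F ({a, b, c} \<union> R) (\<theta> \<circ> \<pi>) Q0 lb lb n +
    of_int (- \<epsilon>) * F ({a, b, c, hx} \<union> R) (\<theta> \<circ> \<pi>) ({a, l, hx} \<union> Q0) lb lb n +
    of_int (- \<epsilon>) * F ({a, b, c, hy} \<union> R) (\<theta> \<circ> \<pi>) ({k, c, hy} \<union> Q0) lb lb n +
    of_int (- \<epsilon>) * F ({a, b, c, hz} \<union> R) (\<theta> \<circ> \<pi>) ({m, b, hz} \<union> Q0) lb lb n +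
    of_int (\<epsilon> * \<epsilon>) * F ({a, b, c, hx, hy} \<union> R) (\<theta> \<circ> \<pi>) ({a, l, hx, k, c, hy} \<union> Q0) lb lb n +
    of_int (\<epsilon> * \<epsilon>) * F ({a, b, c, hx, hz} \<union> R) (\<theta> \<circ> \<pi>) ({a, l, hx, m, b, hz} \<union> Q0) lb lb n +
    of_int (\<epsilon> * \<epsilon>) * F ({a, b, c, hy, hz} \<union> R) (\<theta> \<circ> \<pi>) ({k, c, hy, m, b, hz} \<union> Q0) lb lb n +
    of_int (- \<epsilon> * (\<epsilon> * \<epsilon>)) * F ({a, b, c, hx, hy, hz} \<union> R) (\<theta> \<circ> \<pi>) ({a, l, hx, k, c, hy, m, b, hz} \<union> Q0) lb lb n =
    W (id(l := m, m := l)) + W (id(k := m, m := k)) + W (id(k := l, l := k)) + of_int (- \<epsilon>) * F ({a, b, c, hx, hy, hz} \<union> R) (id(k := l, l := m, m := k, a := c, b := a, c := b) \<circ> \<pi>) ({a, l, hx, k, c, hy, m, b, hz} \<union> Q0) (lab(a := x, l := x, hx := x, k := y, c := y, hy := y, m := z, b := z, hz := z)) (lab(a := x, l := x, hx := x, k := y, c := y, hy := y, m := z, b := z, hz := z)) n"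
    (is "?Fa + of_int (- \<epsilon>) * ?Fb + of_int (- \<epsilon>) * ?Fc + of_int (- \<epsilon>) * ?Fd + of_int (\<epsilon> * \<epsilon>) * ?Fe + of_int (\<epsilon> * \<epsilon>) * ?Ff + of_int (\<epsilon> * \<epsilon>) * ?Fg + of_int (- \<epsilon> * (\<epsilon> * \<epsilon>)) * ?Fh = _")
proof -
  let ?\<theta> = "id(k := l, l := m, m := k)"
  have \<theta>1: "set (map \<theta> [k, l, m, a, b, c]) = {k, l, m, a, b, c}" "\<And>y. y \<notin> {k, l, m, a, b, c} \<Longrightarrow> \<theta> y = y"
    using N unfolding \<theta> by auto
  note locs = loc_triangle[OF _ _ _ \<theta>1]
  have III0: "loc ({a, b, c} \<union> R) \<pi> \<theta> Q0"
    using locs[of "{a, b, c}" "{}"] by simp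
  have HII0: "loc ({a, b, c, hx} \<union> R) \<pi> \<theta> ({a, l, hx} \<union> Q0)"
    by (rule locs; auto)
  have IHI0: "loc ({a, b, c, hy} \<union> R) \<pi> \<theta> ({k, c, hy} \<union> Q0)"
    by (rule locs; auto)
  have IIH0: "loc ({a, b, c, hz} \<union> R) \<pi> \<theta> ({m, b, hz} \<union> Q0)"
    by (rule locs; auto)
  have HHI0: "loc ({a, b, c, hx, hy} \<union> R) \<pi> \<theta> ({a, l, hx, k, c, hy} \<union> Q0)"
    by (rule locs; auto)
  have HIH0: "loc ({a, b, c, hx, hz} \<union> R) \<pi> \<theta> ({a, l, hx, m, b, hz} \<union> Q0)"
    by (rule locs; auto)
  have IHH0: "loc ({a, b, c, hy, hz} \<union> R) \<pi> \<theta> ({k, c, hy, m, b, hz} \<union> Q0)"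
    by (rule locs; auto)
  have HHH0: "loc ({a, b, c, hx, hy, hz} \<union> R) \<pi> \<theta> ({a, l, hx, k, c, hy, m, b, hz} \<union> Q0)"
    by (rule locs; auto)
  have eq: "{y \<in> Q0. lb y = lb i} = {y \<in> Q0. lab y = lab i}" if "i \<in> Q0" for i
    using lb that by (intro Collect_cong) auto
  have T0: "triv Q0 lb lb" using triv0 unfolding triv_def by (simp add: eq)
  have Tx: "triv ({a, l, hx} \<union> Q0) lb lb" by (rule triv1) (use Q0 in \<open>auto simp: N lab\<close>)
  have Ty: "triv ({k, c, hy} \<union> Q0) lb lb" by (rule triv1) (use Q0 in \<open>auto simp: N lab\<close>)
  have Tz: "triv ({m, b, hz} \<union> Q0) lb lb" by (rule triv1) (use Q0 in \<open>auto simp: N lab\<close>)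
  have Txy: "triv ({a, l, hx, k, c, hy} \<union> Q0) lb lb" by (rule triv2) (use Q0 in \<open>auto simp: N lab\<close>)
  have Txz: "triv ({a, l, hx, m, b, hz} \<union> Q0) lb lb" by (rule triv2) (use Q0 in \<open>auto simp: N lab\<close>)
  have Tyz: "triv ({k, c, hy, m, b, hz} \<union> Q0) lb lb" by (rule triv2) (use Q0 in \<open>auto simp: N lab\<close>)
  \<comment> \<open>The inner edges run around in a cycle. With no unoriented crossing they form a
    circle, with one they form a bigon together with its edge, and with two a quadrilateral together
    with both edges.\<close>
  have III1: "leads ?Fa ({b, c} \<union> R) (id(k := l, l := m, m := k, b := c, c := b)) Q0 lb lb" (is "_ = ?Gaa \<and> _")
    by (rule F_through[OF III0, of a]; use Q0 in \<open>auto simp: N \<theta>\<close>)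
  have III2: "leads ?Gaa ({c} \<union> R) ?\<theta> Q0 lb lb" (is "_ = ?Gab \<and> _")
    by (rule F_through[OF III1[THEN conjunct2], of b]; use Q0 in \<open>auto simp: N\<close>)
  have III3: "?Gab =
      3 * F R (?\<theta> \<circ> \<pi>) Q0 lb lb n
      \<and> loc R \<pi> ?\<theta> Q0" (is "_ = _ * ?Gac \<and> _")
    by (rule F_close[OF III2[THEN conjunct2], of c]; use Q0 in \<open>auto simp: N T0\<close>)
  have IIIf: "?Gac = W ?\<theta>"
    by (rule F_lab_cong[OF III3[THEN conjunct2]]; use Q0 in \<open>auto simp: N lab\<close>)
  have HII1: "leads ?Fb ({a, b, hx} \<union> R) (id(k := l, l := m, m := k, a := b, b := a)) ({a, l, hx} \<union> Q0) lb lb" (is "_ = ?Gad \<and> _")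
    by (rule F_through[OF HII0, of c]; use Q0 in \<open>auto simp: N \<theta>\<close>)
  have HII2: "leads ?Gad ({a, hx} \<union> R) ?\<theta> ({a, l, hx} \<union> Q0) lb lb" (is "_ = ?Gae \<and> _")
    by (rule F_through[OF HII1[THEN conjunct2], of b]; use Q0 in \<open>auto simp: N\<close>)
  have HII3: "?Gae =
      of_int (2 * \<epsilon>) * ?Gac
      \<and> loc R \<pi> ?\<theta> Q0"
    by (intro conjI F_resolve_bigon[OF HII2[THEN conjunct2], of a hx "R" l "Q0" "lb" "lb"]; (rule Tx | (simp add: N lab; fail) | use Q0 in \<open>auto simp: N lab\<close>))
  have IHI1: "leads ?Fc ({b, c, hy} \<union> R) (id(k := l, l := m, m := k, b := c, c := b)) ({k, c, hy} \<union> Q0) lb lb" (is "_ = ?Gag \<and> _")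
    by (rule F_through[OF IHI0, of a]; use Q0 in \<open>auto simp: N \<theta>\<close>)
  have IHI2: "leads ?Gag ({c, hy} \<union> R) ?\<theta> ({k, c, hy} \<union> Q0) lb lb" (is "_ = ?Gah \<and> _")
    by (rule F_through[OF IHI1[THEN conjunct2], of b]; use Q0 in \<open>auto simp: N\<close>)
  have IHI3: "?Gah =
      of_int (2 * \<epsilon>) * ?Gac
      \<and> loc R \<pi> ?\<theta> Q0"
    by (intro conjI F_resolve_bigon[OF IHI2[THEN conjunct2], of c hy "R" k "Q0" "lb" "lb"]; (rule Ty | (simp add: N lab; fail) | use Q0 in \<open>auto simp: N lab\<close>))
  have IIH1: "leads ?Fd ({b, c, hz} \<union> R) (id(k := l, l := m, m := k, b := c, c := b)) ({m, b, hz} \<union> Q0) lb lb" (is "_ = ?Gaj \<and> _")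
    by (rule F_through[OF IIH0, of a]; use Q0 in \<open>auto simp: N \<theta>\<close>)
  have IIH2: "leads ?Gaj ({b, hz} \<union> R) ?\<theta> ({m, b, hz} \<union> Q0) lb lb" (is "_ = ?Gak \<and> _")
    by (rule F_through[OF IIH1[THEN conjunct2], of c]; use Q0 in \<open>auto simp: N\<close>)
  have IIH3: "?Gak =
      of_int (2 * \<epsilon>) * ?Gac
      \<and> loc R \<pi> ?\<theta> Q0"
    by (intro conjI F_resolve_bigon[OF IIH2[THEN conjunct2], of b hz "R" m "Q0" "lb" "lb"]; (rule Tz | (simp add: N lab; fail) | use Q0 in \<open>auto simp: N lab\<close>))
  have HHI1: "leads ?Fe ({a, c, hx, hy} \<union> R) (id(k := l, l := m, m := k, a := c, c := a)) ({a, l, hx, k, c, hy} \<union> Q0) lb lb" (is "_ = ?Gam \<and> _")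
    by (rule F_through[OF HHI0, of b]; use Q0 in \<open>auto simp: N \<theta>\<close>)
  have HHI2: "?Gam =
      F ({a, c, hx, hy} \<union> R) (?\<theta> \<circ> \<pi>) ({a, l, hx, k, c, hy} \<union> Q0) lb (lb(a := y, c := x)) n
      \<and> loc ({a, c, hx, hy} \<union> R) \<pi> ?\<theta> ({a, l, hx, k, c, hy} \<union> Q0) \<and> triv ({a, l, hx, k, c, hy} \<union> Q0) lb (lb(a := y, c := x))" (is "_ = ?Gan \<and> _")
    by (rule F_reglue_triv[OF HHI1[THEN conjunct2], where \<sigma> = "id(a := c, c := a)" and xs = "[a, c]" and zs = "[a, l, hx, k, c, hy, m, b, hz]"]; (rule Txy | (simp add: N lab; fail) | use Q0 in \<open>auto simp: N lab\<close>))
  have HHI3: "?Gan =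
      F R (?\<theta> \<circ> \<pi>) Q0 lb (lb(a := y, c := x)) n +
      F R ((id(l := m, m := l)) \<circ> \<pi>) Q0 lb (lb(a := y, c := x)) n" (is "_ = ?Gao + ?Gap")
      "loc R \<pi> ?\<theta> Q0" "loc R \<pi> (id(l := m, m := l)) Q0"
    by (rule F_resolve_quad[OF HHI2[THEN conjunct2, THEN conjunct1], of hx c hy a "R" l k "Q0" "[a, l, hx, k, c, hy, m, b, hz]" "(id(l := m, m := l))" "lb" "(lb(a := y, c := x))"]; (rule HHI2[THEN conjunct2, THEN conjunct2] | (simp add: N lab Transposition.transpose_def; fail) | use Q0 in \<open>auto simp: N lab Transposition.transpose_def\<close>))+
  have HHIf: "?Gao = W ?\<theta>"
    by (rule F_lab_cong[OF HHI3(2)]; use Q0 in \<open>auto simp: N lab\<close>)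
  have HHIg: "?Gap = W (id(l := m, m := l))"
    by (rule F_lab_cong[OF HHI3(3)]; use Q0 in \<open>auto simp: N lab\<close>)
  have HIH1: "leads ?Ff ({a, b, hx, hz} \<union> R) (id(k := l, l := m, m := k, a := b, b := a)) ({a, l, hx, m, b, hz} \<union> Q0) lb lb" (is "_ = ?Gaq \<and> _")
    by (rule F_through[OF HIH0, of c]; use Q0 in \<open>auto simp: N \<theta>\<close>)
  have HIH2: "?Gaq =
      F ({a, b, hx, hz} \<union> R) (?\<theta> \<circ> \<pi>) ({a, l, hx, m, b, hz} \<union> Q0) lb (lb(a := z, b := x)) n
      \<and> loc ({a, b, hx, hz} \<union> R) \<pi> ?\<theta> ({a, l, hx, m, b, hz} \<union> Q0) \<and> triv ({a, l, hx, m, b, hz} \<union> Q0) lb (lb(a := z, b := x))" (is "_ = ?Gar \<and> _")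
    by (rule F_reglue_triv[OF HIH1[THEN conjunct2], where \<sigma> = "id(a := b, b := a)" and xs = "[a, b]" and zs = "[a, l, hx, k, c, hy, m, b, hz]"]; (rule Txz | (simp add: N lab; fail) | use Q0 in \<open>auto simp: N lab\<close>))
  have HIH3: "?Gar =
      F R (?\<theta> \<circ> \<pi>) Q0 lb (lb(a := z, b := x)) n +
      F R ((id(k := m, m := k)) \<circ> \<pi>) Q0 lb (lb(a := z, b := x)) n" (is "_ = ?Gas + ?Gat")
      "loc R \<pi> ?\<theta> Q0" "loc R \<pi> (id(k := m, m := k)) Q0"
    by (rule F_resolve_quad[OF HIH2[THEN conjunct2, THEN conjunct1], of hx b hz a "R" l m "Q0" "[a, l, hx, k, c, hy, m, b, hz]" "(id(k := m, m := k))" "lb" "(lb(a := z, b := x))"]; (rule HIH2[THEN conjunct2, THEN conjunct2] | (simp add: N lab Transposition.transpose_def; fail) | use Q0 in \<open>auto simp: N lab Transposition.transpose_def\<close>))+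
  have HIHf: "?Gas = W ?\<theta>"
    by (rule F_lab_cong[OF HIH3(2)]; use Q0 in \<open>auto simp: N lab\<close>)
  have HIHg: "?Gat = W (id(k := m, m := k))"
    by (rule F_lab_cong[OF HIH3(3)]; use Q0 in \<open>auto simp: N lab\<close>)
  have IHH1: "leads ?Fg ({b, c, hy, hz} \<union> R) (id(k := l, l := m, m := k, b := c, c := b)) ({k, c, hy, m, b, hz} \<union> Q0) lb lb" (is "_ = ?Gau \<and> _")
    by (rule F_through[OF IHH0, of a]; use Q0 in \<open>auto simp: N \<theta>\<close>)
  have IHH2: "?Gau =
      F ({b, c, hy, hz} \<union> R) (?\<theta> \<circ> \<pi>) ({k, c, hy, m, b, hz} \<union> Q0) lb (lb(c := z, b := y)) n
      \<and> loc ({b, c, hy, hz} \<union> R) \<pi> ?\<theta> ({k, c, hy, m, b, hz} \<union> Q0) \<and> triv ({k, c, hy, m, b, hz} \<union> Q0) lb (lb(c := z, b := y))" (is "_ = ?Gav \<and> _")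
    by (rule F_reglue_triv[OF IHH1[THEN conjunct2], where \<sigma> = "id(c := b, b := c)" and xs = "[c, b]" and zs = "[a, l, hx, k, c, hy, m, b, hz]"]; (rule Tyz | (simp add: N lab; fail) | use Q0 in \<open>auto simp: N lab\<close>))
  have IHH3: "?Gav =
      F R (?\<theta> \<circ> \<pi>) Q0 lb (lb(c := z, b := y)) n +
      F R ((id(k := l, l := k)) \<circ> \<pi>) Q0 lb (lb(c := z, b := y)) n" (is "_ = ?Gaw + ?Gax")
      "loc R \<pi> ?\<theta> Q0" "loc R \<pi> (id(k := l, l := k)) Q0"
    by (rule F_resolve_quad[OF IHH2[THEN conjunct2, THEN conjunct1], of hy b hz c "R" k m "Q0" "[a, l, hx, k, c, hy, m, b, hz]" "(id(k := l, l := k))" "lb" "(lb(c := z, b := y))"]; (rule IHH2[THEN conjunct2, THEN conjunct2] | (simp add: N lab Transposition.transpose_def; fail) | use Q0 in \<open>auto simp: N lab Transposition.transpose_def\<close>))+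
  have IHHf: "?Gaw = W ?\<theta>"
    by (rule F_lab_cong[OF IHH3(2)]; use Q0 in \<open>auto simp: N lab\<close>)
  have IHHg: "?Gax = W (id(k := l, l := k))"
    by (rule F_lab_cong[OF IHH3(3)]; use Q0 in \<open>auto simp: N lab\<close>)
  have "?Fa = 3 * W ?\<theta>"
    unfolding III1[THEN conjunct1] III2[THEN conjunct1] III3[THEN conjunct1] IIIf ..
  moreover have "?Fb = of_int (2 * \<epsilon>) * W ?\<theta>"
    unfolding HII1[THEN conjunct1] HII2[THEN conjunct1] HII3[THEN conjunct1] IIIf ..
  moreover have "?Fc = of_int (2 * \<epsilon>) * W ?\<theta>"
    unfolding IHI1[THEN conjunct1] IHI2[THEN conjunct1] IHI3[THEN conjunct1] IIIf ..
  moreover have "?Fd = of_int (2 * \<epsilon>) * W ?\<theta>"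
    unfolding IIH1[THEN conjunct1] IIH2[THEN conjunct1] IIH3[THEN conjunct1] IIIf ..
  moreover have "?Fe = W ?\<theta> + W (id(l := m, m := l))"
    unfolding HHI1[THEN conjunct1] HHI2[THEN conjunct1] HHI3(1) HHIf HHIg ..
  moreover have "?Ff = W ?\<theta> + W (id(k := m, m := k))"
    unfolding HIH1[THEN conjunct1] HIH2[THEN conjunct1] HIH3(1) HIHf HIHg ..
  moreover have "?Fg = W ?\<theta> + W (id(k := l, l := k))"
    unfolding IHH1[THEN conjunct1] IHH2[THEN conjunct1] IHH3(1) IHHf IHHg ..
  moreover have "?Fh = F ({a, b, c, hx, hy, hz} \<union> R) (id(k := l, l := m, m := k, a := c, b := a, c := b) \<circ> \<pi>) ({a, l, hx, k, c, hy, m, b, hz} \<union> Q0) (lab(a := x, l := x, hx := x, k := y, c := y, hy := y, m := z, b := z, hz := z)) (lab(a := x, l := x, hx := x, k := y, c := y, hy := y, m := z, b := z, hz := z)) n"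
    by (rule F_lab_cong[OF HHH0]; ((simp add: N lab \<theta>; fail) | use Q0 in \<open>auto simp: N lab \<theta>\<close>))
  ultimately show ?thesis by (simp only: cyclic_arith)
qed

text \<open>Both sides are a hexagon with the same six external ends. What is an edge between two
  crossings on one side is the edge inside a crossing on the other, so the isomorphism has to
  permute the six inner arcs and to match sources and sinks by different permutations of the
  labels.\<close>

lemma cyclic_sym:
  "F ({a, b, c, hx, hy, hz} \<union> R) (id(k := l, l := m, m := k, a := c, b := a, c := b) \<circ> \<pi>) ({a, l, hx, k, c, hy, m, b, hz} \<union> Q0) (lab(a := x, l := x, hx := x, k := y, c := y, hy := y, m := z, b := z, hz := z)) (lab(a := x, l := x, hx := x, k := y, c := y, hy := y, m := z, b := z, hz := z)) n =
   F ({a, c, b, hy, hx, hz} \<union> R) (id(k := m, m := l, l := k, a := b, c := a, b := c) \<circ> \<pi>) ({a, m, hy, k, b, hx, l, c, hz} \<union> Q0) (lab(a := y, m := y, hy := y, k := x, b := x, hx := x, l := z, c := z, hz := z)) (lab(a := y, m := y, hy := y, k := x, b := x, hx := x, l := z, c := z, hz := z)) n"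
proof -
  \<comment> \<open>\<open>?h\<close> renames the outgoing sides, \<open>?g\<close> the incoming
    ones, \<open>?u\<close> and \<open>?v\<close> the labels of sources and sinks. The external end
    attached to a vertex determines the vertex that corresponds to it: the outgoing end of
    \<open>l\<close>, for instance, leaves source \<open>x\<close> on one side and source
    \<open>z\<close> on the other.\<close>
  let ?h = "id(hx := c, b := hy, a := hz, hz := a, hy := b, c := hx)"
  let ?g = "id(c := hz, a := hy, b := hx, hx := a, hy := c, hz := b, l := m, m := k, k := l)"
  let ?P = "{a, b, c, hx, hy, hz} \<union> R" and ?Q = "{a, l, hx, k, c, hy, m, b, hz} \<union> Q0"
  let ?\<theta> = "id(k := l, l := m, m := k, a := c, b := a, c := b)"
  let ?\<theta>' = "id(k := m, m := l, l := k, a := b, c := a, b := c)"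
  let ?L = "lab(a := x, l := x, hx := x, k := y, c := y, hy := y, m := z, b := z, hz := z)"
  let ?L' = "lab(a := y, m := y, hy := y, k := x, b := x, hx := x, l := z, c := z, hz := z)"
  let ?u = "id(x := z, y := x, z := y)" and ?v = "id(x := y, y := z, z := x)"
  have loc: "loc ?P \<pi> ?\<theta> ?Q"
    by (rule loc_triangle; (simp; fail | use Q0 in \<open>auto simp: N\<close>))
  have ne: "i \<noteq> a" "i \<noteq> b" "i \<noteq> c" "i \<noteq> hx" "i \<noteq> hy" "i \<noteq> hz" if "i \<in> R" for i
    using that D(3) by auto
  have neQ: "i \<in> R" "i \<noteq> k" "i \<noteq> l" "i \<noteq> m" if "i \<in> Q0" for i using that D(2) Q0 by auto
  have lab: "lab i \<noteq> x" "lab i \<noteq> y" "lab i \<noteq> z" if "i \<in> Q0" for i using that D(6) by auto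
  have "?h ` Q0 = id ` Q0" "?g ` Q0 = id ` Q0"
    by (rule image_cong[OF refl]; use neQ ne in simp)+
  then have imQ: "?h ` Q0 = Q0" "?g ` Q0 = Q0" by simp_all
  have "?h ` R = id ` R" by (rule image_cong[OF refl]) (use ne in simp)
  then have imR: "?h ` R = R" by simp
  have "F ?P (?\<theta> \<circ> \<pi>) ?Q ?L ?L n = F ?P (?\<theta>' \<circ> \<pi>) ?Q ?L' ?L' n"
  proof (rule F_rename[where h = ?h and g = ?g and u = ?u and v = ?v, OF loc_perm[OF loc] locD(3)[OF loc]])
    have "?h ` {a, b, c, hx, hy, hz} = {a, b, c, hx, hy, hz}" using N by auto
    then show P: "?P = ?h ` ?P" unfolding image_Un imR by simp
    have "finite ?P" using finite_R by simp
    then show "inj_on ?h ?P" by (rule eq_card_imp_inj_on) (use P in simp)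
    have "?h ` {a, l, hx, k, c, hy, m, b, hz} = {a, l, hx, k, c, hy, m, b, hz}" using N by auto
    then show "?Q = ?h ` ?Q" unfolding image_Un imQ by simp
    have "?g ` {a, l, hx, k, c, hy, m, b, hz} = {a, l, hx, k, c, hy, m, b, hz}" using N by auto
    then show "?g ` ?Q = ?Q" unfolding image_Un imQ by simp
    show "(?\<theta>' \<circ> \<pi>) (?h i) = ?g ((?\<theta> \<circ> \<pi>) i)" if "i \<in> ?P" for i
      using that
    proof
      assume "i \<in> {a, b, c, hx, hy, hz}"
      then show ?thesis using N by (elim insertE emptyE) simp_all
    next
      assume i: "i \<in> R"
      then have h: "?h i = i" using ne[OF i] by simp
      have "?\<theta>' j = ?g (?\<theta> j)" if "j \<in> R" for j
        using N ne[OF that] by (cases "j = k"; cases "j = l"; cases "j = m") simp_all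
      then show ?thesis unfolding h using perm_in[OF \<pi> i] by simp
    qed
    show "?g i = ?h i" if "i \<in> ?P - ?Q" for i
    proof -
      have "i \<in> R" "i \<noteq> k" "i \<noteq> l" "i \<noteq> m" using that by auto
      then show ?thesis using ne[of i] by simp
    qed
    show "?L' (?h i) = ?u (?L i)" if "i \<in> ?Q" for i
      using that
    proof
      assume "i \<in> {a, l, hx, k, c, hy, m, b, hz}"
      then show ?thesis using N by (elim insertE emptyE) simp_all
    next
      assume i: "i \<in> Q0"
      then show ?thesis using neQ[OF i] ne[OF neQ(1)[OF i]] lab[OF i] by simp
    qed
    show "?L' (?g i) = ?v (?L i)" if "i \<in> ?Q" for i
      using that
    proof
      assume "i \<in> {a, l, hx, k, c, hy, m, b, hz}"
      then show ?thesis using N by (elim insertE emptyE) simp_all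
    next
      assume i: "i \<in> Q0"
      then show ?thesis using neQ[OF i] ne[OF neQ(1)[OF i]] lab[OF i] by simp
    qed
    have bij: "inj ?u" "inj ?v" using N unfolding inj_def by auto
    show "inj_on ?u (?L ` ?Q)" "inj_on ?v (?L ` ?Q)"
      by (rule inj_on_subset[OF _ subset_UNIV], rule bij)+
  qed
  moreover have "{a, c, b, hy, hx, hz} = {a, b, c, hx, hy, hz}"
    "{a, m, hy, k, b, hx, l, c, hz} = {a, l, hx, k, c, hy, m, b, hz}" by auto
  ultimately show ?thesis by simp
qed

end

subsection \<open>State sums of chord diagrams\<close>

lemma sum_Pow_insert:
  assumes "finite C" "x \<notin> C"
  shows "(\<Sum>S\<in>Pow (insert x C). g S) = (\<Sum>S\<in>Pow C. g S + g (insert x S))"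
proof -
  have "inj_on (insert x) (Pow C)" 
  proof (rule inj_onI)
    fix S S' assume "S \<in> Pow C" "S' \<in> Pow C" "insert x S = insert x S'"
    moreover from this have "x \<notin> S" "x \<notin> S'" using assms(2) by auto
    ultimately show "S = S'" by (metis insert_ident)
  qed
  moreover have "Pow C \<inter> insert x ` Pow C = {}" using assms(2) by blast
  ultimately show ?thesis
    unfolding Pow_insert using assms(1)
    by (simp add: sum.union_disjoint sum.reindex sum.distrib)
qed

section \<open>Pairing the two passages of each crossing\<close>

text \<open>Ports without a chord in \<open>C\<close> are fixed, so that a strand runs straight on
  through a mere mark.\<close>

definition opp :: "'p set \<Rightarrow> ('p \<Rightarrow> 'c) \<Rightarrow> 'c set \<Rightarrow> 'p \<Rightarrow> 'p" where
  "opp P lab C p = (if p \<in> P \<and> lab p \<in> C then THE q. q \<in> P \<and> q \<noteq> p \<and> lab q = lab p else p)"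

text \<open>
  The crossings \<open>C\<close> label pairs of ports in \<open>P\<close>; ports with other labels are mere marks on the
  link.
\<close>

definition chords :: "'p set \<Rightarrow> ('p \<Rightarrow> 'p) \<Rightarrow> ('p \<Rightarrow> 'c) \<Rightarrow> 'c set \<Rightarrow> bool" where
  "chords P nx lab C \<longleftrightarrow> perm P nx \<and> (\<forall>c\<in>C. card {p \<in> P. lab p = c} = 2)"

lemma chords_subset: "chords P nx lab C \<Longrightarrow> C' \<subseteq> C \<Longrightarrow> chords P nx lab C'"
  by (auto simp: chords_def)

lemma opp_eq:
  assumes "chords P nx lab C" "p \<in> P" "q \<in> P" "p \<noteq> q" "lab p = lab q" "lab p \<in> C"
  shows "opp P lab C p = q"
proof -
  have "card {r \<in> P. lab r = lab p} = 2" using assms by (simp add: chords_def)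
  moreover have "{p, q} \<subseteq> {r \<in> P. lab r = lab p}" using assms by auto
  moreover have "finite {r \<in> P. lab r = lab p}" using assms by (simp add: chords_def perm_def)
  moreover have "card {p, q} = 2" using assms(4) by simp
  ultimately have eq: "{p, q} = {r \<in> P. lab r = lab p}" by (metis card_subset_eq)
  have "(THE q. q \<in> P \<and> q \<noteq> p \<and> lab q = lab p) = q"
  proof (rule the_equality)
    show "q \<in> P \<and> q \<noteq> p \<and> lab q = lab p" using assms by simp
    fix r assume "r \<in> P \<and> r \<noteq> p \<and> lab r = lab p"
    then have "r \<in> {p, q}" unfolding eq by simp
    then show "r = q" using \<open>r \<in> P \<and> r \<noteq> p \<and> lab r = lab p\<close> by simp
  qed
  then show ?thesis using assms by (simp add: opp_def)
qed

lemma opp_partner: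
  assumes "chords P nx lab C" "p \<in> P" "lab p \<in> C"
  obtains q where "q \<in> P" "q \<noteq> p" "lab q = lab p" "opp P lab C p = q" "opp P lab C q = p"
proof -
  have "card {r \<in> P. lab r = lab p} = 2" using assms by (simp add: chords_def)
  then obtain u v where uv: "{r \<in> P. lab r = lab p} = {u, v}" "u \<noteq> v" unfolding card_2_iff by auto
  define q where "q = (if p = u then v else u)"
  have "p \<in> {u, v}" using assms(2) unfolding uv(1)[symmetric] by simp
  then have "q \<in> {u, v}" "q \<noteq> p" unfolding q_def using uv(2) by auto
  then have q: "q \<in> P" "q \<noteq> p" "lab q = lab p" unfolding uv(1)[symmetric] by auto
  then show ?thesis
    using that[OF q] opp_eq[OF assms(1,2) q(1)] opp_eq[OF assms(1) q(1) assms(2)] assms(3) by simp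
qed

lemma opp_outside: "\<not> (p \<in> P \<and> lab p \<in> C) \<Longrightarrow> opp P lab C p = p"
  by (auto simp: opp_def)

lemma opp_in: "chords P nx lab C \<Longrightarrow> p \<in> P \<Longrightarrow> opp P lab C p \<in> P"
  by (metis opp_outside opp_partner)

lemma lab_opp: "chords P nx lab C \<Longrightarrow> lab (opp P lab C p) = lab p"
  by (metis opp_outside opp_partner)

lemma opp_opp: "chords P nx lab C \<Longrightarrow> opp P lab C (opp P lab C p) = p"
  by (metis opp_outside opp_partner)

lemma perm_opp: "chords P nx lab C \<Longrightarrow> perm P (opp P lab C)"
  unfolding perm_def
  by (intro conjI bij_betw_byWitness[where f' = "opp P lab C"])
    (auto simp: opp_opp opp_in chords_def perm_def)

lemma opp_subset:
  assumes "chords P nx lab C" "C' \<subseteq> C"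
  shows "opp P lab C' p = (if lab p \<in> C - C' then p else opp P lab C p)"
  using assms(2) by (auto simp: opp_def)

lemma finite_crossings:
  assumes "chords P nx lab C"
  shows "finite C"
proof -
  have "C \<subseteq> lab ` P"
  proof
    fix c assume "c \<in> C"
    then have "{p \<in> P. lab p = c} \<noteq> {}" using assms unfolding chords_def by (metis card.empty zero_neq_numeral)
    then show "c \<in> lab ` P" by blast
  qed
  then show ?thesis using assms finite_subset unfolding chords_def perm_def by blast
qed

section \<open>The state sum and its invariance under renaming and removal of marks\<close>

context evaluation
begin

abbreviation port_lab :: "('c \<Rightarrow> nat) \<Rightarrow> ('p \<Rightarrow> 'c) \<Rightarrow> 'p + 'c \<Rightarrow> nat" where
  "port_lab \<kappa> lab \<equiv> case_sum (\<kappa> \<circ> lab) \<kappa>"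

text \<open>\<open>Inl p\<close> is a passage and the fixed port \<open>Inr c\<close> is the edge
  from source to sink at an unoriented crossing \<open>c\<close>. When \<phi> is the next passage
  followed by \<open>opp\<close>, passive ports realize the oriented states. An edge arriving at an
  unoriented crossing is recorded at the opposite passage, which does no harm because both passages
  carry the same label.\<close>

definition state ::
  "'p set \<Rightarrow> ('p \<Rightarrow> 'p) \<Rightarrow> ('p \<Rightarrow> 'c) \<Rightarrow> ('c \<Rightarrow> nat) \<Rightarrow> nat \<Rightarrow> 'c set \<Rightarrow> int mpoly" where
  "state P \<phi> lab \<kappa> n S = F (Inl ` P \<union> Inr ` S) (map_sum \<phi> id) (Inl ` {p \<in> P. lab p \<in> S} \<union> Inr ` S)
     (port_lab \<kappa> lab) (port_lab \<kappa> lab) n"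

definition B :: "'p set \<Rightarrow> ('p \<Rightarrow> 'p) \<Rightarrow> ('p \<Rightarrow> 'c) \<Rightarrow> 'c set \<Rightarrow> ('c \<Rightarrow> nat) \<Rightarrow> nat \<Rightarrow> int mpoly" where
  "B P nx lab C \<kappa> n = (\<Sum>S\<in>Pow C. of_int ((- \<epsilon>) ^ card S) * state P (opp P lab C \<circ> nx) lab \<kappa> n S)"

lemma perm_state:
  fixes P :: "'a set" and S :: "'b set"
  assumes "perm P \<phi>" "finite S"
  shows "perm (Inl ` P \<union> Inr ` S) (map_sum \<phi> id)"
proof -
  let ?m = "map_sum \<phi> (id :: 'b \<Rightarrow> 'b)" and ?P = "Inl ` P \<union> Inr ` S :: ('a + 'b) set"
  have "inj_on ?m ?P"
    by (rule inj_onI, elim UnE imageE) (simp_all add: perm_inj[OF assms(1)])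
  moreover have "?m ` Inl ` P = Inl ` \<phi> ` P" "?m ` Inr ` S = Inr ` S"
    by (simp_all add: image_image)
  moreover have "\<phi> ` P = P" using assms(1) by (simp add: perm_def bij_betw_def)
  ultimately have "bij_betw ?m ?P ?P" unfolding bij_betw_def by (simp only: image_Un simp_thms)
  then show ?thesis using perm_finite[OF assms(1)] assms(2) by (simp add: perm_def)
qed

lemma triv_state:
  assumes "chords P nx lab C" "S \<subseteq> C" "inj_on \<kappa> C"
  shows "triv (Inl ` {p \<in> P. lab p \<in> S} \<union> Inr ` S) (port_lab \<kappa> lab) (port_lab \<kappa> lab)"
proof -
  let ?Q = "Inl ` {p \<in> P. lab p \<in> S} \<union> Inr ` S"
  have fin: "finite P" "finite S"
    using assms finite_crossings finite_subset unfolding chords_def perm_def by blast+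
  have card: "card {i \<in> ?Q. port_lab \<kappa> lab i = \<kappa> c} = 3" if c: "c \<in> S" for c
  proof -
    have \<kappa>: "\<kappa> d = \<kappa> c \<longleftrightarrow> d = c" if "d \<in> S" for d
      using inj_on_eq_iff[OF assms(3)] c that assms(2) by blast
    have "{i \<in> ?Q. port_lab \<kappa> lab i = \<kappa> c} = insert (Inr c) (Inl ` {p \<in> P. lab p = c})"
      using c \<kappa> by auto
    moreover have "card (Inl ` {p \<in> P. lab p = c} :: ('a + 'b) set) = 2"
      using assms(1,2) c by (subst card_image) (auto simp: chords_def)
    ultimately show ?thesis using fin by (simp add: image_iff)
  qed
  have "\<exists>c \<in> S. port_lab \<kappa> lab i = \<kappa> c" if "i \<in> ?Q" for i using that by auto
  then show ?thesis unfolding triv_def using card fin by fastforce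
qed

lemma state_cong:
  assumes "perm P \<phi>" "finite S" "\<And>p. p \<in> P \<Longrightarrow> \<phi>' p = \<phi> p" "\<And>p. p \<in> P \<Longrightarrow> lab' p \<in> S \<longleftrightarrow> lab p \<in> S"
    and "\<And>p. p \<in> P \<Longrightarrow> lab p \<in> S \<Longrightarrow> lab' p = lab p"
  shows "state P \<phi> lab \<kappa> n S = state P \<phi>' lab' \<kappa> n S"
proof -
  have "{p \<in> P. lab' p \<in> S} = {p \<in> P. lab p \<in> S}" using assms(4) by blast
  then show ?thesis
    unfolding state_def
    by (simp only:, intro F_cong perm_state assms(1,2)) (use assms(3,5) in auto)
qed

text \<open>Only the successor map and the pairing of passages enter the state sum. The assumption
  \<open>out\<close> keeps mere marks from turning into passages.\<close>

lemma B_rename: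
  assumes ch: "chords P nx lab C" and g: "inj_on g P" "P' = g ` P" and nx': "\<And>p. p \<in> P \<Longrightarrow> nx' (g p) = g (nx p)"
    and h: "inj_on h C" "C' = h ` C" and lab': "\<And>p. p \<in> P \<Longrightarrow> lab p \<in> C \<Longrightarrow> lab' (g p) = h (lab p)"
    and out: "\<And>p. p \<in> P \<Longrightarrow> lab p \<notin> C \<Longrightarrow> lab' (g p) \<notin> C'"
    and \<kappa>: "inj_on \<kappa> C" "inj_on \<kappa>' C'"
  shows "B P nx lab C \<kappa> n = B P' nx' lab' C' \<kappa>' n"
proof -
  have perm: "perm P nx" using ch by (simp add: chords_def)
  have lab_iff: "lab' (g p) \<in> h ` S \<longleftrightarrow> lab p \<in> S" if "p \<in> P" "S \<subseteq> C" for p S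
  proof (cases "lab p \<in> C")
    case True
    then show ?thesis using lab'[OF that(1) True] inj_on_image_mem_iff[OF h(1) True that(2)] by simp
  next
    case False
    then show ?thesis using out[OF that(1) False] that(2) h(2) by blast
  qed
  have labs: "{p' \<in> P'. lab' p' = h c} = g ` {p \<in> P. lab p = c}" if "c \<in> C" for c
    using lab_iff[of _ "{c}"] that unfolding g(2) by auto
  have perm': "perm P' nx'" unfolding g(2) by (rule perm_conj[OF perm g(1) nx'])
  have ch': "chords P' nx' lab' C'"
    unfolding chords_def h(2)
  proof (intro conjI ballI perm')
    fix c' assume "c' \<in> h ` C"
    then obtain c where c: "c \<in> C" "c' = h c" by blast
    have "card (g ` {p \<in> P. lab p = c}) = card {p \<in> P. lab p = c}"
      by (rule card_image[OF inj_on_subset[OF g(1)]]) blast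
    then show "card {p \<in> P'. lab' p = c'} = 2" using ch c unfolding c(2) labs[OF c(1)] chords_def by simp
  qed
  have opp: "opp P' lab' C' (g p) = g (opp P lab C p)" if p: "p \<in> P" for p
  proof (cases "lab p \<in> C")
    case True
    then obtain q where q: "q \<in> P" "q \<noteq> p" "lab q = lab p" "opp P lab C p = q"
      using opp_partner[OF ch p True] by metis
    have "g p \<noteq> g q" using inj_on_eq_iff[OF g(1) p q(1)] q(2) by simp
    moreover have "lab' (g p) = h (lab p)" "lab' (g q) = h (lab p)" using lab' p q True by metis+
    ultimately show ?thesis unfolding q(4)
      by (intro opp_eq[OF ch']) (use p q True g(2) h(2) in auto)
  next
    case False
    then show ?thesis using out[OF p False] by (simp add: opp_outside)
  qed
  have st: "state P (opp P lab C \<circ> nx) lab \<kappa> n S = state P' (opp P' lab' C' \<circ> nx') lab' \<kappa>' n (h ` S)"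
    if S: "S \<subseteq> C" for S
    unfolding state_def
  \<comment> \<open>A vertex label is decoded to its crossing, moved by \<open>h\<close> and encoded
    again by \<open>\<kappa>'\<close>.\<close>
  proof (rule F_rename[where h = "map_sum g h" and g = "map_sum g h" and u = "\<kappa>' \<circ> h \<circ> inv_into C \<kappa>"
        and v = "\<kappa>' \<circ> h \<circ> inv_into C \<kappa>"])
    have fin: "finite S" using finite_crossings[OF ch] S finite_subset by blast
    show "perm (Inl ` P \<union> Inr ` S) (map_sum (opp P lab C \<circ> nx) id)"
      by (rule perm_state[OF perm_comp[OF perm perm_opp[OF ch]] fin])
    show "inj_on (map_sum g h) (Inl ` P \<union> Inr ` S)"
      by (rule inj_onI, elim UnE imageE)
        (simp_all add: inj_on_eq_iff[OF g(1)] inj_on_eq_iff[OF inj_on_subset[OF h(1) S]])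
    show "Inl ` P' \<union> Inr ` h ` S = map_sum g h ` (Inl ` P \<union> Inr ` S)"
      unfolding g(2) by (simp add: image_Un image_image)
    have "{p \<in> P'. lab' p \<in> h ` S} = g ` {p \<in> P. lab p \<in> S}"
      unfolding g(2) using lab_iff[OF _ S] by auto
    then show eq: "Inl ` {p \<in> P'. lab' p \<in> h ` S} \<union> Inr ` h ` S =
        map_sum g h ` (Inl ` {p \<in> P. lab p \<in> S} \<union> Inr ` S)"
      by (simp add: image_Un image_image)
    then show "map_sum g h ` (Inl ` {p \<in> P. lab p \<in> S} \<union> Inr ` S) =
        Inl ` {p \<in> P'. lab' p \<in> h ` S} \<union> Inr ` h ` S" by simp
    show "map_sum (opp P' lab' C' \<circ> nx') id (map_sum g h i) = map_sum g h (map_sum (opp P lab C \<circ> nx) id i)"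
      if "i \<in> Inl ` P \<union> Inr ` S" for i
      using that by (elim UnE imageE) (simp_all add: nx' opp perm_in[OF perm])
    have inv: "inv_into C \<kappa> (\<kappa> c) = c" if "c \<in> S" for c
      using inv_into_f_f[OF \<kappa>(1)] that S by blast
    have lab_S: "lab' (g p) = h (lab p)" if "p \<in> P" "lab p \<in> S" for p
      using lab' that S by blast
    show "port_lab \<kappa>' lab' (map_sum g h i) = (\<kappa>' \<circ> h \<circ> inv_into C \<kappa>) (port_lab \<kappa> lab i)"
      if "i \<in> Inl ` {p \<in> P. lab p \<in> S} \<union> Inr ` S" for i
      using that by (elim UnE imageE CollectE conjE) (simp_all add: inv lab_S)
    then show "port_lab \<kappa>' lab' (map_sum g h i) = (\<kappa>' \<circ> h \<circ> inv_into C \<kappa>) (port_lab \<kappa> lab i)"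
      if "i \<in> Inl ` {p \<in> P. lab p \<in> S} \<union> Inr ` S" for i using that .
    have "port_lab \<kappa> lab ` (Inl ` {p \<in> P. lab p \<in> S} \<union> Inr ` S) \<subseteq> \<kappa> ` S" by auto
    moreover have "inj_on (\<kappa>' \<circ> h \<circ> inv_into C \<kappa>) (\<kappa> ` S)"
    proof (rule inj_onI, elim imageE)
      fix i j c d assume "(\<kappa>' \<circ> h \<circ> inv_into C \<kappa>) i = (\<kappa>' \<circ> h \<circ> inv_into C \<kappa>) j"
        and i: "i = \<kappa> c" "c \<in> S" and j: "j = \<kappa> d" "d \<in> S"
      then have "\<kappa>' (h c) = \<kappa>' (h d)" by (simp add: inv)
      then have "h c = h d" using inj_on_eq_iff[OF \<kappa>(2)] i(2) j(2) S h(2) by blast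
      then show "i = j" using inj_on_eq_iff[OF h(1)] i j S by blast
    qed
    ultimately show "inj_on (\<kappa>' \<circ> h \<circ> inv_into C \<kappa>) (port_lab \<kappa> lab ` (Inl ` {p \<in> P. lab p \<in> S} \<union> Inr ` S))"
      by (rule inj_on_subset[rotated])
    then show "inj_on (\<kappa>' \<circ> h \<circ> inv_into C \<kappa>) (port_lab \<kappa> lab ` (Inl ` {p \<in> P. lab p \<in> S} \<union> Inr ` S))" .
  qed auto
  have "inj_on (image h) (Pow C)" by (rule inj_on_image_Pow[OF h(1)])
  moreover have "Pow C' = image h ` Pow C" unfolding h(2) by (rule image_Pow_surj[OF refl, symmetric])
  ultimately have "B P' nx' lab' C' \<kappa>' n =
      (\<Sum>S\<in>Pow C. of_int ((- \<epsilon>) ^ card (h ` S)) * state P' (opp P' lab' C' \<circ> nx') lab' \<kappa>' n (h ` S))"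
    unfolding B_def by (simp add: sum.reindex)
  also have "\<dots> = B P nx lab C \<kappa> n"
    unfolding B_def
  proof (rule sum.cong[OF refl])
    fix S assume "S \<in> Pow C"
    then have S: "S \<subseteq> C" by simp
    then have "card (h ` S) = card S" by (intro card_image inj_on_subset[OF h(1)])
    then show "of_int ((- \<epsilon>) ^ card (h ` S)) * state P' (opp P' lab' C' \<circ> nx') lab' \<kappa>' n (h ` S) =
        of_int ((- \<epsilon>) ^ card S) * state P (opp P lab C \<circ> nx) lab \<kappa> n S"
      by (simp add: st[OF S])
  qed
  finally show ?thesis ..
qed

lemma state_skip:
  fixes P :: "'p set" and lab :: "'p \<Rightarrow> 'c"
  assumes "perm P \<phi>" "finite S" "a \<in> P" "lab a \<notin> S"
  shows "state P \<phi> lab \<kappa> n S = state (P - {a}) (swap a (\<phi> a) \<circ> \<phi>) lab \<kappa> (n + (if \<phi> a = a then 1 else 0)) S"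
proof -
  let ?P = "Inl ` P \<union> Inr ` S :: ('p + 'c) set" and ?\<phi> = "map_sum \<phi> id :: 'p + 'c \<Rightarrow> 'p + 'c"
    and ?Q = "Inl ` {p \<in> P. lab p \<in> S} \<union> Inr ` S :: ('p + 'c) set"
  have p: "perm ?P ?\<phi>" by (rule perm_state[OF assms(1,2)])
  have mem: "Inl a \<in> ?P - ?Q" using assms(3,4) by auto
  have sets: "?P - {Inl a} = Inl ` (P - {a}) \<union> Inr ` S" "?Q = Inl ` {p \<in> P - {a}. lab p \<in> S} \<union> Inr ` S"
    using assms(4) by auto
  have "state P \<phi> lab \<kappa> n S = F (?P - {Inl a}) (swap (Inl a) (?\<phi> (Inl a)) \<circ> ?\<phi>) ?Q
      (port_lab \<kappa> lab) (port_lab \<kappa> lab) (n + (if ?\<phi> (Inl a) = Inl a then 1 else 0))"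
    unfolding state_def by (rule F_skip[OF p _ mem]) auto
  also have "\<dots> = F (?P - {Inl a}) (map_sum (swap a (\<phi> a) \<circ> \<phi>) id) ?Q
      (port_lab \<kappa> lab) (port_lab \<kappa> lab) (n + (if ?\<phi> (Inl a) = Inl a then 1 else 0))"
  proof (rule F_cong)
    show "perm (?P - {Inl a}) (swap (Inl a) (?\<phi> (Inl a)) \<circ> ?\<phi>)" by (rule perm_skip[OF p]) (use assms(3) in simp)
    show "?Q \<subseteq> ?P - {Inl a}" using assms(4) by auto
    show "map_sum (swap a (\<phi> a) \<circ> \<phi>) id i = (swap (Inl a) (?\<phi> (Inl a)) \<circ> ?\<phi>) i" for i
      by (cases i) (auto simp: Transposition.transpose_def)
  qed simp_all
  finally show ?thesis unfolding sets state_def by simp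
qed

lemma opp_skip:
  assumes "a \<in> P" "lab a \<notin> C"
  shows "opp (P - {a}) lab C p = opp P lab C p"
proof (cases "p \<in> P \<and> lab p \<in> C")
  case True
  have "(q \<in> P - {a} \<and> q \<noteq> p \<and> lab q = lab p) = (q \<in> P \<and> q \<noteq> p \<and> lab q = lab p)" for q
    using True assms(2) by auto
  then show ?thesis unfolding opp_def using assms(2) by auto
qed (auto simp: opp_outside)

text \<open>A mark is a passive port in every state, so it can be skipped in all of them at once. If
  it was its own successor, what remains of it is a free circle counted by \<open>n\<close>.\<close>

lemma B_skip:
  assumes ch: "chords P nx lab C" and a: "a \<in> P" "lab a \<notin> C"
    and nx': "\<And>p. p \<in> P - {a} \<Longrightarrow> nx' p = (if nx p = a then nx a else nx p)"
  shows "B P nx lab C \<kappa> n = B (P - {a}) nx' lab C \<kappa> (if nx a = a then Suc n else n)"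
    and "chords (P - {a}) nx' lab C"
proof -
  have P: "perm P nx" using ch by (simp add: chords_def)
  have "nx p \<noteq> nx a" if "p \<in> P - {a}" for p using perm_inj[OF P] that a(1) by auto
  then have eq: "nx' p = (swap a (nx a) \<circ> nx) p" if "p \<in> P - {a}" for p
    using nx'[OF that] that by (simp add: Transposition.transpose_def)
  have P': "perm (P - {a}) nx'" by (rule perm_cong[OF perm_skip[OF P a(1)]]) (simp add: eq)
  have "{p \<in> P - {a}. lab p = c} = {p \<in> P. lab p = c}" if "c \<in> C" for c using a(2) that by auto
  then show ch': "chords (P - {a}) nx' lab C" using ch P' by (simp add: chords_def)
  let ?o = "opp P lab C"
  have oa: "?o a = a" by (rule opp_outside) (use a in simp)
  have o_a: "?o p = a \<longleftrightarrow> p = a" for p using opp_opp[OF ch, of p] oa by metis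
  show "B P nx lab C \<kappa> n = B (P - {a}) nx' lab C \<kappa> (if nx a = a then Suc n else n)"
    unfolding B_def
  proof (rule sum.cong[OF refl])
    fix S assume "S \<in> Pow C"
    then have S: "S \<subseteq> C" "finite S" using finite_crossings[OF ch] finite_subset by auto
    have p: "perm P (?o \<circ> nx)" by (rule perm_comp[OF P perm_opp[OF ch]])
    have "state P (?o \<circ> nx) lab \<kappa> n S = state (P - {a}) (swap a ((?o \<circ> nx) a) \<circ> (?o \<circ> nx)) lab \<kappa>
        (n + (if (?o \<circ> nx) a = a then 1 else 0)) S"
      by (rule state_skip[OF p S(2) a(1)]) (use a S in blast)
    also have "\<dots> = state (P - {a}) (opp (P - {a}) lab C \<circ> nx') lab \<kappa> (n + (if (?o \<circ> nx) a = a then 1 else 0)) S"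
    proof (rule state_cong[OF perm_skip[OF p a(1)] S(2)])
      fix x assume x: "x \<in> P - {a}"
      have ne: "?o (nx x) \<noteq> ?o (nx a)" using perm_inj[OF p, of x a] x a by simp
      show "(opp (P - {a}) lab C \<circ> nx') x = (swap a ((?o \<circ> nx) a) \<circ> (?o \<circ> nx)) x"
        using ne o_a[of "nx x"] nx'[OF x] by (simp add: opp_skip[of a P lab C, OF a] Transposition.transpose_def)
    qed auto
    finally show "of_int ((- \<epsilon>) ^ card S) * state P (?o \<circ> nx) lab \<kappa> n S =
        of_int ((- \<epsilon>) ^ card S) * state (P - {a}) (opp (P - {a}) lab C \<circ> nx') lab \<kappa> (if nx a = a then Suc n else n) S"
      by (simp add: o_a)
  qed
qed

end

section \<open>Separating the crossings of a move from the rest of a state\<close>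

lemma chord_set:
  assumes "chords P nx lab C" "c \<in> C" "u \<in> P" "v \<in> P" "u \<noteq> v" "lab u = c" "lab v = c"
  shows "{p \<in> P. lab p = c} = {u, v}"
proof (rule sym, rule card_subset_eq)
  show "finite {p \<in> P. lab p = c}" using assms(1) by (simp add: chords_def perm_def)
  show "card {u, v} = card {p \<in> P. lab p = c}" using assms by (simp add: chords_def)
qed (use assms in auto)

text \<open>
  The map \<open>\<sigma>\<close> cuts the inner edges of a move, and \<open>\<theta>\<close> continues every incoming side as the
  oriented states of the crossings in \<open>C - C0\<close> do.
\<close>

lemma reglue_crossings:
  fixes P :: "'p set" and lab :: "'p \<Rightarrow> 'c" and \<theta> :: "'p + 'c \<Rightarrow> 'p + 'c"
  assumes ch: "chords P nx lab C" and C0: "C0 \<subseteq> C" and L: "{p \<in> P. lab p \<in> C - C0} = L" and r: "r \<in> P"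
    and \<theta>: "\<And>p. p \<notin> L \<Longrightarrow> \<theta> (Inl p) = Inl p" and \<sigma>: "\<And>p. p \<notin> L \<Longrightarrow> \<sigma> p = p"
    and local: "\<And>p. p \<in> L \<Longrightarrow> \<theta> (Inl (\<sigma> p)) = Inl (opp P lab C p)"
  shows "\<theta> (Inl (\<sigma> (opp P lab C0 r))) = Inl (opp P lab C r)"
proof (cases "lab r \<in> C - C0")
  case True
  then have "r \<in> L" using r L by blast
  then show ?thesis using local True opp_subset[OF ch C0, of r] by simp
next
  case False
  have "lab (opp P lab C r) = lab r" by (rule lab_opp[OF ch])
  then have n: "opp P lab C r \<notin> L" using False unfolding L[symmetric] by simp
  have q: "opp P lab C0 r = opp P lab C r" by (simp only: opp_subset[OF ch C0] False if_False)
  show ?thesis unfolding q \<sigma>[OF n] by (rule \<theta>[OF n])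
qed

context evaluation
begin

lemma outer_state:
  assumes ch: "chords P nx lab C" and \<kappa>: "inj_on \<kappa> C" and S: "S \<subseteq> C'" and C': "C' \<subseteq> C"
    and A: "A \<subseteq> P" "\<And>p. p \<in> A \<Longrightarrow> lab p \<notin> C'"
    and \<tau>: "perm P \<tau>" "\<And>p. p \<in> A \<Longrightarrow> \<tau> p = p"
  shows "outer f \<epsilon> (Inl ` (P - A) \<union> Inr ` S) (map_sum \<tau> id)
    (Inl ` {p \<in> P. lab p \<in> S} \<union> Inr ` S) (port_lab \<kappa> lab)"
proof (unfold_locales)
  have fin: "finite S"
    by (rule finite_subset[OF subset_trans[OF S C'] finite_crossings[OF ch]])
  have "perm (P - A) \<tau>" by (rule perm_Diff_fixed[OF \<tau>(1) A(1) \<tau>(2)])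
  then show "perm (Inl ` (P - A) \<union> Inr ` S) (map_sum \<tau> id)" by (rule perm_state[OF _ fin])
  show "Inl ` {p \<in> P. lab p \<in> S} \<union> Inr ` S \<subseteq> Inl ` (P - A) \<union> Inr ` S"
    using A(2) S by auto
  show "triv (Inl ` {p \<in> P. lab p \<in> S} \<union> Inr ` S) (port_lab \<kappa> lab) (port_lab \<kappa> lab)"
    by (rule triv_state[OF ch subset_trans[OF S C'] \<kappa>])
qed

lemma weight_insert:
  assumes "finite S" "x \<notin> S"
  shows "of_int ((- \<epsilon>) ^ card (insert x S)) = (of_int (- \<epsilon>) * of_int ((- \<epsilon>) ^ card S) :: int mpoly)"
  by (simp only: card_insert_disjoint[OF assms] power_Suc of_int_mult)

text \<open>The states of the inner crossings differ only in active ports and in the edges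
  \<open>Inr c\<close>, so one outer map \<open>\<tau>\<close> and one inner map \<theta> serve for
  all of them. The outer pairing may come from another labelling \<open>labo\<close>, so that both
  diagrams of a third move can be written with the same \<open>\<tau>\<close>.\<close>

lemma pattern_state:
  assumes ch: "chords P nx lab C" and S: "S \<subseteq> C"
    and \<theta>: "\<And>r. r \<in> P \<Longrightarrow> \<theta> (Inl (\<sigma> (opp P labo Co r))) = Inl (opp P lab C r)" "\<And>c. \<theta> (Inr c) = Inr c"
    and \<tau>: "\<And>p. \<tau> p = \<sigma> (opp P labo Co (nx p))"
    and Po: "Po = Inl ` P \<union> Inr ` S" and Qo: "Qo = Inl ` {p \<in> P. lab p \<in> S} \<union> Inr ` S"
  shows "state P (opp P lab C \<circ> nx) lab \<kappa> n S = F Po (\<theta> \<circ> map_sum \<tau> id) Qo (port_lab \<kappa> lab) (port_lab \<kappa> lab) n"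
  unfolding state_def Po Qo
proof (rule F_cong)
  have perm: "perm P nx" using ch by (simp add: chords_def)
  show "perm (Inl ` P \<union> Inr ` S) (map_sum (opp P lab C \<circ> nx) id)"
    by (rule perm_state[OF perm_comp[OF perm perm_opp[OF ch]] finite_subset[OF S finite_crossings[OF ch]]])
  show "(\<theta> \<circ> map_sum \<tau> id) i = map_sum (opp P lab C \<circ> nx) id i" if "i \<in> Inl ` P \<union> Inr ` S" for i
    using that by (elim UnE imageE) (simp_all add: \<tau> \<theta> perm_in[OF perm])
qed auto

lemma fresh_label:
  assumes "inj_on \<kappa> C" "x \<in> C" "S \<subseteq> C" "x \<notin> S"
  shows "\<kappa> x \<notin> port_lab \<kappa> lab ` (Inl ` {p \<in> P. lab p \<in> S} \<union> Inr ` S)"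
proof
  assume "\<kappa> x \<in> port_lab \<kappa> lab ` (Inl ` {p \<in> P. lab p \<in> S} \<union> Inr ` S)"
  then obtain c where "c \<in> S" "\<kappa> x = \<kappa> c" by auto
  then have "x = c" using inj_on_eq_iff[OF assms(1,2), of c] assms(3) by blast
  with \<open>c \<in> S\<close> assms(4) show False by simp
qed

section \<open>The first and the second move on chord diagrams\<close>

text \<open>For every fixed state of the other crossings, the two states at \<open>x\<close> add up
  by \<open>kink_sum\<close> to the state in which \<open>x\<close> is no longer a crossing.\<close>

lemma B_R1:
  assumes ch: "chords P nx lab (insert x C)" and \<kappa>: "inj_on \<kappa> (insert x C)" and x: "x \<notin> C"
    and ak: "a \<in> P" "k \<in> P" "a \<noteq> k" "lab a = x" "lab k = x" and nx: "nx a = k"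
  shows "B P nx lab (insert x C) \<kappa> n = B P nx lab C \<kappa> n"
proof -
  let ?o = "opp P lab (insert x C)" and ?q = "opp P lab C"
  have perm: "perm P nx" using ch by (simp add: chords_def)
  have sub: "C \<subseteq> insert x C" by blast
  have ch0: "chords P nx lab C" by (rule chords_subset[OF ch sub])
  have fin: "finite C" by (rule finite_crossings[OF ch0])
  have o: "?o a = k" "?o k = a" by (rule opp_eq[OF ch]; simp add: ak not_sym[OF ak(3)])+
  have X: "{p \<in> P. lab p = x} = {a, k}" by (rule chord_set[OF ch]) (simp_all add: ak)
  then have L: "{p \<in> P. lab p \<in> insert x C - C} = {a, k}" using x by auto
  have q: "?q k = k" by (rule opp_outside) (simp add: ak x)
  \<comment> \<open>The transposition cuts the edge from \<open>a\<close> to its successor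
    \<open>k\<close>: it makes \<open>a\<close> a fixed port, as required of inner ports.\<close>
  define \<tau> where "\<tau> = swap a k \<circ> (?q \<circ> nx)"
  have p0: "perm P (?q \<circ> nx)" by (rule perm_comp[OF perm perm_opp[OF ch0]])
  have p\<tau>: "perm P \<tau>" unfolding \<tau>_def by (rule perm_swap[OF p0 ak(1,2)])
  have \<tau>a: "\<tau> a = a" by (simp add: \<tau>_def nx q)
  have \<theta>: "id (Inl (swap a k (?q r))) = (Inl (?o r) :: 'a + 'b)" if "r \<in> P" for r
    by (rule reglue_crossings[OF ch sub L that]) (auto simp: o Transposition.transpose_def)
  have step: "state P (?o \<circ> nx) lab \<kappa> n S + of_int (- \<epsilon>) * state P (?o \<circ> nx) lab \<kappa> n (insert x S) =
      state P (?q \<circ> nx) lab \<kappa> n S" if S: "S \<subseteq> C" for S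
  proof -
    have finS: "finite S" by (rule finite_subset[OF S fin])
    have xS: "x \<notin> S" using x S by blast
    have S': "S \<subseteq> insert x C" "insert x S \<subseteq> insert x C" using S by auto
    let ?R = "Inl ` (P - {a}) \<union> Inr ` S :: ('a + 'b) set" and ?Q = "Inl ` {p \<in> P. lab p \<in> S} \<union> Inr ` S :: ('a + 'b) set"
    interpret outer f \<epsilon> ?R "map_sum \<tau> id" ?Q "port_lab \<kappa> lab" n
      by (rule outer_state[OF ch \<kappa> S sub]; simp add: ak x p\<tau> \<tau>a)
    interpret kink f \<epsilon> ?R "map_sum \<tau> id" ?Q "port_lab \<kappa> lab" n "Inl k" "Inl a" "Inr x" "\<kappa> x"
    proof
      show "\<kappa> x \<notin> port_lab \<kappa> lab ` ?Q" by (rule fresh_label[OF \<kappa> _ S'(1) xS]) simp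
    qed (use ak xS \<tau>a in auto)
    have R: "insert (Inl a) ?R = Inl ` P \<union> Inr ` S" using ak by auto
    have one: "state P (?o \<circ> nx) lab \<kappa> n S = F (insert (Inl a) ?R) (id \<circ> map_sum \<tau> id) ?Q
        (port_lab \<kappa> lab) (port_lab \<kappa> lab) n"
      by (rule pattern_state[where \<theta>=id and \<sigma>="swap a k" and labo=lab and Co=C and \<tau>=\<tau> and \<kappa>=\<kappa> and n=n, OF ch S'(1) \<theta>]) (simp_all only: R \<tau>_def o_apply id_apply)
    have "{p \<in> P. lab p \<in> insert x S} = insert a (insert k {p \<in> P. lab p \<in> S})" using X by auto
    then have two: "state P (?o \<circ> nx) lab \<kappa> n (insert x S) = F (insert (Inr x) (insert (Inl a) ?R)) (id \<circ> map_sum \<tau> id)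
        (insert (Inl a) (insert (Inr x) (insert (Inl k) ?Q))) (port_lab \<kappa> lab) (port_lab \<kappa> lab) n"
      by (intro pattern_state[where \<theta>=id and \<sigma>="swap a k" and labo=lab and Co=C and \<tau>=\<tau> and \<kappa>=\<kappa> and n=n, OF ch S'(2) \<theta>]) (auto simp: \<tau>_def ak(1))
    have k0: "(?q \<circ> nx) a = k" by (simp add: nx q)
    have "state P (?q \<circ> nx) lab \<kappa> n S = state (P - {a}) \<tau> lab \<kappa> n S"
      using state_skip[where lab=lab and a=a and \<kappa>=\<kappa> and n=n, OF p0 finS ak(1)] ak(3,4) xS unfolding k0 \<tau>_def by simp
    also have "\<dots> = W id"
    proof -
      have "{p \<in> P - {a}. lab p \<in> S} = {p \<in> P. lab p \<in> S}" using ak xS by auto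
      then show ?thesis unfolding state_def by simp
    qed
    finally show ?thesis unfolding one two using kink_sum by simp
  qed
  have "B P nx lab (insert x C) \<kappa> n = (\<Sum>S\<in>Pow C. of_int ((- \<epsilon>) ^ card S) * state P (?o \<circ> nx) lab \<kappa> n S +
      of_int ((- \<epsilon>) ^ card (insert x S)) * state P (?o \<circ> nx) lab \<kappa> n (insert x S))"
    unfolding B_def by (rule sum_Pow_insert[OF fin x])
  also have "\<dots> = B P nx lab C \<kappa> n"
    unfolding B_def
  proof (rule sum.cong[OF refl])
    fix S assume "S \<in> Pow C"
    then have S: "S \<subseteq> C" "finite S" "x \<notin> S" using fin finite_subset x by auto
    show "of_int ((- \<epsilon>) ^ card S) * state P (?o \<circ> nx) lab \<kappa> n S +
        of_int ((- \<epsilon>) ^ card (insert x S)) * state P (?o \<circ> nx) lab \<kappa> n (insert x S) =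
        of_int ((- \<epsilon>) ^ card S) * state P (?q \<circ> nx) lab \<kappa> n S"
      unfolding step[OF S(1), symmetric] weight_insert[OF S(2,3)] by (simp only: distrib_left mult_ac)
  qed
  finally show ?thesis .
qed

text \<open>The weight of the state \<open>S\<close> of the other crossings is factored out, so that
  only the weights at \<open>x\<close> and \<open>y\<close> remain.\<close>

definition four where
  "four P \<phi> lab \<kappa> n S x y = state P \<phi> lab \<kappa> n S + of_int (- \<epsilon>) * state P \<phi> lab \<kappa> n (insert x S) +
     of_int (- \<epsilon>) * state P \<phi> lab \<kappa> n (insert y S) + of_int (\<epsilon> * \<epsilon>) * state P \<phi> lab \<kappa> n (insert x (insert y S))"

lemma B_four:
  assumes "finite C" "x \<notin> C" "y \<notin> C" "x \<noteq> y"
  shows "B P nx lab (insert x (insert y C)) \<kappa> n =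
    (\<Sum>S\<in>Pow C. of_int ((- \<epsilon>) ^ card S) * four P (opp P lab (insert x (insert y C)) \<circ> nx) lab \<kappa> n S x y)"
proof -
  let ?s = "state P (opp P lab (insert x (insert y C)) \<circ> nx) lab \<kappa> n"
  let ?g = "\<lambda>S. of_int ((- \<epsilon>) ^ card S) * ?s S"
  have "B P nx lab (insert x (insert y C)) \<kappa> n =
      (\<Sum>S\<in>Pow C. (?g S + ?g (insert x S)) + (?g (insert y S) + ?g (insert x (insert y S))))"
    unfolding B_def using assms by (simp only: sum_Pow_insert finite_insert insert_iff simp_thms)
  also have "\<dots> = (\<Sum>S\<in>Pow C. of_int ((- \<epsilon>) ^ card S) * four P (opp P lab (insert x (insert y C)) \<circ> nx) lab \<kappa> n S x y)"
  proof (rule sum.cong[OF refl])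
    fix S assume "S \<in> Pow C"
    then have S: "S \<subseteq> C" "finite S" "x \<notin> S" "y \<notin> S" "finite (insert y S)" "x \<notin> insert y S"
      using assms finite_subset by auto
    show "(?g S + ?g (insert x S)) + (?g (insert y S) + ?g (insert x (insert y S))) =
        of_int ((- \<epsilon>) ^ card S) * four P (opp P lab (insert x (insert y C)) \<circ> nx) lab \<kappa> n S x y"
      unfolding four_def weight_insert[OF S(2,3)] weight_insert[OF S(2,4)] weight_insert[OF S(5,6)]
      by (simp add: algebra_simps)
  qed
  finally show ?thesis .
qed

text \<open>The edges from \<open>a\<close> to \<open>k\<close> and from \<open>b\<close> to
  \<open>l\<close> both join \<open>x\<close> and \<open>y\<close>. If both run from
  \<open>x\<close> to \<open>y\<close>, the pattern is \<open>parallel_sum\<close>, otherwise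
  \<open>antiparallel_sum\<close>; in either case the four inner states add up to one state without
  these crossings.\<close>

lemma B_R2:
  assumes ch: "chords P nx lab (insert x (insert y C))" and \<kappa>: "inj_on \<kappa> (insert x (insert y C))"
    and xy: "x \<notin> C" "y \<notin> C" "x \<noteq> y"
    and ports: "{a, b, k, l} \<subseteq> P" "distinct [a, b, k, l]" and nx: "nx a = k" "nx b = l"
    and lab: "lab a = x \<and> lab k = y \<and> (lab b = x \<and> lab l = y \<or> lab b = y \<and> lab l = x)"
  shows "B P nx lab (insert x (insert y C)) \<kappa> n = B P nx lab C \<kappa> n"
proof -
  let ?C = "insert x (insert y C)"
  let ?o = "opp P lab ?C" and ?q = "opp P lab C"
  have perm: "perm P nx" using ch by (simp add: chords_def)
  have sub: "C \<subseteq> ?C" by blast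
  have ch0: "chords P nx lab C" by (rule chords_subset[OF ch sub])
  have fin: "finite C" by (rule finite_crossings[OF ch0])
  have P: "a \<in> P" "b \<in> P" "k \<in> P" "l \<in> P" using ports(1) by auto
  have ne: "a \<noteq> b" "a \<noteq> k" "a \<noteq> l" "b \<noteq> k" "b \<noteq> l" "k \<noteq> l" "b \<noteq> a" "k \<noteq> a" "l \<noteq> a" "k \<noteq> b" "l \<noteq> b" "l \<noteq> k"
    using ports(2) by auto
  have q: "?q k = k" "?q l = l" by (rule opp_outside; use lab xy in auto)+
  \<comment> \<open>Two transpositions cut the two inner edges, making \<open>a\<close> and
    \<open>b\<close> fixed ports.\<close>
  define \<tau> where "\<tau> = swap b l \<circ> (swap a k \<circ> (?q \<circ> nx))"
  have p0: "perm P (?q \<circ> nx)" by (rule perm_comp[OF perm perm_opp[OF ch0]])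
  have p1: "perm P (swap a k \<circ> (?q \<circ> nx))" by (rule perm_swap[OF p0 P(1,3)])
  have p\<tau>: "perm P \<tau>" unfolding \<tau>_def by (rule perm_swap[OF p1 P(2,4)])
  have \<tau>a: "\<tau> a = a" "\<tau> b = b" by (simp_all add: \<tau>_def nx q ne Transposition.transpose_def)
  \<comment> \<open>When \<open>x\<close> and \<open>y\<close> no longer count as crossings,
    \<open>a\<close> and \<open>b\<close> are mere marks. Removing them leaves the outer part with
    each strand joined to itself, the term \<open>W id\<close> of the pattern.\<close>
  have skip: "state P (?q \<circ> nx) lab \<kappa> n S =
      F (Inl ` (P - {a, b}) \<union> Inr ` S) (id \<circ> map_sum \<tau> id) (Inl ` {p \<in> P. lab p \<in> S} \<union> Inr ` S)
        (port_lab \<kappa> lab) (port_lab \<kappa> lab) n" if S: "S \<subseteq> C" for S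
  proof -
    have finS: "finite S" by (rule finite_subset[OF S fin])
    have aS: "lab a \<notin> S" "lab b \<notin> S" using lab xy S by auto
    have k0: "(?q \<circ> nx) a = k" by (simp add: nx q)
    have l0: "(swap a k \<circ> (?q \<circ> nx)) b = l" by (simp add: nx q ne Transposition.transpose_def)
    have p1': "perm (P - {a}) (swap a k \<circ> (?q \<circ> nx))" using perm_skip[OF p0 P(1)] unfolding k0 .
    have b: "b \<in> P - {a}" using P ne by simp
    have "state P (?q \<circ> nx) lab \<kappa> n S = state (P - {a}) (swap a k \<circ> (?q \<circ> nx)) lab \<kappa> n S"
      using state_skip[where lab=lab and a=a and \<kappa>=\<kappa> and n=n, OF p0 finS P(1) aS(1)] unfolding k0 by (simp add: ne)
    also have "\<dots> = state (P - {a} - {b}) \<tau> lab \<kappa> n S"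
      using state_skip[where lab=lab and a=b and \<kappa>=\<kappa> and n=n, OF p1' finS b aS(2)] unfolding l0 \<tau>_def by (simp add: ne)
    also have "P - {a} - {b} = P - {a, b}" by auto
    also have "state (P - {a, b}) \<tau> lab \<kappa> n S =
      F (Inl ` (P - {a, b}) \<union> Inr ` S) (id \<circ> map_sum \<tau> id) (Inl ` {p \<in> P. lab p \<in> S} \<union> Inr ` S)
        (port_lab \<kappa> lab) (port_lab \<kappa> lab) n"
    proof -
      have "{p \<in> P - {a, b}. lab p \<in> S} = {p \<in> P. lab p \<in> S}" using aS by auto
      then show ?thesis unfolding state_def by simp
    qed
    finally show ?thesis .
  qed
  have step: "four P (?o \<circ> nx) lab \<kappa> n S x y = state P (?q \<circ> nx) lab \<kappa> n S" if S: "S \<subseteq> C" for S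
  proof -
    have S': "S \<subseteq> ?C" "insert x S \<subseteq> ?C" "insert y S \<subseteq> ?C" "insert x (insert y S) \<subseteq> ?C" using S by auto
    have xS: "x \<notin> S" "y \<notin> S" using xy S by auto
    let ?R = "Inl ` (P - {a, b}) \<union> Inr ` S :: ('a + 'b) set" and ?Q = "Inl ` {p \<in> P. lab p \<in> S} \<union> Inr ` S :: ('a + 'b) set"
    let ?lb = "port_lab \<kappa> lab"
    interpret outer f \<epsilon> ?R "map_sum \<tau> id" ?Q ?lb n
      by (rule outer_state[OF ch \<kappa> S sub]; use P p\<tau> \<tau>a lab xy in auto)
    interpret clasp f \<epsilon> ?R "map_sum \<tau> id" ?Q ?lb n "Inl k" "Inl l" "Inl a" "Inl b" "Inr x" "Inr y" "\<kappa> x" "\<kappa> y"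
    proof
      show "\<kappa> x \<notin> ?lb ` ?Q" "\<kappa> y \<notin> ?lb ` ?Q" by (rule fresh_label[OF \<kappa> _ S'(1)]; simp add: xS)+
      show "\<kappa> x \<noteq> \<kappa> y" using inj_on_eq_iff[OF \<kappa>, of x y] xy(3) by simp
      show "Inl k \<in> ?R - ?Q" "Inl l \<in> ?R - ?Q" using P ne lab xS by auto
      show "i \<notin> ?R \<and> map_sum \<tau> id i = i" if "i \<in> {Inl a, Inl b, Inr x, Inr y}" for i
        using that xS \<tau>a by auto
    qed (simp_all add: ne xy(3))
    have Pset: "Inl ` P = insert (Inl a) (insert (Inl b) (Inl ` (P - {a, b})))" using P by auto
    from lab show ?thesis
    proof (elim conjE disjE)
      assume lab: "lab a = x" "lab k = y" "lab b = x" "lab l = y"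
      have X: "{p \<in> P. lab p = x} = {a, b}" "{p \<in> P. lab p = y} = {k, l}"
        by (rule chord_set[OF ch]; simp add: P ne lab)+
      have L: "{p \<in> P. lab p \<in> ?C - C} = {a, b, k, l}" using X xy by auto
      have o: "?o a = b" "?o b = a" "?o k = l" "?o l = k" by (rule opp_eq[OF ch]; simp add: P ne lab)+
      define \<theta> :: "'a + 'b \<Rightarrow> 'a + 'b" where
        "\<theta> = id(Inl k := Inl b, Inl l := Inl a, Inl a := Inl l, Inl b := Inl k)"
      have \<theta>: "\<theta> (Inl ((swap b l \<circ> swap a k) (?q r))) = Inl (?o r)" if "r \<in> P" for r
        by (rule reglue_crossings[OF ch sub L that])
          (auto simp: \<theta>_def o ne Transposition.transpose_def)
      note st = pattern_state[where \<theta>=\<theta> and \<sigma>="swap b l \<circ> swap a k" and labo=lab and Co=C and \<tau>=\<tau> and \<kappa>=\<kappa> and n=n, OF ch _ \<theta>]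
      have "state P (?o \<circ> nx) lab \<kappa> n S = F ({Inl a, Inl b} \<union> ?R) (\<theta> \<circ> map_sum \<tau> id) ?Q ?lb ?lb n"
        by (rule st[OF S'(1)]) (auto simp: \<theta>_def \<tau>_def Pset)
      moreover have "state P (?o \<circ> nx) lab \<kappa> n (insert x S) =
          F ({Inl a, Inl b, Inr x} \<union> ?R) (\<theta> \<circ> map_sum \<tau> id) ({Inl a, Inl b, Inr x} \<union> ?Q) ?lb ?lb n"
        by (rule st[OF S'(2)]) (use X in \<open>auto simp: \<theta>_def \<tau>_def Pset\<close>)
      moreover have "state P (?o \<circ> nx) lab \<kappa> n (insert y S) =
          F ({Inl a, Inl b, Inr y} \<union> ?R) (\<theta> \<circ> map_sum \<tau> id) ({Inl k, Inl l, Inr y} \<union> ?Q) ?lb ?lb n"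
        by (rule st[OF S'(3)]) (use X in \<open>auto simp: \<theta>_def \<tau>_def Pset\<close>)
      moreover have "state P (?o \<circ> nx) lab \<kappa> n (insert x (insert y S)) =
          F ({Inl a, Inl b, Inr x, Inr y} \<union> ?R) (\<theta> \<circ> map_sum \<tau> id)
            ({Inl a, Inl b, Inr x, Inl k, Inl l, Inr y} \<union> ?Q) ?lb ?lb n"
        by (rule st[OF S'(4)]) (use X in \<open>auto simp: \<theta>_def \<tau>_def Pset\<close>)
      ultimately show ?thesis
        unfolding four_def skip[OF S] by (simp only:) (rule parallel_sum[OF _ _ _ _ \<theta>_def]; simp add: lab)
    next
      assume lab: "lab a = x" "lab k = y" "lab b = y" "lab l = x"
      have X: "{p \<in> P. lab p = x} = {a, l}" "{p \<in> P. lab p = y} = {k, b}"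
        by (rule chord_set[OF ch]; simp add: P ne lab)+
      have L: "{p \<in> P. lab p \<in> ?C - C} = {a, b, k, l}" using X xy by auto
      have o: "?o a = l" "?o l = a" "?o k = b" "?o b = k" by (rule opp_eq[OF ch]; simp add: P ne lab)+
      define \<theta> :: "'a + 'b \<Rightarrow> 'a + 'b" where
        "\<theta> = id(Inl k := Inl l, Inl l := Inl k, Inl a := Inl b, Inl b := Inl a)"
      have \<theta>: "\<theta> (Inl ((swap b l \<circ> swap a k) (?q r))) = Inl (?o r)" if "r \<in> P" for r
        by (rule reglue_crossings[OF ch sub L that])
          (auto simp: \<theta>_def o ne Transposition.transpose_def)
      note st = pattern_state[where \<theta>=\<theta> and \<sigma>="swap b l \<circ> swap a k" and labo=lab and Co=C and \<tau>=\<tau> and \<kappa>=\<kappa> and n=n, OF ch _ \<theta>]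
      have "state P (?o \<circ> nx) lab \<kappa> n S = F ({Inl a, Inl b} \<union> ?R) (\<theta> \<circ> map_sum \<tau> id) ?Q ?lb ?lb n"
        by (rule st[OF S'(1)]) (auto simp: \<theta>_def \<tau>_def Pset)
      moreover have "state P (?o \<circ> nx) lab \<kappa> n (insert x S) =
          F ({Inl a, Inl b, Inr x} \<union> ?R) (\<theta> \<circ> map_sum \<tau> id) ({Inl a, Inl l, Inr x} \<union> ?Q) ?lb ?lb n"
        by (rule st[OF S'(2)]) (use X in \<open>auto simp: \<theta>_def \<tau>_def Pset\<close>)
      moreover have "state P (?o \<circ> nx) lab \<kappa> n (insert y S) =
          F ({Inl a, Inl b, Inr y} \<union> ?R) (\<theta> \<circ> map_sum \<tau> id) ({Inl k, Inl b, Inr y} \<union> ?Q) ?lb ?lb n"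
        by (rule st[OF S'(3)]) (use X in \<open>auto simp: \<theta>_def \<tau>_def Pset\<close>)
      moreover have "state P (?o \<circ> nx) lab \<kappa> n (insert x (insert y S)) =
          F ({Inl a, Inl b, Inr x, Inr y} \<union> ?R) (\<theta> \<circ> map_sum \<tau> id)
            ({Inl a, Inl l, Inr x, Inl k, Inl b, Inr y} \<union> ?Q) ?lb ?lb n"
        by (rule st[OF S'(4)]) (use X in \<open>auto simp: \<theta>_def \<tau>_def Pset\<close>)
      ultimately show ?thesis
        unfolding four_def skip[OF S] by (simp only:) (rule antiparallel_sum[OF _ _ _ _ \<theta>_def]; simp add: lab)
    qed
  qed
  have "B P nx lab ?C \<kappa> n = (\<Sum>S\<in>Pow C. of_int ((- \<epsilon>) ^ card S) * four P (?o \<circ> nx) lab \<kappa> n S x y)"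
    by (rule B_four[OF fin xy])
  also have "\<dots> = B P nx lab C \<kappa> n" unfolding B_def by (rule sum.cong[OF refl]) (simp add: step)
  finally show ?thesis .
qed

section \<open>The third move on chord diagrams\<close>

definition eight where
  "eight P \<phi> lab \<kappa> n S x y z = state P \<phi> lab \<kappa> n S + of_int (- \<epsilon>) * state P \<phi> lab \<kappa> n (insert x S) +
     of_int (- \<epsilon>) * state P \<phi> lab \<kappa> n (insert y S) + of_int (- \<epsilon>) * state P \<phi> lab \<kappa> n (insert z S) +
     of_int (\<epsilon> * \<epsilon>) * state P \<phi> lab \<kappa> n (insert x (insert y S)) +
     of_int (\<epsilon> * \<epsilon>) * state P \<phi> lab \<kappa> n (insert x (insert z S)) +
     of_int (\<epsilon> * \<epsilon>) * state P \<phi> lab \<kappa> n (insert y (insert z S)) +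
     of_int (- \<epsilon> * (\<epsilon> * \<epsilon>)) * state P \<phi> lab \<kappa> n (insert x (insert y (insert z S)))"

lemma eight_commute:
  "eight P \<phi> lab \<kappa> n S y x z = eight P \<phi> lab \<kappa> n S x y z"
  "eight P \<phi> lab \<kappa> n S z y x = eight P \<phi> lab \<kappa> n S x y z"
  unfolding eight_def by (simp_all only: insert_commute[of y x] insert_commute[of z y] insert_commute[of z x] add_ac)

lemma B_eight:
  assumes "finite C" "x \<notin> C" "y \<notin> C" "z \<notin> C" "x \<noteq> y" "x \<noteq> z" "y \<noteq> z"
  shows "B P nx lab (insert x (insert y (insert z C))) \<kappa> n =
    (\<Sum>S\<in>Pow C. of_int ((- \<epsilon>) ^ card S) *
      eight P (opp P lab (insert x (insert y (insert z C))) \<circ> nx) lab \<kappa> n S x y z)"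
proof -
  let ?s = "state P (opp P lab (insert x (insert y (insert z C))) \<circ> nx) lab \<kappa> n"
  let ?g = "\<lambda>S. of_int ((- \<epsilon>) ^ card S) * ?s S"
  have "B P nx lab (insert x (insert y (insert z C))) \<kappa> n =
      (\<Sum>S\<in>Pow C. ((?g S + ?g (insert x S)) + (?g (insert y S) + ?g (insert x (insert y S)))) +
        ((?g (insert z S) + ?g (insert x (insert z S))) +
         (?g (insert y (insert z S)) + ?g (insert x (insert y (insert z S))))))"
    unfolding B_def using assms by (simp only: sum_Pow_insert finite_insert insert_iff simp_thms)
  also have "\<dots> = (\<Sum>S\<in>Pow C. of_int ((- \<epsilon>) ^ card S) *
      eight P (opp P lab (insert x (insert y (insert z C))) \<circ> nx) lab \<kappa> n S x y z)"
  proof (rule sum.cong[OF refl])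
    fix S assume "S \<in> Pow C"
    then have S: "S \<subseteq> C" "finite S" "x \<notin> S" "y \<notin> S" "z \<notin> S" "finite (insert y S)" "x \<notin> insert y S"
      "finite (insert z S)" "x \<notin> insert z S" "y \<notin> insert z S" "finite (insert y (insert z S))"
      "x \<notin> insert y (insert z S)"
      using assms finite_subset by auto
    show "((?g S + ?g (insert x S)) + (?g (insert y S) + ?g (insert x (insert y S)))) +
        ((?g (insert z S) + ?g (insert x (insert z S))) +
         (?g (insert y (insert z S)) + ?g (insert x (insert y (insert z S))))) =
        of_int ((- \<epsilon>) ^ card S) *
        eight P (opp P lab (insert x (insert y (insert z C))) \<circ> nx) lab \<kappa> n S x y z"
      unfolding eight_def weight_insert[OF S(2,3)] weight_insert[OF S(2,4)] weight_insert[OF S(2,5)]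
        weight_insert[OF S(6,7)] weight_insert[OF S(8,9)] weight_insert[OF S(8,10)] weight_insert[OF S(11,12)]
      by (simp add: algebra_simps)
  qed
  finally show ?thesis .
qed

text \<open>Writes the eight inner states over \<open>S\<close> in the shape of the left-hand sides
  of \<open>acyclic_sum\<close> and \<open>cyclic_sum\<close>. The ports at each crossing are
  parameters, since the two patterns and the two sides of the move distribute them
  differently.\<close>

lemma eight_F:
  fixes P :: "'p set" and lab :: "'p \<Rightarrow> 'c" and \<theta> :: "'p + 'c \<Rightarrow> 'p + 'c"
  assumes ch: "chords P nx lab C'" and C': "C' = insert x (insert y (insert z C))" and S: "S \<subseteq> C"
    and abc: "{a, b, c} \<subseteq> P"
    and \<theta>: "\<forall>r\<in>P. \<theta> (Inl (\<sigma> (opp P labo C r))) = Inl (opp P lab C' r)" "\<And>d. \<theta> (Inr d) = Inr d"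
    and \<tau>: "\<And>p. \<tau> p = \<sigma> (opp P labo C (nx p))"
    and R: "R = Inl ` (P - {a, b, c}) \<union> Inr ` S" and Q: "Q = Inl ` {p \<in> P. lab p \<in> S} \<union> Inr ` S"
    and X: "{p \<in> P. lab p = x} = {x1, x2}" "{p \<in> P. lab p = y} = {y1, y2}" "{p \<in> P. lab p = z} = {z1, z2}"
    and lb: "lb = port_lab \<kappa> lab"
  shows "eight P (opp P lab C' \<circ> nx) lab \<kappa> n S x y z = F ({Inl a, Inl b, Inl c} \<union> R) (\<theta> \<circ> map_sum \<tau> id) Q lb lb n +
    of_int (- \<epsilon>) * F ({Inl a, Inl b, Inl c, Inr x} \<union> R) (\<theta> \<circ> map_sum \<tau> id) ({Inl x1, Inl x2, Inr x} \<union> Q) lb lb n +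
    of_int (- \<epsilon>) * F ({Inl a, Inl b, Inl c, Inr y} \<union> R) (\<theta> \<circ> map_sum \<tau> id) ({Inl y1, Inl y2, Inr y} \<union> Q) lb lb n +
    of_int (- \<epsilon>) * F ({Inl a, Inl b, Inl c, Inr z} \<union> R) (\<theta> \<circ> map_sum \<tau> id) ({Inl z1, Inl z2, Inr z} \<union> Q) lb lb n +
    of_int (\<epsilon> * \<epsilon>) * F ({Inl a, Inl b, Inl c, Inr x, Inr y} \<union> R) (\<theta> \<circ> map_sum \<tau> id) ({Inl x1, Inl x2, Inr x, Inl y1, Inl y2, Inr y} \<union> Q) lb lb n +
    of_int (\<epsilon> * \<epsilon>) * F ({Inl a, Inl b, Inl c, Inr x, Inr z} \<union> R) (\<theta> \<circ> map_sum \<tau> id) ({Inl x1, Inl x2, Inr x, Inl z1, Inl z2, Inr z} \<union> Q) lb lb n +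
    of_int (\<epsilon> * \<epsilon>) * F ({Inl a, Inl b, Inl c, Inr y, Inr z} \<union> R) (\<theta> \<circ> map_sum \<tau> id) ({Inl y1, Inl y2, Inr y, Inl z1, Inl z2, Inr z} \<union> Q) lb lb n +
    of_int (- \<epsilon> * (\<epsilon> * \<epsilon>)) * F ({Inl a, Inl b, Inl c, Inr x, Inr y, Inr z} \<union> R) (\<theta> \<circ> map_sum \<tau> id)
      ({Inl x1, Inl x2, Inr x, Inl y1, Inl y2, Inr y, Inl z1, Inl z2, Inr z} \<union> Q) lb lb n"
proof -
  have P: "Inl ` P = {Inl a, Inl b, Inl c} \<union> Inl ` (P - {a, b, c})" using abc by auto
  have Pset: "Inl ` P \<union> Inr ` (A \<union> S) = {Inl a, Inl b, Inl c} \<union> Inr ` A \<union> R" for A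
    unfolding P R image_Un by (simp only: Un_ac)
  have Ls: "{p \<in> P. lab p \<in> A \<union> S} = {p \<in> P. lab p \<in> A} \<union> {p \<in> P. lab p \<in> S}" for A by auto
  have L: "{p \<in> P. lab p \<in> insert d A} = {p \<in> P. lab p = d} \<union> {p \<in> P. lab p \<in> A}" for d A by auto
  have st: "state P (opp P lab C' \<circ> nx) lab \<kappa> n (A \<union> S) =
      F ({Inl a, Inl b, Inl c} \<union> Inr ` A \<union> R) (\<theta> \<circ> map_sum \<tau> id) (Inl ` {p \<in> P. lab p \<in> A} \<union> Inr ` A \<union> Q) lb lb n"
    if "A \<subseteq> {x, y, z}" for A
    unfolding lb
  proof (rule pattern_state[where \<theta>=\<theta> and \<sigma>=\<sigma> and labo=labo and Co=C and \<tau>=\<tau>, OF ch _ bspec[OF \<theta>(1)] \<theta>(2) \<tau>])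
    show "A \<union> S \<subseteq> C'" using that S unfolding C' by auto
    show "{Inl a, Inl b, Inl c} \<union> Inr ` A \<union> R = Inl ` P \<union> Inr ` (A \<union> S)" by (rule Pset[symmetric])
    show "Inl ` {p \<in> P. lab p \<in> A} \<union> Inr ` A \<union> Q = Inl ` {p \<in> P. lab p \<in> A \<union> S} \<union> Inr ` (A \<union> S)"
      unfolding Ls Q image_Un by (simp only: Un_ac)
  qed
  have e: "{p \<in> P. lab p \<in> {}} = {}" by simp
  have s: "{Inl a, Inl b, Inl c} \<union> insert u A = {Inl a, Inl b, Inl c, u} \<union> A" for u and A :: "('p + 'c) set" by auto
  have 0: "state P (opp P lab C' \<circ> nx) lab \<kappa> n S = F ({Inl a, Inl b, Inl c} \<union> R) (\<theta> \<circ> map_sum \<tau> id) Q lb lb n"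
    using st[of "{}"] by simp
  have 1: "state P (opp P lab C' \<circ> nx) lab \<kappa> n (insert u S) = F ({Inl a, Inl b, Inl c, Inr u} \<union> R) (\<theta> \<circ> map_sum \<tau> id)
      ({Inl u1, Inl u2, Inr u} \<union> Q) lb lb n"
    if "u \<in> {x, y, z}" "{p \<in> P. lab p = u} = {u1, u2}" for u u1 u2
  proof -
    have A: "{u} \<subseteq> {x, y, z}" using that by simp
    have "{Inl a, Inl b, Inl c} \<union> Inr ` {u} \<union> R = {Inl a, Inl b, Inl c, Inr u} \<union> R"
      "Inl ` {p \<in> P. lab p \<in> {u}} \<union> Inr ` {u} \<union> Q = {Inl u1, Inl u2, Inr u} \<union> Q"
      unfolding L that(2) e by auto
    then show ?thesis using st[OF A] by simp
  qed
  have 2: "state P (opp P lab C' \<circ> nx) lab \<kappa> n (insert u (insert v S)) = F ({Inl a, Inl b, Inl c, Inr u, Inr v} \<union> R) (\<theta> \<circ> map_sum \<tau> id)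
      ({Inl u1, Inl u2, Inr u, Inl v1, Inl v2, Inr v} \<union> Q) lb lb n"
    if "u \<in> {x, y, z}" "{p \<in> P. lab p = u} = {u1, u2}" "v \<in> {x, y, z}" "{p \<in> P. lab p = v} = {v1, v2}" for u u1 u2 v v1 v2
  proof -
    have A: "{u, v} \<subseteq> {x, y, z}" using that by simp
    have "{Inl a, Inl b, Inl c} \<union> Inr ` {u, v} \<union> R = {Inl a, Inl b, Inl c, Inr u, Inr v} \<union> R"
      "Inl ` {p \<in> P. lab p \<in> {u, v}} \<union> Inr ` {u, v} \<union> Q = {Inl u1, Inl u2, Inr u, Inl v1, Inl v2, Inr v} \<union> Q"
      unfolding L that(2,4) e by auto
    then show ?thesis using st[OF A] by simp
  qed
  have 3: "state P (opp P lab C' \<circ> nx) lab \<kappa> n (insert x (insert y (insert z S))) =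
      F ({Inl a, Inl b, Inl c, Inr x, Inr y, Inr z} \<union> R) (\<theta> \<circ> map_sum \<tau> id)
      ({Inl x1, Inl x2, Inr x, Inl y1, Inl y2, Inr y, Inl z1, Inl z2, Inr z} \<union> Q) lb lb n"
  proof -
    have "{Inl a, Inl b, Inl c} \<union> Inr ` {x, y, z} \<union> R = {Inl a, Inl b, Inl c, Inr x, Inr y, Inr z} \<union> R"
      "Inl ` {p \<in> P. lab p \<in> {x, y, z}} \<union> Inr ` {x, y, z} \<union> Q =
        {Inl x1, Inl x2, Inr x, Inl y1, Inl y2, Inr y, Inl z1, Inl z2, Inr z} \<union> Q"
      unfolding L X e by auto
    then show ?thesis using st[OF subset_refl] by simp
  qed
  have m: "x \<in> {x, y, z}" "y \<in> {x, y, z}" "z \<in> {x, y, z}" by simp_all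
  show ?thesis
    unfolding eight_def 0 3 1[OF m(1) X(1)] 1[OF m(2) X(2)] 1[OF m(3) X(3)]
      2[OF m(1) X(1) m(2) X(2)] 2[OF m(1) X(1) m(3) X(3)] 2[OF m(2) X(2) m(3) X(3)] ..
qed

lemma opp_cong:
  assumes "\<And>p. p \<in> P \<Longrightarrow> lab' p \<in> C \<longleftrightarrow> lab p \<in> C" "\<And>p. p \<in> P \<Longrightarrow> lab p \<in> C \<Longrightarrow> lab' p = lab p"
  shows "opp P lab' C p = opp P lab C p"
proof (cases "p \<in> P \<and> lab p \<in> C")
  case True
  have eq: "lab' p = lab p" by (rule assms(2)) (use True in blast)+
  then have "p \<in> P \<and> lab' p \<in> C" using True by metis
  moreover have "q \<in> P \<and> q \<noteq> p \<and> lab' q = lab p \<longleftrightarrow> q \<in> P \<and> q \<noteq> p \<and> lab q = lab p" for q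
    using assms(1)[of q] assms(2)[of q] True by metis
  ultimately show ?thesis using True unfolding opp_def eq by (simp only: if_True simp_thms)
next
  case False
  then have "\<not> (p \<in> P \<and> lab' p \<in> C)" using assms(1)[of p] by blast
  then have "opp P lab' C p = p" by (rule opp_outside[where lab = lab' and p = p and P = P and C = C])
  moreover have "opp P lab C p = p" by (rule opp_outside[where lab = lab and p = p and P = P and C = C, OF False])
  ultimately show ?thesis by simp
qed

text \<open>The two sides of the move share the outer data \<open>R\<close>, \<open>\<tau>\<close>
  and \<open>Q\<close> and differ in the labelling and in the roles of strands, edges and crossings.
  The primed names allow for every assignment of the roles.\<close>

lemma triangle_setup:
  fixes P :: "'p set" and lab :: "'p \<Rightarrow> 'c"
  assumes ch: "chords P nx lab C'" and C': "C' = insert x (insert y (insert z C))" and \<kappa>: "inj_on \<kappa> C'"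
    and S: "S \<subseteq> C" and xyz: "x \<notin> C" "y \<notin> C" "z \<notin> C" "distinct [x, y, z]"
    and P: "{a, b, c, k, l, m} \<subseteq> P" "distinct [a, b, c, k, l, m]"
    and lab: "{lab a, lab b, lab c, lab k, lab l, lab m} \<subseteq> {x, y, z}"
    and lab': "lab' = lab(a := lab k, k := lab a, b := lab l, l := lab b, c := lab m, m := lab c)"
    and nx: "nx a = k" "nx b = l" "nx c = m"
    and \<tau>: "\<tau> = swap c m \<circ> (swap b l \<circ> (swap a k \<circ> (opp P lab C \<circ> nx)))"
    and R: "R = Inl ` (P - {a, b, c}) \<union> Inr ` S" and Q: "Q = Inl ` {p \<in> P. lab p \<in> S} \<union> Inr ` S"
    and lb: "lb = port_lab \<kappa> lab \<or> lb = port_lab \<kappa> lab'"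
    and k': "k' \<in> {k, l, m}" and perm3: "distinct [k', l', m']" "{k', l', m'} = {k, l, m}"
    and permh: "distinct [a', b', c']" "{a', b', c'} = {a, b, c}" and permx: "distinct [x', y', z']" "{x', y', z'} = {x, y, z}"
  shows "triangle f \<epsilon> R (map_sum \<tau> id) Q (port_lab \<kappa> lab) (Inl k') (Inl l') (Inl m') (Inl a') (Inl b') (Inl c')
    (Inr x') (Inr y') (Inr z') (\<kappa> x') (\<kappa> y') (\<kappa> z') lb"
proof -
  have sub: "C \<subseteq> C'" unfolding C' by blast
  have ch0: "chords P nx lab C" by (rule chords_subset[OF ch sub])
  have perm: "perm P nx" using ch by (simp add: chords_def)
  have mem: "a \<in> P" "b \<in> P" "c \<in> P" "k \<in> P" "l \<in> P" "m \<in> P" using P(1) by auto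
  have out: "lab p \<notin> C" "lab p \<notin> S" if "p \<in> {a, b, c, k, l, m}" for p
  proof -
    have "lab p \<in> lab ` {a, b, c, k, l, m}" by (rule imageI[OF that])
    then have "lab p \<in> {x, y, z}" using lab by (simp only: image_insert image_empty) (rule subsetD)
    then show "lab p \<notin> C" using xyz(1-3) by (elim insertE emptyE) simp_all
    then show "lab p \<notin> S" using subsetD[OF S] by (rule contrapos_nn)
  qed
  have q: "opp P lab C k = k" "opp P lab C l = l" "opp P lab C m = m"
    by (rule opp_outside; simp add: out)+
  have p\<tau>: "perm P \<tau>" unfolding \<tau> by (intro perm_swap perm_comp[OF perm perm_opp[OF ch0]] mem)
  have \<tau>a: "\<tau> a = a" "\<tau> b = b" "\<tau> c = c" using P(2) by (auto simp: \<tau> nx q Transposition.transpose_def)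
  interpret outer f \<epsilon> R "map_sum \<tau> id" Q "port_lab \<kappa> lab"
    unfolding R Q by (rule outer_state[OF ch \<kappa> S sub]; use mem p\<tau> \<tau>a out in auto)
  have xS: "x' \<notin> S" "y' \<notin> S" "z' \<notin> S" "x' \<in> C'" "y' \<in> C'" "z' \<in> C'"
  proof -
    have o: "v \<notin> S" "v \<in> C'" if "v \<in> {x, y, z}" for v
    proof -
      have "v \<notin> C \<and> v \<in> C'" using that xyz(1-3) unfolding C' by (elim insertE emptyE) simp_all
      then show "v \<notin> S" "v \<in> C'" using subsetD[OF S, of v] by metis+
    qed
    have m: "x' \<in> {x, y, z}" "y' \<in> {x, y, z}" "z' \<in> {x, y, z}" unfolding permx(2)[symmetric] by simp_all
    show "x' \<notin> S" "y' \<notin> S" "z' \<notin> S" "x' \<in> C'" "y' \<in> C'" "z' \<in> C'"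
      by (rule o[OF m(1)] o[OF m(2)] o[OF m(3)])+
  qed
  have SC: "S \<subseteq> C'" using S sub by blast
  have fresh: "\<kappa> x' \<notin> port_lab \<kappa> lab ` Q" "\<kappa> y' \<notin> port_lab \<kappa> lab ` Q" "\<kappa> z' \<notin> port_lab \<kappa> lab ` Q"
    unfolding Q by (rule fresh_label[OF \<kappa> _ SC]; simp add: xS)+
  have \<kappa>d: "distinct [\<kappa> x', \<kappa> y', \<kappa> z']"
    using permx(1) inj_on_eq_iff[OF \<kappa> xS(4,5)] inj_on_eq_iff[OF \<kappa> xS(4,6)] inj_on_eq_iff[OF \<kappa> xS(5,6)] by simp
  have kR: "Inl i \<in> R - Q" if "i \<in> {k, l, m}" for i
    using that mem out[of i] P(2) unfolding R Q by auto
  have aR: "Inl i \<notin> R" "\<tau> i = i" if "i \<in> {a, b, c}" for i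
    using that \<tau>a unfolding R by auto
  have xR: "Inr i \<notin> R" if "i \<in> {x', y', z'}" for i using that xS unfolding R by auto
  show ?thesis
  proof (unfold_locales)
    show "{Inl k', Inl l', Inl m'} \<subseteq> R - Q"
    proof (intro insert_subsetI empty_subsetI)
      show "Inl k' \<in> R - Q" "Inl l' \<in> R - Q" "Inl m' \<in> R - Q" by (rule kR; use perm3(2) in blast)+
    qed
    show "i \<notin> R \<and> map_sum \<tau> id i = i" if "i \<in> {Inl a', Inl b', Inl c', Inr x', Inr y', Inr z'}" for i
    proof -
      have "a' \<in> {a, b, c}" "b' \<in> {a, b, c}" "c' \<in> {a, b, c}" using permh(2) by blast+
      then show ?thesis using that aR[of a'] aR[of b'] aR[of c'] xR by (elim insertE) simp_all
    qed
    show "{\<kappa> x', \<kappa> y', \<kappa> z'} \<inter> port_lab \<kappa> lab ` Q = {}" using fresh by blast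
    show "lb i = port_lab \<kappa> lab i" if "i \<in> Q" for i
    proof -
      have "lab' p = lab p" if "lab p \<in> S" for p
      proof -
        have "p \<notin> {a, b, c, k, l, m}" using out(2)[of p] that by blast
        then show ?thesis unfolding lab' by simp
      qed
      then have "port_lab \<kappa> lab' i = port_lab \<kappa> lab i" using that unfolding Q by auto
      then show ?thesis using lb by auto
    qed
  qed (use perm3(1) permh(1) permx(1) \<kappa>d lb in auto)
qed

text \<open>The move exchanges the two labels on each strand and leaves all other ports alone, so
  the pairing of the outer crossings and their active ports are the same for \<open>lab\<close> and
  \<open>lab'\<close>.\<close>

lemma triangle_labels:
  fixes P :: "'p set" and lab :: "'p \<Rightarrow> 'c"
  assumes ch: "chords P nx lab C'" and C': "C' = insert x (insert y (insert z C))"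
    and xyz: "x \<notin> C" "y \<notin> C" "z \<notin> C"
    and P: "{a, b, c, k, l, m} \<subseteq> P" "distinct [a, b, c, k, l, m]"
    and lab: "{lab a, lab b, lab c, lab k, lab l, lab m} \<subseteq> {x, y, z}"
    and lab': "lab' = lab(a := lab k, k := lab a, b := lab l, l := lab b, c := lab m, m := lab c)"
  shows "chords P nx lab' C'" "\<And>p. opp P lab' C p = opp P lab C p"
    "S \<subseteq> C \<Longrightarrow> {p \<in> P. lab' p \<in> S} = {p \<in> P. lab p \<in> S}"
proof -
  have out: "lab p \<notin> C" if "p \<in> {a, b, c, k, l, m}" for p
  proof -
    have "lab p \<in> lab ` {a, b, c, k, l, m}" by (rule imageI[OF that])
    then have "lab p \<in> {x, y, z}" using lab by (simp only: image_insert image_empty) (rule subsetD)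
    then show ?thesis using xyz by (elim insertE emptyE) simp_all
  qed
  have eq: "lab' p = lab p" if "p \<notin> {a, b, c, k, l, m}" for p using that unfolding lab' by simp
  have l': "lab' a = lab k" "lab' k = lab a" "lab' b = lab l" "lab' l = lab b" "lab' c = lab m" "lab' m = lab c"
    using P(2) by (auto simp: lab')
  have out': "lab' p \<notin> C" if "p \<in> {a, b, c, k, l, m}" for p
    using that by (elim insertE emptyE) (simp_all only: l', (rule out, simp)+)
  have iff: "lab' p \<in> C \<longleftrightarrow> lab p \<in> C" for p using eq out out' by metis
  have same: "lab' p = lab p" if "lab p \<in> C" for p using eq[of p] out[of p] that by blast
  show "opp P lab' C p = opp P lab C p" for p by (rule opp_cong) (auto simp: iff same)
  show "{p \<in> P. lab' p \<in> S} = {p \<in> P. lab p \<in> S}" if "S \<subseteq> C"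
    using that iff same by (metis (no_types, lifting) subsetD)
  \<comment> \<open>\<open>lab'\<close> is \<open>lab\<close> composed with the involution
    exchanging the two ports of each strand, hence every crossing keeps exactly two
    passages.\<close>
  let ?g = "swap c m \<circ> (swap b l \<circ> swap a k)"
  have g: "lab' p = lab (?g p)" for p using P(2) unfolding lab' by (auto simp: Transposition.transpose_def)
  have perm: "perm P nx" using ch by (simp add: chords_def)
  have "perm P ?g"
    using P(1) perm_swap[of P "swap b l \<circ> swap a k" c m] perm_swap[of P "swap a k" b l] perm_swap[of P id a k] perm_finite[OF perm]
    by (simp add: perm_def)
  then have bij: "bij_betw ?g P P" by (simp add: perm_def)
  show "chords P nx lab' C'"
    unfolding chords_def
  proof (intro conjI ballI perm)
    fix d assume d: "d \<in> C'"
    have "bij_betw ?g {p \<in> P. lab' p = d} {p \<in> P. lab p = d}"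
    proof (rule bij_betw_subset[OF bij])
      show "?g ` {p \<in> P. lab' p = d} = {p \<in> P. lab p = d}"
        using bij unfolding g bij_betw_def by (auto simp del: o_apply)
    qed auto
    then have "card {p \<in> P. lab' p = d} = card {p \<in> P. lab p = d}" by (rule bij_betw_same_card)
    moreover have "card {p \<in> P. lab p = d} = 2" using ch d by (simp add: chords_def)
    ultimately show "card {p \<in> P. lab' p = d} = 2" by simp
  qed
qed

text \<open>Exchanging the labels of each strand turns an acyclic triangle into another acyclic one.
  Both are reduced by \<open>acyclic_sum\<close> over the same outer data, and the results agree by
  \<open>acyclic_sym\<close>.\<close>

lemma B_R3_acyclic:
  fixes P :: "'p set" and lab :: "'p \<Rightarrow> 'c"
  assumes ch: "chords P nx lab C'" and C': "C' = insert x (insert y (insert z C))" and \<kappa>: "inj_on \<kappa> C'"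
    and xyz: "x \<notin> C" "y \<notin> C" "z \<notin> C" "distinct [x, y, z]"
    and P: "{a, b, c, k, l, m} \<subseteq> P" "distinct [a, b, c, k, l, m]" and nx: "nx a = k" "nx b = l" "nx c = m"
    and lab: "lab a = x" "lab b = x" "lab k = y" "lab c = y" "lab l = z" "lab m = z"
  shows "B P nx lab C' \<kappa> n = B P nx (lab(a := lab k, k := lab a, b := lab l, l := lab b, c := lab m, m := lab c)) C' \<kappa> n"
proof -
  define lab' where "lab' = lab(a := lab k, k := lab a, b := lab l, l := lab b, c := lab m, m := lab c)"
  have labs: "{lab a, lab b, lab c, lab k, lab l, lab m} \<subseteq> {x, y, z}" using lab by simp
  note tl = triangle_labels[OF ch C' xyz(1-3) P labs lab'_def]
  have P': "a \<in> P" "b \<in> P" "c \<in> P" "k \<in> P" "l \<in> P" "m \<in> P" using P(1) by auto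
  have ne: "a \<noteq> b" "a \<noteq> c" "a \<noteq> k" "a \<noteq> l" "a \<noteq> m" "b \<noteq> c" "b \<noteq> k" "b \<noteq> l" "b \<noteq> m" "c \<noteq> k" "c \<noteq> l" "c \<noteq> m"
    "k \<noteq> l" "k \<noteq> m" "l \<noteq> m" using P(2) by auto
  note ne = ne ne[symmetric]
  have lab2: "lab' a = y" "lab' k = x" "lab' b = z" "lab' l = x" "lab' c = z" "lab' m = y"
    using ne unfolding lab'_def by (simp_all add: lab)
  have sub: "C \<subseteq> C'" unfolding C' by blast
  have fin: "finite C" by (rule finite_crossings[OF chords_subset[OF ch sub]])
  have mem: "x \<in> C'" "y \<in> C'" "z \<in> C'" unfolding C' by simp_all
  have X: "{p \<in> P. lab p = x} = {a, b}" "{p \<in> P. lab p = y} = {k, c}" "{p \<in> P. lab p = z} = {l, m}"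
    by (rule chord_set[OF ch]; simp add: P' ne lab mem)+
  have X': "{p \<in> P. lab' p = z} = {c, b}" "{p \<in> P. lab' p = y} = {m, a}" "{p \<in> P. lab' p = x} = {l, k}"
    by (rule chord_set[OF tl(1)]; simp add: P' ne lab2 mem)+
  have L: "{p \<in> P. lab p \<in> C' - C} = {a, b, c, k, l, m}"
  proof -
    have "{p \<in> P. lab p \<in> C' - C} = {p \<in> P. lab p = x} \<union> {p \<in> P. lab p = y} \<union> {p \<in> P. lab p = z}"
      using xyz unfolding C' by auto
    then show ?thesis unfolding X by auto
  qed
  have L': "{p \<in> P. lab' p \<in> C' - C} = {a, b, c, k, l, m}"
  proof -
    have "{p \<in> P. lab' p \<in> C' - C} = {p \<in> P. lab' p = x} \<union> {p \<in> P. lab' p = y} \<union> {p \<in> P. lab' p = z}"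
      using xyz unfolding C' by auto
    then show ?thesis unfolding X' by auto
  qed
  have o: "opp P lab C' a = b" "opp P lab C' b = a" "opp P lab C' k = c" "opp P lab C' c = k" "opp P lab C' l = m" "opp P lab C' m = l"
    by (rule opp_eq[OF ch]; simp add: P' ne lab mem)+
  have o': "opp P lab' C' a = m" "opp P lab' C' m = a" "opp P lab' C' k = l" "opp P lab' C' l = k" "opp P lab' C' b = c" "opp P lab' C' c = b"
    by (rule opp_eq[OF tl(1)]; simp add: P' ne lab2 mem)+
  define \<sigma> where "\<sigma> = swap c m \<circ> (swap b l \<circ> swap a k)"
  have \<sigma>: "\<sigma> a = k" "\<sigma> k = a" "\<sigma> b = l" "\<sigma> l = b" "\<sigma> c = m" "\<sigma> m = c" "\<And>p. p \<notin> {a, b, c, k, l, m} \<Longrightarrow> \<sigma> p = p"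
    unfolding \<sigma>_def by (simp_all add: ne Transposition.transpose_def)
  define \<tau> where "\<tau> = swap c m \<circ> (swap b l \<circ> (swap a k \<circ> (opp P lab C \<circ> nx)))"
  have \<tau>: "\<tau> p = \<sigma> (opp P lab C (nx p))" for p by (simp add: \<tau>_def \<sigma>_def)
  define \<theta> :: "'p + 'c \<Rightarrow> 'p + 'c" where "\<theta> = id(Inl k := Inl b, Inl l := Inl a, Inl m := Inl k, Inl a := Inl c, Inl b := Inl m, Inl c := Inl l)"
  define \<theta>' :: "'p + 'c \<Rightarrow> 'p + 'c" where "\<theta>' = id(Inl m := Inl b, Inl l := Inl c, Inl k := Inl m, Inl c := Inl a, Inl b := Inl k, Inl a := Inl l)"
  have \<theta>: "\<theta> (Inl (\<sigma> (opp P lab C r))) = Inl (opp P lab C' r)" if "r \<in> P" for r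
    by (rule reglue_crossings[where \<theta>=\<theta> and \<sigma>=\<sigma>, OF ch sub L that]; (elim insertE emptyE)?; simp add: \<sigma> \<theta>_def o ne)
  have \<theta>': "\<theta>' (Inl (\<sigma> (opp P lab C r))) = Inl (opp P lab' C' r)" if "r \<in> P" for r
    unfolding tl(2)[symmetric]
    by (rule reglue_crossings[where \<theta>=\<theta>' and \<sigma>=\<sigma>, OF tl(1) sub L' that]; (elim insertE emptyE)?; simp add: \<sigma> \<theta>'_def o' ne)
  have \<theta>b: "\<forall>r\<in>P. \<theta> (Inl (\<sigma> (opp P lab C r))) = Inl (opp P lab C' r)" by (rule ballI) (rule \<theta>)
  have \<theta>b': "\<forall>r\<in>P. \<theta>' (Inl (\<sigma> (opp P lab C r))) = Inl (opp P lab' C' r)" by (rule ballI) (rule \<theta>')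
  have \<theta>r: "\<theta> (Inr d) = Inr d" "\<theta>' (Inr d) = Inr d" for d by (simp_all add: \<theta>_def \<theta>'_def)
  have C2: "C' = insert z (insert y (insert x C))" unfolding C' by auto
  have main: "eight P (opp P lab C' \<circ> nx) lab \<kappa> n S x y z = eight P (opp P lab' C' \<circ> nx) lab' \<kappa> n S z y x" if S: "S \<subseteq> C" for S
  proof -
    let ?R = "Inl ` (P - {a, b, c}) \<union> Inr ` S :: ('p + 'c) set" and ?Q = "Inl ` {p \<in> P. lab p \<in> S} \<union> Inr ` S :: ('p + 'c) set"
    have t1: "triangle f \<epsilon> ?R (map_sum \<tau> id) ?Q (port_lab \<kappa> lab) (Inl k) (Inl l) (Inl m) (Inl a) (Inl b) (Inl c) (Inr x) (Inr y) (Inr z) (\<kappa> x) (\<kappa> y) (\<kappa> z) (port_lab \<kappa> lab)"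
      by (rule triangle_setup[OF ch C' \<kappa> S xyz P labs lab'_def nx \<tau>_def refl refl]) (use ne xyz(4) in auto)
    \<comment> \<open>After the move the crossing met first is \<open>z\<close> and the one met last
      is \<open>x\<close>; hence \<open>k\<close> and \<open>m\<close>, \<open>a\<close> and
      \<open>c\<close>, \<open>x\<close> and \<open>z\<close> exchange their roles.\<close>
    have t2: "triangle f \<epsilon> ?R (map_sum \<tau> id) ?Q (port_lab \<kappa> lab) (Inl m) (Inl l) (Inl k) (Inl c) (Inl b) (Inl a) (Inr z) (Inr y) (Inr x) (\<kappa> z) (\<kappa> y) (\<kappa> x) (port_lab \<kappa> lab')"
      by (rule triangle_setup[OF ch C' \<kappa> S xyz P labs lab'_def nx \<tau>_def refl refl]) (use ne xyz(4) in auto)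
    have R2: "?R = Inl ` (P - {c, b, a}) \<union> Inr ` S" by auto
    have Q2: "?Q = Inl ` {p \<in> P. lab' p \<in> S} \<union> Inr ` S" unfolding tl(3)[OF S] ..
    have abc: "{a, b, c} \<subseteq> P" "{c, b, a} \<subseteq> P" using P(1) by auto
    have lb1: "port_lab \<kappa> lab (Inl a) = \<kappa> x" "port_lab \<kappa> lab (Inl b) = \<kappa> x" "port_lab \<kappa> lab (Inl k) = \<kappa> y" "port_lab \<kappa> lab (Inl c) = \<kappa> y" "port_lab \<kappa> lab (Inl l) = \<kappa> z" "port_lab \<kappa> lab (Inl m) = \<kappa> z"
      by (simp_all add: lab)
    note 1 = trans[OF eight_F[where \<kappa>=\<kappa> and n=n and \<theta>=\<theta> and \<sigma>=\<sigma> and labo=lab and \<tau>=\<tau>, OF ch C' S abc(1) \<theta>b \<theta>r(1) \<tau> refl refl X refl]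
        triangle.acyclic_sum[OF t1 lb1 \<theta>_def]]
    have lb2: "port_lab \<kappa> lab' (Inl c) = \<kappa> z" "port_lab \<kappa> lab' (Inl b) = \<kappa> z" "port_lab \<kappa> lab' (Inl m) = \<kappa> y" "port_lab \<kappa> lab' (Inl a) = \<kappa> y" "port_lab \<kappa> lab' (Inl l) = \<kappa> x" "port_lab \<kappa> lab' (Inl k) = \<kappa> x"
      by (simp_all add: lab2)
    note 2 = trans[OF eight_F[where \<kappa>=\<kappa> and n=n and \<theta>=\<theta>' and \<sigma>=\<sigma> and labo=lab and \<tau>=\<tau>, OF tl(1) C2 S abc(2) \<theta>b' \<theta>r(2) \<tau> R2 Q2 X' refl]
        triangle.acyclic_sum[OF t2 lb2 \<theta>'_def]]
    show ?thesis unfolding 1 2 by (rule triangle.acyclic_sym[OF t1])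
  qed
  have d: "x \<noteq> y" "x \<noteq> z" "y \<noteq> z" using xyz(4) by simp_all
  show ?thesis
    unfolding lab'_def[symmetric] C' B_eight[OF fin xyz(1-3) d]
    unfolding C'[symmetric]
    by (rule sum.cong[OF refl]) (simp add: main eight_commute(2)[of P _ lab' \<kappa> n _ z y x])
qed

text \<open>A cyclic triangle turns into a cyclic one. The three terms of direct gluings are
  permuted and the two hexagons are matched by \<open>cyclic_sym\<close>.\<close>

lemma B_R3_cyclic:
  fixes P :: "'p set" and lab :: "'p \<Rightarrow> 'c"
  assumes ch: "chords P nx lab C'" and C': "C' = insert x (insert y (insert z C))" and \<kappa>: "inj_on \<kappa> C'"
    and xyz: "x \<notin> C" "y \<notin> C" "z \<notin> C" "distinct [x, y, z]"
    and P: "{a, b, c, k, l, m} \<subseteq> P" "distinct [a, b, c, k, l, m]" and nx: "nx a = k" "nx b = l" "nx c = m"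
    and lab: "lab a = x" "lab l = x" "lab k = y" "lab c = y" "lab m = z" "lab b = z"
  shows "B P nx lab C' \<kappa> n = B P nx (lab(a := lab k, k := lab a, b := lab l, l := lab b, c := lab m, m := lab c)) C' \<kappa> n"
proof -
  define lab' where "lab' = lab(a := lab k, k := lab a, b := lab l, l := lab b, c := lab m, m := lab c)"
  have labs: "{lab a, lab b, lab c, lab k, lab l, lab m} \<subseteq> {x, y, z}" using lab by simp
  note tl = triangle_labels[OF ch C' xyz(1-3) P labs lab'_def]
  have P': "a \<in> P" "b \<in> P" "c \<in> P" "k \<in> P" "l \<in> P" "m \<in> P" using P(1) by auto
  have ne: "a \<noteq> b" "a \<noteq> c" "a \<noteq> k" "a \<noteq> l" "a \<noteq> m" "b \<noteq> c" "b \<noteq> k" "b \<noteq> l" "b \<noteq> m" "c \<noteq> k" "c \<noteq> l" "c \<noteq> m"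
    "k \<noteq> l" "k \<noteq> m" "l \<noteq> m" using P(2) by auto
  note ne = ne ne[symmetric]
  have lab2: "lab' a = y" "lab' k = x" "lab' b = x" "lab' l = z" "lab' c = z" "lab' m = y"
    using ne unfolding lab'_def by (simp_all add: lab)
  have sub: "C \<subseteq> C'" unfolding C' by blast
  have fin: "finite C" by (rule finite_crossings[OF chords_subset[OF ch sub]])
  have mem: "x \<in> C'" "y \<in> C'" "z \<in> C'" unfolding C' by simp_all
  have X: "{p \<in> P. lab p = x} = {a, l}" "{p \<in> P. lab p = y} = {k, c}" "{p \<in> P. lab p = z} = {m, b}"
    by (rule chord_set[OF ch]; simp add: P' ne lab mem)+
  have X': "{p \<in> P. lab' p = y} = {a, m}" "{p \<in> P. lab' p = x} = {k, b}" "{p \<in> P. lab' p = z} = {l, c}"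
    by (rule chord_set[OF tl(1)]; simp add: P' ne lab2 mem)+
  have L: "{p \<in> P. lab p \<in> C' - C} = {a, b, c, k, l, m}"
  proof -
    have "{p \<in> P. lab p \<in> C' - C} = {p \<in> P. lab p = x} \<union> {p \<in> P. lab p = y} \<union> {p \<in> P. lab p = z}"
      using xyz unfolding C' by auto
    then show ?thesis unfolding X by auto
  qed
  have L': "{p \<in> P. lab' p \<in> C' - C} = {a, b, c, k, l, m}"
  proof -
    have "{p \<in> P. lab' p \<in> C' - C} = {p \<in> P. lab' p = x} \<union> {p \<in> P. lab' p = y} \<union> {p \<in> P. lab' p = z}"
      using xyz unfolding C' by auto
    then show ?thesis unfolding X' by auto
  qed
  have o: "opp P lab C' a = l" "opp P lab C' l = a" "opp P lab C' k = c" "opp P lab C' c = k" "opp P lab C' b = m" "opp P lab C' m = b"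
    by (rule opp_eq[OF ch]; simp add: P' ne lab mem)+
  have o': "opp P lab' C' a = m" "opp P lab' C' m = a" "opp P lab' C' k = b" "opp P lab' C' b = k" "opp P lab' C' l = c" "opp P lab' C' c = l"
    by (rule opp_eq[OF tl(1)]; simp add: P' ne lab2 mem)+
  define \<sigma> where "\<sigma> = swap c m \<circ> (swap b l \<circ> swap a k)"
  have \<sigma>: "\<sigma> a = k" "\<sigma> k = a" "\<sigma> b = l" "\<sigma> l = b" "\<sigma> c = m" "\<sigma> m = c" "\<And>p. p \<notin> {a, b, c, k, l, m} \<Longrightarrow> \<sigma> p = p"
    unfolding \<sigma>_def by (simp_all add: ne Transposition.transpose_def)
  define \<tau> where "\<tau> = swap c m \<circ> (swap b l \<circ> (swap a k \<circ> (opp P lab C \<circ> nx)))"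
  have \<tau>: "\<tau> p = \<sigma> (opp P lab C (nx p))" for p by (simp add: \<tau>_def \<sigma>_def)
  define \<theta> :: "'p + 'c \<Rightarrow> 'p + 'c" where "\<theta> = id(Inl k := Inl l, Inl l := Inl m, Inl m := Inl k, Inl a := Inl c, Inl b := Inl a, Inl c := Inl b)"
  define \<theta>' :: "'p + 'c \<Rightarrow> 'p + 'c" where "\<theta>' = id(Inl k := Inl m, Inl m := Inl l, Inl l := Inl k, Inl a := Inl b, Inl c := Inl a, Inl b := Inl c)"
  have \<theta>: "\<theta> (Inl (\<sigma> (opp P lab C r))) = Inl (opp P lab C' r)" if "r \<in> P" for r
    by (rule reglue_crossings[where \<theta>=\<theta> and \<sigma>=\<sigma>, OF ch sub L that]; (elim insertE emptyE)?; simp add: \<sigma> \<theta>_def o ne)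
  have \<theta>': "\<theta>' (Inl (\<sigma> (opp P lab C r))) = Inl (opp P lab' C' r)" if "r \<in> P" for r
    unfolding tl(2)[symmetric]
    by (rule reglue_crossings[where \<theta>=\<theta>' and \<sigma>=\<sigma>, OF tl(1) sub L' that]; (elim insertE emptyE)?; simp add: \<sigma> \<theta>'_def o' ne)
  have \<theta>b: "\<forall>r\<in>P. \<theta> (Inl (\<sigma> (opp P lab C r))) = Inl (opp P lab C' r)" by (rule ballI) (rule \<theta>)
  have \<theta>b': "\<forall>r\<in>P. \<theta>' (Inl (\<sigma> (opp P lab C r))) = Inl (opp P lab' C' r)" by (rule ballI) (rule \<theta>')
  have \<theta>r: "\<theta> (Inr d) = Inr d" "\<theta>' (Inr d) = Inr d" for d by (simp_all add: \<theta>_def \<theta>'_def)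
  have C2: "C' = insert y (insert x (insert z C))" unfolding C' by auto
  have main: "eight P (opp P lab C' \<circ> nx) lab \<kappa> n S x y z = eight P (opp P lab' C' \<circ> nx) lab' \<kappa> n S y x z" if S: "S \<subseteq> C" for S
  proof -
    let ?R = "Inl ` (P - {a, b, c}) \<union> Inr ` S :: ('p + 'c) set" and ?Q = "Inl ` {p \<in> P. lab p \<in> S} \<union> Inr ` S :: ('p + 'c) set"
    have t1: "triangle f \<epsilon> ?R (map_sum \<tau> id) ?Q (port_lab \<kappa> lab) (Inl k) (Inl l) (Inl m) (Inl a) (Inl b) (Inl c) (Inr x) (Inr y) (Inr z) (\<kappa> x) (\<kappa> y) (\<kappa> z) (port_lab \<kappa> lab)"
      by (rule triangle_setup[OF ch C' \<kappa> S xyz P labs lab'_def nx \<tau>_def refl refl]) (use ne xyz(4) in auto)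
    \<comment> \<open>The move reverses the cyclic sense: read from \<open>k\<close> again, the
      strands \<open>l\<close> and \<open>m\<close>, the edges \<open>b\<close> and
      \<open>c\<close>, and the crossings \<open>x\<close> and \<open>y\<close> exchange their
      roles.\<close>
    have t2: "triangle f \<epsilon> ?R (map_sum \<tau> id) ?Q (port_lab \<kappa> lab) (Inl k) (Inl m) (Inl l) (Inl a) (Inl c) (Inl b) (Inr y) (Inr x) (Inr z) (\<kappa> y) (\<kappa> x) (\<kappa> z) (port_lab \<kappa> lab')"
      by (rule triangle_setup[OF ch C' \<kappa> S xyz P labs lab'_def nx \<tau>_def refl refl]) (use ne xyz(4) in auto)
    have R2: "?R = Inl ` (P - {a, c, b}) \<union> Inr ` S" by auto
    have Q2: "?Q = Inl ` {p \<in> P. lab' p \<in> S} \<union> Inr ` S" unfolding tl(3)[OF S] ..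
    have abc: "{a, b, c} \<subseteq> P" "{a, c, b} \<subseteq> P" using P(1) by auto
    have lb1: "port_lab \<kappa> lab (Inl a) = \<kappa> x" "port_lab \<kappa> lab (Inl l) = \<kappa> x" "port_lab \<kappa> lab (Inl k) = \<kappa> y" "port_lab \<kappa> lab (Inl c) = \<kappa> y" "port_lab \<kappa> lab (Inl m) = \<kappa> z" "port_lab \<kappa> lab (Inl b) = \<kappa> z"
      by (simp_all add: lab)
    note 1 = trans[OF eight_F[where \<kappa>=\<kappa> and n=n and \<theta>=\<theta> and \<sigma>=\<sigma> and labo=lab and \<tau>=\<tau>, OF ch C' S abc(1) \<theta>b \<theta>r(1) \<tau> refl refl X refl]
        triangle.cyclic_sum[OF t1 lb1 \<theta>_def]]
    have lb2: "port_lab \<kappa> lab' (Inl a) = \<kappa> y" "port_lab \<kappa> lab' (Inl m) = \<kappa> y" "port_lab \<kappa> lab' (Inl k) = \<kappa> x" "port_lab \<kappa> lab' (Inl b) = \<kappa> x" "port_lab \<kappa> lab' (Inl l) = \<kappa> z" "port_lab \<kappa> lab' (Inl c) = \<kappa> z"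
      by (simp_all add: lab2)
    note 2 = trans[OF eight_F[where \<kappa>=\<kappa> and n=n and \<theta>=\<theta>' and \<sigma>=\<sigma> and labo=lab and \<tau>=\<tau>, OF tl(1) C2 S abc(2) \<theta>b' \<theta>r(2) \<tau> R2 Q2 X' refl]
        triangle.cyclic_sum[OF t2 lb2 \<theta>'_def]]
    have tw: "id(Inl m := Inl l, Inl l := Inl m) = (id(Inl l := Inl m, Inl m := Inl l) :: 'p + 'c \<Rightarrow> 'p + 'c)"
      by (rule fun_upd_twist) (simp add: ne)
    show ?thesis unfolding 1 2 tw triangle.cyclic_sym[OF t1] by (simp only: add_ac)
  qed
  have d: "x \<noteq> y" "x \<noteq> z" "y \<noteq> z" using xyz(4) by simp_all
  show ?thesis
    unfolding lab'_def[symmetric] C' B_eight[OF fin xyz(1-3) d]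
    unfolding C'[symmetric]
    by (rule sum.cong[OF refl]) (simp add: main eight_commute(1)[of P _ lab' \<kappa> n _ y x z])
qed

text \<open>
  Each strand joins two of the crossings, so the strands orient the edges of a triangle with the
  crossings as corners: six orientations are acyclic, two are cyclic.
\<close>

lemma B_R3:
  fixes P :: "'p set" and lab :: "'p \<Rightarrow> 'c"
  assumes ch: "chords P nx lab C'" and C': "C' = insert x (insert y (insert z C))" and \<kappa>: "inj_on \<kappa> C'"
    and xyz: "x \<notin> C" "y \<notin> C" "z \<notin> C" "distinct [x, y, z]"
    and P: "{a, b, c, k, l, m} \<subseteq> P" "distinct [a, b, c, k, l, m]" and nx: "nx a = k" "nx b = l" "nx c = m"
    and lab: "lab a = x \<and> lab k = y \<or> lab a = y \<and> lab k = x" "lab b = x \<and> lab l = z \<or> lab b = z \<and> lab l = x"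
      "lab c = y \<and> lab m = z \<or> lab c = z \<and> lab m = y"
    and lab': "\<And>p. p \<notin> {a, b, c, k, l, m} \<Longrightarrow> lab' p = lab p" "lab' a = lab k" "lab' k = lab a" "lab' b = lab l" "lab' l = lab b"
      "lab' c = lab m" "lab' m = lab c"
  shows "B P nx lab C' \<kappa> n = B P nx lab' C' \<kappa> n"
proof -
  have ne: "a \<noteq> b" "a \<noteq> c" "a \<noteq> k" "a \<noteq> l" "a \<noteq> m" "b \<noteq> c" "b \<noteq> k" "b \<noteq> l" "b \<noteq> m" "c \<noteq> k" "c \<noteq> l" "c \<noteq> m"
    "k \<noteq> l" "k \<noteq> m" "l \<noteq> m" using P(2) by auto
  note ne = ne ne[symmetric]
  have P': "a \<in> P" "b \<in> P" "c \<in> P" "k \<in> P" "l \<in> P" "m \<in> P" using P(1) by auto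
  have d: "x \<noteq> y" "x \<noteq> z" "y \<noteq> z" using xyz(4) by simp_all
  note d = d d[symmetric]
  \<comment> \<open>The exchanges on different strands commute. All orders are provided because the
    cases below let the strands play different roles.\<close>
  have 1: "lab' = lab(a := lab k, k := lab a, b := lab l, l := lab b, c := lab m, m := lab c)"
    and 2: "lab' = lab(b := lab l, l := lab b, a := lab k, k := lab a, c := lab m, m := lab c)"
    and 3: "lab' = lab(a := lab k, k := lab a, c := lab m, m := lab c, b := lab l, l := lab b)"
    and 4: "lab' = lab(b := lab l, l := lab b, c := lab m, m := lab c, a := lab k, k := lab a)"
    and 5: "lab' = lab(c := lab m, m := lab c, a := lab k, k := lab a, b := lab l, l := lab b)"
    and 6: "lab' = lab(c := lab m, m := lab c, b := lab l, l := lab b, a := lab k, k := lab a)"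
    by (rule ext; simp add: lab' ne)+
  have sets: "C' = insert x (insert z (insert y C))" "C' = insert y (insert x (insert z C))"
    "C' = insert y (insert z (insert x C))" "C' = insert z (insert x (insert y C))" "C' = insert z (insert y (insert x C))"
    unfolding C' by auto
  have case1: ?thesis if l: "lab a = x" "lab k = y" "lab b = x" "lab l = z" "lab c = y" "lab m = z"
    by (subst 1, rule B_R3_acyclic[where x = x and y = y and z = z and C = C and a = a and b = b and c = c and k = k and l = l and m = m,
          OF ch C' \<kappa>]; simp add: xyz(1-3) d P' ne nx l)
  have case2: ?thesis if l: "lab a = x" "lab k = y" "lab b = x" "lab l = z" "lab c = z" "lab m = y"
    by (subst 2, rule B_R3_acyclic[where x = x and y = z and z = y and C = C and a = b and b = a and c = c and k = l and l = k and m = m,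
          OF ch sets(1) \<kappa>]; simp add: xyz(1-3) d P' ne nx l)
  have case3: ?thesis if l: "lab a = x" "lab k = y" "lab b = z" "lab l = x" "lab c = y" "lab m = z"
    by (subst 1, rule B_R3_cyclic[where x = x and y = y and z = z and C = C and a = a and b = b and c = c and k = k and l = l and m = m,
          OF ch C' \<kappa>]; simp add: xyz(1-3) d P' ne nx l)
  have case4: ?thesis if l: "lab a = x" "lab k = y" "lab b = z" "lab l = x" "lab c = z" "lab m = y"
    by (subst 4, rule B_R3_acyclic[where x = z and y = x and z = y and C = C and a = b and b = c and c = a and k = l and l = m and m = k,
          OF ch sets(4) \<kappa>]; simp add: xyz(1-3) d P' ne nx l)
  have case5: ?thesis if l: "lab a = y" "lab k = x" "lab b = x" "lab l = z" "lab c = y" "lab m = z"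
    by (subst 3, rule B_R3_acyclic[where x = y and y = x and z = z and C = C and a = a and b = c and c = b and k = k and l = m and m = l,
          OF ch sets(2) \<kappa>]; simp add: xyz(1-3) d P' ne nx l)
  have case6: ?thesis if l: "lab a = y" "lab k = x" "lab b = x" "lab l = z" "lab c = z" "lab m = y"
    by (subst 3, rule B_R3_cyclic[where x = y and y = x and z = z and C = C and a = a and b = c and c = b and k = k and l = m and m = l,
          OF ch sets(2) \<kappa>]; simp add: xyz(1-3) d P' ne nx l)
  have case7: ?thesis if l: "lab a = y" "lab k = x" "lab b = z" "lab l = x" "lab c = y" "lab m = z"
    by (subst 5, rule B_R3_acyclic[where x = y and y = z and z = x and C = C and a = c and b = a and c = b and k = m and l = k and m = l,
          OF ch sets(3) \<kappa>]; simp add: xyz(1-3) d P' ne nx l)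
  have case8: ?thesis if l: "lab a = y" "lab k = x" "lab b = z" "lab l = x" "lab c = z" "lab m = y"
    by (subst 6, rule B_R3_acyclic[where x = z and y = y and z = x and C = C and a = c and b = b and c = a and k = m and l = l and m = k,
          OF ch sets(5) \<kappa>]; simp add: xyz(1-3) d P' ne nx l)
  from lab show ?thesis
    by (elim disjE conjE)
      ((rule case1, assumption, assumption, assumption, assumption, assumption, assumption)
      | (rule case2, assumption, assumption, assumption, assumption, assumption, assumption)
      | (rule case3, assumption, assumption, assumption, assumption, assumption, assumption)
      | (rule case4, assumption, assumption, assumption, assumption, assumption, assumption)
      | (rule case5, assumption, assumption, assumption, assumption, assumption, assumption)
      | (rule case6, assumption, assumption, assumption, assumption, assumption, assumption)
      | (rule case7, assumption, assumption, assumption, assumption, assumption, assumption)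
      | (rule case8, assumption, assumption, assumption, assumption, assumption, assumption))+
qed

end

subsection \<open>Marks on a link\<close>

definition next_mark :: "(nat \<times> real) set \<Rightarrow> nat \<times> real \<Rightarrow> nat \<times> real" where
  "next_mark M = (\<lambda>(i, t). (i, frac (t + Min {d. 0 < d \<and> d \<le> 1 \<and> (i, frac (t + d)) \<in> M})))"

lemma next_param_eq: "next_param D = next_mark (cparams D)"
  by (simp add: next_param_def next_mark_def)

lemma frac_eq_shift: "frac s = frac t \<longleftrightarrow> (\<exists>n::int. s = t + of_int n)" for s t :: real
proof
  assume "frac s = frac t"
  then have "s = t + of_int (\<lfloor>s\<rfloor> - \<lfloor>t\<rfloor>)" unfolding frac_def by simp
  then show "\<exists>n::int. s = t + of_int n" by blast
qed (auto simp: frac_def)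

lemma frac_add_frac: "frac (frac t + d) = frac (t + d)" for t d :: real
  unfolding frac_eq_shift by (rule exI[of _ "- \<lfloor>t\<rfloor>"]) (simp add: frac_def)

lemma frac_neq:
  fixes s t :: real
  assumes "s < t" "t < s + 1"
  shows "frac s \<noteq> frac t"
proof
  assume "frac s = frac t"
  then obtain n :: int where n: "s = t + of_int n" unfolding frac_eq_shift by blast
  then have "real_of_int n < 0" "- 1 < real_of_int n" using assms by simp_all
  then have "n < 0" "- 1 < n" by linarith+
  then show False by simp
qed

lemma frac_unique: "0 \<le> t \<Longrightarrow> t < 1 \<Longrightarrow> frac t = t" for t :: real
  by (simp add: frac_eq)

lemma finite_gaps:
  fixes t :: real
  assumes "finite M"
  shows "finite {d. 0 < d \<and> d \<le> 1 \<and> (i, frac (t + d)) \<in> M}"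
proof (rule inj_on_finite[OF _ _ assms])
  show "inj_on (\<lambda>d. (i, frac (t + d))) {d. 0 < d \<and> d \<le> 1 \<and> (i, frac (t + d)) \<in> M}"
  proof (rule inj_onI)
    fix d e assume de: "d \<in> {d. 0 < d \<and> d \<le> 1 \<and> (i, frac (t + d)) \<in> M}"
      "e \<in> {d. 0 < d \<and> d \<le> 1 \<and> (i, frac (t + d)) \<in> M}" "(i, frac (t + d)) = (i, frac (t + e))"
    then show "d = e"
      using frac_neq[of "t + d" "t + e"] frac_neq[of "t + e" "t + d"] by (cases d e rule: linorder_cases) auto
  qed
qed auto

text \<open>Lifted to the real line, the successor is the first mark after \<open>t\<close>. The
  bound \<open>u \<le> t + 1\<close> comes for free: otherwise \<open>u - 1\<close> would be an
  earlier lift of the same mark.\<close>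

lemma next_mark_eq:
  assumes "finite M" "(i, frac u) \<in> M" "t < u" "\<And>v. t < v \<Longrightarrow> v < u \<Longrightarrow> (i, frac v) \<notin> M"
  shows "next_mark M (i, frac t) = (i, frac u)"
proof -
  have u: "u \<le> t + 1"
  proof (rule ccontr)
    assume "\<not> u \<le> t + 1"
    moreover have "frac (u - 1) = frac u" unfolding frac_eq_shift by (rule exI[of _ "-1"]) simp
    ultimately show False using assms(2) assms(4)[of "u - 1"] by simp
  qed
  have "Min {d. 0 < d \<and> d \<le> 1 \<and> (i, frac (frac t + d)) \<in> M} = u - t"
    unfolding frac_add_frac
  proof (rule Min_eqI[OF finite_gaps[OF assms(1)]])
    fix d assume "d \<in> {d. 0 < d \<and> d \<le> 1 \<and> (i, frac (t + d)) \<in> M}"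
    then show "u - t \<le> d" using assms(4)[of "t + d"] by (cases "u - t \<le> d") auto
  qed (use u assms in simp)
  then show ?thesis by (simp add: next_mark_def frac_add_frac)
qed

lemma next_mark_ex:
  fixes t w :: real
  assumes "finite M" "(i, w) \<in> M" "0 \<le> w" "w < 1"
  obtains u where "t < u" "u \<le> t + 1" "(i, frac u) \<in> M" "\<And>v. t < v \<Longrightarrow> v < u \<Longrightarrow> (i, frac v) \<notin> M"
proof -
  let ?G = "{d. 0 < d \<and> d \<le> 1 \<and> (i, frac (t + d)) \<in> M}"
  have fin: "finite ?G" by (rule finite_gaps[OF assms(1)])
  \<comment> \<open>The distance from \<open>t\<close> forward to the mark \<open>w\<close>; it is a
    full turn if the two coincide modulo 1, since a gap must be positive.\<close>
  define d where "d = (if frac (w - t) = 0 then 1 else frac (w - t))"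
  have "t + d = w + of_int ((if frac (w - t) = 0 then 1 else 0) - \<lfloor>w - t\<rfloor>)" by (auto simp: d_def frac_def)
  then have "frac (t + d) = frac w" using frac_eq_shift by blast
  then have "d \<in> ?G"
    using assms frac_ge_0[of "w - t"] frac_lt_1[of "w - t"] by (auto simp: d_def frac_unique split: if_splits)
  then have ne: "?G \<noteq> {}" by blast
  have m: "Min ?G \<in> ?G" by (rule Min_in[OF fin ne])
  show ?thesis
  proof (rule that[of "t + Min ?G"])
    show "(i, frac v) \<notin> M" if v: "t < v" "v < t + Min ?G" for v
    proof
      assume "(i, frac v) \<in> M"
      then have "v - t \<in> ?G" using v m by auto
      then have "Min ?G \<le> v - t" by (rule Min_le[OF fin])
      then show False using v by simp
    qed
  qed (use m in auto)
qed

definition marks :: "nat \<Rightarrow> (nat \<times> real) set \<Rightarrow> bool" where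
  "marks n M \<longleftrightarrow> finite M \<and> M \<subseteq> {..<n} \<times> {0..<1}"

lemma marks_mem:
  assumes "marks n M" "p \<in> M"
  obtains i t where "p = (i, t)" "0 \<le> t" "t < 1" "i < n"
  using assms unfolding marks_def by (cases p) auto

lemma marks_next:
  assumes M: "marks n M" and p: "p \<in> M"
  obtains i t u where "p = (i, t)" "0 \<le> t" "t < 1" "frac t = t" "t < u" "u \<le> t + 1" "(i, frac u) \<in> M"
    "\<And>v. t < v \<Longrightarrow> v < u \<Longrightarrow> (i, frac v) \<notin> M" "next_mark M p = (i, frac u)"
proof -
  obtain i t where it: "p = (i, t)" "0 \<le> t" "t < 1" using marks_mem[OF M p] by metis
  have fin: "finite M" using M by (simp add: marks_def)
  obtain u where u: "t < u" "u \<le> t + 1" "(i, frac u) \<in> M" "\<And>v. t < v \<Longrightarrow> v < u \<Longrightarrow> (i, frac v) \<notin> M"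
    using next_mark_ex[OF fin _ it(2,3), of i t] p it(1) by metis
  show ?thesis
    using that[OF it frac_unique[OF it(2,3)] u] next_mark_eq[OF fin u(3,1,4)] it frac_unique[OF it(2,3)] by simp
qed

text \<open>For marks \<open>s < t\<close> on one component, the successor of \<open>s\<close> has a
  lift \<open>u\<close> with \<open>s < u \<le> t\<close>, and that of \<open>t\<close> a lift
  \<open>w\<close> with \<open>t < w \<le> s + 1\<close>. These are distinct modulo 1, which gives
  injectivity; finiteness does the rest.\<close>

lemma perm_next_mark:
  assumes "marks n M"
  shows "perm M (next_mark M)"
proof -
  have fin: "finite M" using assms by (simp add: marks_def)
  have into: "next_mark M ` M \<subseteq> M"
  proof (rule image_subsetI)
    fix p assume "p \<in> M"
    then show "next_mark M p \<in> M" using marks_next[OF assms] by metis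
  qed
  have less: "next_mark M (i, s) \<noteq> next_mark M (i, t)" if mem: "(i, s) \<in> M" "(i, t) \<in> M" "s < t" for i s t
  proof
    assume eq: "next_mark M (i, s) = next_mark M (i, t)"
    obtain u where u: "0 \<le> s" "frac s = s" "s < u" "\<And>v. s < v \<Longrightarrow> v < u \<Longrightarrow> (i, frac v) \<notin> M" "next_mark M (i, s) = (i, frac u)"
      using marks_next[OF assms mem(1)] by (metis Pair_inject)
    obtain w where w: "t < 1" "frac t = t" "t < w" "\<And>v. t < v \<Longrightarrow> v < w \<Longrightarrow> (i, frac v) \<notin> M" "next_mark M (i, t) = (i, frac w)"
      using marks_next[OF assms mem(2)] by (metis Pair_inject)
    have "u \<le> t" using u(4)[of t] mem w(2) by force
    moreover have "frac (s + 1) = s" using u(2) frac_eq_shift[of "s + 1" s] by (metis of_int_1)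
    then have "w \<le> s + 1" using w(4)[of "s + 1"] mem u(1) w(1) by force
    ultimately have "frac u \<noteq> frac w" using u(3) w(3) by (intro frac_neq) auto
    then show False using eq u(5) w(5) by simp
  qed
  have "inj_on (next_mark M) M"
  proof (rule inj_onI)
    fix p q assume pq: "p \<in> M" "q \<in> M" "next_mark M p = next_mark M q"
    obtain i s where p: "p = (i, s)" by (cases p)
    obtain j t where q: "q = (j, t)" by (cases q)
    have "i = j" using pq(3) unfolding p q by (simp add: next_mark_def)
    then show "p = q" using less[of i s t] less[of i t s] pq unfolding p q by (metis linorder_neqE)
  qed
  then have "bij_betw (next_mark M) M M"
    using endo_inj_surj[OF fin into] by (simp add: bij_betw_def)
  then show ?thesis using fin by (simp add: perm_def)
qed

text \<open>This is the form of the new successor map that \<open>B_skip\<close> asks for.\<close>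

lemma next_mark_remove:
  assumes M: "marks n M" and q: "q \<in> M" and p: "p \<in> M - {q}"
  shows "next_mark (M - {q}) p = (if next_mark M p = q then next_mark M q else next_mark M p)"
proof -
  have fin: "finite (M - {q})" using M by (simp add: marks_def)
  obtain i t u where u: "p = (i, t)" "0 \<le> t" "frac t = t" "t < u" "(i, frac u) \<in> M" "\<And>v. t < v \<Longrightarrow> v < u \<Longrightarrow> (i, frac v) \<notin> M"
    "next_mark M p = (i, frac u)"
    using marks_next[OF M, of p] p by (metis Diff_iff)
  show ?thesis
  proof (cases "(i, frac u) = q")
    case False
    have "next_mark (M - {q}) (i, frac t) = (i, frac u)"
      by (rule next_mark_eq[OF fin _ u(4)]) (use u False in auto)
    then show ?thesis using u False by simp
  next
    case True
    obtain w where w: "u < w" "(i, frac w) \<in> M" "\<And>v. u < v \<Longrightarrow> v < w \<Longrightarrow> (i, frac v) \<notin> M"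
      using next_mark_ex[of M i t u] M p u(1,2) marks_mem[OF M, of p] unfolding marks_def by (metis DiffD1 Pair_inject)
    have nq: "next_mark M q = (i, frac w)"
      unfolding True[symmetric] by (rule next_mark_eq[OF _ w(2,1,3)]) (use M in \<open>auto simp: marks_def\<close>)
    have "next_mark M p = q" using u True by simp
    then have "next_mark M q \<noteq> q" using perm_inj[OF perm_next_mark[OF M], of p q] p q by auto
    then have wq: "(i, frac w) \<in> M - {q}" using w nq by auto
    have "next_mark (M - {q}) (i, frac t) = (i, frac w)"
    proof (rule next_mark_eq[OF fin wq])
      show "t < w" using u w by simp
      show "(i, frac v) \<notin> M - {q}" if "t < v" "v < w" for v
        using that u(6)[of v] w(3)[of v] True by (cases v u rule: linorder_cases) auto
    qed
    then show ?thesis using u True nq by simp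
  qed
qed

definition unmarked :: "nat \<Rightarrow> (nat \<times> real) set \<Rightarrow> nat" where
  "unmarked n M = card {i. i < n \<and> (\<forall>t. (i, t) \<notin> M)}"

text \<open>A component loses its last mark just if that mark was its own successor. The count thus
  changes exactly as the circle count does in \<open>B_skip\<close>.\<close>

lemma unmarked_remove:
  assumes M: "marks n M" and q: "q \<in> M"
  shows "unmarked n (M - {q}) = (if next_mark M q = q then Suc (unmarked n M) else unmarked n M)"
proof -
  obtain i t u where u: "q = (i, t)" "0 \<le> t" "t < 1" "frac t = t" "t < u" "u \<le> t + 1" "(i, frac u) \<in> M"
    "\<And>v. t < v \<Longrightarrow> v < u \<Longrightarrow> (i, frac v) \<notin> M" "next_mark M q = (i, frac u)"
    using marks_next[OF M q] by metis
  have i: "i < n" using M q u(1) by (auto simp: marks_def)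
  show ?thesis
  proof (cases "next_mark M q = q")
    case True
    then have "frac u = frac t" using u by simp
    then have u1: "u = t + 1" using frac_neq[of t u] u by force
    have none: "(i, s) \<notin> M - {q}" for s
    proof
      assume s: "(i, s) \<in> M - {q}"
      then have s01: "0 \<le> s" "s < 1" "s \<noteq> t" using M u(1) by (auto simp: marks_def)
      have "frac (s + 1) = frac s" unfolding frac_eq_shift by (rule exI[of _ 1]) simp
      then have "(i, frac s) \<in> M" "(i, frac (s + 1)) \<in> M" using s s01 by (simp_all add: frac_unique)
      then show False using u(8)[of s] u(8)[of "s + 1"] s01 u(2,3) u1 by (cases s t rule: linorder_cases) auto
    qed
    have "{j. j < n \<and> (\<forall>t. (j, t) \<notin> M - {q})} = insert i {j. j < n \<and> (\<forall>t. (j, t) \<notin> M)}"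
      using none i u(1) by auto
    moreover have "i \<notin> {j. j < n \<and> (\<forall>t. (j, t) \<notin> M)}" using q u(1) by auto
    ultimately show ?thesis using True by (simp add: unmarked_def)
  next
    case False
    then have "{j. j < n \<and> (\<forall>t. (j, t) \<notin> M - {q})} = {j. j < n \<and> (\<forall>t. (j, t) \<notin> M)}"
      using u(1,7,9) by auto
    then show ?thesis using False by (simp add: unmarked_def)
  qed
qed

section \<open>State sums of marked links\<close>

definition chord_marks :: "nat \<Rightarrow> (nat \<times> real) set \<Rightarrow> (nat \<times> real \<Rightarrow> 'c) \<Rightarrow> 'c set \<Rightarrow> bool" where
  "chord_marks n M lab C \<longleftrightarrow> marks n M \<and> (\<forall>c\<in>C. card {p \<in> M. lab p = c} = 2)"

lemma chord_marks_chords: "chord_marks n M lab C \<Longrightarrow> chords M (next_mark M) lab C"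
  using perm_next_mark by (auto simp: chord_marks_def chords_def)

lemma chord_marks_insert:
  assumes "chord_marks n M lab C" "i < n" "lab (i, frac t) \<notin> C"
  shows "chord_marks n (insert (i, frac t) M) lab C"
proof -
  have "{p \<in> insert (i, frac t) M. lab p = c} = {p \<in> M. lab p = c}" if "c \<in> C" for c
    using assms(3) that by auto
  then show ?thesis using assms by (auto simp: chord_marks_def marks_def frac_lt_1)
qed

context evaluation
begin

definition BM where
  "BM n M lab C \<kappa> = B M (next_mark M) lab C \<kappa> (unmarked n M)"

lemma BM_remove:
  assumes M: "chord_marks n M lab C" and q: "q \<in> M" "lab q \<notin> C"
  shows "BM n M lab C \<kappa> = BM n (M - {q}) lab C \<kappa>" "chord_marks n (M - {q}) lab C"
proof -
  have m: "marks n M" using M by (simp add: chord_marks_def)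
  show "BM n M lab C \<kappa> = BM n (M - {q}) lab C \<kappa>"
    unfolding BM_def unmarked_remove[OF m q(1)]
    by (rule B_skip(1)[OF chord_marks_chords[OF M] q next_mark_remove[OF m q(1)]])
  have "{p \<in> M - {q}. lab p = c} = {p \<in> M. lab p = c}" if "c \<in> C" for c using q(2) that by auto
  then show "chord_marks n (M - {q}) lab C" using M by (auto simp: chord_marks_def marks_def)
qed

lemma BM_restrict:
  assumes "chord_marks n M lab C" "M' \<subseteq> M" "\<And>p. p \<in> M - M' \<Longrightarrow> lab p \<notin> C"
  shows "BM n M lab C \<kappa> = BM n M' lab C \<kappa> \<and> chord_marks n M' lab C"
proof -
  have "finite (M - M')" using assms(1) by (auto simp: chord_marks_def marks_def)
  then show ?thesis using assms
  proof (induction "M - M'" arbitrary: M rule: finite_induct)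
    case empty
    then have "M = M'" by blast
    then show ?case using empty by simp
  next
    case (insert q A)
    have q: "q \<in> M" "lab q \<notin> C" "q \<notin> M'" using insert by blast+
    have "A = (M - {q}) - M'" using insert.hyps by blast
    then have "BM n (M - {q}) lab C \<kappa> = BM n M' lab C \<kappa> \<and> chord_marks n M' lab C"
      by (rule insert.hyps(3)) (use BM_remove(2)[OF insert.prems(1) q(1,2)] insert.prems q in auto)
    then show ?case using BM_remove(1)[OF insert.prems(1) q(1,2)] by simp
  qed
qed

lemma BM_relabel:
  assumes M: "chord_marks n M lab C" and h: "inj_on h C" "C' = h ` C"
    and lab': "\<And>p. p \<in> M \<Longrightarrow> lab p \<in> C \<Longrightarrow> lab' p = h (lab p)" "\<And>p. p \<in> M \<Longrightarrow> lab p \<notin> C \<Longrightarrow> lab' p \<notin> C'"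
    and \<kappa>: "inj_on \<kappa> C" "inj_on \<kappa>' C'"
  shows "BM n M lab C \<kappa> = BM n M lab' C' \<kappa>'"
  unfolding BM_def
  by (rule B_rename[where g = id and h = h, OF chord_marks_chords[OF M]]) (use assms in auto)

text \<open>
  A crossing passage may be moved back along a piece of the strand without marks: first put a
  mark at the new place, then let it take over the label, and remove the old one.
\<close>

lemma BM_slide:
  fixes lab :: "nat \<times> real \<Rightarrow> complex"
  assumes M: "chord_marks n M lab C" and \<kappa>: "inj_on \<kappa> C" and i: "i < n" and s: "(i, frac s) \<in> M"
    and r: "r < s" "s < r + 1" "\<And>v. r \<le> v \<Longrightarrow> v < s \<Longrightarrow> (i, frac v) \<notin> M"
    and M': "M' = insert (i, frac r) (M - {(i, frac s)})" and lab': "lab' = lab((i, frac r) := lab (i, frac s))"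
  shows "BM n M lab C \<kappa> = BM n M' lab' C \<kappa> \<and> chord_marks n M' lab' C"
proof -
  let ?r = "(i, frac r)" and ?s = "(i, frac s)"
  have rM: "?r \<notin> M" using r(3)[of r] r(1) by simp
  have ne: "?r \<noteq> ?s" using rM s by metis
  have finC: "finite C" by (rule finite_crossings[OF chord_marks_chords[OF M]])
  \<comment> \<open>The label \<open>d\<close> outside \<open>C\<close> designates a mere mark: in
    \<open>lab1\<close> the new place is the mark, in \<open>lab2\<close> the old one.\<close>
  obtain d where d: "d \<notin> C" using ex_new_if_finite[OF infinite_UNIV_char_0 finC] by blast
  define N where "N = insert ?r M"
  define lab1 where "lab1 = lab(?r := d)"
  define lab2 where "lab2 = lab(?r := lab ?s, ?s := d)"
  have labM: "{p \<in> M. lab1 p = c} = {p \<in> M. lab p = c}" for c using rM by (auto simp: lab1_def)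
  have M1: "chord_marks n M lab1 C" using M by (simp add: chord_marks_def labM)
  have N1: "chord_marks n N lab1 C"
    unfolding N_def by (rule chord_marks_insert[OF M1 i]) (simp add: lab1_def d)
  have mN: "marks n N" using N1 by (simp add: chord_marks_def)
  have a: "BM n M lab C \<kappa> = BM n M lab1 C \<kappa>"
    by (rule BM_relabel[where h = id, OF M]) (use \<kappa> rM in \<open>auto simp: lab1_def\<close>)
  have b: "BM n N lab1 C \<kappa> = BM n M lab1 C \<kappa>"
    using BM_remove(1)[OF N1, of ?r \<kappa>] rM by (simp add: N_def lab1_def d)
  have N2: "chord_marks n N lab2 C"
    unfolding chord_marks_def
  proof (intro conjI ballI mN)
    fix c assume c: "c \<in> C"
    have "{p \<in> N. lab2 p = c} = (if lab ?s = c then insert ?r ({p \<in> M. lab p = c} - {?s}) else {p \<in> M. lab p = c})"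
      using c d s rM ne unfolding N_def lab2_def by (auto split: if_splits)
    moreover have "card {p \<in> M. lab p = c} = 2" "finite {p \<in> M. lab p = c}"
      using M c by (auto simp: chord_marks_def marks_def)
    ultimately show "card {p \<in> N. lab2 p = c} = 2" using s rM by (auto simp: card_Diff_singleton)
  qed
  have next_r: "next_mark N ?r = ?s"
  proof (rule next_mark_eq)
    show "(i, frac v) \<notin> N" if v: "r < v" "v < s" for v
      using r(3)[of v] frac_neq[of r v] v r(2) unfolding N_def by auto
  qed (use mN s r in \<open>auto simp: N_def marks_def\<close>)
  let ?nx = "next_mark N"
  have pN: "perm N ?nx" by (rule perm_next_mark[OF mN])
  have rsN: "?r \<in> N" "?s \<in> N" using s by (auto simp: N_def)
  let ?n1 = "\<lambda>p. if ?nx p = ?r then ?nx ?r else ?nx p" and ?n2 = "\<lambda>p. if ?nx p = ?s then ?nx ?s else ?nx p"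
  have l: "lab1 ?r \<notin> C" "lab2 ?s \<notin> C" using d by (simp_all add: lab1_def lab2_def)
  have nr: "?nx ?r \<noteq> ?r" unfolding next_r using ne by simp
  have 1: "BM n N lab1 C \<kappa> = B (N - {?r}) ?n1 lab1 C \<kappa> (unmarked n N)"
    using B_skip(1)[where nx' = ?n1 and \<kappa> = \<kappa> and n = "unmarked n N", OF chord_marks_chords[OF N1] rsN(1) l(1) refl]
    unfolding BM_def if_not_P[OF nr] .
  have c1: "chords (N - {?r}) ?n1 lab1 C"
    by (rule B_skip(2)[OF chord_marks_chords[OF N1] rsN(1) l(1) refl])
  have ns: "?nx ?s \<noteq> ?s" using perm_inj[OF pN rsN] next_r ne by metis
  have 2: "BM n N lab2 C \<kappa> = B (N - {?s}) ?n2 lab2 C \<kappa> (unmarked n N)"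
    using B_skip(1)[where nx' = ?n2 and \<kappa> = \<kappa> and n = "unmarked n N", OF chord_marks_chords[OF N2] rsN(2) l(2) refl]
    unfolding BM_def if_not_P[OF ns] .
  \<comment> \<open>Both labellings live on the same mark set \<open>N\<close>. Skipping the mark
    \<open>?r\<close> in one and \<open>?s\<close> in the other gives the same chord diagram with
    the passage named \<open>?s\<close> or \<open>?r\<close>, because the two are
    neighbours.\<close>
  let ?g = "id(?s := ?r)"
  have inj: "inj_on ?g (N - {?r})" by (rule inj_onI) (auto split: if_splits)
  have "?g ` (N - {?r} - {?s}) = id ` (N - {?r} - {?s})" by (rule image_cong[OF refl]) auto
  then have ge: "?g ` (N - {?r} - {?s}) = N - {?r} - {?s}" by (simp only: image_id id_apply)
  have ins: "N - {?r} = insert ?s (N - {?r} - {?s})" using rsN ne by auto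
  have "?g ` (N - {?r}) = insert ?r (N - {?r} - {?s})" by (subst ins) (simp only: image_insert ge fun_upd_same)
  then have im: "N - {?s} = ?g ` (N - {?r})" using rsN ne by auto
  have conj: "?n2 (?g p) = ?g (?n1 p)" if p: "p \<in> N - {?r}" for p
  proof -
    have A: "?nx q = ?s \<longleftrightarrow> q = ?r" if "q \<in> N" for q
      using perm_inj[OF pN that rsN(1)] next_r by simp
    have "?nx p \<noteq> ?s" using A p by blast
    then show "?n2 (?g p) = ?g (?n1 p)" unfolding next_r using ne ns next_r by (cases "p = ?s") simp_all
  qed
  have labg: "lab2 (?g p) = lab1 p" if "p \<in> N - {?r}" for p
    using that ne by (cases "p = ?s") (simp_all add: lab1_def lab2_def)
  have 3: "B (N - {?r}) ?n1 lab1 C \<kappa> (unmarked n N) = B (N - {?s}) ?n2 lab2 C \<kappa> (unmarked n N)"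
    by (rule B_rename[where g = ?g and h = id, OF c1 inj im conj inj_on_id _ _ _ \<kappa> \<kappa>])
      (simp_all only: labg image_id id_apply not_False_eq_True)
  have 4: "BM n N lab2 C \<kappa> = BM n (N - {?s}) lab2 C \<kappa>" and c4: "chord_marks n (N - {?s}) lab2 C"
    using BM_remove[OF N2 rsN(2)] d by (simp_all add: lab2_def)
  have NM: "N - {?s} = M'" unfolding N_def M' using ne by auto
  have lab2': "lab2 p = lab' p" if "p \<in> M'" for p
    using that ne unfolding lab2_def lab' M' by auto
  have 5: "BM n M' lab2 C \<kappa> = BM n M' lab' C \<kappa>"
    by (rule BM_relabel[where h = id, OF c4[unfolded NM]]) (use \<kappa> lab2' in auto)
  have "{p \<in> M'. lab' p = c} = {p \<in> M'. lab2 p = c}" for c using lab2' by auto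
  then have "chord_marks n M' lab' C" using c4 unfolding NM chord_marks_def by simp
  then show ?thesis using a b 1 2 3 4 5 NM by simp
qed

end

subsection \<open>The bracket as a state sum\<close>

lemma map_sum_funpow:
  fixes f :: "'a \<Rightarrow> 'a"
  shows "(map_sum f (id :: 'b \<Rightarrow> 'b) ^^ k) (Inl p) = Inl ((f ^^ k) p)"
  by (induction k) simp_all

lemma ret_map_sum:
  fixes f :: "'a \<Rightarrow> 'a" and S :: "'b set"
  shows "ret (map_sum f id) (Inl ` A \<union> Inr ` S) (Inl p) = Inl (ret f A p)"
proof -
  have q: "(Inl q :: 'a + 'b) \<in> Inl ` A \<union> Inr ` S \<longleftrightarrow> q \<in> A" for q by auto
  show ?thesis by (simp only: ret_def map_sum_funpow q)
qed

lemma loops_image: "loops P \<phi> Q = orb \<phi> ` {p \<in> P. orb \<phi> p \<inter> Q = {}}"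
  unfolding loops_def image_def by (rule Collect_cong) auto

text \<open>The ports \<open>Inr s\<close> are active and therefore belong to no loop.\<close>

lemma loops_map_sum:
  fixes f :: "'a \<Rightarrow> 'a" and S :: "'b set"
  shows "loops (Inl ` P \<union> Inr ` S) (map_sum f id) (Inl ` A \<union> Inr ` S) = image Inl ` loops P f A"
proof -
  let ?P = "Inl ` P \<union> Inr ` S :: ('a + 'b) set" and ?A = "Inl ` A \<union> Inr ` S :: ('a + 'b) set"
  let ?m = "map_sum f (id :: 'b \<Rightarrow> 'b)"
  have orb: "orb ?m (Inl p) = Inl ` orb f p" for p
    by (simp only: orb_def map_sum_funpow image_image)
  have disj: "Inl ` X \<inter> ?A = {} \<longleftrightarrow> X \<inter> A = {}" for X :: "'a set" by auto
  have r: "orb ?m (Inr s) \<inter> ?A \<noteq> {}" if "s \<in> S" for s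
  proof -
    have "Inr s \<in> orb ?m (Inr s) \<inter> ?A" by (rule IntI[OF orb_self]) (simp add: that)
    then show ?thesis by (metis empty_iff)
  qed
  have eq: "{p \<in> ?P. orb ?m p \<inter> ?A = {}} = Inl ` {q \<in> P. orb f q \<inter> A = {}}"
  proof (rule set_eqI)
    fix p
    show "p \<in> {p \<in> ?P. orb ?m p \<inter> ?A = {}} \<longleftrightarrow> p \<in> Inl ` {q \<in> P. orb f q \<inter> A = {}}"
    proof (cases p)
      case (Inl q)
      have i: "Inl q \<in> ?P \<longleftrightarrow> q \<in> P" "(Inl q :: 'a + 'b) \<in> Inl ` Y \<longleftrightarrow> q \<in> Y" for Y by auto
      show ?thesis by (simp only: Inl mem_Collect_eq orb disj i)
    next
      case (Inr s)
      have i: "Inr s \<in> ?P \<longleftrightarrow> s \<in> S" "(Inr s :: 'a + 'b) \<in> Inl ` Y \<longleftrightarrow> False" for Y by auto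
      show ?thesis unfolding Inr mem_Collect_eq i using r[of s] by argo
    qed
  qed
  show ?thesis by (simp only: loops_image eq image_image orb)
qed

lemma loops_cong:
  assumes "perm P \<phi>" "\<And>x. x \<in> P \<Longrightarrow> \<psi> x = \<phi> x" "x \<in> P"
  shows "(\<psi> ^^ k) x = (\<phi> ^^ k) x"
proof (induction k)
  case (Suc k)
  have "(\<phi> ^^ k) x \<in> P" by (rule perm_funpow_in[OF assms(1,3)])
  then show ?case using Suc assms(2)[of "(\<phi> ^^ k) x"] by simp
qed simp

section \<open>The classical passages of a diagram as a chord diagram\<close>

lemma diagram_facts:
  assumes "virtual_link_diagram D"
  shows finite_crossings_diagram: "finite (crossings D)"
    and crossing_card: "\<forall>z \<in> crossings D. card {p \<in> params D. point D p = z} = 2"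
    and over_subset: "over D \<subseteq> {p \<in> params D. point D p \<in> classical D}"
    and over_unique: "\<forall>z \<in> classical D. \<exists>!p. p \<in> over D \<and> point D p = z"
    and curve_facts: "\<forall>i < comps D. curve D i C1_differentiable_on UNIV \<and>
        (\<forall>t. curve D i (t + 1) = curve D i t \<and> vector_derivative (curve D i) (at t) \<noteq> 0)"
  using assms unfolding virtual_link_diagram_def by - (elim conjE, assumption)+

lemma finite_classical: "virtual_link_diagram D \<Longrightarrow> finite (classical D)"
  unfolding classical_def by (rule finite_Diff[OF finite_crossings_diagram])

lemma overD:
  assumes "virtual_link_diagram D" "p \<in> over D"
  shows "p \<in> params D" "point D p \<in> classical D"
  using subsetD[OF over_subset[OF assms(1)] assms(2)] by simp_all

lemma over_ex:
  assumes "virtual_link_diagram D" "z \<in> classical D"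
  obtains p where "p \<in> over D" "point D p = z"
  using bspec[OF over_unique[OF assms(1)] assms(2)] by (elim ex1E conjE)

lemma crossing_preimage:
  assumes D: "virtual_link_diagram D" and z: "z \<in> classical D"
  shows "{p \<in> cparams D. point D p = z} = {p \<in> params D. point D p = z}"
    "card {p \<in> cparams D. point D p = z} = 2"
proof -
  show eq: "{p \<in> cparams D. point D p = z} = {p \<in> params D. point D p = z}"
    using z by (auto simp: cparams_def)
  have "z \<in> crossings D" using z by (simp add: classical_def)
  then show "card {p \<in> cparams D. point D p = z} = 2" unfolding eq by (rule bspec[OF crossing_card[OF D]])
qed

lemma cparams_chords:
  assumes D: "virtual_link_diagram D"
  shows "chord_marks (comps D) (cparams D) (point D) (classical D)"
proof -
  have fin: "finite (classical D)" by (rule finite_classical[OF D])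
  have card: "card {p \<in> cparams D. point D p = z} = 2" if "z \<in> classical D" for z
    by (rule crossing_preimage(2)[OF D that])
  have "finite {p \<in> cparams D. point D p = z}" if "z \<in> classical D" for z
    by (rule card_ge_0_finite) (simp add: card[OF that])
  then have "finite (\<Union>z\<in>classical D. {p \<in> cparams D. point D p = z})" using fin by blast
  moreover have "(\<Union>z\<in>classical D. {p \<in> cparams D. point D p = z}) = cparams D" by (auto simp: cparams_def)
  ultimately show ?thesis using card by (auto simp: chord_marks_def marks_def cparams_def params_def)
qed

lemma follow_eq:
  assumes D: "virtual_link_diagram D" and p: "p \<in> cparams D"
  shows "follow D p = (opp (cparams D) (point D) (classical D) \<circ> next_mark (cparams D)) p"
proof -
  note ch = chord_marks_chords[OF cparams_chords[OF D]]
  let ?q = "next_mark (cparams D) p"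
  have "perm (cparams D) (next_mark (cparams D))" using ch by (simp add: chords_def)
  then have q: "?q \<in> cparams D" using p by (rule perm_in)
  then have qc: "point D ?q \<in> classical D" by (simp add: cparams_def)
  have "(r \<in> params D \<and> r \<noteq> ?q \<and> point D r = point D ?q) = (r \<in> cparams D \<and> r \<noteq> ?q \<and> point D r = point D ?q)" for r
    using qc by (auto simp: cparams_def)
  then show ?thesis using q qc unfolding follow_def opposite_param_def next_param_eq opp_def by simp
qed

definition marked_by :: "diagram \<Rightarrow> (nat \<times> real) set \<Rightarrow> bool" where
  "marked_by D M \<longleftrightarrow> finite M \<and> cparams D \<subseteq> M \<and> M \<subseteq> params D"

lemma marked_by_self: "virtual_link_diagram D \<Longrightarrow> marked_by D (cparams D)"
  using cparams_chords[of D] by (auto simp: marked_by_def chord_marks_def marks_def cparams_def)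

lemma marked_by_chords:
  assumes "virtual_link_diagram D" "marked_by D M"
  shows "chord_marks (comps D) M (point D) (classical D)"
proof -
  have "{p \<in> M. point D p = z} = {p \<in> cparams D. point D p = z}" if "z \<in> classical D" for z
    using assms(2) that by (auto simp: marked_by_def cparams_def)
  then show ?thesis
    using assms(2) cparams_chords[OF assms(1)] by (auto simp: chord_marks_def marks_def marked_by_def params_def)
qed

context evaluation
begin

text \<open>\<open>state_web\<close> has the shape of a \<open>pweb\<close> with its arcs as ports:
  \<open>arrival\<close> is a first return of \<open>follow\<close>, and
  \<open>state_circles\<close> counts the loops and the components without marks. Only the vertices
  have to be renamed to numbers.\<close>

lemma specialize_state:
  assumes D: "virtual_link_diagram D" and S: "S \<subseteq> classical D" and \<kappa>: "inj_on \<kappa> (classical D)"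
  shows "specialize \<epsilon> (f (web_class (state_web D S))) =
    state (cparams D) (opp (cparams D) (point D) (classical D) \<circ> next_mark (cparams D)) (point D) \<kappa>
      (unmarked (comps D) (cparams D)) S"
proof -
  note ch = chord_marks_chords[OF cparams_chords[OF D]]
  let ?P = "cparams D" and ?\<phi> = "opp (cparams D) (point D) (classical D) \<circ> next_mark (cparams D)"
  let ?A = "state_params D S"
  have A: "?A = {p \<in> ?P. point D p \<in> S}" by (simp add: state_params_def)
  have perm: "perm ?P ?\<phi>" using ch perm_comp[OF _ perm_opp[OF ch]] unfolding chords_def by blast
  have fin: "finite S" using S finite_crossings[OF ch] finite_subset by blast
  let ?PP = "Inl ` ?P \<union> Inr ` S :: ((nat \<times> real) + complex) set" and ?QQ = "Inl ` ?A \<union> Inr ` S :: ((nat \<times> real) + complex) set"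
  let ?m = "map_sum ?\<phi> id :: (nat \<times> real) + complex \<Rightarrow> (nat \<times> real) + complex"
  let ?n = "unmarked (comps D) ?P" and ?l = "port_lab \<kappa> (point D)"
  have pow: "(follow D ^^ k) p = (?\<phi> ^^ k) p" if "p \<in> ?P" for k p
    by (rule loops_cong[OF perm follow_eq[OF D] that])
  have arr: "arrival D S p = point D (ret ?\<phi> ?A p)" if "p \<in> ?P" for p
    unfolding arrival_def ret_def pow[OF that] ..
  have circ: "state_circles D S = ?n + card (loops ?PP ?m ?QQ)"
  proof -
    have powf: "range (\<lambda>k. (follow D ^^ k) p) = range (\<lambda>k. (?\<phi> ^^ k) p)" if "p \<in> ?P" for p
      by (rule image_cong[OF refl]) (rule pow[OF that])
    have "{C. \<exists>p \<in> ?P. C = range (\<lambda>k. (follow D ^^ k) p) \<and> C \<inter> ?A = {}} = loops ?P ?\<phi> ?A"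
      unfolding loops_def orb_def by (rule Collect_cong, rule bex_cong[OF refl]) (simp only: powf)
    moreover have "card (image Inl ` loops ?P ?\<phi> ?A :: ((nat \<times> real) + complex) set set) = card (loops ?P ?\<phi> ?A)"
      by (rule card_image) (simp add: inj_on_def inj_image_eq_iff)
    ultimately show ?thesis unfolding state_circles_def loops_map_sum unmarked_def by simp
  qed
  have PM: "perm ?PP ?m" by (rule perm_state[OF perm fin])
  have QP: "?QQ \<subseteq> ?PP" unfolding A by auto
  let ?\<Gamma> = "state_web D S" and ?\<Delta> = "pweb ?PP ?m ?QQ ?l ?l ?n"
  have retS: "point D (ret ?\<phi> ?A p) \<in> S" if "p \<in> ?A" for p
    using ret_in[OF perm_reaches[OF perm _ that]] A by auto
  have retI: "ret ?m ?QQ (Inr z) = Inr z" if "z \<in> S" for z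
    using ret_hit[of ?m "Inr z" ?QQ] that by auto
  have surj: "{point D p | p. p \<in> ?A} \<subseteq> S" unfolding A by auto
  \<comment> \<open>Sources go to even numbers and sinks to odd ones, as in
    \<open>pweb\<close>.\<close>
  let ?f = "\<lambda>(z, b). if b then 2 * \<kappa> z else Suc (2 * \<kappa> z)"
  have "web_iso ?\<Gamma> ?\<Delta>"
  proof (rule web_isoI[where f = ?f and g = id])
    show "wf_digraph (graph ?\<Gamma>)"
      by unfold_locales (use retS arr A in \<open>auto simp: state_web_def state_params_def\<close>)
    have "inj_on ?f (S \<times> UNIV)"
    proof (rule inj_onI, clarify)
      fix z b w c assume zw: "z \<in> S" "w \<in> S" "(if b then 2 * \<kappa> z else Suc (2 * \<kappa> z)) = (if c then 2 * \<kappa> w else Suc (2 * \<kappa> w))"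
      then have "b = c" "\<kappa> z = \<kappa> w" by (cases b; cases c; simp; presburger)+
      then show "z = w \<and> b = c" using inj_on_eq_iff[OF \<kappa>] zw S by blast
    qed
    then show "inj_on ?f (verts (graph ?\<Gamma>))" by (simp add: state_web_def)
    show "verts (graph ?\<Delta>) = ?f ` verts (graph ?\<Gamma>)"
    proof -
      have lQ: "?l ` ?QQ = \<kappa> ` S" unfolding A by (auto simp: image_Un image_image)
      have "verts (graph ?\<Delta>) = (\<lambda>v. 2 * v) ` \<kappa> ` S \<union> (\<lambda>v. Suc (2 * v)) ` \<kappa> ` S"
        unfolding lQ[symmetric] by (simp add: image_image)
      moreover have "S \<times> UNIV = (\<lambda>z. (z, True)) ` S \<union> (\<lambda>z. (z, False)) ` S" by (auto simp: UNIV_bool)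
      then have "?f ` (S \<times> UNIV) = (\<lambda>v. 2 * v) ` \<kappa> ` S \<union> (\<lambda>v. Suc (2 * v)) ` \<kappa> ` S"
        by (simp add: image_Un image_image)
      ultimately show ?thesis by (simp add: state_web_def)
    qed
    show "arcs (graph ?\<Delta>) = id ` arcs (graph ?\<Gamma>)" by (simp add: state_web_def Plus_def)
    fix e assume "e \<in> arcs (graph ?\<Gamma>)"
    then have e: "e \<in> ?QQ" by (simp add: state_web_def Plus_def)
    show "tail (graph ?\<Delta>) (id e) = ?f (tail (graph ?\<Gamma>) e)"
      by (cases e) (simp_all add: state_web_def)
    from e show "head (graph ?\<Delta>) (id e) = ?f (head (graph ?\<Gamma>) e)"
    proof (elim UnE imageE)
      fix p assume p: "e = Inl p" "p \<in> ?A"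
      then have "p \<in> ?P" unfolding A by simp
      then show ?thesis unfolding p(1) by (simp add: state_web_def ret_map_sum arr del: map_sum.comp)
    next
      fix z assume "e = Inr z" "z \<in> S"
      then show ?thesis by (simp add: state_web_def retI)
    qed
  next
    show "circles ?\<Gamma> = circles ?\<Delta>" unfolding pweb_simps by (simp add: state_web_def circ)
  qed simp
  then show ?thesis unfolding state_def F_def A[symmetric] by (simp only: web_class_eqI)
qed

text \<open>The exponents 2 and -2 of oriented states give 1, the exponents 1 and -1 of unoriented
  states give \<epsilon>. The sign of the crossing disappears, and each crossing in \<open>S\<close>
  contributes -\<epsilon>.\<close>

lemma specialize_weight:
  assumes "finite (classical D)" "S \<subseteq> classical D"
  shows "laurent_at \<epsilon> (state_weight D S) = (- \<epsilon>) ^ card S"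
proof -
  have e2: "\<epsilon> ^ 2 = 1" using sign by auto
  have s: "\<bar>crossing_sign D z\<bar> = 1" for z by (simp add: crossing_sign_def)
  have "laurent_at \<epsilon> (state_weight D S) =
      (\<Prod>z\<in>classical D. laurent_at \<epsilon> (if z \<in> S then - A_pow (- crossing_sign D z) else A_pow (2 * crossing_sign D z)))"
    by (simp only: state_weight_def laurent_at_prod[OF sign])
  also have "\<dots> = (\<Prod>z\<in>classical D. if z \<in> S then - \<epsilon> else 1)"
  proof (rule prod.cong[OF refl])
    fix z
    show "laurent_at \<epsilon> (if z \<in> S then - A_pow (- crossing_sign D z) else A_pow (2 * crossing_sign D z)) =
        (if z \<in> S then - \<epsilon> else 1)"
      by (cases "z \<in> S") (simp_all add: s e2 abs_mult)
  qed
  also have "\<dots> = (\<Prod>z\<in>S. - \<epsilon>)"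
    using assms by (simp add: prod.If_cases Int_absorb1)
  finally show ?thesis by simp
qed

text \<open>Marks beyond the classical passages do not change the state sum. This freedom permits
  two diagrams to be compared over one common set of marks.\<close>

lemma specialize_bracket:
  assumes D: "virtual_link_diagram D" and M: "marked_by D M" and \<kappa>: "inj_on \<kappa> (classical D)"
  shows "specialize \<epsilon> (bracket f D) = BM (comps D) M (point D) (classical D) \<kappa>"
proof -
  have fin: "finite (classical D)" by (rule finite_classical[OF D])
  let ?st = "state (cparams D) (opp (cparams D) (point D) (classical D) \<circ> next_mark (cparams D)) (point D) \<kappa>
      (unmarked (comps D) (cparams D))"
  have "specialize \<epsilon> (bracket f D) =
      (\<Sum>S\<in>Pow (classical D). specialize \<epsilon> (Const (state_weight D S) * f (web_class (state_web D S))))"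
    by (simp only: bracket_def specialize_sum)
  also have "\<dots> = (\<Sum>S\<in>Pow (classical D). of_int ((- \<epsilon>) ^ card S) * ?st S)"
  proof (rule sum.cong[OF refl])
    fix S assume "S \<in> Pow (classical D)"
    then have S: "S \<subseteq> classical D" by simp
    have "specialize \<epsilon> (Const (state_weight D S) * f (web_class (state_web D S))) =
        specialize \<epsilon> (Const (state_weight D S)) * specialize \<epsilon> (f (web_class (state_web D S)))"
      by (rule specialize_mult[OF sign])
    also have "\<dots> = of_int ((- \<epsilon>) ^ card S) * ?st S"
      by (rule arg_cong2[where f = "(*)", OF trans[OF specialize_Const arg_cong[where f = of_int, OF specialize_weight[OF fin S]]] specialize_state[OF D S \<kappa>]])
    finally show "specialize \<epsilon> (Const (state_weight D S) * f (web_class (state_web D S))) =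
        of_int ((- \<epsilon>) ^ card S) * ?st S" .
  qed
  also have "\<dots> = BM (comps D) (cparams D) (point D) (classical D) \<kappa>" by (simp only: BM_def B_def)
  also have "\<dots> = BM (comps D) M (point D) (classical D) \<kappa>"
  proof -
    have "cparams D \<subseteq> M" using M by (simp add: marked_by_def)
    moreover have "point D p \<notin> classical D" if "p \<in> M - cparams D" for p
      using that M by (auto simp: marked_by_def cparams_def)
    ultimately show ?thesis using BM_restrict[OF marked_by_chords[OF D M]] by metis
  qed
  finally show ?thesis .
qed

end

subsection \<open>Invariance under the moves\<close>

lemma point_frac:
  assumes "virtual_link_diagram D" "i < comps D"
  shows "point D (i, frac t) = curve D i t"
proof -
  have per: "curve D i (t + 1) = curve D i t" for t using curve_facts[OF assms(1)] assms(2) by blast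
  have nat: "curve D i (t + real k) = curve D i t" for t k
  proof (induction k)
    case (Suc k)
    then show ?case using per[of "t + real k"] by (simp add: add_ac)
  qed simp
  have "curve D i (t + of_int k) = curve D i t" for t k
  proof (cases "k \<ge> 0")
    case True
    then show ?thesis using nat[of t "nat k"] by simp
  next
    case False
    then show ?thesis using nat[of "t + of_int k" "nat (- k)"] by simp
  qed
  from this[of "frac t" "\<lfloor>t\<rfloor>"] show ?thesis by (simp add: point_def frac_def)
qed

lemma crossingsI:
  "p \<in> params D \<Longrightarrow> q \<in> params D \<Longrightarrow> p \<noteq> q \<Longrightarrow> point D p = z \<Longrightarrow> point D q = z \<Longrightarrow> z \<in> crossings D"
  unfolding crossings_def by blast

lemma two_params:
  assumes D: "virtual_link_diagram D" and pq: "p \<in> params D" "q \<in> params D" "p \<noteq> q" "point D p = z" "point D q = z"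
  shows "{r \<in> params D. point D r = z} = {p, q}"
proof -
  have "card {r \<in> params D. point D r = z} = 2"
    by (rule bspec[OF crossing_card[OF D] crossingsI[OF pq]])
  moreover from this have "finite {r \<in> params D. point D r = z}" by (intro card_ge_0_finite) simp
  moreover have "{p, q} \<subseteq> {r \<in> params D. point D r = z}" using pq by auto
  moreover have "card {p, q} = 2" using pq(3) by simp
  ultimately show ?thesis by (metis card_subset_eq)
qed

section \<open>Two diagrams that differ inside a disc\<close>

locale tangles =
  fixes D D' U ks
  assumes D: "virtual_link_diagram D" "virtual_link_diagram D'" and rep: "tangle_replacement D D' U ks"
begin

abbreviation "strands \<equiv> \<Union>k \<in> set ks. strand_params k"
abbreviation "C0 \<equiv> classical D - U"

lemma comps: "comps D' = comps D" using rep by (simp add: tangle_replacement_def)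

lemma params: "params D' = params D" by (simp add: params_def comps)

lemma inside: "p \<in> strands \<longleftrightarrow> p \<in> params D \<and> point D p \<in> U" "p \<in> strands \<longleftrightarrow> p \<in> params D \<and> point D' p \<in> U"
proof -
  have "{p \<in> params D. point D p \<in> U} = strands" "{p \<in> params D'. point D' p \<in> U} = strands"
    using rep by (simp_all add: tangle_replacement_def tangle_in_def)
  then show "p \<in> strands \<longleftrightarrow> p \<in> params D \<and> point D p \<in> U" "p \<in> strands \<longleftrightarrow> p \<in> params D \<and> point D' p \<in> U"
    unfolding params by blast+
qed

lemma outside: "p \<in> params D \<Longrightarrow> p \<notin> strands \<Longrightarrow> point D' p = point D p"
  using rep by (simp add: tangle_replacement_def)

lemma point_outside:
  assumes "p \<in> params D" "z \<notin> U"
  shows "point D' p = z \<longleftrightarrow> point D p = z"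
  using assms outside[of p] inside[of p] by metis

lemma crossings_outside: "crossings D' - U = crossings D - U"
proof -
  have "z \<in> crossings D' \<longleftrightarrow> z \<in> crossings D" if "z \<notin> U" for z
    unfolding crossings_def params using point_outside[OF _ that] by blast
  then show ?thesis by blast
qed

lemma classical_outside: "classical D' - U = C0"
proof -
  have "virt D' - U = virt D - U" using rep by (simp add: tangle_replacement_def)
  then show ?thesis using crossings_outside unfolding classical_def by blast
qed

lemma point_C0: "p \<in> params D \<Longrightarrow> z \<in> C0 \<Longrightarrow> point D' p = z \<longleftrightarrow> point D p = z"
  using point_outside by blast

lemma finite_C: "finite (classical D)" "finite (classical D')"
  by (rule finite_classical[OF D(1)], rule finite_classical[OF D(2)])

text \<open>The ends of a strand lie on the boundary of the disc, where there are no crossings;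
  crossings are therefore met strictly between the ends, which leaves room for sliding.\<close>

lemma strand:
  assumes "(i, a, b) \<in> set ks"
  shows "i < comps D" "a < b" "b < a + 1" "t \<in> {a..b} \<Longrightarrow> (i, frac t) \<in> strands"
    "t \<in> {a..b} \<Longrightarrow> point D (i, frac t) \<in> crossings D \<Longrightarrow> a < t \<and> t < b"
    "t \<in> {a..b} \<Longrightarrow> point D' (i, frac t) \<in> crossings D' \<Longrightarrow> a < t \<and> t < b"
proof -
  have t: "tangle_in D U ks" "tangle_in D' U ks" using rep by (simp_all add: tangle_replacement_def)
  have "\<forall>k \<in> set ks. strand_of D k" using t(1) unfolding tangle_in_def by (elim conjE)
  then have "strand_of D (i, a, b)" by (rule bspec[OF _ assms])
  then show i: "i < comps D" and "a < b" "b < a + 1" by simp_all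
  show "(i, frac t) \<in> strands" if "t \<in> {a..b}" using that assms by force
  have ends: "curve D i a \<in> frontier U" "curve D i b \<in> frontier U" "crossings D \<inter> frontier U = {}"
    "curve D' i a \<in> frontier U" "curve D' i b \<in> frontier U" "crossings D' \<inter> frontier U = {}"
    using t assms unfolding tangle_in_def by fastforce+
  have i': "i < comps D'" using i comps by simp
  show "a < t \<and> t < b" if "t \<in> {a..b}" "point D (i, frac t) \<in> crossings D"
  proof -
    have "t \<noteq> a" "t \<noteq> b" using ends(1-3) that(2) unfolding point_frac[OF D(1) i] by blast+
    then show ?thesis using that(1) by simp
  qed
  show "a < t \<and> t < b" if "t \<in> {a..b}" "point D' (i, frac t) \<in> crossings D'"
  proof -
    have "t \<noteq> a" "t \<noteq> b" using ends(4-6) that(2) unfolding point_frac[OF D(2) i'] by blast+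
    then show ?thesis using that(1) by simp
  qed
qed

lemma strand_inj:
  assumes "(i, a, b) \<in> set ks" "s \<in> {a..b}" "t \<in> {a..b}" "frac s = frac t"
  shows "s = t"
  using assms strand(3)[OF assms(1)] frac_neq[of s t] frac_neq[of t s] by (cases s t rule: linorder_cases) auto

end

lemma tangles_sym:
  assumes "tangles D D' U ks"
  shows "tangles D' D U ks"
proof -
  interpret tangles D D' U ks by (rule assms)
  show ?thesis
  proof
    show "tangle_replacement D' D U ks"
      using rep params unfolding tangle_replacement_def by auto
  qed (rule D)+
qed

context tangles
begin

text \<open>The strands are disjoint and a crossing has two parameters only, so an overpass of one
  strand over another accounts for both: one lies on each strand.\<close>

lemma passage:
  assumes k: "(i, a, b) \<in> set ks" and l: "(j, c, d) \<in> set ks"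
    and kl: "strand_params (i, a, b) \<inter> strand_params (j, c, d) = {}" and over: "passes_over D (i, a, b) (j, c, d) z"
  obtains s t where "a < s" "s < b" "c < t" "t < d" "(i, frac s) \<noteq> (j, frac t)"
    "{p \<in> params D. point D p = z} = {(i, frac s), (j, frac t)}" "z \<in> classical D" "z \<in> U"
proof -
  have im: "z \<in> point D ` (over D \<inter> strand_params (i, a, b))" "z \<in> point D ` strand_params (j, c, d)"
    using over by (simp_all only: passes_over_def strand_image_def)
  obtain p where p: "p \<in> over D" "p \<in> strand_params (i, a, b)" "point D p = z"
    using im(1) by (elim imageE IntE) metis
  obtain q where q: "q \<in> strand_params (j, c, d)" "point D q = z"
    using im(2) by (elim imageE) metis
  obtain s where s: "s \<in> {a..b}" "p = (i, frac s)" using p(2) by auto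
  obtain t where t: "t \<in> {c..d}" "q = (j, frac t)" using q(1) by auto
  have pi: "p \<in> strands" "q \<in> strands" using p(2) q(1) k l by blast+
  have z: "z \<in> classical D" using overD(2)[OF D(1) p(1)] p(3) by simp
  then have zc: "z \<in> crossings D" by (simp add: classical_def)
  have ne: "p \<noteq> q" using p(2) q(1) kl by blast
  have "{p \<in> params D. point D p = z} = {p, q}"
    by (rule two_params[OF D(1) _ _ ne p(3) q(2)]) (use pi inside(1) in blast)+
  moreover have "z \<in> U" using pi(1) inside(1) p(3) by blast
  moreover have "a < s \<and> s < b" using strand(5)[OF k s(1)] zc p(3) s(2) by simp
  moreover have "c < t \<and> t < d" using strand(5)[OF l t(1)] zc q(2) t(2) by simp
  ultimately show ?thesis using that[of s t] z ne s(2) t(2) by blast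
qed

lemma marks_outside:
  assumes "p \<in> cparams D" "p \<notin> strands"
  shows "p \<in> cparams D'"
proof -
  have p: "p \<in> params D" "point D p \<in> classical D" using assms(1) by (auto simp: cparams_def)
  then have "point D p \<notin> U" using assms(2) inside(1) by blast
  then have "point D p \<in> classical D' - U" using classical_outside p by blast
  then show ?thesis using p outside[OF p(1) assms(2)] params by (auto simp: cparams_def)
qed

end

text \<open>Without crossings of \<open>D\<close> in the disc, the passages of \<open>D'\<close> may
  serve as marks on \<open>D\<close>. The bracket of \<open>D\<close> becomes the state sum of
  \<open>D'\<close> in which the passages inside the disc are mere marks, so for the first two moves
  both sides live on the same ports.\<close>

lemma (in evaluation) bracket_forget:
  assumes "tangles D D' U ks" and none: "crossings D \<inter> U = {}" and \<kappa>: "inj_on \<kappa> (classical D)"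
  shows "specialize \<epsilon> (bracket f D) =
    BM (comps D') (cparams D') (point D') (classical D) \<kappa>" "classical D' - U = classical D"
proof -
  interpret tangles D D' U ks by (rule assms)
  interpret r: tangles D' D U ks by (rule tangles_sym[OF assms(1)])
  have C: "classical D - U = classical D" using none unfolding classical_def by blast
  then show "classical D' - U = classical D" using classical_outside by simp
  have out: "p \<notin> strands" if "p \<in> cparams D" for p
    using that C inside(1)[of p] by (auto simp: cparams_def)
  have fin: "finite (cparams D')" using cparams_chords[OF D(2)] by (simp add: chord_marks_def marks_def)
  have M: "marked_by D (cparams D')"
    unfolding marked_by_def using fin out marks_outside params by (auto simp: cparams_def)
  have "BM (comps D) (cparams D') (point D) (classical D) \<kappa> = BM (comps D) (cparams D') (point D') (classical D) \<kappa>"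
  proof (rule BM_relabel[where h = id, OF marked_by_chords[OF D(1) M]])
    have iff: "point D' p = z \<longleftrightarrow> point D p = z" if "p \<in> cparams D'" "z \<in> classical D" for p z
      using point_C0[of p z] that C params by (auto simp: cparams_def)
    show "point D' p = id (point D p)" if "p \<in> cparams D'" "point D p \<in> classical D" for p
      using iff[OF that] by simp
    show "point D' p \<notin> classical D" if "p \<in> cparams D'" "point D p \<notin> classical D" for p
      using iff[OF that(1), of "point D' p"] that(2) by auto
  qed (simp_all add: \<kappa>)
  then show "specialize \<epsilon> (bracket f D) = BM (comps D') (cparams D') (point D') (classical D) \<kappa>"
    using specialize_bracket[OF D(1) M \<kappa>] comps by simp
qed

lemma next_in_strand:
  assumes "finite M" "(i, frac t) \<in> M" "s < t" "\<And>v. s < v \<Longrightarrow> v < t \<Longrightarrow> (i, frac v) \<notin> M"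
  shows "next_mark M (i, frac s) = (i, frac t)"
  by (rule next_mark_eq) (use assms in auto)

lemma infinite_labels: "\<exists>\<kappa> :: complex \<Rightarrow> nat. inj_on \<kappa> C" if "finite C"
  using finite_imp_inj_to_nat_seg[OF that] by blast

context evaluation
begin

section \<open>The first and the second Reidemeister move of diagrams\<close>

text \<open>Both passages of the new crossing lie on the single strand of the move with no other
  passage between them, so one is the successor of the other. Either order leads to
  \<open>B_R1\<close>.\<close>

lemma bracket_R1:
  assumes D: "virtual_link_diagram D" "virtual_link_diagram D'" and R: "reidemeister1 D D'"
  shows "specialize \<epsilon> (bracket f D) = specialize \<epsilon> (bracket f D')"
proof -
  obtain U k c where rep: "tangle_replacement D D' U [k]" and X: "crossings D \<inter> U = {}" "crossings D' \<inter> U = {c}" "c \<in> classical D'"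
    using R unfolding reidemeister1_def by blast
  obtain i a b where k: "k = (i, a, b)" by (cases k)
  interpret tangles D D' U "[k]" using D rep by unfold_locales
  obtain \<kappa> :: "complex \<Rightarrow> nat" where \<kappa>: "inj_on \<kappa> (classical D')" using infinite_labels[OF finite_C(2)] by blast
  have CU: "classical D' - U = classical D"
    using X(1) classical_outside unfolding classical_def by blast
  have cU: "c \<in> U" using X(2) by blast
  have C': "classical D' = insert c (classical D)" "c \<notin> classical D"
    using CU X cU unfolding classical_def by blast+
  have \<kappa>0: "inj_on \<kappa> (classical D)" using \<kappa> C'(1) inj_on_subset by blast
  have "card {p \<in> params D'. point D' p = c} = 2"
    using crossing_preimage[OF D(2) X(3)] by simp
  then obtain p q where pq: "{p \<in> params D'. point D' p = c} = {p, q}" "p \<noteq> q" unfolding card_2_iff by auto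
  have pqc: "point D' p = c" "point D' q = c" "p \<in> params D" "q \<in> params D" using pq(1) params by blast+
  have "p \<in> strands" "q \<in> strands" using inside(2) pqc cU by simp_all
  moreover have "strands = strand_params (i, a, b)" by (simp add: k del: strand_params.simps)
  ultimately have "p \<in> strand_params (i, a, b)" "q \<in> strand_params (i, a, b)" by simp_all
  then obtain s t where st: "s \<in> {a..b}" "p = (i, frac s)" "t \<in> {a..b}" "q = (i, frac t)"
    unfolding strand_params.simps by blast
  have ks: "(i, a, b) \<in> set [k]" by (simp add: k)
  have chm: "chord_marks (comps D') (cparams D') (point D') (classical D')" by (rule cparams_chords[OF D(2)])
  have fin: "finite (cparams D')" using chm by (simp add: chord_marks_def marks_def)
  have nxt: "next_mark (cparams D') (i, frac s) = (i, frac t)"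
    if st: "s \<in> {a..b}" "t \<in> {a..b}" "s < t" "{p, q} = {(i, frac s), (i, frac t)}" for s t
  proof (rule next_in_strand[OF fin])
    have "(i, frac t) \<in> {p, q}" using st(4) by simp
    then show "(i, frac t) \<in> cparams D'" using pqc X(3) params by (auto simp: cparams_def)
    show "(i, frac v) \<notin> cparams D'" if v: "s < v" "v < t" for v
    proof
      assume m: "(i, frac v) \<in> cparams D'"
      have vab: "v \<in> {a..b}" using v st by simp
      have "point D' (i, frac v) \<in> U" using strand(4)[OF ks vab] inside(2) by blast
      then have "point D' (i, frac v) = c" using m X(2) unfolding cparams_def classical_def by blast
      then have "(i, frac v) \<in> {p, q}" using pq(1) m by (auto simp: cparams_def)
      then have "frac v = frac s \<or> frac v = frac t" unfolding st(4) by auto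
      then show False using strand_inj[OF ks vab st(1)] strand_inj[OF ks vab st(2)] v by auto
    qed
  qed (use st in auto)
  have "s \<noteq> t" using pq(2) st by auto
  then have "next_mark (cparams D') p = q \<or> next_mark (cparams D') q = p"
    using nxt[of s t] nxt[of t s] st by (cases s t rule: linorder_cases) (auto simp: insert_commute)
  moreover have pqm: "p \<in> cparams D'" "q \<in> cparams D'" using pqc X(3) params by (auto simp: cparams_def)
  note R1 = B_R1[OF chord_marks_chords[OF chm, unfolded C'(1)] \<kappa>[unfolded C'(1)] C'(2)]
  ultimately have "B (cparams D') (next_mark (cparams D')) (point D') (insert c (classical D)) \<kappa> (unmarked (comps D') (cparams D')) =
      B (cparams D') (next_mark (cparams D')) (point D') (classical D) \<kappa> (unmarked (comps D') (cparams D'))"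
    using R1[OF pqm pq(2) pqc(1,2)] R1[OF pqm(2,1) pq(2)[symmetric] pqc(2,1)] by blast
  then have "BM (comps D') (cparams D') (point D') (classical D') \<kappa> = BM (comps D') (cparams D') (point D') (classical D) \<kappa>"
    unfolding BM_def C'(1) .
  then show ?thesis
    using bracket_forget(1)[OF tangles_axioms X(1) \<kappa>0] specialize_bracket[OF D(2) marked_by_self[OF D(2)] \<kappa>] by simp
qed

text \<open>Each strand meets the two crossings in one of two orders, with nothing in between.
  Naming the crossings in the order of the first strand, \<open>B_R2\<close> covers both orders of
  the second one.\<close>

lemma bracket_R2:
  assumes D: "virtual_link_diagram D" "virtual_link_diagram D'" and R: "reidemeister2 D D'"
  shows "specialize \<epsilon> (bracket f D) = specialize \<epsilon> (bracket f D')"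
proof -
  obtain U k l x y where rep: "tangle_replacement D D' U [k, l]" and X: "crossings D \<inter> U = {}" "crossings D' \<inter> U = {x, y}" "x \<noteq> y"
    and ov: "passes_over D' k l x" "passes_over D' k l y"
    using R unfolding reidemeister2_def by blast
  obtain i a b where k: "k = (i, a, b)" by (cases k)
  obtain j c d where l: "l = (j, c, d)" by (cases l)
  interpret tangles D D' U "[k, l]" using D rep by unfold_locales
  interpret r: tangles D' D U "[k, l]" by (rule tangles_sym[OF tangles_axioms])
  obtain \<kappa> :: "complex \<Rightarrow> nat" where \<kappa>: "inj_on \<kappa> (classical D')" using infinite_labels[OF finite_C(2)] by blast
  have kl: "strand_params k \<inter> strand_params l = {}"
    using rep unfolding tangle_replacement_def tangle_in_def by simp
  have ks: "(i, a, b) \<in> set [k, l]" "(j, c, d) \<in> set [k, l]" by (simp_all add: k l)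
  obtain s t where st: "a < s" "s < b" "c < t" "t < d" "(i, frac s) \<noteq> (j, frac t)"
    "{p \<in> params D'. point D' p = x} = {(i, frac s), (j, frac t)}" "x \<in> classical D'" "x \<in> U"
    by (rule r.passage[OF ks kl[unfolded k l] ov(1)[unfolded k l]])
  obtain s' t' where st': "a < s'" "s' < b" "c < t'" "t' < d" "(i, frac s') \<noteq> (j, frac t')"
    "{p \<in> params D'. point D' p = y} = {(i, frac s'), (j, frac t')}" "y \<in> classical D'" "y \<in> U"
    by (rule r.passage[OF ks kl[unfolded k l] ov(2)[unfolded k l]])
  have CU: "classical D' - U = classical D"
    using X(1) classical_outside unfolding classical_def by blast
  have C': "classical D' = insert x (insert y (classical D))" "x \<notin> classical D" "y \<notin> classical D"
    using CU X(2) st(7,8) st'(7,8) unfolding classical_def by blast+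
  have \<kappa>0: "inj_on \<kappa> (classical D)" using \<kappa> C'(1) inj_on_subset by blast
  have chm: "chord_marks (comps D') (cparams D') (point D') (classical D')" by (rule cparams_chords[OF D(2)])
  have fin: "finite (cparams D')" using chm by (simp add: chord_marks_def marks_def)
  let ?A = "(i, frac s)" and ?B = "(j, frac t)" and ?A' = "(i, frac s')" and ?B' = "(j, frac t')"
  have pts: "point D' ?A = x" "point D' ?B = x" "point D' ?A' = y" "point D' ?B' = y" using st(6) st'(6) by blast+
  have mem: "?A \<in> cparams D'" "?B \<in> cparams D'" "?A' \<in> cparams D'" "?B' \<in> cparams D'"
    using st(6,7) st'(6,7) by (auto simp: cparams_def)
  have only: "p \<in> {?A, ?B, ?A', ?B'}" if "p \<in> cparams D'" "p \<in> strands" for p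
  proof -
    have "point D' p \<in> {x, y}" using that inside(2) X(2) unfolding cparams_def classical_def by blast
    then show ?thesis using st(6) st'(6) that(1) by (auto simp: cparams_def)
  qed
  have A_B: "p \<noteq> q" if "p \<in> strand_params k" "q \<in> strand_params l" for p q using kl that by blast
  have kin: "v \<in> {a..b} \<Longrightarrow> (i, frac v) \<in> strand_params k" "w \<in> {c..d} \<Longrightarrow> (j, frac w) \<in> strand_params l" for v w
    by (auto simp: k l)
  have nk: "next_mark (cparams D') (i, frac u) = (i, frac w)"
    if uw: "u \<in> {a..b}" "w \<in> {a..b}" "u < w" "{?A, ?A'} = {(i, frac u), (i, frac w)}" for u w
  proof (rule next_in_strand[OF fin])
    have "(i, frac w) \<in> {?A, ?A'}" using uw(4) by simp
    then show "(i, frac w) \<in> cparams D'" using mem by auto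
    show "(i, frac v) \<notin> cparams D'" if v: "u < v" "v < w" for v
    proof
      assume m: "(i, frac v) \<in> cparams D'"
      have vab: "v \<in> {a..b}" using v uw by simp
      have "(i, frac v) \<in> {?A, ?A', ?B, ?B'}" using only[OF m strand(4)[OF ks(1) vab]] by blast
      moreover have "(i, frac v) \<noteq> ?B" "(i, frac v) \<noteq> ?B'"
        by (rule A_B[OF kin(1)[OF vab] kin(2)]; use st st' in simp)+
      ultimately have "(i, frac v) \<in> {?A, ?A'}" by blast
      then have "frac v = frac u \<or> frac v = frac w" unfolding uw(4) by auto
      then show False using strand_inj[OF ks(1) vab uw(1)] strand_inj[OF ks(1) vab uw(2)] v by auto
    qed
  qed (use uw in auto)
  have nl: "next_mark (cparams D') (j, frac u) = (j, frac w)"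
    if uw: "u \<in> {c..d}" "w \<in> {c..d}" "u < w" "{?B, ?B'} = {(j, frac u), (j, frac w)}" for u w
  proof (rule next_in_strand[OF fin])
    have "(j, frac w) \<in> {?B, ?B'}" using uw(4) by simp
    then show "(j, frac w) \<in> cparams D'" using mem by auto
    show "(j, frac v) \<notin> cparams D'" if v: "u < v" "v < w" for v
    proof
      assume m: "(j, frac v) \<in> cparams D'"
      have vab: "v \<in> {c..d}" using v uw by simp
      have "(j, frac v) \<in> {?A, ?A', ?B, ?B'}" using only[OF m strand(4)[OF ks(2) vab]] by blast
      moreover have "?A \<noteq> (j, frac v)" "?A' \<noteq> (j, frac v)"
        by (rule A_B[OF kin(1) kin(2)[OF vab]]; use st st' in simp)+
      ultimately have "(j, frac v) \<in> {?B, ?B'}" by (metis insert_iff empty_iff)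
      then have "frac v = frac u \<or> frac v = frac w" unfolding uw(4) by auto
      then show False using strand_inj[OF ks(2) vab uw(1)] strand_inj[OF ks(2) vab uw(2)] v by auto
    qed
  qed (use uw in auto)
  have ss: "s < s' \<or> s' < s" and tt: "t < t' \<or> t' < t"
    using pts X(3) by (metis linorder_neqE)+
  have nx: "s < s' \<and> next_mark (cparams D') ?A = ?A' \<or> s' < s \<and> next_mark (cparams D') ?A' = ?A"
    "t < t' \<and> next_mark (cparams D') ?B = ?B' \<or> t' < t \<and> next_mark (cparams D') ?B' = ?B"
    using ss nk[of s s'] nk[of s' s] tt nl[of t t'] nl[of t' t] st st' by (auto simp: insert_commute)
  have ne: "?A \<noteq> ?A'" "?B \<noteq> ?B'" "?A \<noteq> ?B" "?A \<noteq> ?B'" "?A' \<noteq> ?B" "?A' \<noteq> ?B'"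
    using st(5) st'(5) pts X(3) by metis+
  note ne = ne ne[symmetric]
  have C2: "classical D' = insert y (insert x (classical D))" using C'(1) by blast
  note ch = chord_marks_chords[OF chm]
  note R2 = B_R2[OF ch[unfolded C'(1)] \<kappa>[unfolded C'(1)] C'(2,3) X(3)]
  note R2' = B_R2[OF ch[unfolded C2] \<kappa>[unfolded C2] C'(3,2) X(3)[symmetric]]
  have "B (cparams D') (next_mark (cparams D')) (point D') (classical D') \<kappa> n =
      B (cparams D') (next_mark (cparams D')) (point D') (classical D) \<kappa> n" for n
    using nx
  proof (elim disjE conjE)
    assume n: "next_mark (cparams D') ?A = ?A'" "next_mark (cparams D') ?B = ?B'"
    show ?thesis unfolding C'(1) by (rule R2[of ?A ?B ?A' ?B']) (simp_all only: n mem pts ne distinct.simps list.set insert_iff empty_iff simp_thms insert_subset empty_subsetI)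
  next
    assume n: "next_mark (cparams D') ?A = ?A'" "next_mark (cparams D') ?B' = ?B"
    show ?thesis unfolding C'(1) by (rule R2[of ?A ?B' ?A' ?B]) (simp_all only: n mem pts ne distinct.simps list.set insert_iff empty_iff simp_thms insert_subset empty_subsetI)
  next
    assume n: "next_mark (cparams D') ?A' = ?A" "next_mark (cparams D') ?B = ?B'"
    show ?thesis unfolding C2 by (rule R2'[of ?A' ?B ?A ?B']) (simp_all only: n mem pts ne distinct.simps list.set insert_iff empty_iff simp_thms insert_subset empty_subsetI)
  next
    assume n: "next_mark (cparams D') ?A' = ?A" "next_mark (cparams D') ?B' = ?B"
    show ?thesis unfolding C2 by (rule R2'[of ?A' ?B' ?A ?B]) (simp_all only: n mem pts ne distinct.simps list.set insert_iff empty_iff simp_thms insert_subset empty_subsetI)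
  qed
  then have "BM (comps D') (cparams D') (point D') (classical D') \<kappa> = BM (comps D') (cparams D') (point D') (classical D) \<kappa>"
    unfolding BM_def .
  then show ?thesis
    using bracket_forget(1)[OF tangles_axioms X(1) \<kappa>0] specialize_bracket[OF D(2) marked_by_self[OF D(2)] \<kappa>] by simp
qed

section \<open>Detour move, crossing switch and planar isotopy\<close>

text \<open>If the same parameters lie over the same classical crossings, the two chord diagrams are
  equal.\<close>

lemma bracket_same_marks:
  assumes D: "virtual_link_diagram D" "virtual_link_diagram D'" and n: "comps D' = comps D"
    and C: "classical D' = classical D" and pt: "\<And>p z. p \<in> params D \<Longrightarrow> z \<in> classical D \<Longrightarrow> point D' p = z \<longleftrightarrow> point D p = z"
  shows "specialize \<epsilon> (bracket f D) = specialize \<epsilon> (bracket f D')"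
proof -
  have fin: "finite (classical D)" by (rule finite_classical[OF D(1)])
  obtain \<kappa> :: "complex \<Rightarrow> nat" where \<kappa>: "inj_on \<kappa> (classical D)" using infinite_labels[OF fin] by blast
  have P: "params D' = params D" by (simp add: params_def n)
  have cp: "cparams D' = cparams D"
  proof (rule set_eqI)
    fix p
    show "p \<in> cparams D' \<longleftrightarrow> p \<in> cparams D"
      using pt[of p "point D p"] pt[of p "point D' p"] unfolding cparams_def P C by auto
  qed
  have "BM (comps D) (cparams D) (point D) (classical D) \<kappa> = BM (comps D) (cparams D) (point D') (classical D) \<kappa>"
  proof (rule BM_relabel[where h = id, OF cparams_chords[OF D(1)]])
    show "point D' p = id (point D p)" if "p \<in> cparams D" "point D p \<in> classical D" for p
      using pt[of p "point D p"] that by (simp add: cparams_def)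
    show "point D' p \<notin> classical D" if "p \<in> cparams D" "point D p \<notin> classical D" for p
      using that by (simp add: cparams_def)
  qed (simp_all add: \<kappa>)
  then show ?thesis
    using specialize_bracket[OF D(1) marked_by_self[OF D(1)] \<kappa>] specialize_bracket[OF D(2) marked_by_self[OF D(2)], unfolded C, OF \<kappa>]
    by (simp add: n cp)
qed

text \<open>The moved strand carries no classical crossing, before or after, so the classical
  crossings and their passages stay. The local fact \<open>key\<close> is used in both
  directions.\<close>

lemma bracket_detour:
  assumes D: "virtual_link_diagram D" "virtual_link_diagram D'" and R: "detour D D'"
  shows "specialize \<epsilon> (bracket f D) = specialize \<epsilon> (bracket f D')"
proof -
  obtain k where n: "comps D = comps D'"
    and out: "\<And>p. p \<in> params D \<Longrightarrow> p \<notin> strand_params k \<Longrightarrow> point D p = point D' p"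
    and virt: "strand_image D k \<inter> crossings D \<subseteq> virt D" "strand_image D' k \<inter> crossings D' \<subseteq> virt D'"
      "virt D - strand_image D k = virt D' - strand_image D' k"
    and over: "\<And>p. p \<in> params D \<Longrightarrow> p \<notin> strand_params k \<Longrightarrow> p \<in> over D \<longleftrightarrow> p \<in> over D'"
    using R unfolding detour_def by blast
  have P: "params D' = params D" by (simp add: params_def n)
  have key: "z \<in> classical D' \<and> (\<forall>p\<in>params D. point D' p = z \<longleftrightarrow> point D p = z)"
    if D: "virtual_link_diagram D" "virtual_link_diagram D'"
      and P: "params D' = params D" and out: "\<And>p. p \<in> params D \<Longrightarrow> p \<notin> strand_params k \<Longrightarrow> point D p = point D' p"
      and virt: "strand_image D k \<inter> crossings D \<subseteq> virt D" "strand_image D' k \<inter> crossings D' \<subseteq> virt D'"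
        "virt D - strand_image D k = virt D' - strand_image D' k"
      and over: "\<And>p. p \<in> params D \<Longrightarrow> p \<notin> strand_params k \<Longrightarrow> p \<in> over D \<longleftrightarrow> p \<in> over D'"
      and z: "z \<in> classical D" for D D' z
  proof -
    have zD: "z \<in> crossings D" "z \<notin> virt D" "z \<notin> strand_image D k" using z virt(1) by (auto simp: classical_def)
    have off: "p \<notin> strand_params k" if "point D p = z" for p
      using zD(3) that by (auto simp: strand_image_def)
    obtain p q where pq: "p \<in> params D" "q \<in> params D" "p \<noteq> q" "point D p = z" "point D q = z"
      using zD(1) unfolding crossings_def by blast
    have pq': "point D' p = z" "point D' q = z" using out off pq by metis+
    have eq: "{r \<in> params D. point D r = z} = {p, q}" "{r \<in> params D. point D' r = z} = {p, q}"
      using two_params[OF D(1) pq] two_params[OF D(2) _ _ pq(3) pq'] pq(1,2) unfolding P by simp_all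
    have zD': "z \<in> crossings D'" by (rule crossingsI[OF _ _ pq(3) pq']) (simp_all add: P pq)
    \<comment> \<open>If the strand in its new place ran through \<open>z\<close>, then
      \<open>z\<close> would be virtual in \<open>D'\<close>. But the overpassing parameter of
      \<open>z\<close> is off the strand, so it is still in \<open>over D'\<close> and makes
      \<open>z\<close> classical.\<close>
    have "z \<notin> strand_image D' k"
    proof
      assume "z \<in> strand_image D' k"
      then have "z \<in> virt D'" using virt(2) zD' by blast
      obtain r where r: "r \<in> over D" "point D r = z"
        by (rule over_ex[OF D(1) z])
      have rp: "r \<in> params D" by (rule overD(1)[OF D(1) r(1)])
      have "r \<in> over D'" "point D' r = z" using over[OF rp off[OF r(2)]] out[OF rp off[OF r(2)]] r by simp_all
      then have "z \<in> classical D'" using overD(2)[OF D(2), of r] by simp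
      then show False using \<open>z \<in> virt D'\<close> by (simp add: classical_def)
    qed
    then have "z \<notin> virt D'" using virt(3) zD by blast
    then show ?thesis using zD' eq by (auto simp: classical_def)
  qed
  have 1: "z \<in> classical D' \<and> (\<forall>p\<in>params D. point D' p = z \<longleftrightarrow> point D p = z)" if "z \<in> classical D" for z
    by (rule key[OF D P out virt over that])
  have 2: "z \<in> classical D" if "z \<in> classical D'" for z
    using key[OF D(2,1) P[symmetric] _ virt(2,1) virt(3)[symmetric] _ that] out over P by metis
  show ?thesis
    by (rule bracket_same_marks[OF D n[symmetric]]) (use 1 2 in blast)+
qed

lemma bracket_crossing_switch:
  assumes D: "virtual_link_diagram D" "virtual_link_diagram D'" and R: "crossing_switch D D'"
  shows "specialize \<epsilon> (bracket f D) = specialize \<epsilon> (bracket f D')"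
proof -
  obtain X where X: "D' = D\<lparr>over := X\<rparr>" using R unfolding crossing_switch_def by blast
  have "comps D' = comps D" "point D' = point D" "params D' = params D" "virt D' = virt D"
    unfolding X by (simp_all add: point_def params_def)
  then show ?thesis by (intro bracket_same_marks[OF D]) (simp_all add: classical_def crossings_def)
qed

text \<open>The parameter changes are increasing and commute with integer shifts, so they preserve
  the cyclic order of passages on each component, while the map of the plane merely renames the
  crossings.\<close>

lemma bracket_isotopic:
  assumes D: "virtual_link_diagram D" "virtual_link_diagram D'" and R: "isotopic D D'"
  shows "specialize \<epsilon> (bracket f D) = specialize \<epsilon> (bracket f D')"
proof -
  obtain h h' \<sigma> \<phi> where n: "comps D = comps D'" and h: "bij h" and \<sigma>: "\<sigma> permutes {..<comps D}"
    and \<phi>': "\<forall>i < comps D. continuous_on UNIV (\<phi> i) \<and> strict_mono (\<phi> i) \<and>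
           (\<forall>t. \<phi> i (t + 1) = \<phi> i t + 1 \<and> curve D' i t = h (curve D (\<sigma> i) (\<phi> i t)))"
    and virt: "virt D' = h ` virt D"
    using R unfolding isotopic_def by (elim conjE exE) (rule that; assumption)
  note \<phi> = mp[OF spec[OF \<phi>']]
  let ?N = "comps D"
  have mono: "\<phi> i s < \<phi> i t \<longleftrightarrow> s < t" if "i < ?N" for i s t
    using \<phi>[OF that] strict_mono_less by blast
  have one: "\<phi> i (t + 1) = \<phi> i t + 1" if "i < ?N" for i t using \<phi>[OF that] by blast
  have shift_nat: "\<phi> i (t + real k) = \<phi> i t + real k" if "i < ?N" for i t k
  proof (induction k)
    case (Suc k)
    then show ?case using one[OF that, of "t + real k"] by (simp add: add_ac)
  qed simp
  have shift: "\<phi> i (t + of_int k) = \<phi> i t + of_int k" if "i < ?N" for i t k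
  proof (cases "k \<ge> 0")
    case True
    then show ?thesis using shift_nat[OF that, of t "nat k"] by simp
  next
    case False
    then show ?thesis using shift_nat[OF that, of "t + of_int k" "nat (- k)"] by simp
  qed
  \<comment> \<open>The value \<open>u\<close> lies between the values at two consecutive integers,
    as \<open>\<phi> i\<close> shifts by integers; the intermediate value theorem then
    applies.\<close>
  have surj: "\<exists>t. \<phi> i t = u" if i: "i < ?N" for i u
  proof -
    have "\<phi> i (0 + of_int \<lfloor>u - \<phi> i 0\<rfloor>) \<le> u" "u \<le> \<phi> i (0 + of_int (\<lfloor>u - \<phi> i 0\<rfloor> + 1))"
      unfolding shift[OF i] by linarith+
    then show ?thesis
      using IVT'[of "\<phi> i" "0 + of_int \<lfloor>u - \<phi> i 0\<rfloor>" u "0 + of_int (\<lfloor>u - \<phi> i 0\<rfloor> + 1)"] \<phi>[OF i] continuous_on_subset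
      by (metis add_left_mono less_add_one less_imp_le of_int_le_iff subset_UNIV)
  qed
  \<comment> \<open>Takes a parameter of \<open>D'\<close> to the corresponding one of
    \<open>D\<close>, the direction in which \<open>\<sigma>\<close> and \<open>\<phi>\<close> are
    given.\<close>
  define g where "g = (\<lambda>(i, t). (\<sigma> i, frac (\<phi> i t)))"
  have \<phi>frac: "frac (\<phi> i (frac t)) = frac (\<phi> i t)" if "i < ?N" for i t
  proof -
    have "\<phi> i (frac t) = \<phi> i t + of_int (- \<lfloor>t\<rfloor>)" using shift[OF that, of t "- \<lfloor>t\<rfloor>"] by (simp add: frac_def)
    then show ?thesis using frac_eq_shift by blast
  qed
  have g_frac: "g (i, frac t) = (\<sigma> i, frac (\<phi> i t))" if "i < ?N" for i t
    using \<phi>frac[OF that] by (simp add: g_def)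
  have \<sigma>N: "\<sigma> i < ?N \<longleftrightarrow> i < ?N" for i using permutes_in_image[OF \<sigma>, of i] by simp
  have P: "params D' = params D" by (simp add: params_def n)
  have form: "\<exists>i t. p = (i, frac t) \<and> i < ?N" if "p \<in> params D" for p
    using that by (cases p) (auto simp: params_def intro!: exI[of _ "snd p"] frac_unique[symmetric])
  have paramsI: "(i, frac t) \<in> params D" if "i < ?N" for i t
    using that by (simp add: params_def frac_lt_1)
  have g_in: "g p \<in> params D" if "p \<in> params D" for p
    using form[OF that] g_frac paramsI \<sigma>N by metis
  have g_surj: "\<exists>p \<in> params D. g p = q" if q: "q \<in> params D" for q
  proof -
    obtain j u where j: "q = (j, frac u)" "j < ?N" using form[OF q] by blast
    obtain i where i: "\<sigma> i = j" using permutes_surj[OF \<sigma>] by (metis surjD)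
    then have iN: "i < ?N" using \<sigma>N j(2) by blast
    obtain t where "\<phi> i t = u" using surj[OF iN] by blast
    then have "g (i, frac t) = q" using g_frac[OF iN] i j(1) by simp
    then show ?thesis using paramsI[OF iN] by blast
  qed
  have g_inj: "inj_on g (params D)"
  proof (rule inj_onI)
    fix p q assume pq: "p \<in> params D" "q \<in> params D" "g p = g q"
    obtain i s where p: "p = (i, s)" "i < ?N" "0 \<le> s" "s < 1" using pq(1) by (cases p) (auto simp: params_def)
    obtain j t where q: "q = (j, t)" "j < ?N" "0 \<le> t" "t < 1" using pq(2) by (cases q) (auto simp: params_def)
    have "\<sigma> i = \<sigma> j" using pq(3) p(1) q(1) by (simp add: g_def)
    then have ij: "i = j" using permutes_inj[OF \<sigma>] by (simp add: inj_eq)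
    have fr: "frac (\<phi> i s) = frac (\<phi> i t)" using pq(3) p(1) q(1) ij by (simp add: g_def)
    have ne: "frac (\<phi> i u) \<noteq> frac (\<phi> i v)" if "u < v" "0 \<le> u" "v < 1" for u v
    proof (rule frac_neq)
      show "\<phi> i u < \<phi> i v" using mono[OF p(2)] that by simp
      have "\<phi> i v < \<phi> i (u + 1)" using mono[OF p(2)] that by simp
      then show "\<phi> i v < \<phi> i u + 1" using one[OF p(2)] by simp
    qed
    have "s = t" using ne[of s t] ne[of t s] fr p(3,4) q(3,4) by (metis linorder_neqE)
    then show "p = q" using p(1) q(1) ij by simp
  qed
  have pt: "point D' p = h (point D (g p))" if pD: "p \<in> params D" for p
  proof -
    obtain i t where i: "p = (i, frac t)" "i < ?N" using form[OF pD] by blast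
    have "i < comps D'" "\<sigma> i < comps D" using i(2) n \<sigma>N by simp_all
    then show ?thesis
      unfolding i(1) g_frac[OF i(2)] point_frac[OF D(2) \<open>i < comps D'\<close>] point_frac[OF D(1) \<open>\<sigma> i < comps D\<close>]
      using \<phi>[OF i(2)] by blast
  qed
  have hinj: "h u = h v \<longleftrightarrow> u = v" for u v using bij_is_inj[OF h] by (simp add: inj_eq)
  have cross: "crossings D' = h ` crossings D"
  proof (rule set_eqI)
    fix z
    obtain w where w: "z = h w" using bij_is_surj[OF h] by (metis surjD)
    have "z \<in> crossings D' \<longleftrightarrow> (\<exists>p\<in>params D. \<exists>q\<in>params D. p \<noteq> q \<and> point D' p = h w \<and> point D' q = h w)"
      by (simp only: crossings_def P w mem_Collect_eq)
    also have "\<dots> \<longleftrightarrow> (\<exists>p\<in>params D. \<exists>q\<in>params D. p \<noteq> q \<and> point D (g p) = w \<and> point D (g q) = w)"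
      by (intro bex_cong refl) (simp only: pt hinj)
    also have "\<dots> \<longleftrightarrow> (\<exists>p\<in>params D. \<exists>q\<in>params D. p \<noteq> q \<and> point D p = w \<and> point D q = w)"
    proof
      assume "\<exists>p\<in>params D. \<exists>q\<in>params D. p \<noteq> q \<and> point D (g p) = w \<and> point D (g q) = w"
      then obtain p q where pq: "p \<in> params D" "q \<in> params D" "p \<noteq> q" "point D (g p) = w" "point D (g q) = w" by blast
      have "g p \<noteq> g q" using inj_on_eq_iff[OF g_inj pq(1,2)] pq(3) by simp
      then show "\<exists>p\<in>params D. \<exists>q\<in>params D. p \<noteq> q \<and> point D p = w \<and> point D q = w"
        by (intro bexI[OF bexI[OF _ g_in[OF pq(2)]] g_in[OF pq(1)]] conjI pq(4,5))
    next
      assume "\<exists>p\<in>params D. \<exists>q\<in>params D. p \<noteq> q \<and> point D p = w \<and> point D q = w"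
      then obtain p q where pq: "p \<in> params D" "q \<in> params D" "p \<noteq> q" "point D p = w" "point D q = w" by blast
      obtain p' where p': "p' \<in> params D" "g p' = p" using g_surj[OF pq(1)] by (elim bexE)
      obtain q' where q': "q' \<in> params D" "g q' = q" using g_surj[OF pq(2)] by (elim bexE)
      have "p' \<noteq> q'" "point D (g p') = w" "point D (g q') = w" using p' q' pq by auto
      then show "\<exists>p\<in>params D. \<exists>q\<in>params D. p \<noteq> q \<and> point D (g p) = w \<and> point D (g q) = w"
        by (intro bexI[OF bexI[OF _ q'(1)] p'(1)] conjI)
    qed
    also have "\<dots> \<longleftrightarrow> z \<in> h ` crossings D"
      by (simp only: w inj_image_mem_iff[OF bij_is_inj[OF h]] crossings_def mem_Collect_eq)
    finally show "z \<in> crossings D' \<longleftrightarrow> z \<in> h ` crossings D" .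
  qed
  have clas: "classical D' = h ` classical D"
    unfolding classical_def cross virt by (simp add: image_set_diff[OF bij_is_inj[OF h]])
  have cp_iff: "p \<in> cparams D' \<longleftrightarrow> g p \<in> cparams D" if "p \<in> params D" for p
    using that pt[OF that] g_in[OF that] hinj unfolding cparams_def P clas by auto
  have cp_sub: "cparams D' \<subseteq> params D" "cparams D \<subseteq> params D" using P by (auto simp: cparams_def)
  have g_cp: "cparams D = g ` cparams D'"
  proof (rule subset_antisym; rule subsetI)
    fix q assume q: "q \<in> cparams D"
    obtain p where p: "p \<in> params D" "g p = q" using g_surj[OF subsetD[OF cp_sub(2) q]] by (elim bexE)
    have "p \<in> cparams D'" using cp_iff[OF p(1)] p(2) q by simp
    then show "q \<in> g ` cparams D'" unfolding p(2)[symmetric] by (rule imageI)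
  next
    fix q assume "q \<in> g ` cparams D'"
    then obtain p where p: "p \<in> cparams D'" "q = g p" by (elim imageE)
    show "q \<in> cparams D" using cp_iff[OF subsetD[OF cp_sub(1) p(1)]] p by simp
  qed
  have fin: "finite (cparams D)" "finite (cparams D')"
    using cparams_chords[OF D(1)] cparams_chords[OF D(2)] by (simp_all add: chord_marks_def marks_def)
  have marks': "marks (comps D') (cparams D')" using cparams_chords[OF D(2)] by (simp add: chord_marks_def)
  have step: "next_mark (cparams D) (g p) = g (next_mark (cparams D') p)" if p: "p \<in> cparams D'" for p
  proof -
    obtain i t u where u: "p = (i, t)" "frac t = t" "t < u" "(i, frac u) \<in> cparams D'"
      "\<And>v. t < v \<Longrightarrow> v < u \<Longrightarrow> (i, frac v) \<notin> cparams D'" "next_mark (cparams D') p = (i, frac u)"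
      using marks_next[OF marks' p] by metis
    have i: "i < ?N" using p u(1) cp_sub by (auto simp: params_def)
    have "next_mark (cparams D) (\<sigma> i, frac (\<phi> i t)) = (\<sigma> i, frac (\<phi> i u))"
    proof (rule next_mark_eq[OF fin(1)])
      show "(\<sigma> i, frac (\<phi> i u)) \<in> cparams D" using cp_iff[OF paramsI[OF i]] u(4) g_frac[OF i] by metis
      show "\<phi> i t < \<phi> i u" using mono[OF i] u(3) by simp
      show "(\<sigma> i, frac v) \<notin> cparams D" if v: "\<phi> i t < v" "v < \<phi> i u" for v
      proof -
        obtain w where w: "\<phi> i w = v" using surj[OF i] by blast
        have "(i, frac w) \<notin> cparams D'" using u(5)[of w] v mono[OF i] w by metis
        then show ?thesis using cp_iff[OF paramsI[OF i]] g_frac[OF i, of w] w by metis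
      qed
    qed
    then show ?thesis unfolding u(6) g_frac[OF i] using g_frac[OF i, of t] u(1,2) by simp
  qed
  have un: "unmarked ?N (cparams D) = unmarked ?N (cparams D')"
  proof -
    have has: "(\<exists>t. (i, t) \<in> cparams D') \<longleftrightarrow> (\<exists>t. (\<sigma> i, t) \<in> cparams D)" if i: "i < ?N" for i
    proof
      assume "\<exists>t. (i, t) \<in> cparams D'"
      then obtain t where t: "(i, t) \<in> cparams D'" by blast
      then have "g (i, t) \<in> cparams D" using g_cp by blast
      then show "\<exists>t. (\<sigma> i, t) \<in> cparams D" by (auto simp: g_def)
    next
      assume "\<exists>t. (\<sigma> i, t) \<in> cparams D"
      then obtain t q where q: "q \<in> cparams D'" "(\<sigma> i, t) = g q" using g_cp by blast
      obtain j s where j: "q = (j, s)" by (cases q)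
      have "\<sigma> i = \<sigma> j" using q(2) unfolding j by (simp add: g_def)
      then have "i = j" using permutes_inj[OF \<sigma>] by (simp add: inj_eq)
      then show "\<exists>t. (i, t) \<in> cparams D'" using q(1) j by blast
    qed
    have "{j. j < ?N \<and> (\<forall>t. (j, t) \<notin> cparams D)} = \<sigma> ` {i. i < ?N \<and> (\<forall>t. (i, t) \<notin> cparams D')}"
    proof (rule set_eqI)
      fix j
      obtain i where i: "j = \<sigma> i" using permutes_surj[OF \<sigma>] by (metis surjD)
      have "j \<in> \<sigma> ` A \<longleftrightarrow> i \<in> A" for A unfolding i using permutes_inj[OF \<sigma>] by (rule inj_image_mem_iff)
      then show "j \<in> {j. j < ?N \<and> (\<forall>t. (j, t) \<notin> cparams D)} \<longleftrightarrow> j \<in> \<sigma> ` {i. i < ?N \<and> (\<forall>t. (i, t) \<notin> cparams D')}"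
        using has[of i] \<sigma>N[of i] i by auto
    qed
    then show ?thesis
      unfolding unmarked_def by (simp add: card_image inj_on_subset[OF permutes_inj[OF \<sigma>]])
  qed
  obtain \<kappa> :: "complex \<Rightarrow> nat" where \<kappa>: "inj_on \<kappa> (classical D \<union> classical D')"
    using infinite_labels[of "classical D \<union> classical D'"] finite_classical[OF D(1)] finite_classical[OF D(2)] by blast
  then have \<kappa>s: "inj_on \<kappa> (classical D)" "inj_on \<kappa> (classical D')" using inj_on_subset by blast+
  have ih: "inv h (h z) = z" for z by (rule inv_f_f[OF bij_is_inj[OF h]])
  have pc: "point D p \<in> classical D" if "p \<in> cparams D" for p using that by (simp add: cparams_def)
  have "B (cparams D') (next_mark (cparams D')) (point D') (classical D') \<kappa> (unmarked ?N (cparams D')) =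
      B (cparams D) (next_mark (cparams D)) (point D) (classical D) \<kappa> (unmarked ?N (cparams D'))"
  proof (rule B_rename[where g = g and h = "inv h", OF chord_marks_chords[OF cparams_chords[OF D(2)]] inj_on_subset[OF g_inj cp_sub(1)] g_cp])
    show "inj_on (inv h) (classical D')" by (rule inj_on_subset[OF bij_is_inj[OF bij_imp_bij_inv[OF h]]]) simp
    show "classical D = inv h ` classical D'" unfolding clas by (simp add: image_image ih)
    show "point D (g p) = inv h (point D' p)" if "p \<in> cparams D'" for p
      using pt[of p] that cp_sub ih by auto
    show "point D (g p) \<notin> classical D" if "p \<in> cparams D'" "point D' p \<notin> classical D'" for p
      using that by (simp add: cparams_def)
  qed (use step \<kappa>s in auto)
  then have "BM (comps D') (cparams D') (point D') (classical D') \<kappa> = BM (comps D) (cparams D) (point D) (classical D) \<kappa>"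
    unfolding BM_def n[symmetric] un .
  then show ?thesis
    using specialize_bracket[OF D(1) marked_by_self[OF D(1)] \<kappa>s(1)] specialize_bracket[OF D(2) marked_by_self[OF D(2)] \<kappa>s(2)]
    by simp
qed

text \<open>
  Once the crossing passages of each strand are moved close to its beginning, two diagrams related
  by a move have their passages at the same parameters.
\<close>

lemma BM_slide1:
  fixes lab :: "nat \<times> real \<Rightarrow> complex"
  assumes M: "chord_marks n M lab C" and \<kappa>: "inj_on \<kappa> C" and i: "i < n" and ab: "b < a + 1" "a < r" "r < s" "s < b"
    and marks: "\<And>v. a \<le> v \<Longrightarrow> v \<le> b \<Longrightarrow> (i, frac v) \<in> M \<longleftrightarrow> v = s"
  shows "BM n M lab C \<kappa> = BM n (insert (i, frac r) (M - {(i, frac s)})) (lab((i, frac r) := lab (i, frac s))) C \<kappa> \<and>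
    chord_marks n (insert (i, frac r) (M - {(i, frac s)})) (lab((i, frac r) := lab (i, frac s))) C"
  by (rule BM_slide[OF M \<kappa> i]) (use ab marks in auto)

text \<open>The earlier passage moves first, from \<open>s\<close> to \<open>r\<close>; afterwards
  the piece from \<open>r'\<close> to \<open>s'\<close> is free and the later passage can
  follow.\<close>

lemma BM_slide2:
  fixes lab :: "nat \<times> real \<Rightarrow> complex"
  assumes M: "chord_marks n M lab C" and \<kappa>: "inj_on \<kappa> C" and i: "i < n"
    and ab: "b < a + 1" "a < r" "r < r'" "r' < s" "s < s'" "s' < b"
    and marks: "\<And>v. a \<le> v \<Longrightarrow> v \<le> b \<Longrightarrow> (i, frac v) \<in> M \<longleftrightarrow> v = s \<or> v = s'"
    and M': "M' = {(i, frac r), (i, frac r')} \<union> (M - {(i, frac s), (i, frac s')})"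
    and lab': "lab' = lab((i, frac r) := lab (i, frac s), (i, frac r') := lab (i, frac s'))"
  shows "BM n M lab C \<kappa> = BM n M' lab' C \<kappa> \<and> chord_marks n M' lab' C"
proof -
  let ?M = "insert (i, frac r) (M - {(i, frac s)})" and ?lab = "lab((i, frac r) := lab (i, frac s))"
  have ne: "frac u \<noteq> frac v" if "a \<le> u" "u < v" "v \<le> b" for u v using frac_neq[of u v] that ab(1) by simp
  have 1: "BM n M lab C \<kappa> = BM n ?M ?lab C \<kappa> \<and> chord_marks n ?M ?lab C"
    by (rule BM_slide[OF M \<kappa> i _ _ _ _ refl refl]) (use ab marks in auto)
  have n: "frac s' \<noteq> frac r" "frac s' \<noteq> frac s" "frac r \<noteq> frac s" "frac r' \<noteq> frac s" "frac r' \<noteq> frac s'" "frac r' \<noteq> frac r"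
    using ne[of r s'] ne[of s s'] ne[of r s] ne[of r' s] ne[of r' s'] ne[of r r'] ab by auto
  have s'M: "(i, frac s') \<in> M" using marks[of s'] ab by simp
  have M2: "M' = insert (i, frac r') (?M - {(i, frac s')})" unfolding M' using n by auto
  have "BM n ?M ?lab C \<kappa> = BM n M' lab' C \<kappa> \<and> chord_marks n M' lab' C"
  proof (rule BM_slide[OF conjunct2[OF 1] \<kappa> i _ _ _ _ M2])
    show "(i, frac s') \<in> ?M" using s'M n by simp
    show "(i, frac v) \<notin> ?M" if v: "r' \<le> v" "v < s'" for v
      using v marks[of v] ne[of r v] ab by (cases "v = s") auto
    show "lab' = ?lab((i, frac r') := ?lab (i, frac s'))" unfolding lab' using n by simp
  qed (use ab in auto)
  then show ?thesis using 1 by simp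
qed

end

section \<open>The third Reidemeister move of diagrams\<close>

text \<open>The parameters \<open>s\<close> and \<open>s'\<close> are ordered along the strand, and
  \<open>before\<close> decides which crossing comes first. In this form the reversal of order in
  the move becomes an exchange of labels.\<close>

definition positions :: "diagram \<Rightarrow> strand \<Rightarrow> complex \<Rightarrow> complex \<Rightarrow> real \<Rightarrow> real \<Rightarrow> bool" where
  "positions D = (\<lambda>(i, a, b) x y s s'. a < s \<and> s < s' \<and> s' < b \<and>
     (\<forall>v. a \<le> v \<longrightarrow> v \<le> b \<longrightarrow> (i, frac v) \<in> cparams D \<longleftrightarrow> v = s \<or> v = s') \<and>
     point D (i, frac s) = (if before D (i, a, b) x y then x else y) \<and>
     point D (i, frac s') = (if before D (i, a, b) x y then y else x))"

context tangles
begin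

text \<open>Among the three crossings in the disc, \<open>z\<close> has both its passages on other
  strands, so the given strand has exactly one passage at \<open>x\<close> and one at
  \<open>y\<close>.\<close>

lemma positions_ex:
  assumes k: "(i, a, b) \<in> set ks" and xy: "x \<noteq> y" "x \<in> classical D" "y \<in> classical D" and X: "crossings D \<inter> U = {x, y, z}"
    and s: "a < s" "s < b" "a < s'" "s' < b"
    and x: "{p \<in> params D. point D p = x} = {(i, frac s), q}" "q \<notin> strand_params (i, a, b)"
    and y: "{p \<in> params D. point D p = y} = {(i, frac s'), q'}" "q' \<notin> strand_params (i, a, b)"
    and z: "{p \<in> params D. point D p = z} = {w, w'}" "w \<notin> strand_params (i, a, b)" "w' \<notin> strand_params (i, a, b)"
  shows "\<exists>s s'. positions D (i, a, b) x y s s'"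
proof -
  have i: "i < comps D" by (rule strand(1)[OF k])
  have K: "(i, frac v) \<in> strand_params (i, a, b)" "(i, frac v) \<in> params D" if "v \<in> {a..b}" for v
    using that i by (auto simp: params_def frac_lt_1)
  have px: "point D (i, frac v) = x \<longleftrightarrow> v = s" if v: "v \<in> {a..b}" for v
  proof -
    have "point D (i, frac v) = x \<longleftrightarrow> (i, frac v) \<in> {(i, frac s), q}" using x(1) K(2)[OF v] by blast
    also have "\<dots> \<longleftrightarrow> frac v = frac s" using x(2) K(1)[OF v] by auto
    also have "\<dots> \<longleftrightarrow> v = s" using strand_inj[OF k v, of s] s by auto
    finally show ?thesis .
  qed
  have py: "point D (i, frac v) = y \<longleftrightarrow> v = s'" if v: "v \<in> {a..b}" for v
  proof -
    have "point D (i, frac v) = y \<longleftrightarrow> (i, frac v) \<in> {(i, frac s'), q'}" using y(1) K(2)[OF v] by blast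
    also have "\<dots> \<longleftrightarrow> frac v = frac s'" using y(2) K(1)[OF v] by auto
    also have "\<dots> \<longleftrightarrow> v = s'" using strand_inj[OF k v, of s'] s by auto
    finally show ?thesis .
  qed
  have pz: "point D (i, frac v) \<noteq> z" if v: "v \<in> {a..b}" for v
  proof
    assume "point D (i, frac v) = z"
    then have "(i, frac v) \<in> {p \<in> params D. point D p = z}" using K(2)[OF v] by simp
    then have "(i, frac v) \<in> {w, w'}" unfolding z(1) .
    then show False using z(2,3) K(1)[OF v] by (metis insertE empty_iff)
  qed
  have marks: "(i, frac v) \<in> cparams D \<longleftrightarrow> v = s \<or> v = s'" if v: "v \<in> {a..b}" for v
  proof
    assume "(i, frac v) \<in> cparams D"
    then have "point D (i, frac v) \<in> crossings D \<inter> U"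
      using strand(4)[OF k v] inside(1) by (auto simp: cparams_def classical_def)
    then show "v = s \<or> v = s'" unfolding X using px[OF v] py[OF v] pz[OF v] by blast
  next
    assume "v = s \<or> v = s'"
    then have "point D (i, frac v) = x \<or> point D (i, frac v) = y" using px[OF v] py[OF v] by blast
    then show "(i, frac v) \<in> cparams D" using K(2)[OF v] xy by (auto simp: cparams_def)
  qed
  have bf: "before D (i, a, b) x y \<longleftrightarrow> s < s'"
  proof -
    have "before D (i, a, b) x y \<longleftrightarrow> (\<exists>u v. a \<le> u \<and> u < v \<and> v \<le> b \<and> point D (i, frac u) = x \<and> point D (i, frac v) = y)"
      by (simp add: point_frac[OF D(1) i])
    also have "\<dots> \<longleftrightarrow> s < s'"
    proof
      assume "\<exists>u v. a \<le> u \<and> u < v \<and> v \<le> b \<and> point D (i, frac u) = x \<and> point D (i, frac v) = y"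
      then obtain u v where "a \<le> u" "u < v" "v \<le> b" "point D (i, frac u) = x" "point D (i, frac v) = y" by blast
      then show "s < s'" using px[of u] py[of v] by simp
    next
      assume "s < s'"
      then show "\<exists>u v. a \<le> u \<and> u < v \<and> v \<le> b \<and> point D (i, frac u) = x \<and> point D (i, frac v) = y"
        using px[of s] py[of s'] s by (intro exI[of _ s] exI[of _ s']) simp
    qed
    finally show ?thesis .
  qed
  have pt: "point D (i, frac s) = x" "point D (i, frac s') = y" using px[of s] py[of s'] s by simp_all
  then have "s \<noteq> s'" using xy(1) by metis
  then consider "s < s'" | "s' < s" by linarith
  then show ?thesis
  proof cases
    case 1
    then have "positions D (i, a, b) x y s s'" unfolding positions_def using s marks bf pt by auto
    then show ?thesis by blast
  next
    case 2
    then have "positions D (i, a, b) x y s' s" unfolding positions_def using s marks bf pt by auto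
    then show ?thesis by blast
  qed
qed

end

text \<open>The three crossings belong to three different pairs of disjoint strands. Hence they are
  distinct and every strand passes through exactly two of them.\<close>

lemma (in tangles) three_positions:
  assumes ks: "ks = [k, l, m]" and X: "crossings D \<inter> U = {x, y, z}"
    and over: "passes_over D k l x" "passes_over D k m y" "passes_over D l m z"
  shows "\<exists>s s'. positions D k x y s s'" "\<exists>s s'. positions D l x z s s'" "\<exists>s s'. positions D m y z s s'"
    "distinct [x, y, z]" "{x, y, z} \<subseteq> classical D" "classical D = insert x (insert y (insert z C0))"
proof -
  obtain i a b where k: "k = (i, a, b)" by (cases k)
  obtain j c d where l: "l = (j, c, d)" by (cases l)
  obtain h e g where m: "m = (h, e, g)" by (cases m)
  have "sorted_wrt (\<lambda>k l. strand_params k \<inter> strand_params l = {}) ks"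
    using rep unfolding tangle_replacement_def tangle_in_def by blast
  then have dis: "strand_params (i, a, b) \<inter> strand_params (j, c, d) = {}" "strand_params (i, a, b) \<inter> strand_params (h, e, g) = {}"
    "strand_params (j, c, d) \<inter> strand_params (h, e, g) = {}"
    unfolding ks k l m by auto
  have mem: "(i, a, b) \<in> set ks" "(j, c, d) \<in> set ks" "(h, e, g) \<in> set ks" by (simp_all add: ks k l m)
  obtain s t where x0: "a < s" "s < b" "c < t" "t < d" "(i, frac s) \<noteq> (j, frac t)"
    "{p \<in> params D. point D p = x} = {(i, frac s), (j, frac t)}" "x \<in> classical D" "x \<in> U"
    by (rule passage[OF mem(1,2) dis(1) over(1)[unfolded k l]])
  note x = x0(1-4,6,7)
  obtain s' u where y0: "a < s'" "s' < b" "e < u" "u < g" "(i, frac s') \<noteq> (h, frac u)"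
    "{p \<in> params D. point D p = y} = {(i, frac s'), (h, frac u)}" "y \<in> classical D" "y \<in> U"
    by (rule passage[OF mem(1,3) dis(2) over(2)[unfolded k m]])
  note y = y0(1-4,6,7)
  obtain t' u' where z0: "c < t'" "t' < d" "e < u'" "u' < g" "(j, frac t') \<noteq> (h, frac u')"
    "{p \<in> params D. point D p = z} = {(j, frac t'), (h, frac u')}" "z \<in> classical D" "z \<in> U"
    by (rule passage[OF mem(2,3) dis(3) over(3)[unfolded l m]])
  note z = z0(1-4,6,7)
  have K: "(i, frac s) \<in> strand_params (i, a, b)" "(i, frac s') \<in> strand_params (i, a, b)"
    "(j, frac t) \<in> strand_params (j, c, d)" "(j, frac t') \<in> strand_params (j, c, d)"
    "(h, frac u) \<in> strand_params (h, e, g)" "(h, frac u') \<in> strand_params (h, e, g)"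
    using x y z by auto
  have out: "(j, frac t) \<notin> strand_params (i, a, b)" "(j, frac t') \<notin> strand_params (i, a, b)"
    "(h, frac u) \<notin> strand_params (i, a, b)" "(h, frac u') \<notin> strand_params (i, a, b)"
    "(i, frac s) \<notin> strand_params (j, c, d)" "(i, frac s') \<notin> strand_params (j, c, d)"
    "(h, frac u) \<notin> strand_params (j, c, d)" "(h, frac u') \<notin> strand_params (j, c, d)"
    "(i, frac s) \<notin> strand_params (h, e, g)" "(i, frac s') \<notin> strand_params (h, e, g)"
    "(j, frac t) \<notin> strand_params (h, e, g)" "(j, frac t') \<notin> strand_params (h, e, g)"
    using K dis by blast+
  have xy: "x \<noteq> y"
  proof
    assume "x = y"
    then have "(j, frac t) \<in> {(i, frac s'), (h, frac u)}" using x(5) y(5) by blast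
    then show False using K(3) out(6,7) by (metis insertE empty_iff)
  qed
  have xz: "x \<noteq> z"
  proof
    assume "x = z"
    then have "(i, frac s) \<in> {(j, frac t'), (h, frac u')}" using x(5) z(5) by blast
    then show False using K(1) out(2,4) by (metis insertE empty_iff)
  qed
  have yz: "y \<noteq> z"
  proof
    assume "y = z"
    then have "(i, frac s') \<in> {(j, frac t'), (h, frac u')}" using y(5) z(5) by blast
    then show False using K(2) out(2,4) by (metis insertE empty_iff)
  qed
  show "distinct [x, y, z]" using xy xz yz by simp
  show sub: "{x, y, z} \<subseteq> classical D" using x(6) y(6) z(6) by simp
  show "classical D = insert x (insert y (insert z C0))"
    using sub X unfolding classical_def by blast
  have X2: "crossings D \<inter> U = {x, z, y}" "crossings D \<inter> U = {y, z, x}" using X by auto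
  note x' = x(5)[unfolded insert_commute[of "(i, frac s)"]]
  show "\<exists>s s'. positions D k x y s s'" unfolding k
    by (rule positions_ex[OF mem(1) xy x(6) y(6) X x(1,2) y(1,2) x(5) out(1) y(5) out(3) z(5) out(2,4)])
  show "\<exists>s s'. positions D l x z s s'" unfolding l
    by (rule positions_ex[OF mem(2) xz x(6) z(6) X2(1) x(3,4) z(1,2) x' out(5) z(5) out(8) y(5) out(6,7)])
  show "\<exists>s s'. positions D m y z s s'" unfolding m
    by (rule positions_ex[OF mem(3) yz y(6) z(6) X2(2) y(3,4) z(3,4)
          y(5)[unfolded insert_commute[of "(i, frac s')"]] out(10) z(5)[unfolded insert_commute[of "(j, frac t')"]] out(12) x(5) out(9,11)])
qed

context evaluation
begin

text \<open>Removing the whole of \<open>K\<close> makes the new mark set independent of the old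
  positions \<open>s\<close> and \<open>s'\<close>, so that the sets obtained from the two diagrams
  of a move coincide.\<close>

lemma BM_strand2:
  fixes lab :: "nat \<times> real \<Rightarrow> complex"
  assumes M: "chord_marks n M lab C" and \<kappa>: "inj_on \<kappa> C" and i: "i < n"
    and ab: "b < a + 1" "a < r" "r < r'" "r' < s" "s < s'" "s' < b"
    and marks: "\<forall>v. a \<le> v \<and> v \<le> b \<longrightarrow> ((i, frac v) \<in> M \<longleftrightarrow> v = s \<or> v = s')"
    and K: "K = strand_params (i, a, b)"
  obtains lab' where "BM n M lab C \<kappa> = BM n ({(i, frac r), (i, frac r')} \<union> (M - K)) lab' C \<kappa>"
    "chord_marks n ({(i, frac r), (i, frac r')} \<union> (M - K)) lab' C"
    "lab' (i, frac r) = lab (i, frac s)" "lab' (i, frac r') = lab (i, frac s')"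
    "\<forall>p. p \<notin> K \<longrightarrow> lab' p = lab p"
proof -
  define lab' where "lab' = lab((i, frac r) := lab (i, frac s), (i, frac r') := lab (i, frac s'))"
  have inK: "(i, frac v) \<in> K" if "a \<le> v" "v \<le> b" for v using that unfolding K by auto
  have "M \<inter> K = {(i, frac s), (i, frac s')}"
  proof
    show "M \<inter> K \<subseteq> {(i, frac s), (i, frac s')}" using marks unfolding K by auto
    show "{(i, frac s), (i, frac s')} \<subseteq> M \<inter> K" using marks inK[of s] inK[of s'] ab by simp
  qed
  then have eq: "{(i, frac r), (i, frac r')} \<union> (M - K) = {(i, frac r), (i, frac r')} \<union> (M - {(i, frac s), (i, frac s')})"
    by blast
  have 1: "BM n M lab C \<kappa> = BM n ({(i, frac r), (i, frac r')} \<union> (M - K)) lab' C \<kappa> \<and>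
      chord_marks n ({(i, frac r), (i, frac r')} \<union> (M - K)) lab' C"
    by (rule BM_slide2[OF M \<kappa> i ab _ eq lab'_def]) (use marks in simp)
  have "frac r \<noteq> frac r'" using frac_neq[of r r'] ab by simp
  moreover have "(i, frac r) \<in> K" "(i, frac r') \<in> K" using inK[of r] inK[of r'] ab by simp_all
  ultimately have "lab' (i, frac r) = lab (i, frac s)" "lab' (i, frac r') = lab (i, frac s')" "\<forall>p. p \<notin> K \<longrightarrow> lab' p = lab p"
    unfolding lab'_def by auto
  then show ?thesis using that 1 by blast
qed

lemma three_strands:
  fixes lab :: "nat \<times> real \<Rightarrow> complex"
  assumes M: "chord_marks n M lab C" and \<kappa>: "inj_on \<kappa> C" and n: "i < n" "j < n" "h < n"
    and ab: "b < a + 1" "a < r" "r < r'" "r' < s" "s < s'" "s' < b"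
    and cd: "d < c + 1" "c < q" "q < q'" "q' < t" "t < t'" "t' < d"
    and eg: "g < e + 1" "e < w" "w < w'" "w' < u" "u < u'" "u' < g"
    and marks: "\<And>v. a \<le> v \<Longrightarrow> v \<le> b \<Longrightarrow> (i, frac v) \<in> M \<longleftrightarrow> v = s \<or> v = s'"
      "\<And>v. c \<le> v \<Longrightarrow> v \<le> d \<Longrightarrow> (j, frac v) \<in> M \<longleftrightarrow> v = t \<or> v = t'"
      "\<And>v. e \<le> v \<Longrightarrow> v \<le> g \<Longrightarrow> (h, frac v) \<in> M \<longleftrightarrow> v = u \<or> v = u'"
    and K: "K = strand_params (i, a, b)" "L = strand_params (j, c, d)" "N = strand_params (h, e, g)"
    and dis: "K \<inter> L = {}" "K \<inter> N = {}" "L \<inter> N = {}"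
    and M': "M' = {(i, frac r), (i, frac r'), (j, frac q), (j, frac q'), (h, frac w), (h, frac w')} \<union> (M - (K \<union> L \<union> N))"
  shows "\<exists>lab'. BM n M lab C \<kappa> = BM n M' lab' C \<kappa> \<and> chord_marks n M' lab' C \<and>
    lab' (i, frac r) = lab (i, frac s) \<and> lab' (i, frac r') = lab (i, frac s') \<and>
    lab' (j, frac q) = lab (j, frac t) \<and> lab' (j, frac q') = lab (j, frac t') \<and>
    lab' (h, frac w) = lab (h, frac u) \<and> lab' (h, frac w') = lab (h, frac u') \<and>
    (\<forall>p. p \<notin> K \<union> L \<union> N \<longrightarrow> lab' p = lab p)"
proof -
  have inK: "a \<le> v \<Longrightarrow> v \<le> b \<Longrightarrow> (i, frac v) \<in> K" and inL: "c \<le> v \<Longrightarrow> v \<le> d \<Longrightarrow> (j, frac v) \<in> L"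
    and inN: "e \<le> v \<Longrightarrow> v \<le> g \<Longrightarrow> (h, frac v) \<in> N" for v
    unfolding K by auto
  have rK: "(i, frac r) \<in> K" "(i, frac r') \<in> K" using inK[of r] inK[of r'] ab by simp_all
  have qL: "(j, frac q) \<in> L" "(j, frac q') \<in> L" "(j, frac t) \<in> L" "(j, frac t') \<in> L"
    using inL[of q] inL[of q'] inL[of t] inL[of t'] cd by simp_all
  have wN: "(h, frac w) \<in> N" "(h, frac w') \<in> N" "(h, frac u) \<in> N" "(h, frac u') \<in> N"
    using inN[of w] inN[of w'] inN[of u] inN[of u'] eg by simp_all
  let ?M1 = "{(i, frac r), (i, frac r')} \<union> (M - K)"
  have m1: "\<forall>v. a \<le> v \<and> v \<le> b \<longrightarrow> ((i, frac v) \<in> M \<longleftrightarrow> v = s \<or> v = s')"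
    using marks(1) by simp
  obtain lab1 where 1: "BM n M lab C \<kappa> = BM n ?M1 lab1 C \<kappa>" "chord_marks n ?M1 lab1 C"
    "lab1 (i, frac r) = lab (i, frac s)" "lab1 (i, frac r') = lab (i, frac s')" "\<forall>p. p \<notin> K \<longrightarrow> lab1 p = lab p"
    by (rule BM_strand2[OF M \<kappa> n(1) ab m1 K(1)])
  have m2: "\<forall>v. c \<le> v \<and> v \<le> d \<longrightarrow> ((j, frac v) \<in> ?M1 \<longleftrightarrow> v = t \<or> v = t')"
  proof (intro allI impI, elim conjE)
    fix v assume v: "c \<le> v" "v \<le> d"
    have "(j, frac v) \<notin> K" using inL[OF v] dis(1) by blast
    moreover from this have "(j, frac v) \<notin> {(i, frac r), (i, frac r')}" using rK by (metis insertE singletonD)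
    ultimately show "(j, frac v) \<in> ?M1 \<longleftrightarrow> v = t \<or> v = t'" using marks(2)[OF v] by auto
  qed
  let ?M2 = "{(j, frac q), (j, frac q')} \<union> (?M1 - L)"
  obtain lab2 where 2: "BM n ?M1 lab1 C \<kappa> = BM n ?M2 lab2 C \<kappa>" "chord_marks n ?M2 lab2 C"
    "lab2 (j, frac q) = lab1 (j, frac t)" "lab2 (j, frac q') = lab1 (j, frac t')" "\<forall>p. p \<notin> L \<longrightarrow> lab2 p = lab1 p"
    by (rule BM_strand2[OF 1(2) \<kappa> n(2) cd m2 K(2)])
  have m3: "\<forall>v. e \<le> v \<and> v \<le> g \<longrightarrow> ((h, frac v) \<in> ?M2 \<longleftrightarrow> v = u \<or> v = u')"
  proof (intro allI impI, elim conjE)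
    fix v assume v: "e \<le> v" "v \<le> g"
    have n: "(h, frac v) \<notin> K" "(h, frac v) \<notin> L" using inN[OF v] dis(2,3) by blast+
    then have "(h, frac v) \<notin> {(i, frac r), (i, frac r')}" "(h, frac v) \<notin> {(j, frac q), (j, frac q')}"
      using rK qL by (metis insertE singletonD)+
    then show "(h, frac v) \<in> ?M2 \<longleftrightarrow> v = u \<or> v = u'" using n marks(3)[OF v] by auto
  qed
  let ?M3 = "{(h, frac w), (h, frac w')} \<union> (?M2 - N)"
  obtain lab3 where 3: "BM n ?M2 lab2 C \<kappa> = BM n ?M3 lab3 C \<kappa>" "chord_marks n ?M3 lab3 C"
    "lab3 (h, frac w) = lab2 (h, frac u)" "lab3 (h, frac w') = lab2 (h, frac u')" "\<forall>p. p \<notin> N \<longrightarrow> lab3 p = lab2 p"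
    by (rule BM_strand2[OF 2(2) \<kappa> n(3) eg m3 K(3)])
  have M3: "?M3 = M'" unfolding M' using rK qL wN dis by blast
  have nKL: "p \<notin> L" "p \<notin> N" if "p \<in> K" for p using that dis by blast+
  have nLK: "p \<notin> K" "p \<notin> N" if "p \<in> L" for p using that dis by blast+
  have nNK: "p \<notin> K" "p \<notin> L" if "p \<in> N" for p using that dis by blast+
  have "lab3 (i, frac r) = lab (i, frac s)" "lab3 (i, frac r') = lab (i, frac s')"
    using 3(5) 2(5) 1(3,4) nKL[OF rK(1)] nKL[OF rK(2)] by simp_all
  moreover have "lab3 (j, frac q) = lab (j, frac t)" "lab3 (j, frac q') = lab (j, frac t')"
    using 3(5) 2(3,4) 1(5) nLK[OF qL(1)] nLK[OF qL(2)] nLK[OF qL(3)] nLK[OF qL(4)] by simp_all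
  moreover have "lab3 (h, frac w) = lab (h, frac u)" "lab3 (h, frac w') = lab (h, frac u')"
    using 3(3,4) 2(5) 1(5) nNK[OF wN(3)] nNK[OF wN(4)] by simp_all
  moreover have "\<forall>p. p \<notin> K \<union> L \<union> N \<longrightarrow> lab3 p = lab p" using 3(5) 2(5) 1(5) by simp
  ultimately show ?thesis using 1(1) 2(1) 3(1,2) unfolding M3 by (intro exI[of _ lab3]) simp
qed

text \<open>With all passages in the disc slid to common parameters, the two diagrams have one mark
  set \<open>M\<close>. Up to the names of the crossings they differ by an exchange of the two
  labels on each strand, which is the situation of \<open>B_R3\<close>.\<close>

lemma bracket_R3:
  assumes D: "virtual_link_diagram D" "virtual_link_diagram D'" and R: "reidemeister3 D D'"
  shows "specialize \<epsilon> (bracket f D) = specialize \<epsilon> (bracket f D')"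
proof -
  obtain U k l m x y z x' y' z' where rep: "tangle_replacement D D' U [k, l, m]"
    and X: "crossings D \<inter> U = {x, y, z}" "crossings D' \<inter> U = {x', y', z'}"
    and ov: "passes_over D k l x" "passes_over D k m y" "passes_over D l m z"
    and ov': "passes_over D' k l x'" "passes_over D' k m y'" "passes_over D' l m z'"
    and bf: "before D k x y \<longleftrightarrow> \<not> before D' k x' y'" "before D l x z \<longleftrightarrow> \<not> before D' l x' z'"
      "before D m y z \<longleftrightarrow> \<not> before D' m y' z'"
    using R unfolding reidemeister3_def by blast
  interpret tangles D D' U "[k, l, m]" using D rep by unfold_locales
  interpret r: tangles D' D U "[k, l, m]" by (rule tangles_sym[OF tangles_axioms])
  note pos = three_positions[OF refl X(1) ov] and pos' = r.three_positions[OF refl X(2) ov']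
  obtain i a b where k: "k = (i, a, b)" by (cases k)
  obtain j c d where l: "l = (j, c, d)" by (cases l)
  obtain h e g where m: "m = (h, e, g)" by (cases m)
  obtain s1 s2 where s: "positions D k x y s1 s2" using pos(1) by blast
  obtain t1 t2 where t: "positions D l x z t1 t2" using pos(2) by blast
  obtain u1 u2 where u: "positions D m y z u1 u2" using pos(3) by blast
  obtain s1' s2' where s': "positions D' k x' y' s1' s2'" using pos'(1) by blast
  obtain t1' t2' where t': "positions D' l x' z' t1' t2'" using pos'(2) by blast
  obtain u1' u2' where u': "positions D' m y' z' u1' u2'" using pos'(3) by blast
  note s = s[unfolded k positions_def prod.case] and t = t[unfolded l positions_def prod.case] and u = u[unfolded m positions_def prod.case]
  note s' = s'[unfolded k positions_def prod.case] and t' = t'[unfolded l positions_def prod.case] and u' = u'[unfolded m positions_def prod.case]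
  \<comment> \<open>The new places come before the passages of both diagrams, so the same two
    parameters can be used for \<open>D\<close> and \<open>D'\<close>.\<close>
  have two: "\<exists>r r'. a < r \<and> r < r' \<and> r' < v \<and> r' < v'" if "a < v" "a < v'" for a v v' :: real
  proof -
    have "a < min v v'" using that by simp
    then obtain r' where r': "a < r'" "r' < min v v'" using dense by blast
    then obtain r where "a < r" "r < r'" using dense by blast
    then show ?thesis using r' by auto
  qed
  obtain r r' where r: "a < r" "r < r'" "r' < s1" "r' < s1'" using two[of a s1 s1'] s s' by blast
  obtain q q' where q: "c < q" "q < q'" "q' < t1" "q' < t1'" using two[of c t1 t1'] t t' by blast
  obtain w w' where w: "e < w" "w < w'" "w' < u1" "w' < u1'" using two[of e u1 u1'] u u' by blast
  have mem: "(i, a, b) \<in> set [k, l, m]" "(j, c, d) \<in> set [k, l, m]" "(h, e, g) \<in> set [k, l, m]" by (simp_all add: k l m)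
  note st = strand[OF mem(1)] strand[OF mem(2)] strand[OF mem(3)]
  define K where "K = strand_params (i, a, b)"
  define L where "L = strand_params (j, c, d)"
  define N where "N = strand_params (h, e, g)"
  have "sorted_wrt (\<lambda>k l. strand_params k \<inter> strand_params l = {}) [k, l, m]"
    using rep unfolding tangle_replacement_def tangle_in_def by blast
  then have dis: "K \<inter> L = {}" "K \<inter> N = {}" "L \<inter> N = {}" unfolding k l m K_def L_def N_def by auto
  have ins: "strands = K \<union> L \<union> N" by (auto simp: k l m K_def L_def N_def)
  obtain \<kappa> :: "complex \<Rightarrow> nat" where \<kappa>: "inj_on \<kappa> (classical D \<union> classical D')"
    using infinite_labels[of "classical D \<union> classical D'"] finite_C by blast
  then have \<kappa>s: "inj_on \<kappa> (classical D)" "inj_on \<kappa> (classical D')" using inj_on_subset by blast+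
  let ?R = "{(i, frac r), (i, frac r'), (j, frac q), (j, frac q'), (h, frac w), (h, frac w')}"
  define M where "M = ?R \<union> (cparams D - (K \<union> L \<union> N))"
  have same: "cparams D - (K \<union> L \<union> N) = cparams D' - (K \<union> L \<union> N)"
    using marks_outside r.marks_outside unfolding ins by blast
  let ?n = "comps D"
  have "\<exists>lab. BM ?n (cparams D) (point D) (classical D) \<kappa> = BM ?n M lab (classical D) \<kappa> \<and> chord_marks ?n M lab (classical D) \<and>
    lab (i, frac r) = point D (i, frac s1) \<and> lab (i, frac r') = point D (i, frac s2) \<and>
    lab (j, frac q) = point D (j, frac t1) \<and> lab (j, frac q') = point D (j, frac t2) \<and>
    lab (h, frac w) = point D (h, frac u1) \<and> lab (h, frac w') = point D (h, frac u2) \<and>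
    (\<forall>p. p \<notin> K \<union> L \<union> N \<longrightarrow> lab p = point D p)"
    by (rule three_strands[OF cparams_chords[OF D(1)] \<kappa>s(1) strand(1)[OF mem(1)] strand(1)[OF mem(2)] strand(1)[OF mem(3)]
        strand(3)[OF mem(1)] r(1-3) _ _ strand(3)[OF mem(2)] q(1-3) _ _ strand(3)[OF mem(3)] w(1-3) _ _ _ _ _ K_def L_def N_def dis M_def])
      (use s t u in blast)+
  then obtain lab where A: "BM ?n (cparams D) (point D) (classical D) \<kappa> = BM ?n M lab (classical D) \<kappa>" "chord_marks ?n M lab (classical D)"
    and lab: "lab (i, frac r) = point D (i, frac s1)" "lab (i, frac r') = point D (i, frac s2)"
      "lab (j, frac q) = point D (j, frac t1)" "lab (j, frac q') = point D (j, frac t2)"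
      "lab (h, frac w) = point D (h, frac u1)" "lab (h, frac w') = point D (h, frac u2)"
    and lab_out: "\<And>p. p \<notin> K \<union> L \<union> N \<Longrightarrow> lab p = point D p" by blast
  have "\<exists>lab. BM ?n (cparams D') (point D') (classical D') \<kappa> = BM ?n M lab (classical D') \<kappa> \<and> chord_marks ?n M lab (classical D') \<and>
    lab (i, frac r) = point D' (i, frac s1') \<and> lab (i, frac r') = point D' (i, frac s2') \<and>
    lab (j, frac q) = point D' (j, frac t1') \<and> lab (j, frac q') = point D' (j, frac t2') \<and>
    lab (h, frac w) = point D' (h, frac u1') \<and> lab (h, frac w') = point D' (h, frac u2') \<and>
    (\<forall>p. p \<notin> K \<union> L \<union> N \<longrightarrow> lab p = point D' p)"
    by (rule three_strands[OF cparams_chords[OF D(2), unfolded comps] \<kappa>s(2) strand(1)[OF mem(1)] strand(1)[OF mem(2)] strand(1)[OF mem(3)]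
        strand(3)[OF mem(1)] r(1,2,4) _ _ strand(3)[OF mem(2)] q(1,2,4) _ _ strand(3)[OF mem(3)] w(1,2,4) _ _ _ _ _ K_def L_def N_def dis
        M_def[unfolded same]])
      (use s' t' u' in blast)+
  then obtain lab' where A': "BM ?n (cparams D') (point D') (classical D') \<kappa> = BM ?n M lab' (classical D') \<kappa>" "chord_marks ?n M lab' (classical D')"
    and lab': "lab' (i, frac r) = point D' (i, frac s1')" "lab' (i, frac r') = point D' (i, frac s2')"
      "lab' (j, frac q) = point D' (j, frac t1')" "lab' (j, frac q') = point D' (j, frac t2')"
      "lab' (h, frac w) = point D' (h, frac u1')" "lab' (h, frac w') = point D' (h, frac u2')"
    and lab'_out: "\<And>p. p \<notin> K \<union> L \<union> N \<Longrightarrow> lab' p = point D' p" by blast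
  have inK: "a \<le> v \<Longrightarrow> v \<le> b \<Longrightarrow> (i, frac v) \<in> K" and inL: "c \<le> v \<Longrightarrow> v \<le> d \<Longrightarrow> (j, frac v) \<in> L"
    and inN: "e \<le> v \<Longrightarrow> v \<le> g \<Longrightarrow> (h, frac v) \<in> N" for v
    unfolding K_def L_def N_def by auto
  have lt: "r' < b" "q' < d" "w' < g" using r q w s t u by linarith+
  have RK: "(i, frac r) \<in> K" "(i, frac r') \<in> K" "(j, frac q) \<in> L" "(j, frac q') \<in> L" "(h, frac w) \<in> N" "(h, frac w') \<in> N"
    using inK[of r] inK[of r'] inL[of q] inL[of q'] inN[of w] inN[of w'] r q w lt by simp_all
  have ends: "b < a + 1" "d < c + 1" "g < e + 1" using strand(3)[OF mem(1)] strand(3)[OF mem(2)] strand(3)[OF mem(3)] .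
  have fne: "frac r \<noteq> frac r'" "frac q \<noteq> frac q'" "frac w \<noteq> frac w'"
    by (rule frac_neq; use r q w lt ends in linarith)+
  have KN: "p \<noteq> p'" if "p \<in> K" "p' \<in> L \<or> p' \<in> N" for p p' using that dis by blast
  have LN: "p \<noteq> p'" if "p \<in> L" "p' \<in> N" for p p' using that dis by blast
  have dist: "distinct [(i, frac r), (j, frac q), (h, frac w), (i, frac r'), (j, frac q'), (h, frac w')]"
  proof -
    have 1: "(i, frac v) \<noteq> (j, frac q)" "(i, frac v) \<noteq> (j, frac q')" "(i, frac v) \<noteq> (h, frac w)" "(i, frac v) \<noteq> (h, frac w')"
      if "(i, frac v) \<in> K" for v
      by (rule KN[OF that]; simp add: RK)+
    have 2: "(j, frac v) \<noteq> (h, frac w)" "(j, frac v) \<noteq> (h, frac w')" if "(j, frac v) \<in> L" for v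
      by (rule LN[OF that]; simp add: RK)+
    note ne = 1[OF RK(1)] 1[OF RK(2)] 2[OF RK(3)] 2[OF RK(4)]
    show ?thesis using fne ne ne[symmetric] by simp
  qed
  have fin: "finite M" using A(2) by (simp add: chord_marks_def marks_def)
  have nx: "next_mark M (i, frac r) = (i, frac r')"
  proof (rule next_in_strand[OF fin])
    show "(i, frac v) \<notin> M" if v: "r < v" "v < r'" for v
      using inK[of v] KN[of "(i, frac v)"] RK frac_neq[of r v] frac_neq[of v r'] v r(1) lt ends unfolding M_def by auto
  qed (use r in \<open>auto simp: M_def\<close>)
  have nx2: "next_mark M (j, frac q) = (j, frac q')"
  proof (rule next_in_strand[OF fin])
    show "(j, frac v) \<notin> M" if v: "q < v" "v < q'" for v
    proof -
      have vL: "(j, frac v) \<in> L" using inL[of v] v q(1) lt by simp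
      have 1: "(j, frac v) \<noteq> (i, frac r)" "(j, frac v) \<noteq> (i, frac r')"
        by (rule KN[THEN not_sym, OF RK(1)] KN[THEN not_sym, OF RK(2)], rule disjI1, rule vL)+
      have 2: "(j, frac v) \<noteq> (h, frac w)" "(j, frac v) \<noteq> (h, frac w')" by (rule LN[OF vL RK(5)] LN[OF vL RK(6)])+
      have 3: "(j, frac v) \<noteq> (j, frac q)" "(j, frac v) \<noteq> (j, frac q')"
        using frac_neq[of q v] frac_neq[of v q'] v q(1) lt ends by auto
      show ?thesis using vL 1 2 3 unfolding M_def by blast
    qed
  qed (use q in \<open>auto simp: M_def\<close>)
  have nx3: "next_mark M (h, frac w) = (h, frac w')"
  proof (rule next_in_strand[OF fin])
    show "(h, frac v) \<notin> M" if v: "w < v" "v < w'" for v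
    proof -
      have vN: "(h, frac v) \<in> N" using inN[of v] v w(1) lt by simp
      have 1: "(h, frac v) \<noteq> (i, frac r)" "(h, frac v) \<noteq> (i, frac r')"
        by (rule KN[THEN not_sym, OF RK(1)] KN[THEN not_sym, OF RK(2)], rule disjI2, rule vN)+
      have 2: "(h, frac v) \<noteq> (j, frac q)" "(h, frac v) \<noteq> (j, frac q')"
        by (rule LN[THEN not_sym, OF RK(3) vN] LN[THEN not_sym, OF RK(4) vN])+
      have 3: "(h, frac v) \<noteq> (h, frac w)" "(h, frac v) \<noteq> (h, frac w')"
        using frac_neq[of w v] frac_neq[of v w'] v w(1) lt ends by auto
      show ?thesis using vN 1 2 3 unfolding M_def by blast
    qed
  qed (use w in \<open>auto simp: M_def\<close>)
  have xyz: "x \<noteq> y" "x \<noteq> z" "y \<noteq> z" "x' \<noteq> y'" "x' \<noteq> z'" "y' \<noteq> z'" using pos(4) pos'(4) by auto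
  have C: "classical D = insert x (insert y (insert z C0))" "classical D' = insert x' (insert y' (insert z' C0))"
    using pos(6) pos'(6) classical_outside by simp_all
  have xC: "x \<notin> C0" "y \<notin> C0" "z \<notin> C0" "x' \<notin> C0" "y' \<notin> C0" "z' \<notin> C0" using X by blast+
  \<comment> \<open>The crossings of the triangle sit at different points of the plane after the
    move; \<eta> identifies those formed by the same pair of strands.\<close>
  define \<eta> where "\<eta> v = (if v = x' then x else if v = y' then y else if v = z' then z else v)" for v
  have \<eta>: "\<eta> x' = x" "\<eta> y' = y" "\<eta> z' = z" "\<And>v. v \<in> C0 \<Longrightarrow> \<eta> v = v"
    using xyz xC by (auto simp: \<eta>_def)
  have "\<eta> ` C0 = id ` C0" by (rule image_cong[OF refl]) (use \<eta>(4) in simp)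
  then have "\<eta> ` classical D' = insert x (insert y (insert z C0))"
    unfolding C(2) by (simp only: image_insert \<eta>(1-3) image_id id_apply)
  then have \<eta>im: "classical D = \<eta> ` classical D'" by (rule trans[OF C(1) sym])
  have \<eta>inj: "inj_on \<eta> (classical D')"
  proof (rule eq_card_imp_inj_on[OF finite_C(2)])
    have "finite C0" using finite_C(1) by simp
    then have "card (insert x (insert y (insert z C0))) = card (insert x' (insert y' (insert z' C0)))"
      using xyz xC by simp
    then have "card (classical D) = card (classical D')" unfolding C(2) by (rule trans[OF arg_cong[where f = card, OF C(1)]])
    then show "card (\<eta> ` classical D') = card (classical D')" unfolding \<eta>im[symmetric] .
  qed
  \<comment> \<open>The labelling of \<open>D'\<close> with crossings named as in \<open>D\<close>.
    Outside the six ports it is defined by \<open>lab\<close>, since \<open>B_R3\<close> asks for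
    agreement at all other parameters.\<close>
  define lab2 where "lab2 p = (if p \<in> ?R then \<eta> (lab' p) else lab p)" for p
  have L1: "lab (i, frac r) = (if before D k x y then x else y)" "lab (i, frac r') = (if before D k x y then y else x)"
    "lab (j, frac q) = (if before D l x z then x else z)" "lab (j, frac q') = (if before D l x z then z else x)"
    "lab (h, frac w) = (if before D m y z then y else z)" "lab (h, frac w') = (if before D m y z then z else y)"
    using s t u unfolding lab k l m by metis+
  \<comment> \<open>By \<open>bf\<close> every strand meets its two crossings in the opposite order
    in \<open>D'\<close>; expressed by the order in \<open>D\<close>, the labels appear
    exchanged.\<close>
  have L2: "lab' (i, frac r) = (if before D k x y then y' else x')" "lab' (i, frac r') = (if before D k x y then x' else y')"
    "lab' (j, frac q) = (if before D l x z then z' else x')" "lab' (j, frac q') = (if before D l x z then x' else z')"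
    "lab' (h, frac w) = (if before D m y z then z' else y')" "lab' (h, frac w') = (if before D m y z then y' else z')"
    using s' t' u' bf unfolding lab' k l m by metis+
  have L3: "lab2 (i, frac r) = lab (i, frac r')" "lab2 (i, frac r') = lab (i, frac r)" "lab2 (j, frac q) = lab (j, frac q')"
    "lab2 (j, frac q') = lab (j, frac q)" "lab2 (h, frac w) = lab (h, frac w')" "lab2 (h, frac w') = lab (h, frac w)"
    unfolding lab2_def L1 L2 by (simp_all add: \<eta>)
  have rest: "lab' p = lab p" "lab' p \<in> C0" "p \<notin> ?R" if p: "p \<in> M" "p \<notin> ?R" for p
  proof -
    have p2: "p \<in> cparams D" "p \<notin> K \<union> L \<union> N" using p unfolding M_def by blast+
    then have "p \<in> params D" "p \<notin> strands" unfolding ins by (auto simp: cparams_def)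
    then have "point D' p = point D p" "point D p \<notin> U" using outside inside(1) by blast+
    then show "lab' p = lab p" "lab' p \<in> C0" using lab_out[OF p2(2)] lab'_out[OF p2(2)] p2(1) by (auto simp: cparams_def)
  qed (use p in simp)
  have B1: "BM ?n M lab (classical D) \<kappa> = BM ?n M lab2 (classical D) \<kappa>"
    unfolding BM_def
  proof (rule B_R3[OF chord_marks_chords[OF A(2)] C(1) \<kappa>s(1) xC(1-3) pos(4) _ dist nx nx2 nx3])
    show "lab2 p = lab p" if "p \<notin> {(i, frac r), (j, frac q), (h, frac w), (i, frac r'), (j, frac q'), (h, frac w')}" for p
      using that unfolding lab2_def by simp
  qed (simp_all add: L3, simp_all add: L1 M_def)
  have B2: "BM ?n M lab' (classical D') \<kappa> = BM ?n M lab2 (classical D) \<kappa>"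
  proof (rule BM_relabel[OF A'(2) \<eta>inj \<eta>im])
    show "lab2 p = \<eta> (lab' p)" if "p \<in> M" for p
    proof (cases "p \<in> ?R")
      case False
      then show ?thesis using rest[OF that False] \<eta>(4) unfolding lab2_def by simp
    qed (simp add: lab2_def)
    show "lab2 p \<notin> classical D" if "p \<in> M" "lab' p \<notin> classical D'" for p
    proof (cases "p \<in> ?R")
      case True
      then have "lab' p \<in> {x', y', z'}" using L2 by (elim insertE emptyE) simp_all
      then show ?thesis using that(2) C(2) by blast
    next
      case False
      then show ?thesis using rest(2)[OF that(1)] that(2) C(2) by blast
    qed
  qed (rule \<kappa>s)+
  show ?thesis
    using specialize_bracket[OF D(1) marked_by_self[OF D(1)] \<kappa>s(1)] specialize_bracket[OF D(2) marked_by_self[OF D(2)] \<kappa>s(2)]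
      A(1) A'(1) B1 B2 comps by simp
qed

section \<open>The Z-move, and the conclusion for free equivalence\<close>

text \<open>As \<open>v\<close> is virtual, \<open>x\<close> is the only classical crossing in the
  disc and each of the two strands carries just one passage, which can be slid to the prescribed
  place.\<close>

lemma two_strands:
  assumes T: "tangles D D' U [(i, a, b), (j, c, d)]" and X: "crossings D \<inter> U = {x, v}" "v \<in> virt D"
    and x: "x \<in> classical D" "x \<in> U" "{p \<in> params D. point D p = x} = {(i, frac s), (j, frac t)}"
    and s: "a < r" "r < s" "s < b" "c < q" "q < t" "t < d" and \<kappa>: "inj_on \<kappa> (classical D)"
    and K: "K = strand_params (i, a, b)" "L = strand_params (j, c, d)"
    and M: "M = {(i, frac r), (j, frac q)} \<union> (cparams D - (K \<union> L))"
  shows "\<exists>lab. BM (comps D) (cparams D) (point D) (classical D) \<kappa> = BM (comps D) M lab (classical D) \<kappa> \<and>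
    chord_marks (comps D) M lab (classical D) \<and> lab (i, frac r) = x \<and> lab (j, frac q) = x \<and>
    (\<forall>p. p \<notin> K \<union> L \<longrightarrow> lab p = point D p)" "classical D = insert x (classical D - U)"
proof -
  interpret tangles D D' U "[(i, a, b), (j, c, d)]" by (rule T)
  have mem: "(i, a, b) \<in> set [(i, a, b), (j, c, d)]" "(j, c, d) \<in> set [(i, a, b), (j, c, d)]" by simp_all
  have only: "classical D \<inter> U = {x}" using X x unfolding classical_def by blast
  then show "classical D = insert x (classical D - U)" by blast
  have "sorted_wrt (\<lambda>k l. strand_params k \<inter> strand_params l = {}) [(i, a, b), (j, c, d)]"
    using rep unfolding tangle_replacement_def tangle_in_def by blast
  then have dis: "K \<inter> L = {}" unfolding K by simp
  have inK: "a \<le> v \<Longrightarrow> v \<le> b \<Longrightarrow> (i, frac v) \<in> K" and inL: "c \<le> v \<Longrightarrow> v \<le> d \<Longrightarrow> (j, frac v) \<in> L" for v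
    unfolding K by auto
  have pts: "point D (i, frac s) = x" "point D (j, frac t) = x" "(i, frac s) \<in> cparams D" "(j, frac t) \<in> cparams D"
    using x by (auto simp: cparams_def)
  have mk: "p \<in> {(i, frac s), (j, frac t)}" if "p \<in> cparams D" "p \<in> strands" for p
  proof -
    have "point D p \<in> classical D \<inter> U" using that inside(1) by (auto simp: cparams_def)
    then show ?thesis using only x(3) that(1) by (auto simp: cparams_def)
  qed
  have sK: "(i, frac s) \<in> K" "(j, frac t) \<in> L" "(i, frac r) \<in> K" "(j, frac q) \<in> L"
    using inK[of s] inK[of r] inL[of t] inL[of q] s by simp_all
  have mk1: "(i, frac v) \<in> cparams D \<longleftrightarrow> v = s" if v: "a \<le> v" "v \<le> b" for v
  proof
    assume "(i, frac v) \<in> cparams D"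
    then have "(i, frac v) \<in> {(i, frac s), (j, frac t)}" by (rule mk[OF _ strand(4)[OF mem(1)]]) (use v in simp)
    then have "frac v = frac s" using inK[OF v] sK dis by auto
    then show "v = s" using strand_inj[OF mem(1), of v s] v s by simp
  qed (use pts in simp)
  have mk2: "(j, frac v) \<in> cparams D \<longleftrightarrow> v = t" if v: "c \<le> v" "v \<le> d" for v
  proof
    assume "(j, frac v) \<in> cparams D"
    then have "(j, frac v) \<in> {(i, frac s), (j, frac t)}" by (rule mk[OF _ strand(4)[OF mem(2)]]) (use v in simp)
    then have "frac v = frac t" using inL[OF v] sK dis by auto
    then show "v = t" using strand_inj[OF mem(2), of v t] v s by simp
  qed (use pts in simp)
  let ?M1 = "insert (i, frac r) (cparams D - {(i, frac s)})" and ?l1 = "(point D)((i, frac r) := point D (i, frac s))"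
  have 1: "BM (comps D) (cparams D) (point D) (classical D) \<kappa> = BM (comps D) ?M1 ?l1 (classical D) \<kappa> \<and>
      chord_marks (comps D) ?M1 ?l1 (classical D)"
    by (rule BM_slide1[OF cparams_chords[OF D(1)] \<kappa> strand(1)[OF mem(1)] strand(3)[OF mem(1)] s(1-3) mk1])
  have mk2': "(j, frac v) \<in> ?M1 \<longleftrightarrow> v = t" if v: "c \<le> v" "v \<le> d" for v
  proof -
    have "(j, frac v) \<notin> K" using inL[OF v] dis by blast
    then have "(j, frac v) \<noteq> (i, frac r)" "(j, frac v) \<noteq> (i, frac s)" using sK by metis+
    then show ?thesis using mk2[OF v] by auto
  qed
  let ?M2 = "insert (j, frac q) (?M1 - {(j, frac t)})" and ?l2 = "?l1((j, frac q) := ?l1 (j, frac t))"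
  have 2: "BM (comps D) ?M1 ?l1 (classical D) \<kappa> = BM (comps D) ?M2 ?l2 (classical D) \<kappa> \<and>
      chord_marks (comps D) ?M2 ?l2 (classical D)"
    by (rule BM_slide1[OF conjunct2[OF 1] \<kappa> strand(1)[OF mem(2)] strand(3)[OF mem(2)] s(4-6) mk2'])
  have "(j, frac q) \<notin> K" "(j, frac t) \<notin> K" using sK(2,4) dis by blast+
  then have ne: "(i, frac r) \<noteq> (j, frac q)" "(i, frac r) \<noteq> (j, frac t)" using sK(3) by metis+
  have ins: "strands = K \<union> L" unfolding K by simp
  have "cparams D - (K \<union> L) = cparams D - {(i, frac s)} - {(j, frac t)}"
    using mk sK unfolding ins by blast
  then have eq: "?M2 = M" unfolding M using ne by auto
  have l2: "?l2 (i, frac r) = x" "?l2 (j, frac q) = x" "\<forall>p. p \<notin> K \<union> L \<longrightarrow> ?l2 p = point D p"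
    using ne pts sK by auto
  show "\<exists>lab. BM (comps D) (cparams D) (point D) (classical D) \<kappa> = BM (comps D) M lab (classical D) \<kappa> \<and>
    chord_marks (comps D) M lab (classical D) \<and> lab (i, frac r) = x \<and> lab (j, frac q) = x \<and>
    (\<forall>p. p \<notin> K \<union> L \<longrightarrow> lab p = point D p)"
    by (intro exI[of _ ?l2] conjI trans[OF conjunct1[OF 1] conjunct1[OF 2, unfolded eq]] conjunct2[OF 2, unfolded eq] l2)
qed

text \<open>Before and after the move each strand has one classical passage in the disc, no matter
  on which side of the virtual crossing. After sliding, the chord diagrams differ only in the name
  of this crossing.\<close>

lemma bracket_Z_move:
  assumes D: "virtual_link_diagram D" "virtual_link_diagram D'" and R: "Z_move D D'"
  shows "specialize \<epsilon> (bracket f D) = specialize \<epsilon> (bracket f D')"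
proof -
  obtain U k l x v x' v' where rep: "tangle_replacement D D' U [k, l]"
    and X: "crossings D \<inter> U = {x, v}" "crossings D' \<inter> U = {x', v'}" "v \<in> virt D" "v' \<in> virt D'"
    and ov: "passes_over D k l x" "passes_over D' l k x'"
    using R unfolding Z_move_def by blast
  obtain i a b where k: "k = (i, a, b)" by (cases k)
  obtain j c d where l: "l = (j, c, d)" by (cases l)
  have T: "tangles D D' U [(i, a, b), (j, c, d)]" using D rep unfolding k l by unfold_locales
  interpret tangles D D' U "[(i, a, b), (j, c, d)]" by (rule T)
  have T': "tangles D' D U [(i, a, b), (j, c, d)]" by (rule tangles_sym[OF T])
  interpret r: tangles D' D U "[(i, a, b), (j, c, d)]" by (rule T')
  have mem: "(i, a, b) \<in> set [(i, a, b), (j, c, d)]" "(j, c, d) \<in> set [(i, a, b), (j, c, d)]" by simp_all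
  define K where "K = strand_params (i, a, b)"
  define L where "L = strand_params (j, c, d)"
  have "sorted_wrt (\<lambda>k l. strand_params k \<inter> strand_params l = {}) [(i, a, b), (j, c, d)]"
    using rep unfolding tangle_replacement_def tangle_in_def k l by blast
  then have dis: "strand_params (i, a, b) \<inter> strand_params (j, c, d) = {}" "strand_params (j, c, d) \<inter> strand_params (i, a, b) = {}" by auto
  obtain s t where s0: "a < s" "s < b" "c < t" "t < d" "(i, frac s) \<noteq> (j, frac t)"
    "{p \<in> params D. point D p = x} = {(i, frac s), (j, frac t)}" "x \<in> classical D" "x \<in> U"
    by (rule passage[OF mem dis(1) ov(1)[unfolded k l]])
  note s = s0(1-4,6-8)
  obtain t' s' where s0': "c < t'" "t' < d" "a < s'" "s' < b" "(j, frac t') \<noteq> (i, frac s')"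
    "{p \<in> params D'. point D' p = x'} = {(j, frac t'), (i, frac s')}" "x' \<in> classical D'" "x' \<in> U"
    by (rule r.passage[OF mem(2,1) dis(2) ov(2)[unfolded k l]])
  note s' = s0'(1-4,6-8)
  have s'5: "{p \<in> params D'. point D' p = x'} = {(i, frac s'), (j, frac t')}" using s'(5) by auto
  have "a < min s s'" "c < min t t'" using s(1,3) s'(1,3) by simp_all
  then obtain r q where "a < r" "r < min s s'" "c < q" "q < min t t'" using dense[of a "min s s'"] dense[of c "min t t'"] by metis
  then have r: "a < r" "r < s" "r < s'" and q: "c < q" "q < t" "q < t'" by simp_all
  obtain \<kappa> :: "complex \<Rightarrow> nat" where \<kappa>: "inj_on \<kappa> (classical D \<union> classical D')"
    using infinite_labels[of "classical D \<union> classical D'"] finite_C by blast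
  then have \<kappa>s: "inj_on \<kappa> (classical D)" "inj_on \<kappa> (classical D')" using inj_on_subset by blast+
  have ins: "strands = K \<union> L" unfolding K_def L_def by simp
  have same: "cparams D - (K \<union> L) = cparams D' - (K \<union> L)"
    using marks_outside r.marks_outside unfolding ins by blast
  define M where "M = {(i, frac r), (j, frac q)} \<union> (cparams D - (K \<union> L))"
  note A = two_strands[OF T X(1,3) s(6,7,5) r(1,2) s(2) q(1,2) s(4) \<kappa>s(1) K_def L_def M_def]
  note A' = two_strands[OF T' X(2,4) s'(6,7) s'5 r(1,3) s'(4) q(1,3) s'(2) \<kappa>s(2) K_def L_def M_def[unfolded same], unfolded comps]
  obtain lab where B: "BM (comps D) (cparams D) (point D) (classical D) \<kappa> = BM (comps D) M lab (classical D) \<kappa>"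
    "chord_marks (comps D) M lab (classical D)" "lab (i, frac r) = x" "lab (j, frac q) = x" "\<And>p. p \<notin> K \<union> L \<Longrightarrow> lab p = point D p"
    using A(1) by blast
  obtain lab' where B': "BM (comps D) (cparams D') (point D') (classical D') \<kappa> = BM (comps D) M lab' (classical D') \<kappa>"
    "lab' (i, frac r) = x'" "lab' (j, frac q) = x'" "\<And>p. p \<notin> K \<union> L \<Longrightarrow> lab' p = point D' p"
    using A'(1) by blast
  have C: "classical D = insert x C0" "classical D' = insert x' C0" using A(2) A'(2) classical_outside by simp_all
  have xC: "x \<notin> C0" "x' \<notin> C0" using s(7) s'(7) by blast+
  define \<eta> where "\<eta> v = (if v = x then x' else v)" for v
  have \<eta>: "\<eta> x = x'" "\<And>v. v \<in> C0 \<Longrightarrow> \<eta> v = v" using xC by (auto simp: \<eta>_def)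
  have rest: "lab' p = lab p" "lab p \<in> C0" if p: "p \<in> M" "p \<notin> {(i, frac r), (j, frac q)}" for p
  proof -
    have p2: "p \<in> cparams D" "p \<notin> K \<union> L" using p unfolding M_def by blast+
    then have "p \<in> params D" "p \<notin> strands" unfolding ins by (auto simp: cparams_def)
    then have "point D' p = point D p" "point D p \<notin> U" using outside inside(1) by blast+
    then show "lab' p = lab p" "lab p \<in> C0" using B(5)[OF p2(2)] B'(4)[OF p2(2)] p2(1) by (auto simp: cparams_def)
  qed
  have all: "lab' p = \<eta> (lab p) \<and> lab p \<in> classical D" if "p \<in> M" for p
  proof (cases "p \<in> {(i, frac r), (j, frac q)}")
    case True
    then show ?thesis using B(3,4) B'(2,3) \<eta>(1) s(6) by auto
  next
    case False
    then show ?thesis using rest[OF that False] \<eta>(2) by auto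
  qed
  have "BM (comps D) M lab (classical D) \<kappa> = BM (comps D) M lab' (classical D') \<kappa>"
  proof (rule BM_relabel[OF B(2)])
    have "inj_on \<eta> (insert x C0)" by (rule inj_onI) (use xC in \<open>auto simp: \<eta>_def split: if_splits\<close>)
    then show "inj_on \<eta> (classical D)" unfolding C(1)[symmetric] .
    have "\<eta> ` C0 = id ` C0" by (rule image_cong[OF refl]) (use \<eta>(2) in simp)
    then have "\<eta> ` insert x C0 = insert x' C0" by (simp only: image_insert \<eta>(1) image_id id_apply)
    then show "classical D' = \<eta> ` classical D" unfolding C(1)[symmetric] C(2) by (rule sym)
    show "lab' p = \<eta> (lab p)" if "p \<in> M" for p using all[OF that] ..
    show "lab' p \<notin> classical D'" if "p \<in> M" "lab p \<notin> classical D" for p using all[OF that(1)] that(2) by simp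
  qed (rule \<kappa>s)+
  then show ?thesis
    using specialize_bracket[OF D(1) marked_by_self[OF D(1)] \<kappa>s(1)] specialize_bracket[OF D(2) marked_by_self[OF D(2)] \<kappa>s(2)]
      B(1) B'(1) comps by simp
qed

text \<open>Each generating move preserves the specialized bracket, and equality also covers the
  inverse moves that \<open>equivclp\<close> adds.\<close>

lemma bracket_free_equivalent:
  assumes "free_equivalent K K'"
  shows "specialize \<epsilon> (bracket f K) = specialize \<epsilon> (bracket f K')"
proof -
  have move: "specialize \<epsilon> (bracket f D) = specialize \<epsilon> (bracket f D')"
    if "virtual_link_diagram D \<and> virtual_link_diagram D' \<and> (virtual_move D D' \<or> Z_move D D' \<or> crossing_switch D D')" for D D'
    using that bracket_isotopic bracket_R1 bracket_R2 bracket_R3 bracket_detour bracket_Z_move bracket_crossing_switch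
    unfolding virtual_move_def by blast
  show ?thesis
    using assms unfolding free_equivalent_def
  proof (induction rule: equivclp_induct)
    case (step D D')
    then show ?case using move[of D D'] move[of D' D] by metis
  qed simp
qed

end

theorem corollary3:
  fixes f :: "web_class \<Rightarrow> laurent mpoly" and K K' :: diagram
  assumes "web_evaluation f"
    and "virtual_link_diagram K" and "virtual_link_diagram K'"
    and "free_equivalent K K'"
  shows "specialize 1 (bracket f K) = specialize 1 (bracket f K') \<and>
         specialize (-1) (bracket f K) = specialize (-1) (bracket f K')"
proof -
  interpret plus: evaluation f 1 using assms(1) by unfold_locales simp_all
  interpret minus: evaluation f "-1" using assms(1) by unfold_locales simp_all
  show ?thesis
    using plus.bracket_free_equivalent[OF assms(4)] minus.bracket_free_equivalent[OF assms(4)] by blast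
qed

end
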